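(* Let $(H,R)$ be a finite-dimensional quasitriangular Hopf algebra over an algebraically closed field $\Bbbk$, and let $(B,K)$ be a finite-dimensional quasitriangular left $H$-comodule algebra such that $B\text{-}\mathsf{FdMod}$ is an indecomposable and exact left module category over $H\text{-}\mathsf{FdMod}$. Then $(B,K)$ is a factorizable left $H$-comodule algebra if and only if $B\text{-}\mathsf{FdMod}$, with the braiding induced by $K$, is a nondegenerate braided left $(H\text{-}\mathsf{FdMod})$-module category.
   Context: $\otimes=\otimes_\Bbbk$; Sweedler notation $\Delta(h)=h_{(1)}\otimes h_{(2)}$; $S$ is the antipode; repeated indices are summed. $\mathsf{FdMod}$ denotes finite-dimensional modules. Quasitriangular Hopf algebra: $R=R_i\otimes R^i\in H\otimes H$ invertible with $(\Delta\otimes\mathrm{id})(R)=R_{13}R_{23}$, $(\mathrm{id}\otimes\Delta)(R)=R_{13}R_{12}$, $R\Delta(h)=\Delta^{\mathrm{op}}(h)R$. Then $\mathcal C=H\text{-}\mathsf{FdMod}$ is a braided finite tensor category with $c_{X,Y}(x\otimes y)=R^i\cdot y\otimes R_i\cdot x$. A left $H$-comodule algebra is an algebra $B$ with an algebra map $\delta:B\to H\otimes B$, $b\mapsto b_{[-1]}\otimes b_{[0]}$, making $B$ a left $H$-comodule. Then $\mathcal M=B\text{-}\mathsf{FdMod}$ is a left $\mathcal C$-module category: $X\triangleright M=X\otimes M$ with $b\cdot(x\otimes m)=b_{[-1]}x\otimes b_{[0]}m$. It is exact if $P\triangleright M$ is projective for all projective $P\in\mathcal C$ and $M\in\mathcal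 M$; indecomposable if it is not equivalent to a direct sum of two nonzero module categories. $B$ is quasitriangular if equipped with an invertible $K=K_i\otimes K^i\in H\otimes B$ with $(\Delta\otimes\mathrm{id}_B)K=K_{23}R_{21}K_{13}R_{21}^{-1}$, $(\mathrm{id}_H\otimes\delta)K=R_{21}K_{13}R_{12}$, $K\delta(b)=\delta(b)K$ for all $b\in B$. Then $\mathcal M$ is a braided module category with $e_{X,M}(x\otimes m)=K_i x\otimes K^i m$. Factorizable comodule algebra: let $E(H,B)=\{\xi\in\mathrm{Hom}_\Bbbk(H,B)\mid\xi(b_{[-1]}h)b_{[0]}=b\,\xi(h)\ \forall b\in B,h\in H\}$. $(B,K)$ is factorizable if the (well-defined) linear map $\theta_B:H^*\to E(H,B)$, $f\mapsto[h\mapsto\langle f,S(h_{(1)})K_ih_{(2)}\rangle K^i]$, is an isomorphism of vector spaces. Nondegenerate module category: for a braided finite tensor category $\mathcal C$ (unit $\mathbf 1$, left duals $X^*$, $\mathrm{ev}^L_X:X^*\otimes X\to\mathbf 1$, $\mathrm{coev}^L_X:\mathbf 1\to X\otimes X^*$) and a braided module category $(\mathcal M,\triangleright,e)$, let $\underline{\mathrm{Hom}}(M,-)$ be the right adjoint of $(-\triangleright M):\mathcal C\to\mathcal M$, $\mathrm{coev}_{\mathbf 1,M}:\mathbf 1\to\underline{\mathrm{Hom}}(M,M)$ the adjunct of $\mathrm{id}_M$, and use the canonical isomorphisms $X\otimes\underline{\mathrm{Hom}}(M,N)\cong\underline{\mathrm{Hom}}(M,X\triangleright N)$. Let $\mathtt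 E_{\mathcal C}=\int_{X\in\mathcal C}X\otimes X^*$ and $\mathtt E_{\mathcal M}=\int_{M\in\mathcal M}\underline{\mathrm{Hom}}(M,M)$ be the ends in $\mathcal C$ with canonical morphisms $\pi_{\mathcal C}(X)$, $\pi_{\mathcal M}(M)$. Let $\omega_{\mathcal M}:\mathbf 1\to\mathtt E_{\mathcal C}\otimes\mathtt E_{\mathcal M}$ be the unique morphism such that for all $X,M$, $(\pi_{\mathcal C}(X)\otimes\pi_{\mathcal M}(M))\omega_{\mathcal M}$ equals $\mathbf 1\xrightarrow{\mathrm{coev}^L_X\otimes\mathrm{coev}_{\mathbf 1,M}}X\otimes X^*\otimes\underline{\mathrm{Hom}}(M,M)\cong X\otimes\underline{\mathrm{Hom}}(M,X^*\triangleright M)\xrightarrow{\mathrm{id}\otimes\underline{\mathrm{Hom}}(\mathrm{id},e_{X^*,M})}X\otimes\underline{\mathrm{Hom}}(M,X^*\triangleright M)\cong X\otimes X^*\otimes\underline{\mathrm{Hom}}(M,M)$. $\mathcal M$ is nondegenerate if $\theta_{\mathcal M}=(\mathrm{ev}^L_{\mathtt E_{\mathcal C}}\otimes\mathrm{id})(\mathrm{id}\otimes\omega_{\mathcal M}):\mathtt E_{\mathcal C}^*\to\mathtt E_{\mathcal M}$ is an isomorphism in $\mathcal C$. *)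

theory Defs
  imports
    "HOL-Computational_Algebra.Polynomial"
    "Jordan_Normal_Form.Matrix"
begin

section \<open>Tensor products and Sweedler notation\<close>

text \<open>
  A vector space is a type with a scalar multiplication \<open>s\<close> satisfying \<^locale>\<open>vector_space\<close>.
  An element of \<open>U \<otimes> V\<close> is an equivalence class of formal sums \<open>\<Sum> u\<^sub>i \<otimes> v\<^sub>i\<close>, written as
  lists of pairs; two formal sums are identified iff every bilinear form takes the same value on
  them, which over a field is the equality of the tensor product.  Similarly for three factors.
  The term \<open>sweedler t\<close> is a formal sum representing \<open>t\<close>; with list comprehensions
  it plays the role of Sweedler notation.  Every use below is multilinear in the legs, so nothing
  depends on the representative.
\<close>

definition bilinear_form ::
    "('k::field \<Rightarrow> 'u::ab_group_add \<Rightarrow> 'u) \<Rightarrow> ('k \<Rightarrow> 'v::ab_group_add \<Rightarrow> 'v) \<Rightarrow>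
     ('u \<Rightarrow> 'v \<Rightarrow> 'k) \<Rightarrow> bool" where
  "bilinear_form sU sV \<beta> \<longleftrightarrow>
     (\<forall>v. Vector_Spaces.linear sU (*) (\<lambda>u. \<beta> u v)) \<and>
     (\<forall>u. Vector_Spaces.linear sV (*) (\<lambda>v. \<beta> u v))"

definition trilinear_form ::
    "('k::field \<Rightarrow> 'u::ab_group_add \<Rightarrow> 'u) \<Rightarrow> ('k \<Rightarrow> 'v::ab_group_add \<Rightarrow> 'v) \<Rightarrow>
     ('k \<Rightarrow> 'w::ab_group_add \<Rightarrow> 'w) \<Rightarrow> ('u \<Rightarrow> 'v \<Rightarrow> 'w \<Rightarrow> 'k) \<Rightarrow> bool" where
  "trilinear_form sU sV sW \<tau> \<longleftrightarrow>
     (\<forall>v w. Vector_Spaces.linear sU (*) (\<lambda>u. \<tau> u v w)) \<and>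
     (\<forall>u w. Vector_Spaces.linear sV (*) (\<lambda>v. \<tau> u v w)) \<and>
     (\<forall>u v. Vector_Spaces.linear sW (*) (\<lambda>w. \<tau> u v w))"

type_synonym ('u, 'v) tensor2 = "('u \<times> 'v) list set"
type_synonym ('u, 'v, 'w) tensor3 = "('u \<times> 'v \<times> 'w) list set"

definition tensor2 ::
    "('k::field \<Rightarrow> 'u::ab_group_add \<Rightarrow> 'u) \<Rightarrow> ('k \<Rightarrow> 'v::ab_group_add \<Rightarrow> 'v) \<Rightarrow>
     ('u \<times> 'v) list \<Rightarrow> ('u, 'v) tensor2" where
  "tensor2 sU sV t =
     {t'. \<forall>\<beta>. bilinear_form sU sV \<beta> \<longrightarrow> (\<Sum>(u, v)\<leftarrow>t'. \<beta> u v) = (\<Sum>(u, v)\<leftarrow>t. \<beta> u v)}"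

definition tensor3 ::
    "('k::field \<Rightarrow> 'u::ab_group_add \<Rightarrow> 'u) \<Rightarrow> ('k \<Rightarrow> 'v::ab_group_add \<Rightarrow> 'v) \<Rightarrow>
     ('k \<Rightarrow> 'w::ab_group_add \<Rightarrow> 'w) \<Rightarrow> ('u \<times> 'v \<times> 'w) list \<Rightarrow> ('u, 'v, 'w) tensor3" where
  "tensor3 sU sV sW t =
     {t'. \<forall>\<tau>. trilinear_form sU sV sW \<tau> \<longrightarrow>
        (\<Sum>(u, v, w)\<leftarrow>t'. \<tau> u v w) = (\<Sum>(u, v, w)\<leftarrow>t. \<tau> u v w)}"

definition sweedler :: "'t set \<Rightarrow> 't" where
  "sweedler t = (SOME l. l \<in> t)"

definition mul2 :: "('a::times \<times> 'b::times) list \<Rightarrow> ('a \<times> 'b) list \<Rightarrow> ('a \<times> 'b) list"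
    (infixl "*\<^sub>2" 70) where
  "t *\<^sub>2 t' = [(a * a', b * b'). (a, b) \<leftarrow> t, (a', b') \<leftarrow> t']"

definition mul3 ::
    "('a::times \<times> 'b::times \<times> 'c::times) list \<Rightarrow> ('a \<times> 'b \<times> 'c) list \<Rightarrow> ('a \<times> 'b \<times> 'c) list"
    (infixl "*\<^sub>3" 70) where
  "t *\<^sub>3 t' = [(a * a', b * b', c * c'). (a, b, c) \<leftarrow> t, (a', b', c') \<leftarrow> t']"

definition swap2 :: "('a \<times> 'b) list \<Rightarrow> ('b \<times> 'a) list" where
  "swap2 t = [(b, a). (a, b) \<leftarrow> t]"

text \<open>Leg notation: \<open>t\<^sub>2\<^sub>1\<close> is \<open>leg12 (swap2 t)\<close>.\<close>

definition leg12 :: "('a \<times> 'b) list \<Rightarrow> ('a \<times> 'b \<times> 'c::one) list" where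
  "leg12 t = [(a, b, 1). (a, b) \<leftarrow> t]"
definition leg13 :: "('a \<times> 'c) list \<Rightarrow> ('a \<times> 'b::one \<times> 'c) list" where
  "leg13 t = [(a, 1, c). (a, c) \<leftarrow> t]"
definition leg23 :: "('b \<times> 'c) list \<Rightarrow> ('a::one \<times> 'b \<times> 'c) list" where
  "leg23 t = [(1, b, c). (b, c) \<leftarrow> t]"

definition map_left :: "('a \<Rightarrow> ('b, 'c) tensor2) \<Rightarrow> ('a \<times> 'd) list \<Rightarrow> ('b \<times> 'c \<times> 'd) list" where
  "map_left D t = [(b, c, d). (a, d) \<leftarrow> t, (b, c) \<leftarrow> sweedler (D a)]"
definition map_right :: "('a \<Rightarrow> ('c, 'd) tensor2) \<Rightarrow> ('b \<times> 'a) list \<Rightarrow> ('b \<times> 'c \<times> 'd) list" where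
  "map_right D t = [(b, c, d). (b, a) \<leftarrow> t, (c, d) \<leftarrow> sweedler (D a)]"


section \<open>Quasitriangular Hopf algebras and comodule algebras\<close>

text \<open>The sort \<open>{ring, monoid_mult}\<close> is that of unital rings, the zero ring included.\<close>

locale fd_algebra = vector_space sA
  for sA :: "'k::field \<Rightarrow> 'a::{ring,monoid_mult} \<Rightarrow> 'a" +
  assumes finite_dim: "\<exists>V. finite V \<and> span V = UNIV"
    and scale_mult_left: "sA c a * b = sA c (a * b)"
    and scale_mult_right: "a * sA c b = sA c (a * b)"

definition tensor_algebra_map ::
    "('k::field \<Rightarrow> 'a::{ring,monoid_mult} \<Rightarrow> 'a) \<Rightarrow> ('k \<Rightarrow> 'u::{ring,monoid_mult} \<Rightarrow> 'u) \<Rightarrow>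
     ('k \<Rightarrow> 'v::{ring,monoid_mult} \<Rightarrow> 'v) \<Rightarrow> ('a \<Rightarrow> ('u, 'v) tensor2) \<Rightarrow> bool" where
  "tensor_algebra_map sA sU sV D \<longleftrightarrow>
     (\<forall>a. D a \<in> range (tensor2 sU sV)) \<and>
     (\<forall>a b. D (a + b) = tensor2 sU sV (sweedler (D a) @ sweedler (D b))) \<and>
     (\<forall>c a. D (sA c a) = tensor2 sU sV [(sU c u, v). (u, v) \<leftarrow> sweedler (D a)]) \<and>
     D 1 = tensor2 sU sV [(1, 1)] \<and>
     (\<forall>a b. D (a * b) = tensor2 sU sV (sweedler (D a) *\<^sub>2 sweedler (D b)))"

definition tensor_inverse ::
    "('k::field \<Rightarrow> 'u::{ring,monoid_mult} \<Rightarrow> 'u) \<Rightarrow> ('k \<Rightarrow> 'v::{ring,monoid_mult} \<Rightarrow> 'v) \<Rightarrow>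
     ('u, 'v) tensor2 \<Rightarrow> ('u, 'v) tensor2 \<Rightarrow> bool" where
  "tensor_inverse sU sV t t' \<longleftrightarrow>
     t \<in> range (tensor2 sU sV) \<and> t' \<in> range (tensor2 sU sV) \<and>
     tensor2 sU sV (sweedler t *\<^sub>2 sweedler t') = tensor2 sU sV [(1, 1)] \<and>
     tensor2 sU sV (sweedler t' *\<^sub>2 sweedler t) = tensor2 sU sV [(1, 1)]"

locale fd_hopf_algebra = fd_algebra sH
  for sH :: "'k::field \<Rightarrow> 'h::{ring,monoid_mult} \<Rightarrow> 'h" +
  fixes \<Delta> :: "'h \<Rightarrow> ('h, 'h) tensor2" and \<epsilon> :: "'h \<Rightarrow> 'k" and S :: "'h \<Rightarrow> 'h"
  assumes comul_alg_map: "tensor_algebra_map sH sH sH \<Delta>"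
    and coassoc: "tensor3 sH sH sH (map_left \<Delta> (sweedler (\<Delta> h))) =
                  tensor3 sH sH sH (map_right \<Delta> (sweedler (\<Delta> h)))"
    and counit_linear: "Vector_Spaces.linear sH (*) \<epsilon>"
    and counit_one: "\<epsilon> 1 = 1"
    and counit_mult: "\<epsilon> (g * h) = \<epsilon> g * \<epsilon> h"
    and counit_left: "(\<Sum>(x, y)\<leftarrow>sweedler (\<Delta> h). sH (\<epsilon> x) y) = h"
    and counit_right: "(\<Sum>(x, y)\<leftarrow>sweedler (\<Delta> h). sH (\<epsilon> y) x) = h"
    and antipode_linear: "Vector_Spaces.linear sH sH S"
    and antipode_left: "(\<Sum>(x, y)\<leftarrow>sweedler (\<Delta> h). S x * y) = sH (\<epsilon> h) 1"
    and antipode_right: "(\<Sum>(x, y)\<leftarrow>sweedler (\<Delta> h). x * S y) = sH (\<epsilon> h) 1"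

locale fd_quasitriangular_hopf_algebra = fd_hopf_algebra sH \<Delta> \<epsilon> S
  for sH :: "'k::field \<Rightarrow> 'h::{ring,monoid_mult} \<Rightarrow> 'h" and \<Delta> \<epsilon> S +
  fixes R :: "('h, 'h) tensor2"
  assumes R_invertible: "\<exists>R'. tensor_inverse sH sH R R'"
    and R_comul_left: "tensor3 sH sH sH (map_left \<Delta> (sweedler R)) =
          tensor3 sH sH sH (leg13 (sweedler R) *\<^sub>3 leg23 (sweedler R))"
    and R_comul_right: "tensor3 sH sH sH (map_right \<Delta> (sweedler R)) =
          tensor3 sH sH sH (leg13 (sweedler R) *\<^sub>3 leg12 (sweedler R))"
    and R_comul: "tensor2 sH sH (sweedler R *\<^sub>2 sweedler (\<Delta> h)) =
          tensor2 sH sH (swap2 (sweedler (\<Delta> h)) *\<^sub>2 sweedler R)"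

locale fd_comodule_algebra = H: fd_hopf_algebra sH \<Delta> \<epsilon> S + B: fd_algebra sB
  for sH :: "'k::field \<Rightarrow> 'h::{ring,monoid_mult} \<Rightarrow> 'h" and \<Delta> \<epsilon> S
    and sB :: "'k \<Rightarrow> 'b::{ring,monoid_mult} \<Rightarrow> 'b" +
  fixes \<delta> :: "'b \<Rightarrow> ('h, 'b) tensor2"
  assumes coact_alg_map: "tensor_algebra_map sB sH sB \<delta>"
    and coact_coassoc: "tensor3 sH sH sB (map_left \<Delta> (sweedler (\<delta> b))) =
                        tensor3 sH sH sB (map_right \<delta> (sweedler (\<delta> b)))"
    and coact_counit: "(\<Sum>(x, y)\<leftarrow>sweedler (\<delta> b). sB (\<epsilon> x) y) = b"

locale fd_quasitriangular_comodule_algebra =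
  fd_quasitriangular_hopf_algebra sH \<Delta> \<epsilon> S R + fd_comodule_algebra sH \<Delta> \<epsilon> S sB \<delta>
  for sH :: "'k::field \<Rightarrow> 'h::{ring,monoid_mult} \<Rightarrow> 'h" and \<Delta> \<epsilon> S R
    and sB :: "'k \<Rightarrow> 'b::{ring,monoid_mult} \<Rightarrow> 'b" and \<delta> +
  fixes K :: "('h, 'b) tensor2"
  assumes K_invertible: "\<exists>K'. tensor_inverse sH sB K K'"
    and K_comul: "tensor_inverse sH sH R R' \<Longrightarrow>
          tensor3 sH sH sB (map_left \<Delta> (sweedler K)) =
          tensor3 sH sH sB (leg23 (sweedler K) *\<^sub>3 leg12 (swap2 (sweedler R))
            *\<^sub>3 leg13 (sweedler K) *\<^sub>3 leg12 (swap2 (sweedler R')))"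
    and K_coact_right: "tensor3 sH sH sB (map_right \<delta> (sweedler K)) =
          tensor3 sH sH sB (leg12 (swap2 (sweedler R)) *\<^sub>3 leg13 (sweedler K)
            *\<^sub>3 leg12 (sweedler R))"
    and K_coact: "tensor2 sH sB (sweedler K *\<^sub>2 sweedler (\<delta> b)) =
          tensor2 sH sB (sweedler (\<delta> b) *\<^sub>2 sweedler K)"

definition E_space ::
    "('k::field \<Rightarrow> 'h::{ring,monoid_mult} \<Rightarrow> 'h) \<Rightarrow> ('k \<Rightarrow> 'b::{ring,monoid_mult} \<Rightarrow> 'b) \<Rightarrow>
     ('b \<Rightarrow> ('h, 'b) tensor2) \<Rightarrow> ('h \<Rightarrow> 'b) set" where
  "E_space sH sB \<delta> = {\<xi>. Vector_Spaces.linear sH sB \<xi> \<and>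
     (\<forall>b h. (\<Sum>(x, y)\<leftarrow>sweedler (\<delta> b). \<xi> (x * h) * y) = b * \<xi> h)}"

definition theta_B ::
    "('h \<Rightarrow> ('h::{ring,monoid_mult}, 'h) tensor2) \<Rightarrow> ('h \<Rightarrow> 'h) \<Rightarrow>
     ('k::field \<Rightarrow> 'b::{ring,monoid_mult} \<Rightarrow> 'b) \<Rightarrow>
     ('h, 'b) tensor2 \<Rightarrow> ('h \<Rightarrow> 'k) \<Rightarrow> 'h \<Rightarrow> 'b" where
  "theta_B \<Delta> S sB K f =
     (\<lambda>h. \<Sum>(x, y)\<leftarrow>[(S h1 * k * h2, k'). (h1, h2) \<leftarrow> sweedler (\<Delta> h), (k, k') \<leftarrow> sweedler K].
            sB (f x) y)"

text \<open>\<open>theta_B\<close> is linear in \<open>f\<close> by its very formula, so bijectivity is all that is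
  asked of it.\<close>

definition factorizable ::
    "('k::field \<Rightarrow> 'h::{ring,monoid_mult} \<Rightarrow> 'h) \<Rightarrow> ('h \<Rightarrow> ('h, 'h) tensor2) \<Rightarrow> ('h \<Rightarrow> 'h) \<Rightarrow>
     ('k \<Rightarrow> 'b::{ring,monoid_mult} \<Rightarrow> 'b) \<Rightarrow> ('b \<Rightarrow> ('h, 'b) tensor2) \<Rightarrow>
     ('h, 'b) tensor2 \<Rightarrow> bool" where
  "factorizable sH \<Delta> S sB \<delta> K \<longleftrightarrow>
     bij_betw (theta_B \<Delta> S sB K) {f. Vector_Spaces.linear sH (*) f} (E_space sH sB \<delta>)"


section \<open>Linear categories\<close>

record ('k, 'o, 'm) lin_cat =
  Obj :: "'o set"
  Hom :: "'o \<Rightarrow> 'o \<Rightarrow> 'm set"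
  Cmp :: "'m \<Rightarrow> 'm \<Rightarrow> 'm"  (infixl "\<cdot>\<index>" 70)
  Idn :: "'o \<Rightarrow> 'm"
  Add :: "'m \<Rightarrow> 'm \<Rightarrow> 'm"
  Scl :: "'k \<Rightarrow> 'm \<Rightarrow> 'm"

definition linear_category :: "('k::field, 'o, 'm, 'z) lin_cat_scheme \<Rightarrow> bool" where
  "linear_category A \<longleftrightarrow>
     (\<forall>X\<in>Obj A. Idn A X \<in> Hom A X X) \<and>
     (\<forall>X\<in>Obj A. \<forall>Y\<in>Obj A. \<forall>Z\<in>Obj A. \<forall>f\<in>Hom A X Y. \<forall>g\<in>Hom A Y Z. g \<cdot>\<^bsub>A\<^esub> f \<in> Hom A X Z) \<and>
     (\<forall>X\<in>Obj A. \<forall>Y\<in>Obj A. \<forall>f\<in>Hom A X Y. f \<cdot>\<^bsub>A\<^esub> Idn A X = f \<and> Idn A Y \<cdot>\<^bsub>A\<^esub> f = f) \<and>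
     (\<forall>W\<in>Obj A. \<forall>X\<in>Obj A. \<forall>Y\<in>Obj A. \<forall>Z\<in>Obj A. \<forall>f\<in>Hom A W X. \<forall>g\<in>Hom A X Y. \<forall>h\<in>Hom A Y Z.
        (h \<cdot>\<^bsub>A\<^esub> g) \<cdot>\<^bsub>A\<^esub> f = h \<cdot>\<^bsub>A\<^esub> (g \<cdot>\<^bsub>A\<^esub> f)) \<and>
     (\<forall>X\<in>Obj A. \<forall>Y\<in>Obj A.
        (\<forall>f\<in>Hom A X Y. \<forall>g\<in>Hom A X Y. Add A f g \<in> Hom A X Y \<and> Add A f g = Add A g f) \<and>
        (\<forall>f\<in>Hom A X Y. \<forall>g\<in>Hom A X Y. \<forall>h\<in>Hom A X Y.
           Add A (Add A f g) h = Add A f (Add A g h)) \<and>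
        (\<exists>z\<in>Hom A X Y. \<forall>f\<in>Hom A X Y. Add A z f = f \<and> (\<exists>g\<in>Hom A X Y. Add A f g = z)) \<and>
        (\<forall>c. \<forall>f\<in>Hom A X Y. Scl A c f \<in> Hom A X Y) \<and>
        (\<forall>f\<in>Hom A X Y. Scl A 1 f = f) \<and>
        (\<forall>c d. \<forall>f\<in>Hom A X Y. Scl A (c * d) f = Scl A c (Scl A d f) \<and>
           Scl A (c + d) f = Add A (Scl A c f) (Scl A d f)) \<and>
        (\<forall>c. \<forall>f\<in>Hom A X Y. \<forall>g\<in>Hom A X Y.
           Scl A c (Add A f g) = Add A (Scl A c f) (Scl A c g))) \<and>
     (\<forall>X\<in>Obj A. \<forall>Y\<in>Obj A. \<forall>Z\<in>Obj A. \<forall>f\<in>Hom A X Y. \<forall>f'\<in>Hom A X Y. \<forall>g\<in>Hom A Y Z. \<forall>g'\<in>Hom A Y Z.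
        g \<cdot>\<^bsub>A\<^esub> Add A f f' = Add A (g \<cdot>\<^bsub>A\<^esub> f) (g \<cdot>\<^bsub>A\<^esub> f') \<and>
        Add A g g' \<cdot>\<^bsub>A\<^esub> f = Add A (g \<cdot>\<^bsub>A\<^esub> f) (g' \<cdot>\<^bsub>A\<^esub> f) \<and>
        (\<forall>c. g \<cdot>\<^bsub>A\<^esub> Scl A c f = Scl A c (g \<cdot>\<^bsub>A\<^esub> f) \<and> Scl A c g \<cdot>\<^bsub>A\<^esub> f = Scl A c (g \<cdot>\<^bsub>A\<^esub> f)))"

definition inverse_of ::
    "('k, 'o, 'm, 'z) lin_cat_scheme \<Rightarrow> 'o \<Rightarrow> 'o \<Rightarrow> 'm \<Rightarrow> 'm \<Rightarrow> bool" where
  "inverse_of A X Y f g \<longleftrightarrow> f \<in> Hom A X Y \<and> g \<in> Hom A Y X \<and>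
     g \<cdot>\<^bsub>A\<^esub> f = Idn A X \<and> f \<cdot>\<^bsub>A\<^esub> g = Idn A Y"

definition is_iso :: "('k, 'o, 'm, 'z) lin_cat_scheme \<Rightarrow> 'o \<Rightarrow> 'o \<Rightarrow> 'm \<Rightarrow> bool" where
  "is_iso A X Y f \<longleftrightarrow> (\<exists>g. inverse_of A X Y f g)"

definition inv_mor :: "('k, 'o, 'm, 'z) lin_cat_scheme \<Rightarrow> 'o \<Rightarrow> 'o \<Rightarrow> 'm \<Rightarrow> 'm" where
  "inv_mor A X Y f = (THE g. inverse_of A X Y f g)"

definition is_epi :: "('k, 'o, 'm, 'z) lin_cat_scheme \<Rightarrow> 'o \<Rightarrow> 'o \<Rightarrow> 'm \<Rightarrow> bool" where
  "is_epi A X Y f \<longleftrightarrow> f \<in> Hom A X Y \<and>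
     (\<forall>Z\<in>Obj A. \<forall>u\<in>Hom A Y Z. \<forall>v\<in>Hom A Y Z. u \<cdot>\<^bsub>A\<^esub> f = v \<cdot>\<^bsub>A\<^esub> f \<longrightarrow> u = v)"

definition projective :: "('k, 'o, 'm, 'z) lin_cat_scheme \<Rightarrow> 'o \<Rightarrow> bool" where
  "projective A P \<longleftrightarrow> P \<in> Obj A \<and>
     (\<forall>X\<in>Obj A. \<forall>Y\<in>Obj A. \<forall>g f. is_epi A X Y g \<longrightarrow> f \<in> Hom A P Y \<longrightarrow>
        (\<exists>f'\<in>Hom A P X. g \<cdot>\<^bsub>A\<^esub> f' = f))"

definition zero_object :: "('k, 'o, 'm, 'z) lin_cat_scheme \<Rightarrow> 'o \<Rightarrow> bool" where
  "zero_object A X \<longleftrightarrow> X \<in> Obj A \<and>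
     (\<forall>Y\<in>Obj A. (\<exists>!f. f \<in> Hom A X Y) \<and> (\<exists>!f. f \<in> Hom A Y X))"

definition nonzero_category :: "('k, 'o, 'm, 'z) lin_cat_scheme \<Rightarrow> bool" where
  "nonzero_category A \<longleftrightarrow> (\<exists>X\<in>Obj A. \<not> zero_object A X)"

text \<open>
  Ends in \<open>D\<close> of a functor \<open>T : A\<^sup>o\<^sup>p \<times> A \<rightarrow> D\<close>, given on objects by \<open>T\<close> and on morphisms
  by \<open>Tc X Y Z f = T(f, Z) : T(Y, Z) \<rightarrow> T(X, Z)\<close> and \<open>Tv X Y Z f = T(Z, f) : T(Z, X) \<rightarrow> T(Z, Y)\<close>,
  for \<open>f : X \<rightarrow> Y\<close>.
\<close>

definition is_wedge ::
    "('k, 'o, 'm, 'y) lin_cat_scheme \<Rightarrow> ('k, 'x, 'f, 'z) lin_cat_scheme \<Rightarrow> ('o \<Rightarrow> 'o \<Rightarrow> 'x) \<Rightarrow>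
     ('o \<Rightarrow> 'o \<Rightarrow> 'o \<Rightarrow> 'm \<Rightarrow> 'f) \<Rightarrow> ('o \<Rightarrow> 'o \<Rightarrow> 'o \<Rightarrow> 'm \<Rightarrow> 'f) \<Rightarrow> 'x \<Rightarrow> ('o \<Rightarrow> 'f) \<Rightarrow> bool" where
  "is_wedge A D T Tc Tv W p \<longleftrightarrow> W \<in> Obj D \<and>
     (\<forall>X\<in>Obj A. p X \<in> Hom D W (T X X)) \<and>
     (\<forall>X\<in>Obj A. \<forall>Y\<in>Obj A. \<forall>f\<in>Hom A X Y. Tv X Y X f \<cdot>\<^bsub>D\<^esub> p X = Tc X Y Y f \<cdot>\<^bsub>D\<^esub> p Y)"

definition is_end ::
    "('k, 'o, 'm, 'y) lin_cat_scheme \<Rightarrow> ('k, 'x, 'f, 'z) lin_cat_scheme \<Rightarrow> ('o \<Rightarrow> 'o \<Rightarrow> 'x) \<Rightarrow>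
     ('o \<Rightarrow> 'o \<Rightarrow> 'o \<Rightarrow> 'm \<Rightarrow> 'f) \<Rightarrow> ('o \<Rightarrow> 'o \<Rightarrow> 'o \<Rightarrow> 'm \<Rightarrow> 'f) \<Rightarrow> 'x \<Rightarrow> ('o \<Rightarrow> 'f) \<Rightarrow> bool" where
  "is_end A D T Tc Tv E \<pi> \<longleftrightarrow> is_wedge A D T Tc Tv E \<pi> \<and>
     (\<forall>W p. is_wedge A D T Tc Tv W p \<longrightarrow>
        (\<exists>!u. u \<in> Hom D W E \<and> (\<forall>X\<in>Obj A. \<pi> X \<cdot>\<^bsub>D\<^esub> u = p X)))"


section \<open>Tensor categories and module categories\<close>

text \<open>
  Tensor categories are strict here: \<open>\<otimes>\<close> is associative and unital on the nose, as it is for the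
  model of \<open>H-FdMod\<close> defined at the end, where it is given by Kronecker products of matrices.
  Duals are left duals, with \<open>Ev X : X\<^sup>* \<otimes> X \<rightarrow> 1\<close> and \<open>Coev X : 1 \<rightarrow> X \<otimes> X\<^sup>*\<close>.
\<close>

record ('k, 'x, 'f) tensor_cat = "('k, 'x, 'f) lin_cat" +
  TenO :: "'x \<Rightarrow> 'x \<Rightarrow> 'x"
  TenM :: "'f \<Rightarrow> 'f \<Rightarrow> 'f"
  Unt :: 'x
  Dual :: "'x \<Rightarrow> 'x"
  Ev :: "'x \<Rightarrow> 'f"
  Coev :: "'x \<Rightarrow> 'f"

definition dual_mor :: "('k, 'x, 'f) tensor_cat \<Rightarrow> 'x \<Rightarrow> 'x \<Rightarrow> 'f \<Rightarrow> 'f" where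
  "dual_mor C X Y f =
     TenM C (Ev C Y) (Idn C (Dual C X))
       \<cdot>\<^bsub>C\<^esub> TenM C (Idn C (Dual C Y)) (TenM C f (Idn C (Dual C X)))
       \<cdot>\<^bsub>C\<^esub> TenM C (Idn C (Dual C Y)) (Coev C X)"

text \<open>Constraints \<open>Asc X Y M : (X \<otimes> Y) \<triangleright> M \<rightarrow> X \<triangleright> (Y \<triangleright> M)\<close> and \<open>Uni M : 1 \<triangleright> M \<rightarrow> M\<close>.\<close>

record ('k, 'x, 'f, 'o, 'm) mod_cat = "('k, 'o, 'm) lin_cat" +
  ActO :: "'x \<Rightarrow> 'o \<Rightarrow> 'o"
  ActM :: "'f \<Rightarrow> 'm \<Rightarrow> 'm"
  Asc :: "'x \<Rightarrow> 'x \<Rightarrow> 'o \<Rightarrow> 'm"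
  Uni :: "'o \<Rightarrow> 'm"

definition module_category ::
    "('k::field, 'x, 'f) tensor_cat \<Rightarrow> ('k, 'x, 'f, 'o, 'm) mod_cat \<Rightarrow> bool" where
  "module_category C A \<longleftrightarrow> linear_category A \<and>
     (\<forall>X\<in>Obj C. \<forall>M\<in>Obj A. ActO A X M \<in> Obj A \<and>
        ActM A (Idn C X) (Idn A M) = Idn A (ActO A X M)) \<and>
     (\<forall>X\<in>Obj C. \<forall>Y\<in>Obj C. \<forall>M\<in>Obj A. \<forall>N\<in>Obj A. \<forall>f\<in>Hom C X Y. \<forall>g\<in>Hom A M N.
        ActM A f g \<in> Hom A (ActO A X M) (ActO A Y N)) \<and>
     (\<forall>X\<in>Obj C. \<forall>Y\<in>Obj C. \<forall>Z\<in>Obj C. \<forall>M\<in>Obj A. \<forall>N\<in>Obj A. \<forall>P\<in>Obj A.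
      \<forall>f\<in>Hom C X Y. \<forall>f'\<in>Hom C Y Z. \<forall>g\<in>Hom A M N. \<forall>g'\<in>Hom A N P.
        ActM A (f' \<cdot>\<^bsub>C\<^esub> f) (g' \<cdot>\<^bsub>A\<^esub> g) = ActM A f' g' \<cdot>\<^bsub>A\<^esub> ActM A f g) \<and>
     (\<forall>X\<in>Obj C. \<forall>Y\<in>Obj C. \<forall>M\<in>Obj A. \<forall>N\<in>Obj A.
      \<forall>f\<in>Hom C X Y. \<forall>f'\<in>Hom C X Y. \<forall>g\<in>Hom A M N. \<forall>g'\<in>Hom A M N.
        ActM A (Add C f f') g = Add A (ActM A f g) (ActM A f' g) \<and>
        ActM A f (Add A g g') = Add A (ActM A f g) (ActM A f g') \<and>
        (\<forall>c. ActM A (Scl C c f) g = Scl A c (ActM A f g) \<and>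
             ActM A f (Scl A c g) = Scl A c (ActM A f g))) \<and>
     (\<forall>X\<in>Obj C. \<forall>Y\<in>Obj C. \<forall>M\<in>Obj A.
        is_iso A (ActO A (TenO C X Y) M) (ActO A X (ActO A Y M)) (Asc A X Y M)) \<and>
     (\<forall>M\<in>Obj A. is_iso A (ActO A (Unt C) M) M (Uni A M)) \<and>
     (\<forall>X\<in>Obj C. \<forall>X'\<in>Obj C. \<forall>Y\<in>Obj C. \<forall>Y'\<in>Obj C. \<forall>M\<in>Obj A. \<forall>M'\<in>Obj A.
      \<forall>f\<in>Hom C X X'. \<forall>g\<in>Hom C Y Y'. \<forall>h\<in>Hom A M M'.
        Asc A X' Y' M' \<cdot>\<^bsub>A\<^esub> ActM A (TenM C f g) h = ActM A f (ActM A g h) \<cdot>\<^bsub>A\<^esub> Asc A X Y M) \<and>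
     (\<forall>M\<in>Obj A. \<forall>M'\<in>Obj A. \<forall>h\<in>Hom A M M'.
        Uni A M' \<cdot>\<^bsub>A\<^esub> ActM A (Idn C (Unt C)) h = h \<cdot>\<^bsub>A\<^esub> Uni A M) \<and>
     (\<forall>X\<in>Obj C. \<forall>Y\<in>Obj C. \<forall>Z\<in>Obj C. \<forall>M\<in>Obj A.
        ActM A (Idn C X) (Asc A Y Z M) \<cdot>\<^bsub>A\<^esub> Asc A X (TenO C Y Z) M =
        Asc A X Y (ActO A Z M) \<cdot>\<^bsub>A\<^esub> Asc A (TenO C X Y) Z M) \<and>
     (\<forall>X\<in>Obj C. \<forall>M\<in>Obj A.
        ActM A (Idn C X) (Uni A M) \<cdot>\<^bsub>A\<^esub> Asc A X (Unt C) M = Idn A (ActO A X M) \<and>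
        Uni A (ActO A X M) \<cdot>\<^bsub>A\<^esub> Asc A (Unt C) X M = Idn A (ActO A X M))"

definition exact_module_category ::
    "('k, 'x, 'f) tensor_cat \<Rightarrow> ('k, 'x, 'f, 'o, 'm) mod_cat \<Rightarrow> bool" where
  "exact_module_category C A \<longleftrightarrow>
     (\<forall>P M. projective C P \<longrightarrow> M \<in> Obj A \<longrightarrow> projective A (ActO A P M))"

definition direct_sum ::
    "('k, 'x, 'f, 'o, 'm) mod_cat \<Rightarrow> ('k, 'x, 'f, 'o, 'm) mod_cat \<Rightarrow>
     ('k, 'x, 'f, 'o \<times> 'o, 'm \<times> 'm) mod_cat" where
  "direct_sum A1 A2 = \<lparr>
     Obj = Obj A1 \<times> Obj A2,
     Hom = (\<lambda>(M1, M2) (N1, N2). Hom A1 M1 N1 \<times> Hom A2 M2 N2),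
     Cmp = (\<lambda>(g1, g2) (f1, f2). (g1 \<cdot>\<^bsub>A1\<^esub> f1, g2 \<cdot>\<^bsub>A2\<^esub> f2)),
     Idn = (\<lambda>(M1, M2). (Idn A1 M1, Idn A2 M2)),
     Add = (\<lambda>(f1, f2) (g1, g2). (Add A1 f1 g1, Add A2 f2 g2)),
     Scl = (\<lambda>c (f1, f2). (Scl A1 c f1, Scl A2 c f2)),
     ActO = (\<lambda>X (M1, M2). (ActO A1 X M1, ActO A2 X M2)),
     ActM = (\<lambda>f (g1, g2). (ActM A1 f g1, ActM A2 f g2)),
     Asc = (\<lambda>X Y (M1, M2). (Asc A1 X Y M1, Asc A2 X Y M2)),
     Uni = (\<lambda>(M1, M2). (Uni A1 M1, Uni A2 M2)) \<rparr>"

text \<open>Equivalence of module categories: a linear functor \<open>(FO, FM)\<close> that is fully faithful and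
  essentially surjective, with natural isomorphisms \<open>s X M : F(X \<triangleright> M) \<rightarrow> X \<triangleright> F M\<close> compatible with
  the constraints.\<close>

definition module_equivalence ::
    "('k, 'x, 'f) tensor_cat \<Rightarrow> ('k, 'x, 'f, 'o, 'm) mod_cat \<Rightarrow> ('k, 'x, 'f, 'p, 'n) mod_cat \<Rightarrow>
     ('o \<Rightarrow> 'p) \<Rightarrow> ('o \<Rightarrow> 'o \<Rightarrow> 'm \<Rightarrow> 'n) \<Rightarrow> ('x \<Rightarrow> 'o \<Rightarrow> 'n) \<Rightarrow> bool" where
  "module_equivalence C A D FO FM s \<longleftrightarrow>
     (\<forall>M\<in>Obj A. FO M \<in> Obj D \<and> FM M M (Idn A M) = Idn D (FO M)) \<and>
     (\<forall>M\<in>Obj A. \<forall>N\<in>Obj A. \<forall>P\<in>Obj A. \<forall>f\<in>Hom A M N. \<forall>g\<in>Hom A N P.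
        FM M P (g \<cdot>\<^bsub>A\<^esub> f) = FM N P g \<cdot>\<^bsub>D\<^esub> FM M N f) \<and>
     (\<forall>M\<in>Obj A. \<forall>N\<in>Obj A. \<forall>f\<in>Hom A M N. \<forall>g\<in>Hom A M N.
        FM M N (Add A f g) = Add D (FM M N f) (FM M N g) \<and>
        (\<forall>c. FM M N (Scl A c f) = Scl D c (FM M N f))) \<and>
     (\<forall>M\<in>Obj A. \<forall>N\<in>Obj A. bij_betw (FM M N) (Hom A M N) (Hom D (FO M) (FO N))) \<and>
     (\<forall>P\<in>Obj D. \<exists>M\<in>Obj A. \<exists>i. is_iso D (FO M) P i) \<and>
     (\<forall>X\<in>Obj C. \<forall>M\<in>Obj A. is_iso D (FO (ActO A X M)) (ActO D X (FO M)) (s X M)) \<and>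
     (\<forall>X\<in>Obj C. \<forall>Y\<in>Obj C. \<forall>M\<in>Obj A. \<forall>N\<in>Obj A. \<forall>f\<in>Hom C X Y. \<forall>g\<in>Hom A M N.
        s Y N \<cdot>\<^bsub>D\<^esub> FM (ActO A X M) (ActO A Y N) (ActM A f g) = ActM D f (FM M N g) \<cdot>\<^bsub>D\<^esub> s X M) \<and>
     (\<forall>X\<in>Obj C. \<forall>Y\<in>Obj C. \<forall>M\<in>Obj A.
        Asc D X Y (FO M) \<cdot>\<^bsub>D\<^esub> s (TenO C X Y) M =
        ActM D (Idn C X) (s Y M) \<cdot>\<^bsub>D\<^esub> s X (ActO A Y M)
          \<cdot>\<^bsub>D\<^esub> FM (ActO A (TenO C X Y) M) (ActO A X (ActO A Y M)) (Asc A X Y M)) \<and>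
     (\<forall>M\<in>Obj A. Uni D (FO M) \<cdot>\<^bsub>D\<^esub> s (Unt C) M = FM (ActO A (Unt C) M) M (Uni A M))"

text \<open>
  The summands range over module categories with the same types of objects and morphisms as \<open>A\<close>.
  This is no restriction: if \<open>A\<close> is equivalent to \<open>A1 \<oplus> A2\<close>, each \<open>Ai\<close> is equivalent to the full
  module subcategory of the objects of \<open>A\<close> whose image in the other summand is zero.  For the same
  reason a summand is finite abelian, with action exact in each variable, as soon as \<open>A\<close> is, so
  this need not be required of it separately.
\<close>

definition indecomposable_module_category ::
    "('k::field, 'x, 'f) tensor_cat \<Rightarrow> ('k, 'x, 'f, 'o, 'm) mod_cat \<Rightarrow> bool" where
  "indecomposable_module_category C A \<longleftrightarrow>
     \<not> (\<exists>(A1 :: ('k, 'x, 'f, 'o, 'm) mod_cat) (A2 :: ('k, 'x, 'f, 'o, 'm) mod_cat) FO FM s.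
          module_category C A1 \<and> module_category C A2 \<and>
          nonzero_category A1 \<and> nonzero_category A2 \<and>
          module_equivalence C A (direct_sum A1 A2) FO FM s)"


section \<open>Braided module categories and nondegeneracy\<close>

text \<open>The last two axioms are \<open>e\<^bsub>X\<otimes>Y,M\<^esub> = (X \<triangleright> e\<^bsub>Y,M\<^esub>) c\<^bsub>Y,X\<^esub> (Y \<triangleright> e\<^bsub>X,M\<^esub>) c\<^bsub>Y,X\<^esub>\<^sup>-\<^sup>1\<close>, with the
  inverse cleared, and \<open>e\<^bsub>X,Y\<triangleright>M\<^esub> = c\<^bsub>Y,X\<^esub> (Y \<triangleright> e\<^bsub>X,M\<^esub>) c\<^bsub>X,Y\<^esub>\<close>, up to \<open>Asc\<close>; for \<open>c\<close> and \<open>e\<close> given by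
  \<open>R\<close> and \<open>K\<close> they are the first two axioms on \<open>K\<close>.\<close>

definition braided_module_category ::
    "('k::field, 'x, 'f) tensor_cat \<Rightarrow> ('x \<Rightarrow> 'x \<Rightarrow> 'f) \<Rightarrow> ('k, 'x, 'f, 'o, 'm) mod_cat \<Rightarrow>
     ('x \<Rightarrow> 'o \<Rightarrow> 'm) \<Rightarrow> bool" where
  "braided_module_category C c A e \<longleftrightarrow> module_category C A \<and>
     (\<forall>X\<in>Obj C. \<forall>M\<in>Obj A. is_iso A (ActO A X M) (ActO A X M) (e X M)) \<and>
     (\<forall>X\<in>Obj C. \<forall>Y\<in>Obj C. \<forall>M\<in>Obj A. \<forall>N\<in>Obj A. \<forall>f\<in>Hom C X Y. \<forall>g\<in>Hom A M N.
        e Y N \<cdot>\<^bsub>A\<^esub> ActM A f g = ActM A f g \<cdot>\<^bsub>A\<^esub> e X M) \<and>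
     (\<forall>X\<in>Obj C. \<forall>Y\<in>Obj C. \<forall>M\<in>Obj A.
        Asc A X Y M \<cdot>\<^bsub>A\<^esub> e (TenO C X Y) M \<cdot>\<^bsub>A\<^esub> ActM A (c Y X) (Idn A M) =
        ActM A (Idn C X) (e Y M) \<cdot>\<^bsub>A\<^esub> Asc A X Y M \<cdot>\<^bsub>A\<^esub> ActM A (c Y X) (Idn A M)
          \<cdot>\<^bsub>A\<^esub> inv_mor A (ActO A (TenO C Y X) M) (ActO A Y (ActO A X M)) (Asc A Y X M)
          \<cdot>\<^bsub>A\<^esub> ActM A (Idn C Y) (e X M) \<cdot>\<^bsub>A\<^esub> Asc A Y X M) \<and>
     (\<forall>X\<in>Obj C. \<forall>Y\<in>Obj C. \<forall>M\<in>Obj A.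
        e X (ActO A Y M) \<cdot>\<^bsub>A\<^esub> Asc A X Y M =
        Asc A X Y M \<cdot>\<^bsub>A\<^esub> ActM A (c Y X) (Idn A M)
          \<cdot>\<^bsub>A\<^esub> inv_mor A (ActO A (TenO C Y X) M) (ActO A Y (ActO A X M)) (Asc A Y X M)
          \<cdot>\<^bsub>A\<^esub> ActM A (Idn C Y) (e X M) \<cdot>\<^bsub>A\<^esub> Asc A Y X M \<cdot>\<^bsub>A\<^esub> ActM A (c X Y) (Idn A M))"

text \<open>Internal Homs: \<open>ih M N\<close> with the counit \<open>iev M N : ih M N \<triangleright> M \<rightarrow> N\<close> of the adjunction
  \<open>(- \<triangleright> M) \<stileturn> ih M\<close>.\<close>

definition internal_hom ::
    "('k, 'x, 'f) tensor_cat \<Rightarrow> ('k, 'x, 'f, 'o, 'm) mod_cat \<Rightarrow>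
     ('o \<Rightarrow> 'o \<Rightarrow> 'x) \<Rightarrow> ('o \<Rightarrow> 'o \<Rightarrow> 'm) \<Rightarrow> bool" where
  "internal_hom C A ih iev \<longleftrightarrow>
     (\<forall>M\<in>Obj A. \<forall>N\<in>Obj A. ih M N \<in> Obj C \<and> iev M N \<in> Hom A (ActO A (ih M N) M) N \<and>
        (\<forall>X\<in>Obj C. \<forall>f\<in>Hom A (ActO A X M) N.
           \<exists>!g. g \<in> Hom C X (ih M N) \<and> iev M N \<cdot>\<^bsub>A\<^esub> ActM A g (Idn A M) = f))"

locale internal_hom_data =
  fixes C :: "('k, 'x, 'f) tensor_cat" and A :: "('k, 'x, 'f, 'o, 'm) mod_cat"
    and ih :: "'o \<Rightarrow> 'o \<Rightarrow> 'x" and iev :: "'o \<Rightarrow> 'o \<Rightarrow> 'm"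
begin

text \<open>The adjunct \<open>X \<rightarrow> ih M N\<close> of \<open>f : X \<triangleright> M \<rightarrow> N\<close>.\<close>

definition adjunct :: "'x \<Rightarrow> 'o \<Rightarrow> 'o \<Rightarrow> 'm \<Rightarrow> 'f" where
  "adjunct X M N f = (THE g. g \<in> Hom C X (ih M N) \<and> iev M N \<cdot>\<^bsub>A\<^esub> ActM A g (Idn A M) = f)"

text \<open>\<open>ih_cov N N' M f = ih(M, f)\<close> for \<open>f : N \<rightarrow> N'\<close>, and \<open>ih_con M M' N f = ih(f, N)\<close> for
  \<open>f : M \<rightarrow> M'\<close>.\<close>

definition ih_cov :: "'o \<Rightarrow> 'o \<Rightarrow> 'o \<Rightarrow> 'm \<Rightarrow> 'f" where
  "ih_cov N N' M f = adjunct (ih M N) M N' (f \<cdot>\<^bsub>A\<^esub> iev M N)"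

definition ih_con :: "'o \<Rightarrow> 'o \<Rightarrow> 'o \<Rightarrow> 'm \<Rightarrow> 'f" where
  "ih_con M M' N f =
     adjunct (ih M' N) M N (iev M' N \<cdot>\<^bsub>A\<^esub> ActM A (Idn C (ih M' N)) f)"

definition ih_coev :: "'o \<Rightarrow> 'f" where
  "ih_coev M = adjunct (Unt C) M M (Uni A M)"

text \<open>The canonical isomorphism \<open>X \<otimes> ih M N \<rightarrow> ih M (X \<triangleright> N)\<close>.\<close>

definition ih_can :: "'x \<Rightarrow> 'o \<Rightarrow> 'o \<Rightarrow> 'f" where
  "ih_can X M N = adjunct (TenO C X (ih M N)) M (ActO A X N)
     (ActM A (Idn C X) (iev M N) \<cdot>\<^bsub>A\<^esub> Asc A X (ih M N) M)"

definition ih_can_inv :: "'x \<Rightarrow> 'o \<Rightarrow> 'o \<Rightarrow> 'f" where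
  "ih_can_inv X M N = inv_mor C (TenO C X (ih M N)) (ih M (ActO A X N)) (ih_can X M N)"

text \<open>The composite \<open>1 \<rightarrow> X \<otimes> X\<^sup>* \<otimes> ih M M\<close> that determines \<open>\<omega>\<close>.\<close>

definition omega_component :: "('x \<Rightarrow> 'o \<Rightarrow> 'm) \<Rightarrow> 'x \<Rightarrow> 'o \<Rightarrow> 'f" where
  "omega_component e X M =
     TenM C (Idn C X) (ih_can_inv (Dual C X) M M)
       \<cdot>\<^bsub>C\<^esub> TenM C (Idn C X)
             (ih_cov (ActO A (Dual C X) M) (ActO A (Dual C X) M) M (e (Dual C X) M))
       \<cdot>\<^bsub>C\<^esub> TenM C (Idn C X) (ih_can (Dual C X) M M)
       \<cdot>\<^bsub>C\<^esub> TenM C (Coev C X) (ih_coev M)"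

end

definition end_of_C :: "('k, 'x, 'f) tensor_cat \<Rightarrow> 'x \<Rightarrow> ('x \<Rightarrow> 'f) \<Rightarrow> bool" where
  "end_of_C C E \<pi> \<longleftrightarrow> is_end C C
     (\<lambda>X Y. TenO C Y (Dual C X))
     (\<lambda>X Y Z f. TenM C (Idn C Z) (dual_mor C X Y f))
     (\<lambda>X Y Z f. TenM C f (Idn C (Dual C Z)))
     E \<pi>"

definition end_of_M ::
    "('k, 'x, 'f) tensor_cat \<Rightarrow> ('k, 'x, 'f, 'o, 'm) mod_cat \<Rightarrow>
     ('o \<Rightarrow> 'o \<Rightarrow> 'x) \<Rightarrow> ('o \<Rightarrow> 'o \<Rightarrow> 'm) \<Rightarrow> 'x \<Rightarrow> ('o \<Rightarrow> 'f) \<Rightarrow> bool" where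
  "end_of_M C A ih iev E \<pi> \<longleftrightarrow> is_end A C ih
     (internal_hom_data.ih_con C A ih iev)
     (internal_hom_data.ih_cov C A ih iev)
     E \<pi>"

text \<open>The internal Homs, the two ends and \<open>\<omega>\<close> are unique up to unique isomorphism, so it does
  not matter for which of them \<open>\<theta> : E\<^sub>C\<^sup>* \<rightarrow> E\<^sub>M\<close> is required to be invertible.\<close>

definition nondegenerate_braided_module_category ::
    "('k::field, 'x, 'f) tensor_cat \<Rightarrow> ('x \<Rightarrow> 'x \<Rightarrow> 'f) \<Rightarrow> ('k, 'x, 'f, 'o, 'm) mod_cat \<Rightarrow>
     ('x \<Rightarrow> 'o \<Rightarrow> 'm) \<Rightarrow> bool" where
  "nondegenerate_braided_module_category C c A e \<longleftrightarrow>
     braided_module_category C c A e \<and>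
     (\<exists>ih iev EC \<pi>C EM \<pi>M \<omega>.
        internal_hom C A ih iev \<and>
        end_of_C C EC \<pi>C \<and>
        end_of_M C A ih iev EM \<pi>M \<and>
        \<omega> \<in> Hom C (Unt C) (TenO C EC EM) \<and>
        (\<forall>X\<in>Obj C. \<forall>M\<in>Obj A.
           TenM C (\<pi>C X) (\<pi>M M) \<cdot>\<^bsub>C\<^esub> \<omega> = internal_hom_data.omega_component C A ih iev e X M) \<and>
        is_iso C (Dual C EC) EM
          (TenM C (Ev C EC) (Idn C EM) \<cdot>\<^bsub>C\<^esub> TenM C (Idn C (Dual C EC)) \<omega>))"


section \<open>Finite-dimensional modules\<close>

text \<open>
  A finite-dimensional module over an algebra is taken to be a matrix representation \<open>(n, \<rho>)\<close> on
  \<open>k\<^sup>n\<close>; every finite-dimensional module is isomorphic to one of these.  Morphisms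
  are intertwining matrices, and \<open>k\<^sup>m \<otimes> k\<^sup>n = k\<^sup>m\<^sup>n\<close> via \<open>e\<^sub>i \<otimes> e\<^sub>j \<mapsto> e\<^bsub>i n + j\<^esub>\<close> (Kronecker product),
  which is strictly associative and unital.
\<close>

type_synonym ('k, 'a) rep = "nat \<times> ('a \<Rightarrow> 'k mat)"

definition fdmods :: "('k::field \<Rightarrow> 'a::{ring,monoid_mult} \<Rightarrow> 'a) \<Rightarrow> ('k, 'a) rep set" where
  "fdmods sA = {(n, \<rho>).
     (\<forall>a. \<rho> a \<in> carrier_mat n n) \<and> \<rho> 1 = 1\<^sub>m n \<and> (\<forall>a b. \<rho> (a * b) = \<rho> a * \<rho> b) \<and>
     (\<forall>a b. \<rho> (a + b) = \<rho> a + \<rho> b) \<and> (\<forall>c a. \<rho> (sA c a) = c \<cdot>\<^sub>m \<rho> a)}"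

definition intertwiners :: "('k::field, 'a) rep \<Rightarrow> ('k, 'a) rep \<Rightarrow> 'k mat set" where
  "intertwiners X Y = {f \<in> carrier_mat (fst Y) (fst X). \<forall>a. f * snd X a = snd Y a * f}"

definition kron :: "'k::field mat \<Rightarrow> 'k mat \<Rightarrow> 'k mat" where
  "kron f g = mat (dim_row f * dim_row g) (dim_col f * dim_col g)
     (\<lambda>(i, j). f $$ (i div dim_row g, j div dim_col g) * g $$ (i mod dim_row g, j mod dim_col g))"

definition flip_mat :: "nat \<Rightarrow> nat \<Rightarrow> 'k::field mat" where
  "flip_mat m n = mat (n * m) (m * n)
     (\<lambda>(i, j). if i div m = j mod n \<and> i mod m = j div n then 1 else 0)"

text \<open>The action of a tensor \<open>\<Sum> a \<otimes> b\<close> on \<open>X \<otimes> Y\<close>.\<close>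

definition tensor_act :: "('a, 'b) tensor2 \<Rightarrow> ('k::field, 'a) rep \<Rightarrow> ('k, 'b) rep \<Rightarrow> 'k mat" where
  "tensor_act t X Y = mat (fst X * fst Y) (fst X * fst Y)
     (\<lambda>ij. \<Sum>(a, b)\<leftarrow>sweedler t. kron (snd X a) (snd Y b) $$ ij)"

definition tensor_rep ::
    "('a \<Rightarrow> ('h, 'a) tensor2) \<Rightarrow> ('k::field, 'h) rep \<Rightarrow> ('k, 'a) rep \<Rightarrow> ('k, 'a) rep" where
  "tensor_rep D X M = (fst X * fst M, \<lambda>a. tensor_act (D a) X M)"

definition H_FdMod ::
    "('k::field \<Rightarrow> 'h::{ring,monoid_mult} \<Rightarrow> 'h) \<Rightarrow> ('h \<Rightarrow> ('h, 'h) tensor2) \<Rightarrow> ('h \<Rightarrow> 'k) \<Rightarrow>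
     ('h \<Rightarrow> 'h) \<Rightarrow> ('k, ('k, 'h) rep, 'k mat) tensor_cat" where
  "H_FdMod sH \<Delta> \<epsilon> S = \<lparr>
     Obj = fdmods sH, Hom = intertwiners, Cmp = (*), Idn = (\<lambda>X. 1\<^sub>m (fst X)),
     Add = (+), Scl = (\<cdot>\<^sub>m),
     TenO = tensor_rep \<Delta>,
     TenM = kron,
     Unt = (1, \<lambda>h. mat 1 1 (\<lambda>_. \<epsilon> h)),
     Dual = (\<lambda>X. (fst X, \<lambda>h. transpose_mat (snd X (S h)))),
     Ev = (\<lambda>X. mat 1 (fst X * fst X) (\<lambda>(i, j). if j div fst X = j mod fst X then 1 else 0)),
     Coev = (\<lambda>X. mat (fst X * fst X) 1 (\<lambda>(i, j). if i div fst X = i mod fst X then 1 else 0)) \<rparr>"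

definition B_FdMod ::
    "('k::field \<Rightarrow> 'b::{ring,monoid_mult} \<Rightarrow> 'b) \<Rightarrow> ('b \<Rightarrow> ('h, 'b) tensor2) \<Rightarrow>
     ('k, ('k, 'h) rep, 'k mat, ('k, 'b) rep, 'k mat) mod_cat" where
  "B_FdMod sB \<delta> = \<lparr>
     Obj = fdmods sB, Hom = intertwiners, Cmp = (*), Idn = (\<lambda>X. 1\<^sub>m (fst X)),
     Add = (+), Scl = (\<cdot>\<^sub>m),
     ActO = tensor_rep \<delta>,
     ActM = kron,
     Asc = (\<lambda>X Y M. 1\<^sub>m (fst X * fst Y * fst M)),
     Uni = (\<lambda>M. 1\<^sub>m (fst M)) \<rparr>"

definition R_braiding ::
    "('h, 'h) tensor2 \<Rightarrow> ('k::field, 'h) rep \<Rightarrow> ('k, 'h) rep \<Rightarrow> 'k mat" where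
  "R_braiding R X Y = flip_mat (fst X) (fst Y) * tensor_act R X Y"

definition K_braiding ::
    "('h, 'b) tensor2 \<Rightarrow> ('k::field, 'h) rep \<Rightarrow> ('k, 'b) rep \<Rightarrow> 'k mat" where
  "K_braiding K X M = tensor_act K X M"

end

theory Submission
  imports Defs "HOL-Library.Function_Algebras"
begin

text \<open>
  The elements of the end of \<open>X \<otimes> X\<^sup>*\<close> are the families \<open>(\<rho>\<^sub>X(a))\<close> for \<open>a \<in> H\<close>, so its dual is
  \<open>H\<^sup>*\<close>.  The elements of \<open>ih M N\<close> are the \<open>B\<close>-linear maps \<open>H \<triangleright> M \<rightarrow> N\<close>, where \<open>v\<close> corresponds to
  \<open>h \<otimes> m \<mapsto> iev (h v \<otimes> m)\<close>; by naturality with respect to maps out of the regular \<open>B\<close>-module, the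
  elements of the end of \<open>ih M M\<close> are the families \<open>(\<rho>\<^sub>M(\<xi> h))\<close> with \<open>\<xi> \<in> E(H,B)\<close>.  Under these
  identifications, contracting \<open>\<omega>\<close> with the matrix coefficient \<open>f \<in> H\<^sup>*\<close> yields \<open>\<theta>\<^sub>B(f \<circ> S)\<close>: the
  braiding contributes the action of \<open>S(h\<^sub>1) K\<^sub>i h\<^sub>2\<close> on \<open>X\<^sup>*\<close>, which is where the remaining antipode comes
  from.  As \<open>S\<close> is bijective (its square is conjugation by the Drinfeld element), \<open>\<theta>\<close> is invertible
  iff \<open>\<theta>\<^sub>B\<close> is.  Conversely, the formula determines the matrix of an invariant \<open>\<omega>\<close>, and the internal
  Homs and the ends are constructed from these descriptions.
\<close>

text \<open>The categorical definitions speak of modules only, never of their elements. Elements are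
  recovered by mapping out of a regular module: a vector x of X is the module map from H to X
  sending 1 to x. This determines the vector spaces underlying arbitrary internal Homs and ends that
  satisfy the universal properties, not just of particular models; over B the same device evaluates
  natural families.

  The component of \<omega> involves the inverse of the canonical map X \<otimes> ih M N
  \<rightarrow> ih M (X \<triangleright> N). No formula for it is written down; instead, pairing
  S(h1) \<psi>(h2) with functionals on X undoes the diagonal action of h in the canonical map. The
  factor S(h1) in \<open>theta_B\<close> comes from there, K from the module braiding, and h2 from
  the action on the vector inserted by coevaluation.

  A functional on the end over H-modules makes no reference to any single X. Since every functional
  on H is a matrix coefficient of the regular H-module, it is pulled back from that one component,
  so the component of \<omega> there already computes \<theta> on it.\<close>

section \<open>Sweedler sums and the evaluation of multilinear maps on formal tensors\<close>

definition sw :: "('u \<times> 'v) list set \<Rightarrow> ('u \<Rightarrow> 'v \<Rightarrow> 'w::comm_monoid_add) \<Rightarrow> 'w" where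
  "sw t \<beta> = (\<Sum>(u, v)\<leftarrow>sweedler t. \<beta> u v)"

text \<open>Only the two equations of linearity: \<open>Vector_Spaces.linear\<close> also asserts
  the vector space axioms on both sides, which would reappear as side conditions in every structural
  rule for composites.\<close>

definition lin :: "('k::field \<Rightarrow> 'u::ab_group_add \<Rightarrow> 'u) \<Rightarrow> ('k \<Rightarrow> 'w::ab_group_add \<Rightarrow> 'w) \<Rightarrow>
    ('u \<Rightarrow> 'w) \<Rightarrow> bool" where
  "lin sU sW f \<longleftrightarrow> (\<forall>x y. f (x + y) = f x + f y) \<and> (\<forall>c x. f (sU c x) = sW c (f x))"

definition bilin :: "('k::field \<Rightarrow> 'u::ab_group_add \<Rightarrow> 'u) \<Rightarrow> ('k \<Rightarrow> 'v::ab_group_add \<Rightarrow> 'v) \<Rightarrow>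
    ('k \<Rightarrow> 'w::ab_group_add \<Rightarrow> 'w) \<Rightarrow> ('u \<Rightarrow> 'v \<Rightarrow> 'w) \<Rightarrow> bool" where
  "bilin sU sV sW \<beta> \<longleftrightarrow> (\<forall>v. lin sU sW (\<lambda>u. \<beta> u v)) \<and> (\<forall>u. lin sV sW (\<beta> u))"

definition trilin :: "('k::field \<Rightarrow> 'u::ab_group_add \<Rightarrow> 'u) \<Rightarrow> ('k \<Rightarrow> 'v::ab_group_add \<Rightarrow> 'v) \<Rightarrow>
    ('k \<Rightarrow> 'x::ab_group_add \<Rightarrow> 'x) \<Rightarrow> ('k \<Rightarrow> 'w::ab_group_add \<Rightarrow> 'w) \<Rightarrow>
    ('u \<Rightarrow> 'v \<Rightarrow> 'x \<Rightarrow> 'w) \<Rightarrow> bool" where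
  "trilin sU sV sX sW \<tau> \<longleftrightarrow> (\<forall>v x. lin sU sW (\<lambda>u. \<tau> u v x)) \<and>
     (\<forall>u x. lin sV sW (\<lambda>v. \<tau> u v x)) \<and> (\<forall>u v. lin sX sW (\<tau> u v))"

lemma linI:
  "(\<And>x y. f (x + y) = f x + f y) \<Longrightarrow> (\<And>c x. f (sU c x) = sW c (f x)) \<Longrightarrow> lin sU sW f"
  unfolding lin_def by blast

lemma linD: "lin sU sW f \<Longrightarrow> f (x + y) = f x + f y" "lin sU sW f \<Longrightarrow> f (sU c x) = sW c (f x)"
  unfolding lin_def by blast+

lemma lin_zero: "lin sU sW f \<Longrightarrow> f 0 = 0"
  using linD(1)[of sU sW f 0 0] by simp

lemma lin_diff: "lin sU sW f \<Longrightarrow> f (x - y) = f x - f y"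
  using linD(1)[of sU sW f "x - y" y] by simp

lemma bilinI: "(\<And>v. lin sU sW (\<lambda>u. \<beta> u v)) \<Longrightarrow> (\<And>u. lin sV sW (\<beta> u)) \<Longrightarrow> bilin sU sV sW \<beta>"
  unfolding bilin_def by blast

lemma bilinD: "bilin sU sV sW \<beta> \<Longrightarrow> lin sU sW (\<lambda>u. \<beta> u v)" "bilin sU sV sW \<beta> \<Longrightarrow> lin sV sW (\<beta> u)"
  unfolding bilin_def by blast+

lemma trilinI: "(\<And>v x. lin sU sW (\<lambda>u. \<tau> u v x)) \<Longrightarrow> (\<And>u x. lin sV sW (\<lambda>v. \<tau> u v x)) \<Longrightarrow>
    (\<And>u v. lin sX sW (\<tau> u v)) \<Longrightarrow> trilin sU sV sX sW \<tau>"
  unfolding trilin_def by blast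

lemma linear_iff_lin:
  assumes "vector_space sU" "vector_space sW"
  shows "Vector_Spaces.linear sU sW f \<longleftrightarrow> lin sU sW f"
  using assms unfolding Vector_Spaces.linear_def module_hom_def module_hom_axioms_def lin_def
    module_iff_vector_space by auto

lemma linear_imp_lin: "Vector_Spaces.linear sU sW f \<Longrightarrow> lin sU sW f"
  unfolding Vector_Spaces.linear_def module_hom_def module_hom_axioms_def lin_def by auto

lemma vector_space_field: "vector_space ((*) :: 'k::field \<Rightarrow> 'k \<Rightarrow> 'k)"
  by (unfold_locales) (auto simp: algebra_simps)

lemma lin_sum_list: "lin sU sW f \<Longrightarrow> f (\<Sum>(x,y)\<leftarrow>l. g x y) = (\<Sum>(x,y)\<leftarrow>l. f (g x y))"
  by (induction l) (auto simp: lin_zero linD)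

lemma lin_sum_list3: "lin sU sW f \<Longrightarrow> f (\<Sum>(x,y,z)\<leftarrow>l. g x y z) = (\<Sum>(x,y,z)\<leftarrow>l. f (g x y z))"
  by (induction l) (auto simp: lin_zero linD)

lemma lin_sw: "lin sU sW f \<Longrightarrow> f (sw t g) = sw t (\<lambda>x y. f (g x y))"
  unfolding sw_def by (rule lin_sum_list)

lemma lin_sum: "lin sU sW f \<Longrightarrow> f (\<Sum>i\<in>I. g i) = (\<Sum>i\<in>I. f (g i))"
  by (induction I rule: infinite_finite_induct) (auto simp: lin_zero linD)

lemma sum_list_add: "(\<Sum>(x,y)\<leftarrow>l. f x y + g x y :: 'w::comm_monoid_add) = (\<Sum>(x,y)\<leftarrow>l. f x y) + (\<Sum>(x,y)\<leftarrow>l. g x y)"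
  by (induction l) (auto simp: algebra_simps)

lemma sw_add: "sw t (\<lambda>x y. f x y + g x y) = sw t f + sw t g"
  unfolding sw_def by (rule sum_list_add)

lemma sw_zero [simp]: "sw t (\<lambda>(x::'a) (y::'b). 0::'c::comm_monoid_add) = 0"
proof -
  have "(\<Sum>(x,y)\<leftarrow>l. 0::'c::comm_monoid_add) = 0" for l :: "('a \<times> 'b) list" by (induction l) auto
  then show ?thesis unfolding sw_def by blast
qed

lemma sw_cong: "(\<And>x y. f x y = g x y) \<Longrightarrow> sw t f = sw t g"
  by (rule arg_cong[of f g]) (simp add: fun_eq_iff)

lemma sw_sum: "sw t (\<lambda>x y. \<Sum>i\<in>I. f i x y) = (\<Sum>i\<in>I. sw t (f i))"
  by (induction I rule: infinite_finite_induct) (auto simp: sw_add)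

lemma sw_swap: "sw t (\<lambda>x y. sw t' (\<lambda>u v. f x y u v)) = sw t' (\<lambda>u v. sw t (\<lambda>x y. f x y u v))"
proof -
  have "(\<Sum>(x,y)\<leftarrow>l. \<Sum>(u,v)\<leftarrow>l'. f x y u v) = (\<Sum>(u,v)\<leftarrow>l'. \<Sum>(x,y)\<leftarrow>l. f x y u v)" for l l'
  proof (induction l)
    case Nil then show ?case by (induction l') auto
  next
    case (Cons a l) then show ?case
      by (cases a) (simp add: sum_list_add)
  qed
  then show ?thesis unfolding sw_def .
qed

text \<open>The difference \<open>w - w'\<close> is nonzero, hence an independent singleton, and a
  linear map may be prescribed to be 1 on it. Tensor equality tests scalar-valued forms only;
  separating functionals extend it to maps with values in any vector space.\<close>

lemma lin_separates:
  assumes W: "vector_space sW" and "w \<noteq> w'"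
  obtains f where "lin sW (*) f" "f w \<noteq> (f w' :: 'k::field)"
proof -
  interpret W: vector_space sW by fact
  interpret pr: vector_space_pair sW "(*) :: 'k \<Rightarrow> 'k \<Rightarrow> 'k"
    by (simp add: vector_space_pair_def W vector_space_field)
  have ind: "W.independent {w - w'}" using assms by simp
  let ?f = "pr.construct {w - w'} (\<lambda>_. 1)"
  have "lin sW (*) ?f" using pr.linear_construct[OF ind] by (rule linear_imp_lin)
  moreover have "?f (w - w') = 1" using pr.construct_basis[OF ind] by simp
  moreover from this have "?f w \<noteq> ?f w'"
    using lin_diff[OF \<open>lin sW (*) ?f\<close>, of w w'] by auto
  ultimately show ?thesis using that[of ?f] by blast
qed

lemma mem_tensor2: "l \<in> tensor2 sU sV l" unfolding tensor2_def by simp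
lemma mem_tensor3: "l \<in> tensor3 sU sV sX l" unfolding tensor3_def by simp

lemma tensor2_mem_eq: "l' \<in> tensor2 sU sV l \<Longrightarrow> tensor2 sU sV l' = tensor2 sU sV l"
  unfolding tensor2_def by auto

lemma tensor2_sweedler: "t \<in> range (tensor2 sU sV) \<Longrightarrow> tensor2 sU sV (sweedler t) = t"
  unfolding sweedler_def using mem_tensor2 tensor2_mem_eq by (metis rangeE someI)

text \<open>If the two values of \<open>\<beta>\<close> differed, a functional separating them would
  compose with \<open>\<beta>\<close> to a scalar bilinear form distinguishing \<open>l\<close> from
  \<open>l'\<close>. Thus every bilinear map is well defined on tensors, whichever formal sum
  \<open>sweedler\<close> picks.\<close>

lemma tensor2_eqD:
  assumes "vector_space sU" "vector_space sV" and W: "vector_space sW"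
    and eq: "tensor2 sU sV l = tensor2 sU sV l'" and "bilin sU sV sW \<beta>"
  shows "(\<Sum>(u, v)\<leftarrow>l. \<beta> u v) = (\<Sum>(u, v)\<leftarrow>l'. \<beta> u v)"
proof (rule ccontr)
  assume "\<not> ?thesis"
  then obtain f where f: "lin sW (*) f" and
    ne: "f (\<Sum>(u, v)\<leftarrow>l. \<beta> u v) \<noteq> f (\<Sum>(u, v)\<leftarrow>l'. \<beta> u v)" using lin_separates[OF W] by metis
  have "bilinear_form sU sV (\<lambda>u v. f (\<beta> u v))"
    using assms f unfolding bilinear_form_def bilin_def
    by (simp add: linear_iff_lin vector_space_field) (auto simp: lin_def)
  moreover have "l' \<in> tensor2 sU sV l" using eq mem_tensor2 by metis
  ultimately have "(\<Sum>(u, v)\<leftarrow>l. f (\<beta> u v)) = (\<Sum>(u, v)\<leftarrow>l'. f (\<beta> u v))"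
    unfolding tensor2_def by simp
  then show False using ne by (simp add: lin_sum_list[OF f])
qed

lemma tensor3_eqD:
  assumes "vector_space sU" "vector_space sV" "vector_space sX" and W: "vector_space sW"
    and eq: "tensor3 sU sV sX l = tensor3 sU sV sX l'" and "trilin sU sV sX sW \<tau>"
  shows "(\<Sum>(u, v, x)\<leftarrow>l. \<tau> u v x) = (\<Sum>(u, v, x)\<leftarrow>l'. \<tau> u v x)"
proof (rule ccontr)
  assume "\<not> ?thesis"
  then obtain f where f: "lin sW (*) f" and
    ne: "f (\<Sum>(u, v, x)\<leftarrow>l. \<tau> u v x) \<noteq> f (\<Sum>(u, v, x)\<leftarrow>l'. \<tau> u v x)" using lin_separates[OF W] by metis
  have "trilinear_form sU sV sX (\<lambda>u v x. f (\<tau> u v x))"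
    using assms f unfolding trilinear_form_def trilin_def
    by (simp add: linear_iff_lin vector_space_field) (auto simp: lin_def)
  moreover have "l' \<in> tensor3 sU sV sX l" using eq mem_tensor3 by metis
  ultimately have "(\<Sum>(u, v, x)\<leftarrow>l. f (\<tau> u v x)) = (\<Sum>(u, v, x)\<leftarrow>l'. f (\<tau> u v x))"
    unfolding tensor3_def by simp
  then show False using ne by (simp add: lin_sum_list3[OF f])
qed

lemma sum_list_map_bind2:
  "(\<Sum>(u, v)\<leftarrow>[(f a b c d, g a b c d). (a, b) \<leftarrow> l, (c, d) \<leftarrow> l' a b]. \<beta> u v) =
   (\<Sum>(a, b)\<leftarrow>l. \<Sum>(c, d)\<leftarrow>l' a b. \<beta> (f a b c d) (g a b c d) :: 'w::comm_monoid_add)"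
proof -
  have "(\<Sum>(u, v)\<leftarrow>map (\<lambda>(c, d). (f a b c d, g a b c d)) m. \<beta> u v) =
      (\<Sum>(c, d)\<leftarrow>m. \<beta> (f a b c d) (g a b c d))" for a b m
    by (induction m) auto
  then show ?thesis by (induction l) auto
qed

lemma sum_list_map_bind3:
  "(\<Sum>(u, v, w)\<leftarrow>[(f a b c d, g a b c d, h a b c d). (a, b) \<leftarrow> l, (c, d) \<leftarrow> l' a b]. \<beta> u v w) =
   (\<Sum>(a, b)\<leftarrow>l. \<Sum>(c, d)\<leftarrow>l' a b. \<beta> (f a b c d) (g a b c d) (h a b c d) :: 'w::comm_monoid_add)"
proof -
  have "(\<Sum>(u, v, w)\<leftarrow>map (\<lambda>(c, d). (f a b c d, g a b c d, h a b c d)) m. \<beta> u v w) =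
      (\<Sum>(c, d)\<leftarrow>m. \<beta> (f a b c d) (g a b c d) (h a b c d))" for a b m
    by (induction m) auto
  then show ?thesis by (induction l) auto
qed

lemma sum_mul2: "(\<Sum>(u, v)\<leftarrow>sweedler t *\<^sub>2 sweedler t'. \<beta> u v) = sw t (\<lambda>a b. sw t' (\<lambda>c d. \<beta> (a * c) (b * d)))"
  unfolding mul2_def sw_def by (rule sum_list_map_bind2)

lemma sum_map_left: "(\<Sum>(u, v, w)\<leftarrow>map_left D (sweedler t). \<beta> u v w) = sw t (\<lambda>a b. sw (D a) (\<lambda>c d. \<beta> c d b))"
  unfolding map_left_def sw_def by (rule sum_list_map_bind3)

lemma sum_map_right: "(\<Sum>(u, v, w)\<leftarrow>map_right D (sweedler t). \<beta> u v w) = sw t (\<lambda>a b. sw (D b) (\<lambda>c d. \<beta> a c d))"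
  unfolding map_right_def sw_def by (rule sum_list_map_bind3)

lemma sum_swap2: "(\<Sum>(u, v)\<leftarrow>swap2 l. \<beta> u v) = (\<Sum>(u, v)\<leftarrow>l. \<beta> v u)"
  unfolding swap2_def by (induction l) auto

lemma sum_list_mul2: "(\<Sum>(u, v)\<leftarrow>l *\<^sub>2 l'. \<beta> u v) =
   (\<Sum>(a,b)\<leftarrow>l. \<Sum>(c,d)\<leftarrow>l'. \<beta> (a * c) (b * d) :: 'w::comm_monoid_add)"
  unfolding mul2_def by (rule sum_list_map_bind2)

lemma sum_list_mul3: "(\<Sum>(u, v, w)\<leftarrow>l *\<^sub>3 l'. \<beta> u v w) =
   (\<Sum>(a,b,c)\<leftarrow>l. \<Sum>(a',b',c')\<leftarrow>l'. \<beta> (a * a') (b * b') (c * c') :: 'w::comm_monoid_add)"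
proof -
  have "(\<Sum>(u, v, w)\<leftarrow>map (\<lambda>(a',b',c'). (a * a', b * b', c * c')) m. \<beta> u v w) =
      (\<Sum>(a',b',c')\<leftarrow>m. \<beta> (a * a') (b * b') (c * c'))" for a b c m
    by (induction m) auto
  then show ?thesis unfolding mul3_def by (induction l) auto
qed

lemma sum_leg12: "(\<Sum>(u, v, w)\<leftarrow>leg12 l. \<beta> u v w) = (\<Sum>(a,b)\<leftarrow>l. \<beta> a b 1)"
  unfolding leg12_def by (induction l) auto
lemma sum_leg13: "(\<Sum>(u, v, w)\<leftarrow>leg13 l. \<beta> u v w) = (\<Sum>(a,b)\<leftarrow>l. \<beta> a 1 b)"
  unfolding leg13_def by (induction l) auto
lemma sum_leg23: "(\<Sum>(u, v, w)\<leftarrow>leg23 l. \<beta> u v w) = (\<Sum>(a,b)\<leftarrow>l. \<beta> 1 a b)"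
  unfolding leg23_def by (induction l) auto

lemmas sum_legs = sum_list_mul3 sum_leg12 sum_leg13 sum_leg23 sum_swap2 sum_map_left sum_map_right

section \<open>Kronecker products, columns and rows\<close>

lemma div_mod_less:
  fixes i :: nat assumes "i < a * b" shows "i div b < a" "i mod b < b"
proof -
  have "b > 0" using assms by (cases b) auto
  then show "i div b < a" "i mod b < b" using assms by (auto simp: less_mult_imp_div_less)
qed

lemma mult_add_less: fixes i :: nat assumes "i < a" "j < b" shows "i * b + j < a * b"
proof -
  have "i * b + j < Suc i * b" using assms by simp
  also have "\<dots> \<le> a * b" using assms by (intro mult_right_mono) auto
  finally show ?thesis .
qed

text \<open>With k = i n + j, sums over the index set of a tensor product become double sums, which
  is what the mixed-product rule for \<open>kron\<close> rests on.\<close>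

lemma sum_div_mod:
  fixes f :: "nat \<Rightarrow> nat \<Rightarrow> 'a::comm_monoid_add"
  shows "(\<Sum>k<m * n. f (k div n) (k mod n)) = (\<Sum>i<m. \<Sum>j<n. f i j)"
proof -
  have "(\<Sum>k<m * n. f (k div n) (k mod n)) = (\<Sum>i<m. \<Sum>k=i*n..<i*n+n. f (k div n) (k mod n))"
    by (rule sum.nat_group[symmetric])
  also have "\<dots> = (\<Sum>i<m. \<Sum>j<n. f i j)"
  proof (rule sum.cong[OF refl])
    fix i
    have "(\<Sum>k=i*n..<i*n+n. f (k div n) (k mod n)) = (\<Sum>j=0..<n. f ((j + i*n) div n) ((j + i*n) mod n))"
      using sum.shift_bounds_nat_ivl[of "\<lambda>k. f (k div n) (k mod n)" 0 "i*n" n] by (simp add: add.commute)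
    also have "\<dots> = (\<Sum>j<n. f i j)" by (rule sum.cong) auto
    finally show "(\<Sum>k=i*n..<i*n+n. f (k div n) (k mod n)) = (\<Sum>j<n. f i j)" .
  qed
  finally show ?thesis .
qed

lemma mult_index: 
  assumes "A \<in> carrier_mat n m" "B \<in> carrier_mat m p" "i < n" "j < p"
  shows "(A * B) $$ (i, j) = (\<Sum>k<m. A $$ (i, k) * B $$ (k, j))"
  using assms by (auto simp: scalar_prod_def lessThan_atLeast0 intro!: sum.cong)

lemma kron_dim [simp]:
  "dim_row (kron A B) = dim_row A * dim_row B" "dim_col (kron A B) = dim_col A * dim_col B"
  unfolding kron_def by auto

lemma kron_carrier [simp, intro]:
  "A \<in> carrier_mat a b \<Longrightarrow> B \<in> carrier_mat c d \<Longrightarrow> kron A B \<in> carrier_mat (a * c) (b * d)"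
  by auto

lemma kron_index:
  assumes "A \<in> carrier_mat a b" "B \<in> carrier_mat c d" "i < a * c" "j < b * d"
  shows "kron A B $$ (i, j) = A $$ (i div c, j div d) * B $$ (i mod c, j mod d)"
  using assms unfolding kron_def by auto

lemma kron_mult:
  assumes A: "A \<in> carrier_mat a b" and B: "B \<in> carrier_mat c d"
    and A': "A' \<in> carrier_mat b e" and B': "B' \<in> carrier_mat d f"
  shows "kron A B * kron A' B' = kron (A * A') (B * B')"
proof (rule eq_matI)
  fix i j assume ij: "i < dim_row (kron (A * A') (B * B'))" "j < dim_col (kron (A * A') (B * B'))"
  then have i: "i < a * c" and j: "j < e * f" using assms by auto
  have "(kron A B * kron A' B') $$ (i, j) = (\<Sum>k<b * d. kron A B $$ (i, k) * kron A' B' $$ (k, j))"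
    using mult_index[OF kron_carrier[OF A B] kron_carrier[OF A' B'] i j] .
  also have "\<dots> = (\<Sum>k<b * d. (\<lambda>p q. (A $$ (i div c, p) * A' $$ (p, j div f)) *
      (B $$ (i mod c, q) * B' $$ (q, j mod f))) (k div d) (k mod d))"
    by (rule sum.cong) (auto simp: kron_index[OF A B i] kron_index[OF A' B' _ j])
  also have "\<dots> = (\<Sum>p<b. \<Sum>q<d. (A $$ (i div c, p) * A' $$ (p, j div f)) *
      (B $$ (i mod c, q) * B' $$ (q, j mod f)))" by (rule sum_div_mod)
  also have "\<dots> = (A * A') $$ (i div c, j div f) * (B * B') $$ (i mod c, j mod f)"
    by (simp only: mult_index[OF A A' div_mod_less(1)[OF i] div_mod_less(1)[OF j]]
        mult_index[OF B B' div_mod_less(2)[OF i] div_mod_less(2)[OF j]] sum_product)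
  also have "\<dots> = kron (A * A') (B * B') $$ (i, j)"
    by (rule kron_index[symmetric]) (use assms i j in auto)
  finally show "(kron A B * kron A' B') $$ (i, j) = kron (A * A') (B * B') $$ (i, j)" .
qed (use assms in auto)

lemma kron_assoc: "kron (kron A B) C = kron A (kron B C)"
proof (rule eq_matI)
  fix i j assume ij: "i < dim_row (kron A (kron B C))" "j < dim_col (kron A (kron B C))"
  let ?a = "dim_row A" and ?b = "dim_row B" and ?c = "dim_row C"
  let ?a' = "dim_col A" and ?b' = "dim_col B" and ?c' = "dim_col C"
  have i: "i < (?a * ?b) * ?c" "i < ?a * (?b * ?c)" and j: "j < (?a' * ?b') * ?c'" "j < ?a' * (?b' * ?c')"
    using ij by (auto simp: ac_simps)
  \<comment> \<open>The three mixed-radix digits of an index do not depend on the bracketing; a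
    vanishing factor is covered by the convention for division by zero.\<close>
  have ci: "i mod (?b * ?c) div ?c = i div ?c mod ?b" "i mod (?b * ?c) mod ?c = i mod ?c"
    "i div (?b * ?c) = i div ?c div ?b" for i
    by (cases "?c = 0"; simp add: mod_mult2_eq mult.commute[of ?b] div_mult2_eq)+
  have cj: "j mod (?b' * ?c') div ?c' = j div ?c' mod ?b'" "j mod (?b' * ?c') mod ?c' = j mod ?c'"
    "j div (?b' * ?c') = j div ?c' div ?b'" for j
    by (cases "?c' = 0"; simp add: mod_mult2_eq mult.commute[of ?b'] div_mult2_eq)+
  show "kron (kron A B) C $$ (i, j) = kron A (kron B C) $$ (i, j)"
    using i j div_mod_less[OF i(1)] div_mod_less[OF j(1)] div_mod_less[OF i(2)] div_mod_less[OF j(2)]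
    by (simp add: kron_def ci cj)
qed (auto simp: ac_simps)

lemma kron_one [simp]: "kron (1\<^sub>m a) (1\<^sub>m b) = 1\<^sub>m (a * b)"
proof (rule eq_matI)
  fix i j assume "i < dim_row (1\<^sub>m (a * b))" "j < dim_col (1\<^sub>m (a * b))"
  then have i: "i < a * b" and j: "j < a * b" by auto
  have "i = j" if "i div b = j div b" "i mod b = j mod b" using that by (metis div_mult_mod_eq)
  then show "kron (1\<^sub>m a) (1\<^sub>m b) $$ (i, j) = 1\<^sub>m (a * b) $$ (i, j)"
    using i j div_mod_less[OF i] div_mod_less[OF j] by (auto simp: kron_def)
qed auto

lemma kron_one1 [simp]: "kron (1\<^sub>m (Suc 0)) A = A" "kron A (1\<^sub>m (Suc 0)) = A"
  "kron (1\<^sub>m 1) A = A" "kron A (1\<^sub>m 1) = A"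
  by (auto intro!: eq_matI simp: kron_def)

lemma kron_add_left:
  "A \<in> carrier_mat a b \<Longrightarrow> A' \<in> carrier_mat a b \<Longrightarrow> kron (A + A') B = kron A B + kron A' B"
  by (auto intro!: eq_matI simp: kron_def div_mod_less distrib_right)

lemma kron_add_right:
  "B \<in> carrier_mat a b \<Longrightarrow> B' \<in> carrier_mat a b \<Longrightarrow> kron A (B + B') = kron A B + kron A B'"
  by (auto intro!: eq_matI simp: kron_def div_mod_less distrib_left)

lemma kron_smult_left: "kron (c \<cdot>\<^sub>m A) B = c \<cdot>\<^sub>m kron A B"
  by (auto intro!: eq_matI simp: kron_def div_mod_less)

lemma kron_smult_right: "kron A (c \<cdot>\<^sub>m B) = c \<cdot>\<^sub>m kron A B"
  by (auto intro!: eq_matI simp: kron_def div_mod_less)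

lemma kron_transpose: "transpose_mat (kron A B) = kron (transpose_mat A) (transpose_mat B)"
  by (auto intro!: eq_matI simp: kron_def div_mod_less)

text \<open>The standard basis vector as an n by 1 matrix. Vectors are such matrices throughout, and
  functionals are 1 by n matrices, so that application, pairing and composition are all matrix
  products.\<close>

definition ucol :: "nat \<Rightarrow> nat \<Rightarrow> 'k::field mat" where
  "ucol n i = mat n 1 (\<lambda>(k, _). if k = i then 1 else 0)"

lemma ucol_carrier [simp]: "ucol n i \<in> carrier_mat n 1" "ucol n i \<in> carrier_mat n (Suc 0)"
  unfolding ucol_def by simp_all

lemma mult_ucol_index:
  assumes "A \<in> carrier_mat n m" "i < n" "j < m"
  shows "(A * ucol m j) $$ (i, 0) = A $$ (i, j)"
  by (subst mult_index[OF assms(1) ucol_carrier(1) assms(2)])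
    (use assms in \<open>auto simp: ucol_def if_distrib cong: if_cong\<close>)

lemma urow_mult_index:
  assumes "A \<in> carrier_mat n m" "i < n" "j < m"
  shows "(transpose_mat (ucol n i) * A) $$ (0, j) = A $$ (i, j)"
proof -
  have "transpose_mat (ucol n i) \<in> carrier_mat 1 n" by simp
  from mult_index[OF this assms(1) _ assms(3), of 0]
  have "(transpose_mat (ucol n i) * A) $$ (0, j) = (\<Sum>k<n. transpose_mat (ucol n i) $$ (0, k) * A $$ (k, j))"
    by simp
  also have "\<dots> = (\<Sum>k<n. if k = i then A $$ (k, j) else 0)"
    by (rule sum.cong) (auto simp: ucol_def)
  finally show ?thesis using assms by simp
qed

lemma mat_eq_cols:
  fixes A B :: "'k::field mat"
  assumes A: "A \<in> carrier_mat n m" and B: "B \<in> carrier_mat n m"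
    and eq: "\<And>v. v \<in> carrier_mat m 1 \<Longrightarrow> A * v = B * v"
  shows "A = B"
proof (rule eq_matI)
  fix i j assume "i < dim_row B" "j < dim_col B"
  then have "i < n" "j < m" using B by auto
  then show "A $$ (i, j) = B $$ (i, j)"
    using mult_ucol_index[OF A, of i j] mult_ucol_index[OF B, of i j] eq[OF ucol_carrier(1), of j] by simp
qed (use A B in auto)

lemma ucol_dim [simp]: "dim_row (ucol n i) = n" "dim_col (ucol n i) = 1"
  unfolding ucol_def by simp_all

lemma ucol_kron: "k < a * b \<Longrightarrow> ucol (a * b) k = kron (ucol a (k div b)) (ucol b (k mod b))"
proof (rule eq_matI)
  fix i j assume "i < dim_row (kron (ucol a (k div b)) (ucol b (k mod b)))"
    "j < dim_col (kron (ucol a (k div b)) (ucol b (k mod b)))" and k: "k < a * b"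
  then have i: "i < a * b" and j: "j = 0" by (auto simp: ucol_def)
  have "i = k" if "i div b = k div b" "i mod b = k mod b" using that by (metis div_mult_mod_eq)
  then show "ucol (a * b) k $$ (i, j) = kron (ucol a (k div b)) (ucol b (k mod b)) $$ (i, j)"
    using i j div_mod_less[OF i] by (auto simp: kron_def ucol_def)
qed (auto simp: ucol_def)

text \<open>Each unit column of the tensor product is itself a pure tensor of unit columns, so
  agreement on pure tensors is agreement on a basis.\<close>

lemma mat_eq_kron_cols:
  fixes A B :: "'k::field mat"
  assumes A: "A \<in> carrier_mat n (a * b)" and B: "B \<in> carrier_mat n (a * b)"
    and eq: "\<And>u v. u \<in> carrier_mat a 1 \<Longrightarrow> v \<in> carrier_mat b 1 \<Longrightarrow> A * kron u v = B * kron u v"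
  shows "A = B"
proof (rule eq_matI)
  fix i j assume "i < dim_row B" "j < dim_col B"
  then have "i < n" "j < a * b" using B by auto
  then show "A $$ (i, j) = B $$ (i, j)"
    using mult_ucol_index[OF A, of i j] mult_ucol_index[OF B, of i j]
      eq[OF ucol_carrier(1) ucol_carrier(1), of "j div b" "j mod b"] ucol_kron[of j a b, where ?'a = 'k] by simp
qed (use A B in auto)

text \<open>Functionals on the first tensor factor separate the vectors of the product: row i is
  read off by contracting with coordinate i div b and taking coordinate i mod b of the result. This
  allows a tensor leg to be removed one functional at a time.\<close>

lemma col_eq_contract:
  fixes A B :: "'k::field mat"
  assumes A: "A \<in> carrier_mat (a * b) m" and B: "B \<in> carrier_mat (a * b) m"
    and eq: "\<And>c. c \<in> carrier_mat 1 a \<Longrightarrow> kron c (1\<^sub>m b) * A = kron c (1\<^sub>m b) * B"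
  shows "A = B"
proof (rule eq_matI)
  fix i j assume "i < dim_row B" "j < dim_col B"
  then have i: "i < a * b" and j: "j < m" using B by auto
  let ?c = "transpose_mat (ucol a (i div b)) :: 'k mat" and ?d = "transpose_mat (ucol b (i mod b)) :: 'k mat"
  have *: "transpose_mat (ucol (a * b) i) = ?d * kron ?c (1\<^sub>m b)"
  proof -
    have "?d * kron ?c (1\<^sub>m b) = kron (1\<^sub>m 1) ?d * kron ?c (1\<^sub>m b)" by simp
    also have "\<dots> = kron ?c ?d"
      by (subst kron_mult[of _ 1 1 _ 1 b _ a _ b]) (auto simp: left_mult_one_mat[of _ "Suc 0" a] right_mult_one_mat[of _ "Suc 0" b])
    finally show ?thesis using ucol_kron[OF i, where ?'a = 'k] by (simp add: kron_transpose)
  qed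
  have **: "transpose_mat (ucol (a * b) i) * X = ?d * (kron ?c (1\<^sub>m b) * X)"
    if "X \<in> carrier_mat (a * b) m" for X :: "'k mat"
    unfolding * using kron_carrier[of ?c 1 a "1\<^sub>m b" b b] that by (auto intro!: assoc_mult_mat[of _ 1 b _ "a * b" _ m])
  show "A $$ (i, j) = B $$ (i, j)"
    using urow_mult_index[OF A i j] urow_mult_index[OF B i j] eq[of ?c] **[OF A] **[OF B] by simp
qed (use A B in auto)

text \<open>The columns of \<open>G\<close> are the images of the unit columns. Additivity and
  homogeneity are assumed on m by 1 columns only, because \<open>'k mat\<close> contains matrices of
  every size.\<close>

lemma linear_to_mat:
  fixes g :: "'k::field mat \<Rightarrow> 'k mat"
  assumes gc: "\<And>v. v \<in> carrier_mat m 1 \<Longrightarrow> g v \<in> carrier_mat n 1"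
    and add: "\<And>v w. v \<in> carrier_mat m 1 \<Longrightarrow> w \<in> carrier_mat m 1 \<Longrightarrow> g (v + w) = g v + g w"
    and sm: "\<And>c v. v \<in> carrier_mat m 1 \<Longrightarrow> g (c \<cdot>\<^sub>m v) = c \<cdot>\<^sub>m g v"
  obtains G where "G \<in> carrier_mat n m" "\<And>v. v \<in> carrier_mat m 1 \<Longrightarrow> G * v = g v"
proof -
  define G where "G = mat n m (\<lambda>(i, j). g (ucol m j) $$ (i, 0))"
  have Gc: "G \<in> carrier_mat n m" unfolding G_def by simp
  have "G * v = g v" if v: "v \<in> carrier_mat m 1" for v
  proof -
    \<comment> \<open>The truncation of \<open>v\<close> to its first k entries; induction adds one
      coordinate at a time.\<close>
    define w where "w k = mat m 1 (\<lambda>(i, _). if i < k then v $$ (i, 0) else 0)" for k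
    have wc: "w k \<in> carrier_mat m 1" for k unfolding w_def by simp
    have w: "g (w k) $$ (i, 0) = (\<Sum>j<k. G $$ (i, j) * v $$ (j, 0))" if "k \<le> m" "i < n" for k i
      using that
    proof (induction k)
      case 0
      \<comment> \<open>The zero column is 0 times itself, so homogeneity gives the value 0
        there.\<close>
      have "w 0 = 0 \<cdot>\<^sub>m w 0" by (auto simp: w_def)
      then have "g (w 0) = 0 \<cdot>\<^sub>m g (w 0)" using sm[OF wc, of 0 0] by simp
      moreover have "(0 \<cdot>\<^sub>m g (w 0)) $$ (i, 0) = 0" using gc[OF wc, of 0] 0 by auto
      ultimately show ?case by simp
    next
      case (Suc k)
      have "w (Suc k) = w k + v $$ (k, 0) \<cdot>\<^sub>m ucol m k"
        using v by (auto simp: w_def ucol_def less_Suc_eq intro!: eq_matI)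
      then have "g (w (Suc k)) = g (w k) + v $$ (k, 0) \<cdot>\<^sub>m g (ucol m k)"
        using add[OF wc] sm[OF ucol_carrier(1)] by simp
      moreover have "g (ucol m k) $$ (i, 0) = G $$ (i, k)" using Suc.prems by (simp add: G_def)
      ultimately show ?case using Suc gc[OF wc, of k] gc[of "ucol m k"] by auto
    qed
    have "w m = v" using v by (auto simp: w_def)
    then show ?thesis using w[of m] gc[OF v] Gc v
      by (intro eq_matI) (auto simp: mult_index[OF Gc v] simp del: index_mult_mat(1))
  qed
  then show ?thesis using that Gc by blast
qed

text \<open>Applying the injective map \<open>A\<close> to both sides shows that the set-theoretic
  inverse is additive and homogeneous, so it is again given by a matrix.\<close>

lemma bij_to_inverse_mat:
  fixes A :: "'k::field mat"
  assumes A: "A \<in> carrier_mat n m" and bij: "bij_betw (\<lambda>v. A * v) (carrier_mat m 1) (carrier_mat n 1)"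
  obtains B where "B \<in> carrier_mat m n" "B * A = 1\<^sub>m m" "A * B = 1\<^sub>m n"
proof -
  define g where "g = inv_into (carrier_mat m 1) (\<lambda>v. A * v)"
  have gc: "g v \<in> carrier_mat m 1" if "v \<in> carrier_mat n 1" for v
    using that bij inv_into_into[of v "\<lambda>v. A * v" "carrier_mat m 1"] unfolding bij_betw_def g_def by simp
  have Ag: "A * g v = v" if "v \<in> carrier_mat n 1" for v
    unfolding g_def by (rule bij_betw_inv_into_right[OF bij that])
  have inj: "v = w" if "v \<in> carrier_mat m 1" "w \<in> carrier_mat m 1" "A * v = A * w" for v w
    using that bij unfolding bij_betw_def inj_on_def by blast
  obtain B where B: "B \<in> carrier_mat m n" and Bg: "\<And>v. v \<in> carrier_mat n 1 \<Longrightarrow> B * v = g v"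
  proof (rule linear_to_mat[of n g m])
    fix v w :: "'k mat" assume vw: "v \<in> carrier_mat n 1" "w \<in> carrier_mat n 1"
    show "g (v + w) = g v + g w"
      by (rule inj) (use vw A gc in \<open>auto simp: Ag mult_add_distrib_mat[OF A gc gc]\<close>)
  next
    fix c and v :: "'k mat" assume vw: "v \<in> carrier_mat n 1"
    show "g (c \<cdot>\<^sub>m v) = c \<cdot>\<^sub>m g v"
      by (rule inj) (use vw A gc in \<open>auto simp: Ag mult_smult_distrib[OF A gc]\<close>)
  qed (use gc in auto)
  have "A * B = 1\<^sub>m n"
    by (rule mat_eq_cols[of _ n n]) (use A B Ag Bg gc in \<open>auto simp: assoc_mult_mat[OF A B]\<close>)
  moreover have "B * A = 1\<^sub>m m"
  proof (rule mat_eq_cols[of _ m m])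
    fix v :: "'k mat" assume v: "v \<in> carrier_mat m 1"
    then have Av: "A * v \<in> carrier_mat n 1" using A by auto
    have "g (A * v) = v" by (rule inj) (use v gc Av Ag in auto)
    then show "B * A * v = 1\<^sub>m m * v" using v Av by (simp add: assoc_mult_mat[OF B A v] Bg)
  qed (use A B in auto)
  ultimately show ?thesis using that B by blast
qed

section \<open>Flattened matrices, evaluation, coevaluation and the flip\<close>

text \<open>Row-major flattening. It identifies the matrices of maps W \<rightarrow> V with V
  \<otimes> W', where W' is the dual of W with the dual basis, compatibly with
  \<open>kron\<close>.\<close>

definition vecc :: "'k::field mat \<Rightarrow> 'k mat" where
  "vecc A = mat (dim_row A * dim_col A) 1 (\<lambda>(i, _). A $$ (i div dim_col A, i mod dim_col A))"

lemma vecc_carrier [simp]: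
  "A \<in> carrier_mat n m \<Longrightarrow> vecc A \<in> carrier_mat (n * m) 1"
  "A \<in> carrier_mat n m \<Longrightarrow> vecc A \<in> carrier_mat (n * m) (Suc 0)"
  unfolding vecc_def by auto

lemma vecc_index: "A \<in> carrier_mat n m \<Longrightarrow> i < n * m \<Longrightarrow> vecc A $$ (i, 0) = A $$ (i div m, i mod m)"
  unfolding vecc_def by auto

text \<open>The second leg of a flattened matrix lies in a dual space, where maps act by their
  transposes; hence they become right multiplication. Coevaluation, the adjoint action on the end
  and contraction with rows are all instances.\<close>

lemma vecc_mult:
  assumes F: "F \<in> carrier_mat a b" and A: "A \<in> carrier_mat b c" and G: "G \<in> carrier_mat c d"
  shows "kron F (transpose_mat G) * vecc A = vecc (F * A * G)"
proof (rule eq_matI)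
  fix i j assume "i < dim_row (vecc (F * A * G))" "j < dim_col (vecc (F * A * G))"
  then have i: "i < a * d" and j: "j = 0" using assms by (auto simp: vecc_def)
  have G': "transpose_mat G \<in> carrier_mat d c" using G by simp
  have "(kron F (transpose_mat G) * vecc A) $$ (i, 0) =
     (\<Sum>k<b * c. kron F (transpose_mat G) $$ (i, k) * vecc A $$ (k, 0))"
    by (rule mult_index[OF kron_carrier[OF F G'] vecc_carrier(1)[OF A] i]) simp
  also have "\<dots> = (\<Sum>k<b * c. (\<lambda>p q. F $$ (i div d, p) * A $$ (p, q) * G $$ (q, i mod d)) (k div c) (k mod c))"
    using G by (intro sum.cong) (auto simp: kron_index[OF F G' i] vecc_index[OF A] div_mod_less[OF i] div_mod_less)
  also have "\<dots> = (\<Sum>p<b. \<Sum>q<c. F $$ (i div d, p) * A $$ (p, q) * G $$ (q, i mod d))" by (rule sum_div_mod)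
  also have "\<dots> = (\<Sum>q<c. (\<Sum>p<b. F $$ (i div d, p) * A $$ (p, q)) * G $$ (q, i mod d))"
    unfolding sum_distrib_right by (rule sum.swap)
  also have "\<dots> = (F * A * G) $$ (i div d, i mod d)"
    unfolding mult_index[OF mult_carrier_mat[OF F A] G div_mod_less[OF i]]
    by (rule sum.cong) (simp_all add: mult_index[OF F A div_mod_less(1)[OF i]] del: index_mult_mat)
  also have "\<dots> = vecc (F * A * G) $$ (i, 0)"
    by (rule vecc_index[symmetric]) (use assms i in auto)
  finally show "(kron F (transpose_mat G) * vecc A) $$ (i, j) = vecc (F * A * G) $$ (i, j)" using j by simp
qed (use assms in \<open>auto simp: vecc_def\<close>)

lemma vecc_inj: "A \<in> carrier_mat n m \<Longrightarrow> B \<in> carrier_mat n m \<Longrightarrow> vecc A = vecc B \<Longrightarrow> A = B"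
proof (rule eq_matI)
  fix i j assume A: "A \<in> carrier_mat n m" and B: "B \<in> carrier_mat n m" and e: "vecc A = vecc B" and "i < dim_row B" "j < dim_col B"
  then have ij: "i < n" "j < m" by auto
  have k: "i * m + j < n * m" using ij by (rule mult_add_less)
  show "A $$ (i, j) = B $$ (i, j)"
    using vecc_index[OF A k] vecc_index[OF B k] e ij by simp
qed auto

definition unvec :: "nat \<Rightarrow> nat \<Rightarrow> 'k::field mat \<Rightarrow> 'k mat" where
  "unvec n m y = mat n m (\<lambda>(i, j). y $$ (i * m + j, 0))"

lemma unvec_carrier [simp]: "unvec n m y \<in> carrier_mat n m" unfolding unvec_def by simp

lemma vecc_unvec: "y \<in> carrier_mat (n * m) 1 \<Longrightarrow> vecc (unvec n m y) = y"
  by (auto intro!: eq_matI simp: vecc_def unvec_def div_mod_less)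

lemma vecc_add: "A \<in> carrier_mat n m \<Longrightarrow> B \<in> carrier_mat n m \<Longrightarrow> vecc (A + B) = vecc A + vecc B"
  by (auto intro!: eq_matI simp: vecc_def div_mod_less)

lemma vecc_smult: "vecc (c \<cdot>\<^sub>m A) = c \<cdot>\<^sub>m vecc A"
  by (auto intro!: eq_matI simp: vecc_def div_mod_less)

lemma vecc_row: "A \<in> carrier_mat 1 n \<Longrightarrow> vecc A = transpose_mat A"
  by (auto intro!: eq_matI simp: vecc_def)

lemma vecc_col: "A \<in> carrier_mat n 1 \<Longrightarrow> vecc A = A"
  by (auto intro!: eq_matI simp: vecc_def)

text \<open>The matrices of \<open>Ev\<close> and \<open>Coev\<close> in \<open>H_FdMod\<close>,
  which depend on the dimension alone; naming them allows the contraction rules to be stated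
  once.\<close>

definition evm :: "nat \<Rightarrow> 'k::field mat" where
  "evm n = mat 1 (n * n) (\<lambda>(i, j). if j div n = j mod n then 1 else 0)"

definition coevm :: "nat \<Rightarrow> 'k::field mat" where
  "coevm n = mat (n * n) 1 (\<lambda>(i, j). if i div n = i mod n then 1 else 0)"

lemma evm_carrier [simp]: "evm n \<in> carrier_mat 1 (n * n)" "evm n \<in> carrier_mat (Suc 0) (n * n)"
  unfolding evm_def by simp_all
lemma coevm_carrier [simp]: "coevm n \<in> carrier_mat (n * n) 1" "coevm n \<in> carrier_mat (n * n) (Suc 0)"
  unfolding coevm_def by simp_all

lemma evm_dim [simp]: "dim_row (evm n) = 1" "dim_col (evm n) = n * n"
    "dim_row (coevm n) = n * n" "dim_col (coevm n) = 1"
  by (simp_all add: evm_def coevm_def)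

lemma coevm_eq_vecc: "coevm n = vecc (1\<^sub>m n)"
  unfolding coevm_def vecc_def by (auto intro!: eq_matI simp: div_mod_less)

lemma evm_transpose: "evm n = transpose_mat (coevm n)"
  unfolding coevm_def evm_def by (auto intro!: eq_matI)

lemma coevm_contract:
  assumes F: "F \<in> carrier_mat a n"
  shows "kron F (1\<^sub>m n) * coevm n = vecc F"
  using vecc_mult[OF F one_carrier_mat one_carrier_mat] F by (simp add: coevm_eq_vecc)

lemma evm_contract:
  assumes f: "f \<in> carrier_mat n 1"
  shows "evm n * kron f (1\<^sub>m n) = transpose_mat f"
proof -
  have f': "transpose_mat f \<in> carrier_mat 1 n" using f by simp
  have "evm n * kron f (1\<^sub>m n) = transpose_mat (kron (transpose_mat f) (1\<^sub>m n) * coevm n)"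
    using f by (subst transpose_mult[of _ "1 * n" "n * n" _ 1]) (auto simp: kron_transpose evm_transpose)
  then show ?thesis using coevm_contract[OF f'] f' by (simp add: vecc_row)
qed

text \<open>Evaluation pairs the column \<open>f\<close>, read as a functional, with the first leg
  of \<open>w\<close>. This is how \<theta> is computed from \<omega>.\<close>

lemma evm_contract2:
  assumes f: "f \<in> carrier_mat n 1" and w: "w \<in> carrier_mat (n * m) p"
  shows "kron (evm n) (1\<^sub>m m) * kron f w = kron (transpose_mat f) (1\<^sub>m m) * w"
proof -
  have k: "kron f (1\<^sub>m n) \<in> carrier_mat (n * n) n" using kron_carrier[OF f one_carrier_mat, of n] by simp
  have "kron f w = kron f (1\<^sub>m (n * m)) * kron (1\<^sub>m 1) w"
    using f w by (subst kron_mult[of _ n 1 _ "n * m" "n * m" _ 1 _ p]) auto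
  also have "kron f (1\<^sub>m (n * m)) = kron (kron f (1\<^sub>m n)) (1\<^sub>m m)"
    by (simp only: kron_assoc kron_one)
  finally have "kron (evm n) (1\<^sub>m m) * kron f w = kron (evm n) (1\<^sub>m m) * (kron (kron f (1\<^sub>m n)) (1\<^sub>m m) * w)"
    by simp
  also have "\<dots> = kron (evm n) (1\<^sub>m m) * kron (kron f (1\<^sub>m n)) (1\<^sub>m m) * w"
    by (rule assoc_mult_mat[OF kron_carrier[OF evm_carrier(1) one_carrier_mat]
          kron_carrier[OF k one_carrier_mat] w, symmetric])
  also have "kron (evm n) (1\<^sub>m m) * kron (kron f (1\<^sub>m n)) (1\<^sub>m m) = kron (transpose_mat f) (1\<^sub>m m)"
    using evm_contract[OF f]
    by (simp add: kron_mult[OF evm_carrier(1) one_carrier_mat k one_carrier_mat])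
  finally show ?thesis .
qed

lemma flip_carrier [simp]: "flip_mat m n \<in> carrier_mat (n * m) (m * n)"
  unfolding flip_mat_def by simp

lemma flip_kron:
  assumes u: "u \<in> carrier_mat m 1" and v: "v \<in> carrier_mat n 1"
  shows "flip_mat m n * kron u v = kron v u"
proof (rule eq_matI)
  fix i j assume "i < dim_row (kron v u)" "j < dim_col (kron v u)"
  then have i: "i < n * m" and j: "j = 0" using assms by auto
  have k: "(i mod m) * n + i div m < m * n" using div_mod_less[OF i] by (intro mult_add_less)
  \<comment> \<open>Row i of the flip has a single nonzero entry, at the index whose two digits are
    those of i exchanged.\<close>
  have *: "(i div m = k mod n \<and> i mod m = k div n) \<longleftrightarrow> k = (i mod m) * n + i div m" if "k < m * n" for k
  proof -
    have r: "i div m < n" using div_mod_less[OF i] by simp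
    show ?thesis
    proof
      assume "i div m = k mod n \<and> i mod m = k div n"
      then show "k = (i mod m) * n + i div m" by simp
    next
      assume k: "k = (i mod m) * n + i div m"
      show "i div m = k mod n \<and> i mod m = k div n" unfolding k using r by simp
    qed
  qed
  have "(flip_mat m n * kron u v) $$ (i, 0) = (\<Sum>k<m * n. flip_mat m n $$ (i, k) * kron u v $$ (k, 0))"
    by (rule mult_index[OF flip_carrier kron_carrier[OF u v] i]) simp
  also have "\<dots> = (\<Sum>k<m * n. if k = (i mod m) * n + i div m then kron u v $$ (k, 0) else 0)"
    by (rule sum.cong) (use i * in \<open>auto simp: flip_mat_def\<close>)
  also have "\<dots> = kron u v $$ ((i mod m) * n + i div m, 0)" using k by simp
  also have "\<dots> = kron v u $$ (i, 0)"
    using div_mod_less[OF i] kron_index[OF u v k, of 0] kron_index[OF v u i, of 0] by simp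
  finally show "(flip_mat m n * kron u v) $$ (i, j) = kron v u $$ (i, j)" using j by simp
qed (use assms in \<open>auto simp: flip_mat_def\<close>)

lemma flip_kron_mat:
  assumes A: "A \<in> carrier_mat m m'" and B: "B \<in> carrier_mat n n'"
  shows "flip_mat m n * kron A B = kron B A * flip_mat m' n'"
proof (rule mat_eq_kron_cols[of _ "n * m" m' n'])
  fix u v :: "'a mat" assume u: "u \<in> carrier_mat m' 1" and v: "v \<in> carrier_mat n' 1"
  have AB: "kron A B \<in> carrier_mat (m * n) (m' * n')" "kron B A \<in> carrier_mat (n * m) (n' * m')"
    "kron u v \<in> carrier_mat (m' * n') 1"
    using A B kron_carrier[OF u v] by auto
  have "flip_mat m n * kron A B * kron u v = flip_mat m n * (kron (A * u) (B * v))"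
    using AB kron_mult[OF A B u v] by (simp add: assoc_mult_mat[OF flip_carrier AB(1) AB(3)])
  also have "\<dots> = kron (B * v) (A * u)" by (rule flip_kron) (use A B u v in auto)
  also have "\<dots> = kron B A * flip_mat m' n' * kron u v"
    using kron_mult[OF B A v u] by (simp add: assoc_mult_mat[OF AB(2) flip_carrier AB(3)] flip_kron[OF u v])
  finally show "flip_mat m n * kron A B * kron u v = kron B A * flip_mat m' n' * kron u v" .
qed (rule mult_carrier_mat[OF flip_carrier kron_carrier[OF A B]] mult_carrier_mat[OF kron_carrier[OF B A] flip_carrier])+

section \<open>Matrix-valued linear maps and matrix-valued Sweedler sums\<close>

text \<open>The type \<open>'k mat\<close> mixes all sizes and has no common zero, so it is not a
  vector space and \<open>lin\<close> does not apply; the size has to be recorded.\<close>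

definition mlin :: "('k::field \<Rightarrow> 'u::ab_group_add \<Rightarrow> 'u) \<Rightarrow> nat \<Rightarrow> nat \<Rightarrow> ('u \<Rightarrow> 'k mat) \<Rightarrow> bool" where
  "mlin sU n m f \<longleftrightarrow> (\<forall>u. f u \<in> carrier_mat n m) \<and> (\<forall>u v. f (u + v) = f u + f v) \<and>
     (\<forall>c u. f (sU c u) = c \<cdot>\<^sub>m f u)"

definition mbilin :: "('k::field \<Rightarrow> 'u::ab_group_add \<Rightarrow> 'u) \<Rightarrow> ('k \<Rightarrow> 'v::ab_group_add \<Rightarrow> 'v) \<Rightarrow>
    nat \<Rightarrow> nat \<Rightarrow> ('u \<Rightarrow> 'v \<Rightarrow> 'k mat) \<Rightarrow> bool" where
  "mbilin sU sV n m F \<longleftrightarrow> (\<forall>v. mlin sU n m (\<lambda>u. F u v)) \<and> (\<forall>u. mlin sV n m (F u))"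

text \<open>Entrywise and with prescribed size, because a sum over a list needs a zero element and
  the zero matrix is determined only once the size is fixed.\<close>

definition msum :: "nat \<Rightarrow> nat \<Rightarrow> ('a, 'b) tensor2 \<Rightarrow> ('a \<Rightarrow> 'b \<Rightarrow> 'k::field mat) \<Rightarrow> 'k mat" where
  "msum n m t F = mat n m (\<lambda>ij. sw t (\<lambda>a b. F a b $$ ij))"

lemma mlinI: "(\<And>u. f u \<in> carrier_mat n m) \<Longrightarrow> (\<And>u v. f (u + v) = f u + f v) \<Longrightarrow>
    (\<And>c u. f (sU c u) = c \<cdot>\<^sub>m f u) \<Longrightarrow> mlin sU n m f"
  unfolding mlin_def by blast

lemma mlinD: assumes "mlin sU n m f"
  shows "f u \<in> carrier_mat n m" "f (u + v) = f u + f v" "f (sU c u) = c \<cdot>\<^sub>m f u"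
  using assms unfolding mlin_def by blast+

lemma mbilinI: "(\<And>v. mlin sU n m (\<lambda>u. F u v)) \<Longrightarrow> (\<And>u. mlin sV n m (F u)) \<Longrightarrow> mbilin sU sV n m F"
  unfolding mbilin_def by blast

lemma mbilinD: "mbilin sU sV n m F \<Longrightarrow> mlin sU n m (\<lambda>u. F u v)" "mbilin sU sV n m F \<Longrightarrow> mlin sV n m (F u)"
  unfolding mbilin_def by blast+

lemma mbilin_carrier: "mbilin sU sV n m F \<Longrightarrow> F u v \<in> carrier_mat n m"
  using mbilinD(2) mlinD(1) by blast

lemma mlin_entry:
  assumes f: "mlin sU n m f" and "i < n" "j < m"
  shows "lin sU (*) (\<lambda>u. f u $$ (i, j))"
proof (rule linI)
  fix u v show "f (u + v) $$ (i, j) = f u $$ (i, j) + f v $$ (i, j)"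
    using mlinD(1)[OF f, of u] mlinD(1)[OF f, of v] mlinD(2)[OF f] assms by simp
next
  fix c u show "f (sU c u) $$ (i, j) = c * f u $$ (i, j)"
    using mlinD(1)[OF f, of u] mlinD(3)[OF f] assms by simp
qed

lemma mlin_iff_entries:
  assumes "\<And>u. f u \<in> carrier_mat n m"
    and "\<And>i j. i < n \<Longrightarrow> j < m \<Longrightarrow> lin sU (*) (\<lambda>u. f u $$ (i, j))"
  shows "mlin sU n m f"
proof (rule mlinI)
  fix u v show "f (u + v) = f u + f v"
    using assms(1)[of u] assms(1)[of v] assms(1)[of "u + v"] linD(1)[OF assms(2)] by (auto intro!: eq_matI)
next
  fix c u show "f (sU c u) = c \<cdot>\<^sub>m f u"
    using assms(1)[of u] assms(1)[of "sU c u"] linD(2)[OF assms(2)] by (auto intro!: eq_matI)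
qed fact

lemma mbilin_entry:
  assumes F: "mbilin sU sV n m F" and "i < n" "j < m"
  shows "bilin sU sV (*) (\<lambda>u v. F u v $$ (i, j))"
  using assms by (intro bilinI mlin_entry[OF mbilinD(1)[OF F]] mlin_entry[OF mbilinD(2)[OF F]])

subsection \<open>Introduction rules for linearity\<close>

lemma mlin_mult_left:
  assumes A: "A \<in> carrier_mat p n" and f: "mlin sU n m f" shows "mlin sU p m (\<lambda>u. A * f u)"
  by (intro mlinI) (simp_all add: mlinD(2,3)[OF f] mult_add_distrib_mat[OF A mlinD(1)[OF f] mlinD(1)[OF f]]
      mult_smult_distrib[OF A mlinD(1)[OF f]] mult_carrier_mat[OF A mlinD(1)[OF f]])

lemma mlin_mult_right:
  assumes A: "A \<in> carrier_mat m p" and f: "mlin sU n m f" shows "mlin sU n p (\<lambda>u. f u * A)"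
  by (intro mlinI) (simp_all add: mlinD(2,3)[OF f] add_mult_distrib_mat[OF mlinD(1)[OF f] mlinD(1)[OF f] A]
      mult_smult_assoc_mat[OF mlinD(1)[OF f] A] mult_carrier_mat[OF mlinD(1)[OF f] A])

lemma mlin_kron_left:
  assumes B: "B \<in> carrier_mat p q" and f: "mlin sU n m f"
  shows "mlin sU (n * p) (m * q) (\<lambda>u. kron (f u) B)"
  by (intro mlinI) (simp_all add: mlinD(2,3)[OF f] kron_add_left[OF mlinD(1)[OF f] mlinD(1)[OF f]]
      kron_smult_left kron_carrier[OF mlinD(1)[OF f] B])

lemma mlin_kron_right:
  assumes B: "B \<in> carrier_mat p q" and f: "mlin sU n m f"
  shows "mlin sU (p * n) (q * m) (\<lambda>u. kron B (f u))"
  by (intro mlinI) (simp_all add: mlinD(2,3)[OF f] kron_add_right[OF mlinD(1)[OF f] mlinD(1)[OF f]]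
      kron_smult_right kron_carrier[OF B mlinD(1)[OF f]])

lemma mlin_transpose: "mlin sU n m f \<Longrightarrow> mlin sU m n (\<lambda>u. transpose_mat (f u))"
  unfolding mlin_def by (auto simp: transpose_add[of _ n m])

lemma mlin_comp: "mlin sA n m f \<Longrightarrow> lin sU sA g \<Longrightarrow> mlin sU n m (\<lambda>u. f (g u))"
  unfolding mlin_def lin_def by auto

lemma mlin_smult_const:
  assumes f: "mlin sU n m f" shows "mlin sU n m (\<lambda>u. c \<cdot>\<^sub>m f u)"
proof (intro mlinI)
  fix d u show "c \<cdot>\<^sub>m f (sU d u) = d \<cdot>\<^sub>m (c \<cdot>\<^sub>m f u)"
    by (rule eq_matI) (auto simp: mlinD(3)[OF f])
qed (simp_all add: mlinD(1,2)[OF f] add_smult_distrib_left_mat[OF mlinD(1)[OF f] mlinD(1)[OF f]])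

lemma mlin_smult: "A \<in> carrier_mat n m \<Longrightarrow> lin sU (*) f \<Longrightarrow> mlin sU n m (\<lambda>u. f u \<cdot>\<^sub>m A)"
  unfolding mlin_def lin_def by (auto simp: algebra_simps intro!: eq_matI)

lemma mlin_msum:
  fixes F :: "'u::ab_group_add \<Rightarrow> 'a \<Rightarrow> 'b \<Rightarrow> 'k::field mat"
  assumes "\<And>a b. mlin sU n m (\<lambda>u. F u a b)"
  shows "mlin sU n m (\<lambda>u. msum n m t (F u))"
proof (rule mlin_iff_entries)
  fix i j assume ij: "i < n" "j < m"
  have l: "lin (*) (*) (\<lambda>x. c * x)" for c :: 'k by (auto simp: lin_def algebra_simps)
  have f: "lin sU (*) (\<lambda>u. F u a b $$ (i, j))" for a b using mlin_entry[OF assms ij] .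
  show "lin sU (*) (\<lambda>u. msum n m t (F u) $$ (i, j))"
    using ij by (intro linI) (simp_all add: msum_def linD[OF f] sw_add lin_sw[OF l])
qed (simp add: msum_def)

lemma lin_id: "lin s s (\<lambda>u. u)" by (simp add: lin_def)

lemma lin_comp: "lin sA sW f \<Longrightarrow> lin sU sA g \<Longrightarrow> lin sU sW (\<lambda>u. f (g u))"
  by (auto simp: lin_def)

text \<open>Linearity in a parameter passes through Sweedler sums. Together with the rules for
  products, antipode and counit this makes multilinearity of nested Sweedler expressions a purely
  syntactic matter.\<close>

lemma lin_sw_fun:
  assumes W: "vector_space sW" and f: "\<And>a b. lin sU sW (\<lambda>u. F u a b)"
  shows "lin sU sW (\<lambda>u. sw t (F u))"
proof -
  interpret W: vector_space sW by fact
  have l: "lin sW sW (\<lambda>x. sW c x)" for c by (auto simp: lin_def algebra_simps)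
  have "F (x + y) = (\<lambda>a b. F x a b + F y a b)" "F (sU c x) = (\<lambda>a b. sW c (F x a b))" for x y c
    by (intro ext linD[OF f])+
  then show ?thesis by (intro linI) (simp_all add: sw_add lin_sw[OF l])
qed

lemma lin_scale: "vector_space sW \<Longrightarrow> lin sU sW f \<Longrightarrow> lin sU sW (\<lambda>u. sW c (f u))"
  by (auto simp: lin_def vector_space.vector_space_assms mult.commute)

lemma lin_scale_left: "vector_space sW \<Longrightarrow> lin sU (*) f \<Longrightarrow> lin sU sW (\<lambda>u. sW (f u) w)"
  by (auto simp: lin_def vector_space.vector_space_assms)

lemma (in fd_algebra) lin_mult_left: "lin sU sA f \<Longrightarrow> lin sU sA (\<lambda>u. a * f u)"
  by (auto simp: lin_def distrib_left scale_mult_right)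

lemma (in fd_algebra) lin_mult_right: "lin sU sA f \<Longrightarrow> lin sU sA (\<lambda>u. f u * a)"
  by (auto simp: lin_def distrib_right scale_mult_left)

subsection \<open>Sums of matrices over a tensor\<close>

lemma msum_carrier [simp, intro]: "msum n m t F \<in> carrier_mat n m" unfolding msum_def by simp

lemma msum_index: "i < n \<Longrightarrow> j < m \<Longrightarrow> msum n m t F $$ (i, j) = sw t (\<lambda>a b. F a b $$ (i, j))"
  unfolding msum_def by simp

lemma msum_cong: "(\<And>a b. F a b = G a b) \<Longrightarrow> msum n m t F = msum n m t G"
  by (rule arg_cong[of F G]) (simp add: fun_eq_iff)

lemma msum_mult_left:
  assumes A: "A \<in> carrier_mat p n" and F: "\<And>a b. F a b \<in> carrier_mat n m"
  shows "A * msum n m t F = msum p m t (\<lambda>a b. A * F a b)"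
proof (rule eq_matI)
  fix i j assume "i < dim_row (msum p m t (\<lambda>a b. A * F a b))" "j < dim_col (msum p m t (\<lambda>a b. A * F a b))"
  then have ij: "i < p" "j < m" by (auto simp: msum_def)
  have l: "lin (*) (*) (\<lambda>x. c * x)" for c :: 'a by (auto simp: lin_def algebra_simps)
  have "(A * msum n m t F) $$ (i, j) = (\<Sum>k<n. A $$ (i, k) * sw t (\<lambda>a b. F a b $$ (k, j)))"
    using ij by (subst mult_index[OF A msum_carrier]) (auto simp: msum_index intro!: sum.cong)
  also have "\<dots> = sw t (\<lambda>a b. \<Sum>k<n. A $$ (i, k) * F a b $$ (k, j))"
    by (simp add: sw_sum lin_sw[OF l])
  also have "\<dots> = sw t (\<lambda>a b. (A * F a b) $$ (i, j))"
    by (rule sw_cong) (rule mult_index[OF A F ij, symmetric])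
  finally show "(A * msum n m t F) $$ (i, j) = msum p m t (\<lambda>a b. A * F a b) $$ (i, j)"
    using ij by (simp add: msum_index)
qed (use A in \<open>auto simp: msum_def\<close>)

lemma msum_mult_right:
  assumes A: "A \<in> carrier_mat m p" and F: "\<And>a b. F a b \<in> carrier_mat n m"
  shows "msum n m t F * A = msum n p t (\<lambda>a b. F a b * A)"
proof (rule eq_matI)
  fix i j assume "i < dim_row (msum n p t (\<lambda>a b. F a b * A))" "j < dim_col (msum n p t (\<lambda>a b. F a b * A))"
  then have ij: "i < n" "j < p" by (auto simp: msum_def)
  have l: "lin (*) (*) (\<lambda>x. x * c)" for c :: 'a by (auto simp: lin_def algebra_simps)
  have "(msum n m t F * A) $$ (i, j) = (\<Sum>k<m. sw t (\<lambda>a b. F a b $$ (i, k)) * A $$ (k, j))"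
    using ij by (subst mult_index[OF msum_carrier A]) (auto simp: msum_index intro!: sum.cong)
  also have "\<dots> = sw t (\<lambda>a b. \<Sum>k<m. F a b $$ (i, k) * A $$ (k, j))"
    by (simp add: sw_sum lin_sw[OF l])
  also have "\<dots> = sw t (\<lambda>a b. (F a b * A) $$ (i, j))"
    by (rule sw_cong) (rule mult_index[OF F A ij, symmetric])
  finally show "(msum n m t F * A) $$ (i, j) = msum n p t (\<lambda>a b. F a b * A) $$ (i, j)"
    using ij by (simp add: msum_index)
qed (use A in \<open>auto simp: msum_def\<close>)

lemma kron_msum_left:
  assumes B: "B \<in> carrier_mat p q" and F: "\<And>a b. F a b \<in> carrier_mat n m"
  shows "kron (msum n m t F) B = msum (n * p) (m * q) t (\<lambda>a b. kron (F a b) B)"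
proof (rule eq_matI)
  fix i j assume "i < dim_row (msum (n * p) (m * q) t (\<lambda>a b. kron (F a b) B))" "j < dim_col (msum (n * p) (m * q) t (\<lambda>a b. kron (F a b) B))"
  then have ij: "i < n * p" "j < m * q" by (auto simp: msum_def)
  have l: "lin (*) (*) (\<lambda>x. x * c)" for c :: 'a by (auto simp: lin_def algebra_simps)
  show "kron (msum n m t F) B $$ (i, j) = msum (n * p) (m * q) t (\<lambda>a b. kron (F a b) B) $$ (i, j)"
    using ij div_mod_less[OF ij(1)] div_mod_less[OF ij(2)]
    by (simp add: msum_index kron_index[OF msum_carrier B ij] kron_index[OF F B ij] lin_sw[OF l])
qed (use B in \<open>auto simp: msum_def\<close>)

lemma kron_msum_right:
  assumes B: "B \<in> carrier_mat p q" and F: "\<And>a b. F a b \<in> carrier_mat n m"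
  shows "kron B (msum n m t F) = msum (p * n) (q * m) t (\<lambda>a b. kron B (F a b))"
proof (rule eq_matI)
  fix i j assume "i < dim_row (msum (p * n) (q * m) t (\<lambda>a b. kron B (F a b)))" "j < dim_col (msum (p * n) (q * m) t (\<lambda>a b. kron B (F a b)))"
  then have ij: "i < p * n" "j < q * m" by (auto simp: msum_def)
  have l: "lin (*) (*) (\<lambda>x. c * x)" for c :: 'a by (auto simp: lin_def algebra_simps)
  show "kron B (msum n m t F) $$ (i, j) = msum (p * n) (q * m) t (\<lambda>a b. kron B (F a b)) $$ (i, j)"
    using ij div_mod_less[OF ij(1)] div_mod_less[OF ij(2)]
    by (simp add: msum_index kron_index[OF B msum_carrier ij] kron_index[OF B F ij] lin_sw[OF l])
qed (use B in \<open>auto simp: msum_def\<close>)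

lemma msum_swap:
  "msum n m t (\<lambda>a b. msum n m t' (\<lambda>c d. F a b c d)) = msum n m t' (\<lambda>c d. msum n m t (\<lambda>a b. F a b c d))"
proof (rule eq_matI)
  fix i j assume "i < dim_row (msum n m t' (\<lambda>c d. msum n m t (\<lambda>a b. F a b c d)))"
    "j < dim_col (msum n m t' (\<lambda>c d. msum n m t (\<lambda>a b. F a b c d)))"
  then have ij: "i < n" "j < m" by (auto simp: msum_def)
  show "msum n m t (\<lambda>a b. msum n m t' (\<lambda>c d. F a b c d)) $$ (i, j) = msum n m t' (\<lambda>c d. msum n m t (\<lambda>a b. F a b c d)) $$ (i, j)"
    using ij by (simp add: msum_index) (rule sw_swap)
qed (auto simp: msum_def)

lemma msum_mult_msum:
  assumes F: "\<And>a b. F a b \<in> carrier_mat n m" and G: "\<And>a b. G a b \<in> carrier_mat m p"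
  shows "msum n m t F * msum m p t' G = msum n p t (\<lambda>a b. msum n p t' (\<lambda>c d. F a b * G c d))"
  by (simp add: msum_mult_right[OF msum_carrier F] msum_mult_left[OF F G])

lemma msum_eqI:
  assumes "\<And>i j. i < n \<Longrightarrow> j < m \<Longrightarrow> sw t (\<lambda>a b. F a b $$ (i, j)) = A $$ (i, j)" and "A \<in> carrier_mat n m"
  shows "msum n m t F = A"
  using assms by (auto intro!: eq_matI simp: msum_def)

text \<open>Transfers identities between Sweedler sums in an algebra, such as the antipode axioms,
  to the matrices by which the algebra acts.\<close>

lemma msum_lin:
  assumes f: "mlin s n m f"
  shows "f (sw t g) = msum n m t (\<lambda>a b. f (g a b))"
proof (rule sym, rule msum_eqI)
  show "f (sw t g) \<in> carrier_mat n m" by (rule mlinD(1)[OF f])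
next
  fix i j assume "i < n" "j < m"
  then show "sw t (\<lambda>a b. f (g a b) $$ (i, j)) = f (sw t g) $$ (i, j)"
    using lin_sw[OF mlin_entry[OF f], of i j t g] by simp
qed

subsection \<open>Representations\<close>

lemma fdmodsD:
  assumes "X \<in> fdmods sA"
  shows "snd X a \<in> carrier_mat (fst X) (fst X)" "snd X 1 = 1\<^sub>m (fst X)" "snd X (a * b) = snd X a * snd X b"
    "snd X (a + b) = snd X a + snd X b" "snd X (sA c a) = c \<cdot>\<^sub>m snd X a" "mlin sA (fst X) (fst X) (snd X)"
  using assms unfolding fdmods_def mlin_def by auto

lemma fdmodsI:
  "mlin sA n n \<rho> \<Longrightarrow> \<rho> 1 = 1\<^sub>m n \<Longrightarrow> (\<And>a b. \<rho> (a * b) = \<rho> a * \<rho> b) \<Longrightarrow> (n, \<rho>) \<in> fdmods sA"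
  unfolding fdmods_def mlin_def by auto

lemma mlin_rep: "X \<in> fdmods sA \<Longrightarrow> lin sU sA g \<Longrightarrow> mlin sU (fst X) (fst X) (\<lambda>u. snd X (g u))"
  using mlin_comp[OF fdmodsD(6)] .

lemma tensor_act_msum: "tensor_act t X Y = msum (fst X * fst Y) (fst X * fst Y) t (\<lambda>a b. kron (snd X a) (snd Y b))"
  unfolding tensor_act_def msum_def sw_def ..

lemma tensor_act_carrier [simp]: "tensor_act t X Y \<in> carrier_mat (fst X * fst Y) (fst X * fst Y)"
  by (simp add: tensor_act_msum)

lemma fst_tensor_rep [simp]: "fst (tensor_rep D X Y) = fst X * fst Y"
  by (simp add: tensor_rep_def)

lemma snd_tensor_rep: "snd (tensor_rep D X Y) a = tensor_act (D a) X Y"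
  by (simp add: tensor_rep_def)

lemma mbilin_kron_rep:
  assumes X: "X \<in> fdmods sA" and Y: "Y \<in> fdmods sB"
  shows "mbilin sA sB (fst X * fst Y) (fst X * fst Y) (\<lambda>a b. kron (snd X a) (snd Y b))"
  by (intro mbilinI mlin_kron_left mlin_kron_right mlin_rep[OF X] mlin_rep[OF Y] fdmodsD(1)[OF X] fdmodsD(1)[OF Y] lin_id)

lemma intertwinersD:
  assumes "f \<in> intertwiners X Y"
  shows "f \<in> carrier_mat (fst Y) (fst X)" "f * snd X a = snd Y a * f"
  using assms unfolding intertwiners_def by auto

lemma intertwinersI:
  "f \<in> carrier_mat (fst Y) (fst X) \<Longrightarrow> (\<And>a. f * snd X a = snd Y a * f) \<Longrightarrow> f \<in> intertwiners X Y"
  unfolding intertwiners_def by auto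

subsection \<open>Comultiplication and coaction\<close>

context fd_comodule_algebra begin

lemma vsH: "vector_space sH" and vsB: "vector_space sB"
  by (fact H.vector_space_axioms, fact B.vector_space_axioms)

lemma delta_range: "\<delta> b \<in> range (tensor2 sH sB)"
  using coact_alg_map unfolding tensor_algebra_map_def by blast

context
  fixes sW :: "'k \<Rightarrow> 'w::ab_group_add \<Rightarrow> 'w" and \<beta>
  assumes W: "vector_space sW" and \<beta>: "bilin sH sB sW \<beta>"
begin

text \<open>The representative chosen by \<open>sweedler\<close> may be replaced by any list
  presenting the same tensor. The axioms on \<delta>, which are equalities of tensors, thereby
  become equations for an arbitrary bilinear \<beta>.\<close>

lemma delta_eq:
  assumes "\<delta> b = tensor2 sH sB l" shows "sw (\<delta> b) \<beta> = (\<Sum>(u, v)\<leftarrow>l. \<beta> u v)"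
proof -
  have "tensor2 sH sB (sweedler (\<delta> b)) = tensor2 sH sB l"
    using assms delta_range tensor2_sweedler by metis
  then show ?thesis unfolding sw_def using tensor2_eqD[OF vsH vsB W _ \<beta>] by blast
qed

lemma delta_add: "sw (\<delta> (a + b)) \<beta> = sw (\<delta> a) \<beta> + sw (\<delta> b) \<beta>"
proof -
  have "\<delta> (a + b) = tensor2 sH sB (sweedler (\<delta> a) @ sweedler (\<delta> b))"
    using coact_alg_map unfolding tensor_algebra_map_def by blast
  from delta_eq[OF this] show ?thesis by (simp add: sw_def)
qed

lemma delta_scale: "sw (\<delta> (sB c a)) \<beta> = sW c (sw (\<delta> a) \<beta>)"
proof -
  interpret W: vector_space sW by (fact W)
  have "\<delta> (sB c a) = tensor2 sH sB [(sH c u, v). (u, v) \<leftarrow> sweedler (\<delta> a)]"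
    using coact_alg_map unfolding tensor_algebra_map_def by blast
  from delta_eq[OF this] have "sw (\<delta> (sB c a)) \<beta> = (\<Sum>(u, v)\<leftarrow>[(sH c u, v). (u, v) \<leftarrow> sweedler (\<delta> a)]. \<beta> u v)" .
  also have "\<dots> = sW c (\<Sum>(u, v)\<leftarrow>sweedler (\<delta> a). \<beta> u v)"
  proof -
    have "(\<Sum>(u, v)\<leftarrow>[(sH c u, v). (u, v) \<leftarrow> l]. \<beta> u v) = sW c (\<Sum>(u, v)\<leftarrow>l. \<beta> u v)" for l
      by (induction l) (auto simp: linD[OF bilinD(1)[OF \<beta>]] W.scale_right_distrib)
    then show ?thesis .
  qed
  finally show ?thesis by (simp add: sw_def)
qed

lemma lin_delta: "lin sB sW (\<lambda>b. sw (\<delta> b) \<beta>)"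
  by (intro linI delta_add delta_scale)

lemma delta_one: "sw (\<delta> 1) \<beta> = \<beta> 1 1"
proof -
  have "\<delta> 1 = tensor2 sH sB [(1, 1)]"
    using coact_alg_map unfolding tensor_algebra_map_def by blast
  from delta_eq[OF this] show ?thesis by simp
qed

lemma delta_mult: "sw (\<delta> (a * b)) \<beta> = sw (\<delta> a) (\<lambda>x y. sw (\<delta> b) (\<lambda>x' y'. \<beta> (x * x') (y * y')))"
proof -
  have "\<delta> (a * b) = tensor2 sH sB (sweedler (\<delta> a) *\<^sub>2 sweedler (\<delta> b))"
    using coact_alg_map unfolding tensor_algebra_map_def by blast
  from delta_eq[OF this] show ?thesis by (simp only: sum_mul2)
qed

end

lemma delta_coassoc:
  assumes "vector_space sW" "trilin sH sH sB sW \<tau>"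
  shows "sw (\<delta> b) (\<lambda>x y. sw (\<Delta> x) (\<lambda>u v. \<tau> u v y)) = sw (\<delta> b) (\<lambda>x y. sw (\<delta> y) (\<lambda>u v. \<tau> x u v))"
  using tensor3_eqD[OF vsH vsH vsB assms(1) coact_coassoc assms(2), of b] by (simp only: sum_legs)

lemma delta_counit: "lin sB sW f \<Longrightarrow> sw (\<delta> b) (\<lambda>x y. sW (\<epsilon> x) (f y)) = f b"
  using lin_sw[of sB sW f "\<delta> b" "\<lambda>x y. sB (\<epsilon> x) y"] coact_counit[of b, folded sw_def]
  by (simp add: linD(2)[of sB sW f])

lemma mdelta_one: "mbilin sH sB n m F \<Longrightarrow> msum n m (\<delta> 1) F = F 1 1"
  by (intro msum_eqI) (auto simp: mbilin_carrier delta_one[OF vector_space_field mbilin_entry])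

lemma mdelta_mult: "mbilin sH sB n m F \<Longrightarrow>
    msum n m (\<delta> (a * b)) F = msum n m (\<delta> a) (\<lambda>x y. msum n m (\<delta> b) (\<lambda>x' y'. F (x * x') (y * y')))"
  by (intro msum_eqI) (auto simp: msum_index delta_mult[OF vector_space_field mbilin_entry])

lemma mlin_delta:
  assumes "mbilin sH sB n m F" shows "mlin sB n m (\<lambda>b. msum n m (\<delta> b) F)"
  by (rule mlin_iff_entries)
    (auto simp: msum_index intro!: lin_delta[OF vector_space_field mbilin_entry[OF assms]])

lemma mdelta_coassoc:
  assumes "\<And>v w. mlin sH n m (\<lambda>u. F u v w)" "\<And>u w. mlin sH n m (\<lambda>v. F u v w)" "\<And>u v. mlin sB n m (F u v)"
  shows "msum n m (\<delta> b) (\<lambda>x y. msum n m (\<Delta> x) (\<lambda>u v. F u v y)) =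
         msum n m (\<delta> b) (\<lambda>x y. msum n m (\<delta> y) (\<lambda>u v. F x u v))"
proof (rule msum_eqI)
  fix i j assume ij: "i < n" "j < m"
  have "trilin sH sH sB (*) (\<lambda>u v w. F u v w $$ (i, j))"
    by (intro trilinI mlin_entry[OF _ ij] assms)
  from delta_coassoc[OF vector_space_field this]
  show "sw (\<delta> b) (\<lambda>a ba. msum n m (\<Delta> a) (\<lambda>u v. F u v ba) $$ (i, j)) =
           msum n m (\<delta> b) (\<lambda>x y. msum n m (\<delta> y) (\<lambda>u v. F x u v)) $$ (i, j)"
    using ij by (simp add: msum_index)
qed simp

lemma mdelta_counit:
  assumes f: "mlin sB n m f" shows "msum n m (\<delta> b) (\<lambda>x y. \<epsilon> x \<cdot>\<^sub>m f y) = f b"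
proof (rule msum_eqI)
  fix i j assume ij: "i < n" "j < m"
  have "f y \<in> carrier_mat n m" for y using mlinD(1)[OF f] .
  then have "dim_row (f y) = n" "dim_col (f y) = m" for y by auto
  then show "sw (\<delta> b) (\<lambda>a b. (\<epsilon> a \<cdot>\<^sub>m f b) $$ (i, j)) = f b $$ (i, j)"
    using delta_counit[OF mlin_entry[OF f ij]] ij by simp
qed (rule mlinD(1)[OF f])

end

context fd_hopf_algebra begin

text \<open>A Hopf algebra coacts on itself by \<Delta>; every statement about \<delta> then
  specializes to \<Delta>, and the tensor product of H-modules becomes a special case of the action
  on B-modules.\<close>

lemma self_comodule: "fd_comodule_algebra sH \<Delta> \<epsilon> S sH \<Delta>"
  by (intro fd_comodule_algebra.intro fd_comodule_algebra_axioms.intro fd_hopf_algebra_axioms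
      fd_algebra_axioms comul_alg_map coassoc counit_left)

lemmas lin_counit = linear_imp_lin[OF counit_linear]
lemmas lin_antipode = linear_imp_lin[OF antipode_linear]

lemma Delta_counit_right:
  assumes "lin sH sW f" shows "sw (\<Delta> h) (\<lambda>x y. sW (\<epsilon> y) (f x)) = f h"
  using lin_sw[OF assms, of "\<Delta> h" "\<lambda>x y. sH (\<epsilon> y) x"] counit_right[of h, folded sw_def]
  by (simp add: linD(2)[OF assms])

lemma Delta_antipode_left: "sw (\<Delta> h) (\<lambda>x y. S x * y) = sH (\<epsilon> h) 1"
  using antipode_left unfolding sw_def .

lemma Delta_antipode_right: "sw (\<Delta> h) (\<lambda>x y. x * S y) = sH (\<epsilon> h) 1"
  using antipode_right unfolding sw_def .

lemmas lin_Delta = fd_comodule_algebra.lin_delta[OF self_comodule]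
lemmas Delta_one = fd_comodule_algebra.delta_one[OF self_comodule]
lemmas Delta_mult = fd_comodule_algebra.delta_mult[OF self_comodule]
lemmas Delta_coassoc = fd_comodule_algebra.delta_coassoc[OF self_comodule]
lemmas Delta_counit_left = fd_comodule_algebra.delta_counit[OF self_comodule]
lemmas mDelta_mult = fd_comodule_algebra.mdelta_mult[OF self_comodule]
lemmas mlin_Delta = fd_comodule_algebra.mlin_delta[OF self_comodule]
lemmas mDelta_coassoc = fd_comodule_algebra.mdelta_coassoc[OF self_comodule]
lemmas mDelta_counit_left = fd_comodule_algebra.mdelta_counit[OF self_comodule]

lemma mDelta_counit_right:
  assumes f: "mlin sH n m f" shows "msum n m (\<Delta> h) (\<lambda>x y. \<epsilon> y \<cdot>\<^sub>m f x) = f h"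
proof (rule msum_eqI)
  fix i j assume ij: "i < n" "j < m"
  have "f y \<in> carrier_mat n m" for y using mlinD(1)[OF f] .
  then have "dim_row (f y) = n" "dim_col (f y) = m" for y by auto
  then show "sw (\<Delta> h) (\<lambda>a b. (\<epsilon> b \<cdot>\<^sub>m f a) $$ (i, j)) = f h $$ (i, j)"
    using Delta_counit_right[OF mlin_entry[OF f ij]] ij by simp
qed (rule mlinD(1)[OF f])

end

lemma (in fd_algebra) fd_basis:
  obtains Ba where "finite_dimensional_vector_space sA Ba"
proof -
  obtain V where V: "finite V" "span V = UNIV" using finite_dim by blast
  obtain Ba where Ba: "Ba \<subseteq> V" "independent Ba" "V \<subseteq> span Ba"
    using maximal_independent_subset[of V] by blast
  have "span Ba = UNIV" using Ba V by (metis span_mono span_span top.extremum_uniqueI)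
  then have "finite_dimensional_vector_space sA Ba"
    using Ba V finite_subset by unfold_locales auto
  then show ?thesis by (rule that)
qed

text \<open>Left multiplication by \<open>u\<close> is surjective, hence injective in finite
  dimension, and it sends \<open>v * u\<close> and 1 to the same element.\<close>

lemma (in fd_algebra) right_inverse_imp_left:
  fixes u v :: 'a assumes "u * v = 1" shows "v * u = 1"
proof -
  obtain Ba where "finite_dimensional_vector_space sA Ba" by (rule fd_basis)
  then interpret fd: finite_dimensional_vector_space sA Ba .
  have l: "Vector_Spaces.linear sA sA ((*) u)"
    by (simp add: linear_iff_lin vector_space_axioms lin_mult_left lin_id)
  have "u * (v * y) = y" for y using assms by (simp add: mult.assoc[symmetric])
  then have "surj ((*) u)" unfolding surj_def by metis
  then have "inj ((*) u)" by (rule fd.linear_surj_imp_inj[OF l])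
  moreover have "u * (v * u) = u * 1" using assms by (simp add: mult.assoc[symmetric])
  ultimately show ?thesis by (meson injD)
qed

section \<open>The antipode reverses products\<close>

context fd_hopf_algebra begin

lemma lin_S: "lin sU sH f \<Longrightarrow> lin sU sH (\<lambda>u. S (f u))"
  by (rule lin_comp[OF lin_antipode])

lemma lin_eps: "lin sU sH f \<Longrightarrow> lin sU (*) (\<lambda>u. \<epsilon> (f u))"
  by (rule lin_comp[OF lin_counit])

lemmas lin_sH = lin_scale[OF vector_space_axioms] lin_scale_left[OF vector_space_axioms]

lemmas lin_rules = lin_mult_left lin_mult_right lin_S lin_eps lin_sH lin_id

lemmas lin_sw_rules = lin_sw_fun[OF vector_space_axioms]

lemma Delta_antipode_left_mult: "sw (\<Delta> h) (\<lambda>x y. p * (S x * y) * q) = sH (\<epsilon> h) (p * q)"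
  using lin_sw[of sH sH "\<lambda>z. p * z * q" "\<Delta> h" "\<lambda>x y. S x * y"]
  by (simp add: Delta_antipode_left lin_rules scale_mult_left scale_mult_right)

lemma Delta_antipode_right_mult: "sw (\<Delta> h) (\<lambda>x y. p * (x * S y) * q) = sH (\<epsilon> h) (p * q)"
  using lin_sw[of sH sH "\<lambda>z. p * z * q" "\<Delta> h" "\<lambda>x y. x * S y"]
  by (simp add: Delta_antipode_right lin_rules scale_mult_left scale_mult_right)

lemma antipode_one: "S 1 = 1"
proof -
  have "bilin sH sH sH (\<lambda>x y. S x * y)" by (intro bilinI lin_rules)
  from Delta_one[OF vector_space_axioms this] show ?thesis
    by (simp add: Delta_antipode_left counit_one)
qed

text \<open>Uniqueness of convolution inverses on H \<otimes> H: both (g, h) \<mapsto> S(gh) and (g,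
  h) \<mapsto> S(h) S(g) invert the multiplication. The auxiliary \<open>T\<close> is the threefold
  convolution product of S(gh), gh and S(h) S(g), evaluated in both bracketings.\<close>

lemma antipode_mult: "S (g * h) = S h * S g"
proof -
  define T where "T = sw (\<Delta> g) (\<lambda>g1 g2. sw (\<Delta> h) (\<lambda>h1 h2. sw (\<Delta> g2) (\<lambda>a b. sw (\<Delta> h2) (\<lambda>c d.
      S (g1 * h1) * (a * c * (S d * S b))))))"
  \<comment> \<open>Collapsing from the right: the second and third parts of h cancel, and after
    them those of g.\<close>
  have inner1: "sw (\<Delta> h2) (\<lambda>c d. w * (a * c * (S d * S b))) = sH (\<epsilon> h2) (w * (a * S b))" for h2 w a b
    using Delta_antipode_right_mult[of h2 "w * a" "S b"] by (simp add: mult.assoc)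
  have inner2: "sw (\<Delta> g2) (\<lambda>a b. sw (\<Delta> h2) (\<lambda>c d. w * (a * c * (S d * S b)))) = sH (\<epsilon> h2) (sH (\<epsilon> g2) w)"
    for g2 h2 w
    using Delta_antipode_right_mult[of g2 "sH (\<epsilon> h2) w" 1]
    by (simp add: inner1 scale_mult_left)
  have "T = sw (\<Delta> g) (\<lambda>g1 g2. sw (\<Delta> h) (\<lambda>h1 h2. sH (\<epsilon> h2) (sH (\<epsilon> g2) (S (g1 * h1)))))"
    unfolding T_def inner2 ..
  also have "\<dots> = sw (\<Delta> g) (\<lambda>g1 g2. sH (\<epsilon> g2) (S (g1 * h)))"
    by (intro sw_cong Delta_counit_right lin_rules)
  also have "\<dots> = S (g * h)"
    by (intro Delta_counit_right lin_rules)
  finally have 1: "T = S (g * h)" .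
  \<comment> \<open>Rebracketing by coassociativity brings the first and second parts together as
    the coproduct of a product, where the left antipode axiom applies.\<close>
  have "T = sw (\<Delta> g) (\<lambda>g1 g2. sw (\<Delta> g2) (\<lambda>a b. sw (\<Delta> h) (\<lambda>h1 h2. sw (\<Delta> h2) (\<lambda>c d.
      S (g1 * h1) * (a * c * (S d * S b))))))"
    unfolding T_def by (intro sw_cong sw_swap)
  also have "\<dots> = sw (\<Delta> g) (\<lambda>x b. sw (\<Delta> x) (\<lambda>g1 a. sw (\<Delta> h) (\<lambda>h1 h2. sw (\<Delta> h2) (\<lambda>c d.
      S (g1 * h1) * (a * c * (S d * S b))))))"
    by (rule Delta_coassoc[OF vector_space_axioms, symmetric])
      (intro trilinI lin_sw_rules lin_rules)
  also have "\<dots> = sw (\<Delta> g) (\<lambda>x b. sw (\<Delta> x) (\<lambda>g1 a. sw (\<Delta> h) (\<lambda>y d. sw (\<Delta> y) (\<lambda>h1 c.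
      S (g1 * h1) * (a * c * (S d * S b))))))"
    by (intro sw_cong Delta_coassoc[OF vector_space_axioms, symmetric] trilinI lin_sw_rules lin_rules)
  also have "\<dots> = sw (\<Delta> g) (\<lambda>x b. sw (\<Delta> h) (\<lambda>y d. sw (\<Delta> x) (\<lambda>g1 a. sw (\<Delta> y) (\<lambda>h1 c.
      S (g1 * h1) * (a * c * (S d * S b))))))"
    by (intro sw_cong sw_swap)
  also have "\<dots> = sw (\<Delta> g) (\<lambda>x b. sw (\<Delta> h) (\<lambda>y d. sw (\<Delta> (x * y)) (\<lambda>p q. S p * (q * (S d * S b)))))"
    by (intro sw_cong Delta_mult[OF vector_space_axioms, symmetric] bilinI lin_rules)
  also have "\<dots> = sw (\<Delta> g) (\<lambda>x b. sw (\<Delta> h) (\<lambda>y d. sH (\<epsilon> y) (sH (\<epsilon> x) (S d * S b))))"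
  proof (intro sw_cong)
    fix x b y d
    show "sw (\<Delta> (x * y)) (\<lambda>p q. S p * (q * (S d * S b))) = sH (\<epsilon> y) (sH (\<epsilon> x) (S d * S b))"
      using Delta_antipode_left_mult[of "x * y" 1 "S d * S b"]
      by (simp add: mult.assoc counit_mult mult.commute[of "\<epsilon> x"])
  qed
  also have "\<dots> = sw (\<Delta> g) (\<lambda>x b. sH (\<epsilon> x) (S h * S b))"
    by (intro sw_cong Delta_counit_left lin_rules)
  also have "\<dots> = S h * S g"
    by (intro Delta_counit_left lin_rules)
  finally show ?thesis using 1 by simp
qed

end

subsection \<open>Consequences of the R-matrix axioms\<close>

context fd_quasitriangular_hopf_algebra begin

lemma R_comul_left':
  assumes "vector_space sW" "trilin sH sH sH sW \<tau>"
  shows "sw R (\<lambda>a b. sw (\<Delta> a) (\<lambda>u v. \<tau> u v b)) = sw R (\<lambda>a b. sw R (\<lambda>c d. \<tau> a c (b * d)))"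
  using tensor3_eqD[OF vector_space_axioms vector_space_axioms vector_space_axioms assms(1) R_comul_left assms(2)]
  by (simp add: sum_legs sw_def)

lemma R_comul_right':
  assumes "vector_space sW" "trilin sH sH sH sW \<tau>"
  shows "sw R (\<lambda>a b. sw (\<Delta> b) (\<lambda>u v. \<tau> a u v)) = sw R (\<lambda>a b. sw R (\<lambda>c d. \<tau> (a * c) d b))"
  using tensor3_eqD[OF vector_space_axioms vector_space_axioms vector_space_axioms assms(1) R_comul_right assms(2)]
  by (simp add: sum_legs sw_def)

lemma R_comul':
  assumes "vector_space sW" "bilin sH sH sW \<beta>"
  shows "sw R (\<lambda>a b. sw (\<Delta> h) (\<lambda>x y. \<beta> (a * x) (b * y))) = sw (\<Delta> h) (\<lambda>x y. sw R (\<lambda>a b. \<beta> (y * a) (x * b)))"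
proof -
  have "(\<Sum>(u, v)\<leftarrow>swap2 (sweedler (\<Delta> h)) *\<^sub>2 sweedler R. \<beta> u v) = sw (\<Delta> h) (\<lambda>x y. sw R (\<lambda>a b. \<beta> (y * a) (x * b)))"
    by (simp only: sum_list_mul2 sum_swap2 sw_def)
  then show ?thesis
    using tensor2_eqD[OF vector_space_axioms vector_space_axioms assms(1) R_comul[of h] assms(2)]
    by (simp add: sum_mul2)
qed

lemma R_cancel:
  obtains R' where "tensor_inverse sH sH R R'"
    "\<And>sW \<beta>. vector_space sW \<Longrightarrow> bilin sH sH sW (\<beta> :: 'h \<Rightarrow> 'h \<Rightarrow> 'w::ab_group_add) \<Longrightarrow>
      sw R (\<lambda>a b. sw R' (\<lambda>c d. \<beta> (a * c) (b * d))) = \<beta> 1 1"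
proof -
  obtain R' where R': "tensor_inverse sH sH R R'" using R_invertible by blast
  then have e: "tensor2 sH sH (sweedler R *\<^sub>2 sweedler R') = tensor2 sH sH [(1, 1)]"
    unfolding tensor_inverse_def by blast
  show ?thesis
  proof (rule that[OF R'])
    fix sW and \<beta> :: "'h \<Rightarrow> 'h \<Rightarrow> 'w"
    assume "vector_space sW" "bilin sH sH sW \<beta>"
    from tensor2_eqD[OF vector_space_axioms vector_space_axioms this(1) e this(2)]
    show "sw R (\<lambda>a b. sw R' (\<lambda>c d. \<beta> (a * c) (b * d))) = \<beta> 1 1" by (simp add: sum_mul2)
  qed
qed

text \<open>Let e be the left-hand side. Applying \<epsilon> to the first leg of (\<Delta> \<otimes>
  id)R = R13 R23 gives R = (1 \<otimes> e)R. Applying \<epsilon> \<otimes> id to R R' = 1 and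
  inserting this gives 1 = e.\<close>

lemma R_counit_left: "sw R (\<lambda>a b. sH (\<epsilon> a) b) = 1"
proof -
  define e where "e = sw R (\<lambda>a b. sH (\<epsilon> a) b)"
  obtain R' where R': "\<And>sW \<beta>. vector_space sW \<Longrightarrow> bilin sH sH sW (\<beta> :: 'h \<Rightarrow> 'h \<Rightarrow> 'h) \<Longrightarrow>
      sw R (\<lambda>a b. sw R' (\<lambda>c d. \<beta> (a * c) (b * d))) = \<beta> 1 1" by (rule R_cancel) blast
  have *: "sw R \<beta> = sw R (\<lambda>c d. \<beta> c (e * d))" if \<beta>: "bilin sH sH sH \<beta>" for \<beta>
  proof -
    have l: "lin sH sH (\<beta> c)" "lin sH sH (\<lambda>c. \<beta> c d)" for c d using \<beta> by (auto simp: bilin_def)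
    have "sw R \<beta> = sw R (\<lambda>a b. sw (\<Delta> a) (\<lambda>u v. sH (\<epsilon> u) (\<beta> v b)))"
      by (intro sw_cong Delta_counit_left[symmetric] l)
    also have "\<dots> = sw R (\<lambda>a b. sw R (\<lambda>c d. sH (\<epsilon> a) (\<beta> c (b * d))))"
      by (intro R_comul_left'[OF vector_space_axioms] trilinI lin_rules l)
    also have "\<dots> = sw R (\<lambda>c d. sw R (\<lambda>a b. \<beta> c (sH (\<epsilon> a) b * d)))"
      by (subst sw_swap) (simp add: scale_mult_left linD(2)[OF l(1)])
    also have "\<dots> = sw R (\<lambda>c d. \<beta> c (e * d))"
    proof (rule sw_cong)
      fix c d
      have m: "lin sH sH (\<lambda>z. \<beta> c (z * d))" by (rule lin_comp[OF l(1)]) (intro lin_rules)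
      show "sw R (\<lambda>a b. \<beta> c (sH (\<epsilon> a) b * d)) = \<beta> c (e * d)"
        by (simp only: e_def lin_sw[OF m])
    qed
    finally show ?thesis .
  qed
  have b: "bilin sH sH sH (\<lambda>u v. sw R' (\<lambda>c d. sH (\<epsilon> (u * c)) (p * (v * d))))" for p
    by (intro bilinI lin_sw_rules lin_rules)
  have b2: "bilin sH sH sH (\<lambda>u v. sH (\<epsilon> u) (p * v))" for p
    by (intro bilinI lin_rules)
  have "1 = sw R (\<lambda>a b. sw R' (\<lambda>c d. sH (\<epsilon> (a * c)) (1 * (b * d))))"
    using R'[OF vector_space_axioms b2[of 1]] by (simp add: counit_one)
  also have "\<dots> = sw R (\<lambda>a b. sw R' (\<lambda>c d. sH (\<epsilon> (a * c)) (e * (b * d))))"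
    using *[OF b[of 1]] by (simp add: mult.assoc)
  also have "\<dots> = e"
    using R'[OF vector_space_axioms b2[of e]] by (simp add: counit_one)
  finally show ?thesis unfolding e_def by simp
qed

text \<open>The mirror argument, from (id \<otimes> \<Delta>)R = R13 R12 with the counit on the last
  leg.\<close>

lemma R_counit_right: "sw R (\<lambda>a b. sH (\<epsilon> b) a) = 1"
proof -
  define e where "e = sw R (\<lambda>a b. sH (\<epsilon> b) a)"
  obtain R' where R': "\<And>sW \<beta>. vector_space sW \<Longrightarrow> bilin sH sH sW (\<beta> :: 'h \<Rightarrow> 'h \<Rightarrow> 'h) \<Longrightarrow>
      sw R (\<lambda>a b. sw R' (\<lambda>c d. \<beta> (a * c) (b * d))) = \<beta> 1 1" by (rule R_cancel) blast
  have *: "sw R \<beta> = sw R (\<lambda>c d. \<beta> (e * c) d)" if \<beta>: "bilin sH sH sH \<beta>" for \<beta>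
  proof -
    have l: "lin sH sH (\<beta> c)" "lin sH sH (\<lambda>c. \<beta> c d)" for c d using \<beta> by (auto simp: bilin_def)
    have "sw R \<beta> = sw R (\<lambda>a b. sw (\<Delta> b) (\<lambda>u v. sH (\<epsilon> v) (\<beta> a u)))"
      by (intro sw_cong Delta_counit_right[symmetric] l)
    also have "\<dots> = sw R (\<lambda>a b. sw R (\<lambda>c d. sH (\<epsilon> b) (\<beta> (a * c) d)))"
      by (intro R_comul_right'[OF vector_space_axioms] trilinI lin_rules l lin_comp[OF l(2)])
    also have "\<dots> = sw R (\<lambda>c d. sw R (\<lambda>a b. \<beta> (sH (\<epsilon> b) a * c) d))"
      by (subst sw_swap) (simp add: scale_mult_left linD(2)[OF l(2)])
    also have "\<dots> = sw R (\<lambda>c d. \<beta> (e * c) d)"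
    proof (rule sw_cong)
      fix c d
      have m: "lin sH sH (\<lambda>z. \<beta> (z * c) d)" by (rule lin_comp[OF l(2)]) (intro lin_rules)
      show "sw R (\<lambda>a b. \<beta> (sH (\<epsilon> b) a * c) d) = \<beta> (e * c) d"
        by (simp only: e_def lin_sw[OF m])
    qed
    finally show ?thesis .
  qed
  have b: "bilin sH sH sH (\<lambda>u v. sw R' (\<lambda>c d. sH (\<epsilon> (v * d)) (p * (u * c))))" for p
    by (intro bilinI lin_sw_rules lin_rules)
  have b2: "bilin sH sH sH (\<lambda>u v. sH (\<epsilon> v) (p * u))" for p
    by (intro bilinI lin_rules)
  have "1 = sw R (\<lambda>a b. sw R' (\<lambda>c d. sH (\<epsilon> (b * d)) (1 * (a * c))))"
    using R'[OF vector_space_axioms b2[of 1]] by (simp add: counit_one)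
  also have "\<dots> = sw R (\<lambda>a b. sw R' (\<lambda>c d. sH (\<epsilon> (b * d)) (e * (a * c))))"
    using *[OF b[of 1]] by (simp add: mult.assoc)
  also have "\<dots> = e"
    using R'[OF vector_space_axioms b2[of e]] by (simp add: counit_one)
  finally show ?thesis unfolding e_def by simp
qed

context
  fixes \<beta> :: "'h \<Rightarrow> 'h \<Rightarrow> 'h"
  assumes \<beta>: "bilin sH sH sH \<beta>"
begin

private lemma l: "lin sH sH (\<beta> c)" "lin sH sH (\<lambda>c. \<beta> c d)"
  using \<beta> by (auto simp: bilin_def)

private lemma l': "lin sU sH g \<Longrightarrow> lin sU sH (\<lambda>u. \<beta> c (g u))" "lin sU sH g \<Longrightarrow> lin sU sH (\<lambda>u. \<beta> (g u) d)"
  by (rule lin_comp[OF l(1)] lin_comp[OF l(2)], assumption)+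

text \<open>By the first coproduct axiom the double sum is one over a1 S(a2) \<otimes> b, which
  collapses to 1; in other words, (S \<otimes> id)R is a right inverse of R.\<close>

lemma R_antipode_right: "sw R (\<lambda>a b. sw R (\<lambda>c d. \<beta> (a * S c) (b * d))) = \<beta> 1 1"
proof -
  have "sw R (\<lambda>a b. sw R (\<lambda>c d. \<beta> (a * S c) (b * d))) = sw R (\<lambda>a b. sw (\<Delta> a) (\<lambda>u v. \<beta> (u * S v) b))"
    by (intro R_comul_left'[OF vector_space_axioms, symmetric] trilinI l' lin_rules)
  also have "\<dots> = sw R (\<lambda>a b. \<beta> 1 (sH (\<epsilon> a) b))"
    by (intro sw_cong)
      (simp only: lin_sw[OF l(2), symmetric] Delta_antipode_right linD(2)[OF l(1)] linD(2)[OF l(2)])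
  also have "\<dots> = \<beta> 1 1" by (simp only: lin_sw[OF l(1), symmetric] R_counit_left)
  finally show ?thesis .
qed

text \<open>By the second coproduct axiom and antimultiplicativity the double sum is one over S(a)
  \<otimes> b1 S(b2). It makes (S \<otimes> S)R a right inverse of (S \<otimes> id)R.\<close>

lemma R_antipode_swap: "sw R (\<lambda>a b. sw R (\<lambda>c d. \<beta> (S c * S a) (d * S b))) = \<beta> 1 1"
proof -
  have "sw R (\<lambda>a b. sw R (\<lambda>c d. \<beta> (S c * S a) (d * S b))) = sw R (\<lambda>a b. sw (\<Delta> b) (\<lambda>u v. \<beta> (S a) (u * S v)))"
    unfolding antipode_mult[symmetric]
    by (intro R_comul_right'[OF vector_space_axioms, symmetric] trilinI l' lin_rules)
  also have "\<dots> = sw R (\<lambda>a b. \<beta> (S (sH (\<epsilon> b) a)) 1)"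
    by (intro sw_cong)
      (simp only: lin_sw[OF l(1), symmetric] Delta_antipode_right linD(2)[OF l(1)] linD(2)[OF l(2)]
        linD(2)[OF lin_antipode])
  also have "\<dots> = \<beta> 1 1"
    by (simp only: lin_sw[OF l(2), symmetric] lin_sw[OF lin_antipode, symmetric] R_counit_right antipode_one)
  finally show ?thesis .
qed

end

text \<open>The element (S \<otimes> id)R has R as a left inverse and (S \<otimes> S)R as a right
  inverse, so the two coincide.\<close>

lemma R_antipode_antipode:
  assumes \<beta>: "bilin sH sH sH \<beta>"
  shows "sw R (\<lambda>a b. \<beta> (S a) (S b)) = sw R \<beta>"
proof -
  have l: "lin sU sH g \<Longrightarrow> lin sU sH (\<lambda>u. \<beta> c (g u))" "lin sU sH g \<Longrightarrow> lin sU sH (\<lambda>u. \<beta> (g u) d)"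
    for c d and sU :: "'k \<Rightarrow> 'h \<Rightarrow> 'h" and g using \<beta> by (auto simp: bilin_def lin_def)
  have "sw R \<beta> = sw R (\<lambda>p q. \<beta> (p * 1) (q * 1))" by simp
  also have "\<dots> = sw R (\<lambda>p q. sw R (\<lambda>a b. sw R (\<lambda>c d. \<beta> (p * (S c * S a)) (q * (d * S b)))))"
    by (intro sw_cong R_antipode_swap[symmetric] bilinI l lin_rules)
  also have "\<dots> = sw R (\<lambda>a b. sw R (\<lambda>p q. sw R (\<lambda>c d. \<beta> (p * (S c * S a)) (q * (d * S b)))))"
    by (rule sw_swap)
  also have "\<dots> = sw R (\<lambda>a b. sw R (\<lambda>p q. sw R (\<lambda>c d. \<beta> ((p * S c) * S a) ((q * d) * S b))))"
    by (simp add: mult.assoc)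
  also have "\<dots> = sw R (\<lambda>a b. \<beta> (1 * S a) (1 * S b))"
    by (intro sw_cong R_antipode_right bilinI l lin_rules)
  finally show ?thesis by simp
qed

definition drinfeld :: 'h where "drinfeld = sw R (\<lambda>a b. S b * a)"

text \<open>The relation between R \<Delta>(x) and the opposite coproduct, for x = h1, is contracted
  by \<open>?\<phi>\<close> together with the remaining leg z = h2. On the opposite side S(x1) x2
  collapses and leaves S(S(h)) times the Drinfeld element; on the other side S(x2 S(z)) collapses
  and leaves the Drinfeld element times h.\<close>

lemma antipode_square_drinfeld: "S (S h) * drinfeld = drinfeld * h"
proof -
  let ?\<phi> = "\<lambda>a b z. S (S z) * (S b * a)"
  have "sw (\<Delta> h) (\<lambda>x z. sw R (\<lambda>a b. sw (\<Delta> x) (\<lambda>x1 x2. ?\<phi> (a * x1) (b * x2) z))) =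
        sw (\<Delta> h) (\<lambda>x z. sw (\<Delta> x) (\<lambda>x1 x2. sw R (\<lambda>a b. ?\<phi> (x2 * a) (x1 * b) z)))"
    by (intro sw_cong R_comul'[OF vector_space_axioms] bilinI lin_rules)
  moreover have "sw (\<Delta> h) (\<lambda>x z. sw (\<Delta> x) (\<lambda>x1 x2. sw R (\<lambda>a b. ?\<phi> (x2 * a) (x1 * b) z))) = S (S h) * drinfeld"
  proof -
    have "sw (\<Delta> x) (\<lambda>x1 x2. sw R (\<lambda>a b. ?\<phi> (x2 * a) (x1 * b) z)) = sH (\<epsilon> x) (S (S z) * drinfeld)" for x z
    proof -
      have "sw (\<Delta> x) (\<lambda>x1 x2. sw R (\<lambda>a b. ?\<phi> (x2 * a) (x1 * b) z)) =
          sw R (\<lambda>a b. sw (\<Delta> x) (\<lambda>x1 x2. (S (S z) * S b) * (S x1 * x2) * a))"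
        by (subst sw_swap) (simp add: antipode_mult mult.assoc)
      also have "\<dots> = sw R (\<lambda>a b. (sH (\<epsilon> x) (S (S z))) * (S b * a))"
        by (simp only: Delta_antipode_left_mult) (simp add: mult.assoc scale_mult_left)
      also have "\<dots> = sH (\<epsilon> x) (S (S z) * drinfeld)"
        unfolding drinfeld_def scale_mult_left[symmetric]
        by (rule lin_sw[symmetric, of sH sH "\<lambda>u. sH (\<epsilon> x) (S (S z)) * u"]) (intro lin_rules)
      finally show ?thesis .
    qed
    then show ?thesis by (simp only:) (intro Delta_counit_left lin_rules)
  qed
  moreover have "sw (\<Delta> h) (\<lambda>x z. sw R (\<lambda>a b. sw (\<Delta> x) (\<lambda>x1 x2. ?\<phi> (a * x1) (b * x2) z))) = drinfeld * h"
  proof -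
    have "sw (\<Delta> h) (\<lambda>x z. sw R (\<lambda>a b. sw (\<Delta> x) (\<lambda>x1 x2. ?\<phi> (a * x1) (b * x2) z))) =
        sw R (\<lambda>a b. sw (\<Delta> h) (\<lambda>x z. sw (\<Delta> x) (\<lambda>x1 x2. ?\<phi> (a * x1) (b * x2) z)))"
      by (rule sw_swap)
    also have "\<dots> = sw R (\<lambda>a b. sw (\<Delta> h) (\<lambda>x1 y. sw (\<Delta> y) (\<lambda>x2 z. ?\<phi> (a * x1) (b * x2) z)))"
      by (intro sw_cong Delta_coassoc[OF vector_space_axioms] trilinI lin_rules)
    also have "\<dots> = sw R (\<lambda>a b. sw (\<Delta> h) (\<lambda>x1 y. sH (\<epsilon> y) (S b * a * x1)))"
    proof (intro sw_cong)
      fix a b x1 y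
      have "sw (\<Delta> y) (\<lambda>x2 z. ?\<phi> (a * x1) (b * x2) z) = sw (\<Delta> y) (\<lambda>x2 z. S (x2 * S z) * (S b * a * x1))"
        by (simp add: antipode_mult mult.assoc)
      also have "\<dots> = S (sw (\<Delta> y) (\<lambda>x2 z. x2 * S z)) * (S b * a * x1)"
        by (rule lin_sw[symmetric, of sH sH "\<lambda>z. S z * (S b * a * x1)"]) (intro lin_rules)
      also have "\<dots> = sH (\<epsilon> y) (S b * a * x1)"
        by (simp add: Delta_antipode_right linD(2)[OF lin_antipode] antipode_one scale_mult_left)
      finally show "sw (\<Delta> y) (\<lambda>x2 z. ?\<phi> (a * x1) (b * x2) z) = sH (\<epsilon> y) (S b * a * x1)" .
    qed
    also have "\<dots> = sw R (\<lambda>a b. S b * a * h)"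
      by (intro sw_cong Delta_counit_right lin_rules)
    also have "\<dots> = drinfeld * h"
      unfolding drinfeld_def by (rule lin_sw[symmetric, of sH sH "\<lambda>z. z * h"]) (intro lin_rules)
    finally show ?thesis .
  qed
  ultimately show ?thesis by simp
qed

text \<open>Moving u = \<open>drinfeld\<close> across b turns the sum into one over S(S(b)) u
  S(S(a)). Invariance of R under S \<otimes> S removes one antipode from each leg, and expanding u
  leaves the product of R and (S \<otimes> id)R, which is 1, read through x \<otimes> y \<mapsto>
  S(y) x.\<close>

lemma drinfeld_right_inverse: "drinfeld * sw R (\<lambda>a b. b * S (S a)) = 1"
proof -
  have "drinfeld * sw R (\<lambda>a b. b * S (S a)) = sw R (\<lambda>a b. (drinfeld * b) * S (S a))"
    using lin_sw[of sH sH "\<lambda>z. drinfeld * z" R "\<lambda>a b. b * S (S a)"] by (simp add: lin_rules mult.assoc)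
  also have "\<dots> = sw R (\<lambda>a b. S (S b) * drinfeld * S (S a))"
    by (simp only: antipode_square_drinfeld)
  also have "\<dots> = sw R (\<lambda>a b. S b * drinfeld * S a)"
    by (rule R_antipode_antipode[of "\<lambda>a b. S b * drinfeld * S a"]) (intro bilinI lin_rules)
  also have "\<dots> = sw R (\<lambda>a b. sw R (\<lambda>c d. S b * (S d * c) * S a))"
    unfolding drinfeld_def
    by (intro sw_cong lin_sw[of sH sH "\<lambda>z. S _ * z * S _"] lin_rules)
  also have "\<dots> = sw R (\<lambda>c d. sw R (\<lambda>a b. S (d * b) * (c * S a)))"
    by (subst sw_swap) (simp add: antipode_mult mult.assoc)
  also have "\<dots> = S 1 * 1"
    by (rule R_antipode_right[of "\<lambda>u v. S v * u"]) (intro bilinI lin_rules)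
  finally show ?thesis by (simp add: antipode_one)
qed

text \<open>The square of the antipode is conjugation by the Drinfeld element.\<close>

lemma antipode_inj: "S g = S h \<Longrightarrow> g = h"
proof -
  assume "S g = S h"
  then have e: "drinfeld * g = drinfeld * h" by (metis antipode_square_drinfeld)
  have v: "sw R (\<lambda>a b. b * S (S a)) * drinfeld = 1"
    by (rule right_inverse_imp_left[OF drinfeld_right_inverse])
  have "g = sw R (\<lambda>a b. b * S (S a)) * (drinfeld * g)" by (simp add: v mult.assoc[symmetric])
  also have "\<dots> = h" unfolding e by (simp add: v mult.assoc[symmetric])
  finally show ?thesis .
qed

lemma antipode_bij: "bij S"
proof -
  obtain Ba where "finite_dimensional_vector_space sH Ba" by (rule fd_basis)
  then interpret fd: finite_dimensional_vector_space sH Ba .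
  have "inj S" using antipode_inj by (auto intro: injI)
  then show ?thesis using fd.linear_inj_imp_surj[OF antipode_linear] by (auto intro: bijI)
qed

end

section \<open>Tensor products and duals of matrix representations\<close>

lemma mlin_vecc: "mlin sU n m f \<Longrightarrow> mlin sU (n * m) 1 (\<lambda>u. vecc (f u))"
  unfolding mlin_def by (auto simp: vecc_smult vecc_add[of _ n m])

lemma kron_scalar: "kron (mat 1 1 (\<lambda>_. c)) A = c \<cdot>\<^sub>m A" "kron A (mat 1 1 (\<lambda>_. c)) = c \<cdot>\<^sub>m A"
  by (auto intro!: eq_matI simp: kron_def)

lemma scalar_mult: "A \<in> carrier_mat 1 m \<Longrightarrow> mat 1 1 (\<lambda>_. c) * A = c \<cdot>\<^sub>m A"
  by (auto intro!: eq_matI simp: scalar_prod_def)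

lemma mult_scalar: "A \<in> carrier_mat m 1 \<Longrightarrow> A * mat 1 1 (\<lambda>_. c) = c \<cdot>\<^sub>m (A :: 'k::field mat)"
  by (auto intro!: eq_matI simp: scalar_prod_def mult.commute)

text \<open>Module maps commute with every algebra element, hence with every tensor
  \<open>t\<close>. For t = K this is the naturality of the module braiding; for t a coproduct or
  coaction it is functoriality of the tensor product.\<close>

lemma intertwiners_tensor:
  assumes X: "X \<in> fdmods sA" "Y \<in> fdmods sA" and M: "M \<in> fdmods sB" "N \<in> fdmods sB"
    and f: "f \<in> intertwiners X Y" and g: "g \<in> intertwiners M N"
  shows "kron f g * tensor_act t X M = tensor_act t Y N * kron f g"
    "kron f g \<in> intertwiners (tensor_rep D X M) (tensor_rep D Y N)"
proof -
  note fc = intertwinersD(1)[OF f] and gc = intertwinersD(1)[OF g]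
  note c = fdmodsD(1)[OF X(1)] fdmodsD(1)[OF X(2)] fdmodsD(1)[OF M(1)] fdmodsD(1)[OF M(2)]
  show 1: "kron f g * tensor_act t X M = tensor_act t Y N * kron f g" for t
    unfolding tensor_act_msum
    by (simp add: msum_mult_left[OF kron_carrier[OF fc gc] kron_carrier[OF c(1) c(3)]]
        msum_mult_right[OF kron_carrier[OF fc gc] kron_carrier[OF c(2) c(4)]]
        kron_mult[OF fc gc c(1) c(3)] kron_mult[OF c(2) c(4) fc gc] intertwinersD(2)[OF f] intertwinersD(2)[OF g])
  show "kron f g \<in> intertwiners (tensor_rep D X M) (tensor_rep D Y N)"
    by (rule intertwinersI) (simp_all add: snd_tensor_rep 1 kron_carrier[OF fc gc])
qed

lemma one_intertwiners: "X \<in> fdmods sA \<Longrightarrow> 1\<^sub>m (fst X) \<in> intertwiners X X"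
  by (rule intertwinersI) (auto simp: left_mult_one_mat[OF fdmodsD(1)] right_mult_one_mat[OF fdmodsD(1)])

lemma intertwiners_comp:
  assumes X: "X \<in> fdmods sA" "Y \<in> fdmods sA" "Z \<in> fdmods sA"
    and f: "f \<in> intertwiners X Y" and g: "g \<in> intertwiners Y Z"
  shows "g * f \<in> intertwiners X Z"
proof (rule intertwinersI)
  fix a
  note c = fdmodsD(1)[OF X(1), of a] fdmodsD(1)[OF X(2), of a] fdmodsD(1)[OF X(3), of a]
  note fc = intertwinersD(1)[OF f] and gc = intertwinersD(1)[OF g]
  show "g * f * snd X a = snd Z a * (g * f)"
    by (simp add: assoc_mult_mat[OF gc fc c(1)] intertwinersD(2)[OF f] assoc_mult_mat[OF gc c(2) fc, symmetric]
        intertwinersD(2)[OF g] assoc_mult_mat[OF c(3) gc fc])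
qed (rule mult_carrier_mat[OF intertwinersD(1)[OF g] intertwinersD(1)[OF f]])

lemma inverse_intertwiner:
  assumes X: "X \<in> fdmods sA" "Y \<in> fdmods sA" and f: "f \<in> intertwiners X Y"
    and g: "g \<in> carrier_mat (fst X) (fst Y)" "g * f = 1\<^sub>m (fst X)" "f * g = 1\<^sub>m (fst Y)"
  shows "g \<in> intertwiners Y X"
proof (rule intertwinersI)
  fix a
  note c = fdmodsD(1)[OF X(1), of a] fdmodsD(1)[OF X(2), of a]
  note fc = intertwinersD(1)[OF f]
  have "g * snd Y a = g * snd Y a * (f * g)" using g(3) right_mult_one_mat[OF mult_carrier_mat[OF g(1) c(2)]] by simp
  also have "\<dots> = g * (snd Y a * f) * g"
    by (simp add: assoc_mult_mat[OF g(1) c(2) fc, symmetric] assoc_mult_mat[OF mult_carrier_mat[OF g(1) c(2)] fc g(1)])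
  also have "\<dots> = (g * f) * (snd X a * g)"
    by (simp add: intertwinersD(2)[OF f, symmetric] assoc_mult_mat[OF g(1) fc c(1), symmetric]
        assoc_mult_mat[OF mult_carrier_mat[OF g(1) fc] c(1) g(1)])
  also have "\<dots> = snd X a * g" using g(2) left_mult_one_mat[OF mult_carrier_mat[OF c(1) g(1)]] by simp
  finally show "g * snd Y a = snd X a * g" .
qed (rule g)

text \<open>A bijection on vectors has an inverse matrix, and the inverse of a module map is a
  module map. This leads from bijections of elements to isomorphisms in the category.\<close>

lemma is_iso_intertwiner:
  assumes X: "X \<in> fdmods sA" "Y \<in> fdmods sA" and f: "f \<in> intertwiners X Y"
    and bij: "bij_betw (\<lambda>v. f * v) (carrier_mat (fst X) 1) (carrier_mat (fst Y) 1)"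
  obtains g where "g \<in> intertwiners Y X" "g * f = 1\<^sub>m (fst X)" "f * g = 1\<^sub>m (fst Y)"
  using bij_to_inverse_mat[OF intertwinersD(1)[OF f] bij] inverse_intertwiner[OF X f] by metis

context fd_comodule_algebra begin

lemma tensor_rep_fdmods:
  assumes X: "X \<in> fdmods sH" and M: "M \<in> fdmods sB"
  shows "tensor_rep \<delta> X M \<in> fdmods sB"
  unfolding tensor_rep_def tensor_act_msum
proof (rule fdmodsI)
  note b = mbilin_kron_rep[OF X M]
  note c = fdmodsD(1)[OF X] fdmodsD(1)[OF M]
  note k = kron_carrier[OF c]
  show "mlin sB (fst X * fst M) (fst X * fst M) (\<lambda>a. msum (fst X * fst M) (fst X * fst M) (\<delta> a) (\<lambda>a b. kron (snd X a) (snd M b)))"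
    by (rule mlin_delta[OF b])
  show "msum (fst X * fst M) (fst X * fst M) (\<delta> 1) (\<lambda>a b. kron (snd X a) (snd M b)) = 1\<^sub>m (fst X * fst M)"
    by (simp add: mdelta_one[OF b] fdmodsD(2)[OF X] fdmodsD(2)[OF M])
  fix a b
  show "msum (fst X * fst M) (fst X * fst M) (\<delta> (a * b)) (\<lambda>a b. kron (snd X a) (snd M b)) =
       msum (fst X * fst M) (fst X * fst M) (\<delta> a) (\<lambda>a b. kron (snd X a) (snd M b)) *
       msum (fst X * fst M) (fst X * fst M) (\<delta> b) (\<lambda>a b. kron (snd X a) (snd M b))"
    by (simp add: mdelta_mult[OF b] msum_mult_msum[OF k k] fdmodsD(3)[OF X] fdmodsD(3)[OF M] kron_mult[OF c c])
qed

lemma tensor_rep_unit: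
  assumes M: "M \<in> fdmods sB"
  shows "tensor_rep \<delta> (1, \<lambda>h. mat 1 1 (\<lambda>_. \<epsilon> h)) M = M"
proof -
  have "msum (fst M) (fst M) (\<delta> b) (\<lambda>x y. kron (mat 1 1 (\<lambda>_. \<epsilon> x)) (snd M y)) = snd M b" for b
    unfolding kron_scalar by (rule mdelta_counit[OF fdmodsD(6)[OF M]])
  then show ?thesis by (simp add: tensor_rep_def tensor_act_msum)
qed

text \<open>An equality rather than an isomorphism: the Kronecker product is strictly associative,
  so coassociativity identifies the two actions matrix by matrix.\<close>

lemma tensor_rep_assoc:
  assumes X: "X \<in> fdmods sH" and Y: "Y \<in> fdmods sH" and M: "M \<in> fdmods sB"
  shows "tensor_rep \<delta> (tensor_rep \<Delta> X Y) M = tensor_rep \<delta> X (tensor_rep \<delta> Y M)"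
proof -
  note c = fdmodsD(1)[OF X] fdmodsD(1)[OF Y] fdmodsD(1)[OF M]
  let ?n = "fst X * (fst Y * fst M)"
  have "tensor_act (\<delta> b) (tensor_rep \<Delta> X Y) M = tensor_act (\<delta> b) X (tensor_rep \<delta> Y M)" for b
  proof -
    have "tensor_act (\<delta> b) (tensor_rep \<Delta> X Y) M =
       msum ?n ?n (\<delta> b) (\<lambda>x y. msum ?n ?n (\<Delta> x) (\<lambda>u v. kron (snd X u) (kron (snd Y v) (snd M y))))"
      unfolding tensor_act_msum[of "\<delta> b"] fst_tensor_rep snd_tensor_rep
      by (simp add: tensor_act_msum kron_msum_left[OF c(3) kron_carrier[OF c(1,2)]] kron_assoc mult.assoc)
    also have "\<dots> = msum ?n ?n (\<delta> b) (\<lambda>x y. msum ?n ?n (\<delta> y) (\<lambda>u v. kron (snd X x) (kron (snd Y u) (snd M v))))"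
      by (intro mdelta_coassoc mlin_kron_left mlin_kron_right kron_carrier c mlin_rep[OF X] mlin_rep[OF Y] mlin_rep[OF M] lin_id)
    also have "\<dots> = tensor_act (\<delta> b) X (tensor_rep \<delta> Y M)"
      unfolding tensor_act_msum[of "\<delta> b" X] fst_tensor_rep snd_tensor_rep
      by (simp add: tensor_act_msum kron_msum_right[OF c(1) kron_carrier[OF c(2,3)]])
    finally show ?thesis .
  qed
  then show ?thesis by (simp add: tensor_rep_def[of \<delta>] mult.assoc)
qed

end

context fd_hopf_algebra begin

abbreviation (input) "unit_rep \<equiv> (1 :: nat, \<lambda>h. mat 1 1 (\<lambda>_. \<epsilon> h))"
abbreviation (input) "dual_rep X \<equiv> (fst X :: nat, \<lambda>h. transpose_mat (snd X (S h)))"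

lemmas tensor_rep_fdmodsH = fd_comodule_algebra.tensor_rep_fdmods[OF self_comodule]
lemmas tensor_rep_unitH = fd_comodule_algebra.tensor_rep_unit[OF self_comodule]
lemmas tensor_rep_assocH = fd_comodule_algebra.tensor_rep_assoc[OF self_comodule]

lemma tensor_rep_unit_right:
  assumes M: "M \<in> fdmods sH"
  shows "tensor_rep \<Delta> M unit_rep = M"
proof -
  have "msum (fst M) (fst M) (\<Delta> b) (\<lambda>x y. kron (snd M x) (mat 1 1 (\<lambda>_. \<epsilon> y))) = snd M b" for b
    unfolding kron_scalar by (rule mDelta_counit_right[OF fdmodsD(6)[OF M]])
  then show ?thesis by (simp add: tensor_rep_def tensor_act_msum)
qed

lemma unit_rep_fdmods: "unit_rep \<in> fdmods sH"
  by (rule fdmodsI)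
    (auto intro!: mlinI eq_matI simp: counit_one counit_mult linD[OF lin_counit] scalar_prod_def)

lemma dual_rep_fdmods:
  assumes X: "X \<in> fdmods sH" shows "dual_rep X \<in> fdmods sH"
proof (rule fdmodsI)
  show "mlin sH (fst X) (fst X) (\<lambda>h. transpose_mat (snd X (S h)))"
    by (intro mlin_transpose mlin_rep[OF X] lin_rules)
  fix a b show "transpose_mat (snd X (S (a * b))) = transpose_mat (snd X (S a)) * transpose_mat (snd X (S b))"
    by (simp add: antipode_mult fdmodsD(3)[OF X] transpose_mult[OF fdmodsD(1)[OF X] fdmodsD(1)[OF X]])
qed (simp add: antipode_one fdmodsD(2)[OF X])

lemma unit_intertwiners:
  "f \<in> carrier_mat (fst X) 1 \<Longrightarrow> (\<And>h. snd X h * f = \<epsilon> h \<cdot>\<^sub>m f) \<Longrightarrow> f \<in> intertwiners unit_rep X"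
  by (rule intertwinersI) (auto simp: mult_scalar[simplified])

text \<open>Flattened, the coevaluation is the identity matrix, on which h acts as the sum of h1
  S(h2), that is, by \<epsilon>(h).\<close>

lemma coevm_intertwiner:
  assumes X: "X \<in> fdmods sH"
  shows "coevm (fst X) \<in> intertwiners unit_rep (tensor_rep \<Delta> X (dual_rep X))"
proof (rule unit_intertwiners)
  fix h
  let ?n = "fst X"
  note c = fdmodsD(1)[OF X]
  have l: "mlin sH (?n * ?n) 1 (\<lambda>z. vecc (snd X z))" by (intro mlin_vecc mlin_rep[OF X] lin_id)
  have "snd (tensor_rep \<Delta> X (dual_rep X)) h * coevm ?n =
     msum (?n * ?n) 1 (\<Delta> h) (\<lambda>x y. vecc (snd X (x * S y)))"
    unfolding snd_tensor_rep tensor_act_msum fst_conv snd_conv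
    using c by (subst msum_mult_right[of _ _ 1])
      (simp_all add: coevm_eq_vecc vecc_mult[OF c one_carrier_mat c] fdmodsD(3)[OF X] right_mult_one_mat[OF c])
  also have "\<dots> = vecc (snd X (sw (\<Delta> h) (\<lambda>x y. x * S y)))" by (rule msum_lin[OF l, symmetric])
  also have "\<dots> = \<epsilon> h \<cdot>\<^sub>m coevm ?n"
    by (simp add: Delta_antipode_right mlinD(3)[OF l] fdmodsD(2)[OF X] coevm_eq_vecc)
  finally show "snd (tensor_rep \<Delta> X (dual_rep X)) h * coevm ?n = \<epsilon> h \<cdot>\<^sub>m coevm ?n" .
qed simp

lemma evm_kron:
  assumes A: "A \<in> carrier_mat n n" and B: "B \<in> carrier_mat n n"
  shows "evm n * kron (transpose_mat A) B = transpose_mat (vecc (A * B))"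
proof -
  have k: "kron A (transpose_mat B) \<in> carrier_mat (n * n) (n * n)" using A B by auto
  have "evm n * kron (transpose_mat A) B = transpose_mat (kron A (transpose_mat B) * coevm n)"
    by (simp add: transpose_mult[OF k coevm_carrier(1)] evm_transpose kron_transpose)
  also have "kron A (transpose_mat B) * coevm n = vecc (A * B)"
    using A B by (simp add: coevm_eq_vecc vecc_mult[OF A one_carrier_mat B])
  finally show ?thesis .
qed

lemma evm_intertwiner:
  assumes X: "X \<in> fdmods sH"
  shows "evm (fst X) \<in> intertwiners (tensor_rep \<Delta> (dual_rep X) X) unit_rep"
proof (rule intertwinersI)
  fix h
  let ?n = "fst X"
  note c = fdmodsD(1)[OF X]
  have l: "mlin sH 1 (?n * ?n) (\<lambda>z. transpose_mat (vecc (snd X z)))"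
    by (intro mlin_transpose mlin_vecc mlin_rep[OF X] lin_id)
  have "evm ?n * snd (tensor_rep \<Delta> (dual_rep X) X) h =
     msum 1 (?n * ?n) (\<Delta> h) (\<lambda>x y. transpose_mat (vecc (snd X (S x * y))))"
    unfolding snd_tensor_rep tensor_act_msum fst_conv snd_conv
    using c by (subst msum_mult_left[of _ 1])
      (simp_all add: evm_kron fdmodsD(3)[OF X])
  also have "\<dots> = transpose_mat (vecc (snd X (sw (\<Delta> h) (\<lambda>x y. S x * y))))" by (rule msum_lin[OF l, symmetric])
  also have "\<dots> = \<epsilon> h \<cdot>\<^sub>m evm ?n"
    by (simp add: Delta_antipode_left mlinD(3)[OF l] fdmodsD(2)[OF X] coevm_eq_vecc evm_transpose)
  also have "\<dots> = snd unit_rep h * evm ?n" by (simp only: snd_conv scalar_mult[OF evm_carrier(1)])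
  finally show "evm ?n * snd (tensor_rep \<Delta> (dual_rep X) X) h = snd unit_rep h * evm ?n" .
qed simp

end

section \<open>The module categories and their strict constraints\<close>

lemma H_FdMod_simps [simp]:
  "Obj (H_FdMod sH \<Delta> \<epsilon> S) = fdmods sH" "Hom (H_FdMod sH \<Delta> \<epsilon> S) = intertwiners"
  "Cmp (H_FdMod sH \<Delta> \<epsilon> S) = (*)" "Idn (H_FdMod sH \<Delta> \<epsilon> S) X = 1\<^sub>m (fst X)"
  "Add (H_FdMod sH \<Delta> \<epsilon> S) = (+)" "Scl (H_FdMod sH \<Delta> \<epsilon> S) = (\<cdot>\<^sub>m)"
  "TenO (H_FdMod sH \<Delta> \<epsilon> S) = tensor_rep \<Delta>" "TenM (H_FdMod sH \<Delta> \<epsilon> S) = kron"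
  "Unt (H_FdMod sH \<Delta> \<epsilon> S) = (1, \<lambda>h. mat 1 1 (\<lambda>_. \<epsilon> h))"
  "Dual (H_FdMod sH \<Delta> \<epsilon> S) X = (fst X, \<lambda>h. transpose_mat (snd X (S h)))"
  "Ev (H_FdMod sH \<Delta> \<epsilon> S) X = evm (fst X)" "Coev (H_FdMod sH \<Delta> \<epsilon> S) X = coevm (fst X)"
  unfolding H_FdMod_def evm_def coevm_def by simp_all

lemma B_FdMod_simps [simp]:
  "Obj (B_FdMod sB \<delta>) = fdmods sB" "Hom (B_FdMod sB \<delta>) = intertwiners"
  "Cmp (B_FdMod sB \<delta>) = (*)" "Idn (B_FdMod sB \<delta>) M = 1\<^sub>m (fst M)"
  "Add (B_FdMod sB \<delta>) = (+)" "Scl (B_FdMod sB \<delta>) = (\<cdot>\<^sub>m)"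
  "ActO (B_FdMod sB \<delta>) = tensor_rep \<delta>" "ActM (B_FdMod sB \<delta>) = kron"
  "Asc (B_FdMod sB \<delta>) X Y M = 1\<^sub>m (fst X * fst Y * fst M)" "Uni (B_FdMod sB \<delta>) M = 1\<^sub>m (fst M)"
  unfolding B_FdMod_def by simp_all

lemma intertwiners_add:
  assumes "X \<in> fdmods sA" "Y \<in> fdmods sA" "f \<in> intertwiners X Y" "g \<in> intertwiners X Y"
  shows "f + g \<in> intertwiners X Y"
proof (rule intertwinersI)
  note fc = intertwinersD(1)[OF assms(3)] and gc = intertwinersD(1)[OF assms(4)]
  show "f + g \<in> carrier_mat (fst Y) (fst X)" using fc gc by simp
  fix a show "(f + g) * snd X a = snd Y a * (f + g)"
    by (simp add: add_mult_distrib_mat[OF fc gc fdmodsD(1)[OF assms(1)]]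
        mult_add_distrib_mat[OF fdmodsD(1)[OF assms(2)] fc gc] intertwinersD(2)[OF assms(3)] intertwinersD(2)[OF assms(4)])
qed

lemma intertwiners_smult:
  assumes "X \<in> fdmods sA" "Y \<in> fdmods sA" "f \<in> intertwiners X Y"
  shows "c \<cdot>\<^sub>m f \<in> intertwiners X Y"
proof (rule intertwinersI)
  note fc = intertwinersD(1)[OF assms(3)]
  show "c \<cdot>\<^sub>m f \<in> carrier_mat (fst Y) (fst X)" using fc by simp
  fix a show "(c \<cdot>\<^sub>m f) * snd X a = snd Y a * (c \<cdot>\<^sub>m f)"
    by (simp add: mult_smult_assoc_mat[OF fc fdmodsD(1)[OF assms(1)]]
        mult_smult_distrib[OF fdmodsD(1)[OF assms(2)] fc] intertwinersD(2)[OF assms(3)])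
qed

lemma intertwiners_zero:
  assumes "X \<in> fdmods sA" "Y \<in> fdmods sA"
  shows "0\<^sub>m (fst Y) (fst X) \<in> intertwiners X Y"
  by (rule intertwinersI)
    (simp_all add: left_mult_zero_mat[OF fdmodsD(1)[OF assms(1)]] right_mult_zero_mat[OF fdmodsD(1)[OF assms(2)]])

lemma linear_category_B_FdMod: "linear_category (B_FdMod sB \<delta>)"
  unfolding linear_category_def B_FdMod_simps
proof (intro conjI ballI)
  fix X Y assume X: "X \<in> fdmods sB" and Y: "Y \<in> fdmods sB"
  have c: "f \<in> carrier_mat (fst Y) (fst X)" if "f \<in> intertwiners X Y" for f using intertwinersD(1)[OF that] .
  show "\<exists>z\<in>intertwiners X Y. \<forall>f\<in>intertwiners X Y. z + f = f \<and> (\<exists>g\<in>intertwiners X Y. f + g = z)"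
  proof (rule bexI[of _ "0\<^sub>m (fst Y) (fst X)"], intro ballI conjI)
    fix f assume f: "f \<in> intertwiners X Y"
    show "0\<^sub>m (fst Y) (fst X) + f = f" using c[OF f] by simp
    show "\<exists>g\<in>intertwiners X Y. f + g = 0\<^sub>m (fst Y) (fst X)"
      by (rule bexI[of _ "(- 1) \<cdot>\<^sub>m f"]) (use c[OF f] intertwiners_smult[OF X Y f] in \<open>auto intro!: eq_matI\<close>)
  qed (rule intertwiners_zero[OF X Y])
  show "\<forall>c. \<forall>f\<in>intertwiners X Y. c \<cdot>\<^sub>m f \<in> intertwiners X Y" using intertwiners_smult[OF X Y] by blast
  show "\<forall>c d. \<forall>f\<in>intertwiners X Y. (c * d) \<cdot>\<^sub>m f = c \<cdot>\<^sub>m (d \<cdot>\<^sub>m f) \<and> (c + d) \<cdot>\<^sub>m f = c \<cdot>\<^sub>m f + d \<cdot>\<^sub>m f"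
    by (auto intro!: eq_matI simp: algebra_simps)
  show "\<forall>c. \<forall>f\<in>intertwiners X Y. \<forall>g\<in>intertwiners X Y. c \<cdot>\<^sub>m (f + g) = c \<cdot>\<^sub>m f + c \<cdot>\<^sub>m g"
    using add_smult_distrib_left_mat[OF c c] by blast
next
  fix X Y f g assume "X \<in> fdmods sB" "Y \<in> fdmods sB" "f \<in> intertwiners X Y" "g \<in> intertwiners X Y"
  then show "f + g \<in> intertwiners X Y" by (rule intertwiners_add)
next
  fix X Y f g assume "f \<in> intertwiners X Y" "g \<in> intertwiners X Y"
  then show "f + g = g + f" using comm_add_mat[OF intertwinersD(1) intertwinersD(1)] by blast
next
  fix X Y f g h assume "f \<in> intertwiners X Y" "g \<in> intertwiners X Y" "h \<in> intertwiners X Y"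
  then show "f + g + h = f + (g + h)" using assoc_add_mat[OF intertwinersD(1) intertwinersD(1) intertwinersD(1)] by blast
next
  fix X Y f assume "f \<in> intertwiners X Y"
  then show "1 \<cdot>\<^sub>m f = f" by (auto intro!: eq_matI)
next
  fix X Y f assume "f \<in> intertwiners X Y"
  then show "f * 1\<^sub>m (fst X) = f" "1\<^sub>m (fst Y) * f = f" by (auto dest: intertwinersD(1))
next
  fix W X Y Z f g h assume "f \<in> intertwiners W X" "g \<in> intertwiners X Y" "h \<in> intertwiners Y Z"
  then show "h * g * f = h * (g * f)" by (auto dest!: intertwinersD(1))
next
  fix X Y Z f f' g g' assume "f \<in> intertwiners X Y" "f' \<in> intertwiners X Y" "g \<in> intertwiners Y Z" "g' \<in> intertwiners Y Z"
  note c = this[THEN intertwinersD(1)]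
  show "g * (f + f') = g * f + g * f'" by (rule mult_add_distrib_mat[OF c(3) c(1,2)])
  show "(g + g') * f = g * f + g' * f" by (rule add_mult_distrib_mat[OF c(3,4,1)])
  show "\<forall>c. g * (c \<cdot>\<^sub>m f) = c \<cdot>\<^sub>m (g * f) \<and> c \<cdot>\<^sub>m g * f = c \<cdot>\<^sub>m (g * f)"
    using mult_smult_distrib[OF c(3,1)] mult_smult_assoc_mat[OF c(3,1)] by simp
qed (auto intro: one_intertwiners intertwiners_comp)

lemma is_iso_one:
  assumes "X \<in> fdmods sB" shows "is_iso (B_FdMod sB \<delta>) X X (1\<^sub>m (fst X))"
  unfolding is_iso_def inverse_of_def
  by (rule exI[of _ "1\<^sub>m (fst X)"]) (simp add: one_intertwiners[OF assms])

text \<open>All constraints are identity matrices, so naturality and coherence reduce to strict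
  associativity of \<open>kron\<close> and identities of dimensions; that these matrices connect the
  right objects is \<open>tensor_rep_assoc\<close> and \<open>tensor_rep_unit\<close>.\<close>

lemma (in fd_comodule_algebra) module_category_B_FdMod:
  "module_category (H_FdMod sH \<Delta> \<epsilon> S) (B_FdMod sB \<delta>)"
proof -
  note aH = H.tensor_rep_fdmodsH and aB = tensor_rep_fdmods
  note iso = is_iso_one[where \<delta> = \<delta>]
  have d: "dim_row f = fst Y" "dim_col f = fst X" if "f \<in> intertwiners X Y"
    for f :: "'k mat" and X Y :: "('k, 'c) rep" using intertwinersD(1)[OF that] by auto
  have sq: "A * 1\<^sub>m (dim_col A) = A" "1\<^sub>m (dim_row A) * A = A" for A :: "'k mat"
    by (auto intro: right_mult_one_mat left_mult_one_mat)
  show ?thesis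
    unfolding module_category_def H_FdMod_simps B_FdMod_simps
  proof (intro conjI ballI linear_category_B_FdMod)
    fix X Y Z :: "('k, 'h) rep" and M N P :: "('k, 'b) rep" and f f' g g'
    assume "f \<in> intertwiners X Y" "f' \<in> intertwiners Y Z" "g \<in> intertwiners M N" "g' \<in> intertwiners N P"
    note c = this[THEN intertwinersD(1)]
    show "kron (f' * f) (g' * g) = kron f' g' * kron f g"
      by (rule kron_mult[OF c(2,4,1,3), symmetric])
  next
    fix X Y :: "('k, 'h) rep" and M N :: "('k, 'b) rep" and f f' g g'
    assume "f \<in> intertwiners X Y" "f' \<in> intertwiners X Y" "g \<in> intertwiners M N" "g' \<in> intertwiners M N"
    note c = this[THEN intertwinersD(1)]
    show "kron (f + f') g = kron f g + kron f' g" by (rule kron_add_left[OF c(1,2)])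
    show "kron f (g + g') = kron f g + kron f g'" by (rule kron_add_right[OF c(3,4)])
    show "\<forall>c. kron (c \<cdot>\<^sub>m f) g = c \<cdot>\<^sub>m kron f g \<and> kron f (c \<cdot>\<^sub>m g) = c \<cdot>\<^sub>m kron f g"
      by (simp add: kron_smult_left kron_smult_right)
  next
    fix X Y M assume "X \<in> fdmods sH" "Y \<in> fdmods sH" "M \<in> fdmods sB"
    then show "is_iso (B_FdMod sB \<delta>) (tensor_rep \<delta> (tensor_rep \<Delta> X Y) M) (tensor_rep \<delta> X (tensor_rep \<delta> Y M)) (1\<^sub>m (fst X * fst Y * fst M))"
      using iso[OF aB[OF aH aB]] iso[of "tensor_rep \<delta> (tensor_rep \<Delta> X Y) M"]
      by (simp add: tensor_rep_assoc[symmetric] aB aH)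
  next
    fix M assume "M \<in> fdmods sB"
    then show "is_iso (B_FdMod sB \<delta>) (tensor_rep \<delta> (1, \<lambda>h. mat 1 1 (\<lambda>_. \<epsilon> h)) M) M (1\<^sub>m (fst M))"
      by (simp only: tensor_rep_unit iso)
  next
    fix X X' Y Y' :: "('k, 'h) rep" and M M' :: "('k, 'b) rep" and f g h
    assume a: "f \<in> intertwiners X X'" "g \<in> intertwiners Y Y'" "h \<in> intertwiners M M'"
    have "dim_row (kron f (kron g h)) = fst X' * fst Y' * fst M'" "dim_col (kron f (kron g h)) = fst X * fst Y * fst M"
      using a[THEN intertwinersD(1)] by auto
    then show "1\<^sub>m (fst X' * fst Y' * fst M') * kron (kron f g) h = kron f (kron g h) * 1\<^sub>m (fst X * fst Y * fst M)"
      using sq[of "kron f (kron g h)"] by (simp add: kron_assoc)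
  qed (auto simp: tensor_rep_fdmods mult.assoc intertwiners_tensor dest!: intertwinersD(1))
qed

lemma flip_flip: "flip_mat n m * flip_mat m n = 1\<^sub>m (m * n)"
proof (rule mat_eq_kron_cols[of _ "m * n" m n])
  fix u v :: "'a mat" assume u: "u \<in> carrier_mat m 1" and v: "v \<in> carrier_mat n 1"
  show "flip_mat n m * flip_mat m n * kron u v = 1\<^sub>m (m * n) * kron u v"
    using kron_carrier[OF u v]
    by (simp add: assoc_mult_mat[OF flip_carrier flip_carrier kron_carrier[OF u v]] flip_kron[OF u v] flip_kron[OF v u]
        left_mult_one_mat[OF kron_carrier[OF u v]])
qed (simp_all add: mult_carrier_mat[OF flip_carrier flip_carrier])

lemma tensor_inverse_sw:
  assumes i: "tensor_inverse sU sV t t'" and "vector_space sU" "vector_space sV" "vector_space sW" "bilin sU sV sW \<beta>"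
  shows "sw t (\<lambda>a b. sw t' (\<lambda>c d. \<beta> (a * c) (b * d))) = \<beta> 1 1"
    "sw t' (\<lambda>a b. sw t (\<lambda>c d. \<beta> (a * c) (b * d))) = \<beta> 1 1"
proof -
  have e: "tensor2 sU sV (sweedler t *\<^sub>2 sweedler t') = tensor2 sU sV [(1, 1)]"
    "tensor2 sU sV (sweedler t' *\<^sub>2 sweedler t) = tensor2 sU sV [(1, 1)]"
    using i unfolding tensor_inverse_def by blast+
  show "sw t (\<lambda>a b. sw t' (\<lambda>c d. \<beta> (a * c) (b * d))) = \<beta> 1 1"
    using tensor2_eqD[OF assms(2-4) e(1) assms(5)] by (simp add: sum_mul2)
  show "sw t' (\<lambda>a b. sw t (\<lambda>c d. \<beta> (a * c) (b * d))) = \<beta> 1 1"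
    using tensor2_eqD[OF assms(2-4) e(2) assms(5)] by (simp add: sum_mul2)
qed

lemma tensor_act_inverse:
  assumes i: "tensor_inverse sU sV t t'" and v: "vector_space sU" "vector_space sV"
    and X: "X \<in> fdmods sU" and Y: "Y \<in> fdmods sV"
  shows "tensor_act t X Y * tensor_act t' X Y = 1\<^sub>m (fst X * fst Y)"
    "tensor_act t' X Y * tensor_act t X Y = 1\<^sub>m (fst X * fst Y)"
proof -
  note c = fdmodsD(1)[OF X] fdmodsD(1)[OF Y]
  note b = mbilin_kron_rep[OF X Y]
  have k: "kron (snd X a) (snd Y b) * kron (snd X a') (snd Y b') = kron (snd X (a * a')) (snd Y (b * b'))" for a b a' b'
    by (simp add: kron_mult[OF c c] fdmodsD(3)[OF X] fdmodsD(3)[OF Y])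
  have o: "kron (snd X 1) (snd Y 1) = 1\<^sub>m (fst X * fst Y)" by (simp add: fdmodsD(2)[OF X] fdmodsD(2)[OF Y])
  note s = tensor_inverse_sw[OF i v vector_space_field mbilin_entry[OF b]]
  show "tensor_act t X Y * tensor_act t' X Y = 1\<^sub>m (fst X * fst Y)"
    unfolding tensor_act_msum msum_mult_msum[OF kron_carrier[OF c] kron_carrier[OF c]] k
    by (rule msum_eqI) (simp_all add: msum_index s(1) o)
  show "tensor_act t' X Y * tensor_act t X Y = 1\<^sub>m (fst X * fst Y)"
    unfolding tensor_act_msum msum_mult_msum[OF kron_carrier[OF c] kron_carrier[OF c]] k
    by (rule msum_eqI) (simp_all add: msum_index s(2) o)
qed

lemma mtensor3_entries:
  assumes "\<And>v w. mlin sU n m (\<lambda>u. F u v w)" "\<And>u w. mlin sV n m (\<lambda>v. F u v w)" "\<And>u v. mlin sX n m (F u v)"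
    and "i < n" "j < m"
  shows "trilin sU sV sX (*) (\<lambda>u v w. F u v w $$ (i, j))"
  by (intro trilinI mlin_entry[OF _ assms(4,5)] assms)

section \<open>The K-matrix axioms and the braided module category\<close>

context fd_quasitriangular_comodule_algebra begin

lemma K_comul_sw:
  assumes R': "tensor_inverse sH sH R R'" and "vector_space sW" "trilin sH sH sB sW \<tau>"
  shows "sw K (\<lambda>a b. sw (\<Delta> a) (\<lambda>u v. \<tau> u v b)) =
     sw K (\<lambda>k k'. sw R (\<lambda>r r'. sw K (\<lambda>l l'. sw R' (\<lambda>s s'. \<tau> (r' * l * s') (k * r * s) (k' * l')))))"
  using tensor3_eqD[OF vsH vsH vsB assms(2) K_comul[OF R'] assms(3)]
  by (simp only: sum_legs sw_def mult_1_left mult_1_right)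

lemma K_coact_right_sw:
  assumes "vector_space sW" "trilin sH sH sB sW \<tau>"
  shows "sw K (\<lambda>a b. sw (\<delta> b) (\<lambda>u v. \<tau> a u v)) =
     sw R (\<lambda>r r'. sw K (\<lambda>k k'. sw R (\<lambda>s s'. \<tau> (r' * k * s) (r * s') k')))"
  using tensor3_eqD[OF vsH vsH vsB assms(1) K_coact_right assms(2)]
  by (simp only: sum_legs sw_def mult_1_left mult_1_right)

lemma K_coact_sw:
  assumes "vector_space sW" "bilin sH sB sW \<beta>"
  shows "sw K (\<lambda>k k'. sw (\<delta> b) (\<lambda>x y. \<beta> (k * x) (k' * y))) = sw (\<delta> b) (\<lambda>x y. sw K (\<lambda>k k'. \<beta> (x * k) (y * k')))"
  using tensor2_eqD[OF vsH vsB assms(1) K_coact[of b] assms(2)]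
  by (simp only: sum_mul2)

lemma tensor_act_K_intertwiner:
  assumes X: "X \<in> fdmods sH" and M: "M \<in> fdmods sB"
  shows "tensor_act K X M \<in> intertwiners (tensor_rep \<delta> X M) (tensor_rep \<delta> X M)"
proof (rule intertwinersI)
  fix b
  note c = fdmodsD(1)[OF X] fdmodsD(1)[OF M]
  have k: "kron (snd X a) (snd M b) * kron (snd X a') (snd M b') = kron (snd X (a * a')) (snd M (b * b'))" for a b a' b'
    by (simp add: kron_mult[OF c c] fdmodsD(3)[OF X] fdmodsD(3)[OF M])
  show "tensor_act K X M * snd (tensor_rep \<delta> X M) b = snd (tensor_rep \<delta> X M) b * tensor_act K X M"
    unfolding snd_tensor_rep tensor_act_msum msum_mult_msum[OF kron_carrier[OF c] kron_carrier[OF c]] k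
    by (rule msum_eqI) (simp_all add: msum_index K_coact_sw[OF vector_space_field mbilin_entry[OF mbilin_kron_rep[OF X M]]])
qed simp

lemma K_act_iso:
  assumes X: "X \<in> fdmods sH" and M: "M \<in> fdmods sB"
  shows "is_iso (B_FdMod sB \<delta>) (tensor_rep \<delta> X M) (tensor_rep \<delta> X M) (tensor_act K X M)"
proof -
  obtain K' where K': "tensor_inverse sH sB K K'" using K_invertible by blast
  note i = tensor_act_inverse[OF K' vsH vsB X M]
  have "tensor_act K' X M \<in> intertwiners (tensor_rep \<delta> X M) (tensor_rep \<delta> X M)"
    by (rule inverse_intertwiner[of _ sB, OF _ _ tensor_act_K_intertwiner[OF X M]])
      (simp_all add: i tensor_rep_fdmods X M)
  then show ?thesis unfolding is_iso_def inverse_of_def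
    by (intro exI[of _ "tensor_act K' X M"]) (simp add: tensor_act_K_intertwiner X M i)
qed

context
  fixes X Y M
  assumes X: "X \<in> fdmods sH" and Y: "Y \<in> fdmods sH" and M: "M \<in> fdmods sB"
begin

text \<open>The endomorphisms \<open>R\<^sub>2\<^sub>1\<close>, \<open>R\<^sub>1\<^sub>2\<close>, \<open>K\<^sub>2\<^sub>3\<close> and \<open>K\<^sub>1\<^sub>3\<close> of \<open>X \<otimes> Y \<otimes> M\<close>.\<close>

private abbreviation (input) "xy \<equiv> fst X * fst Y"
private abbreviation (input) "nn \<equiv> fst X * fst Y * fst M"
private definition "op21 t = kron (msum xy xy t (\<lambda>a b. kron (snd X b) (snd Y a))) (1\<^sub>m (fst M))"
private definition "op12 t = kron (tensor_act t X Y) (1\<^sub>m (fst M))"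
private definition "op23 = kron (1\<^sub>m (fst X)) (tensor_act K Y M)"
private definition "op13 = msum nn nn K (\<lambda>a b. kron (kron (snd X a) (1\<^sub>m (fst Y))) (snd M b))"

private lemmas c = fdmodsD(1)[OF X] fdmodsD(1)[OF Y] fdmodsD(1)[OF M]
private lemma kc: "kron (kron (snd X a) (snd Y b)) (snd M m) \<in> carrier_mat nn nn"
    "kron (kron (snd X a) (snd Y b)) (1\<^sub>m (fst M)) \<in> carrier_mat nn nn"
    "kron (kron (1\<^sub>m (fst X)) (snd Y b)) (snd M m) \<in> carrier_mat nn nn"
    "kron (kron (snd X a) (1\<^sub>m (fst Y))) (snd M m) \<in> carrier_mat nn nn"
  by (intro kron_carrier c one_carrier_mat)+

private lemma op_msum:
  "op21 t = msum nn nn t (\<lambda>a b. kron (kron (snd X b) (snd Y a)) (1\<^sub>m (fst M)))"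
  "op12 t = msum nn nn t (\<lambda>a b. kron (kron (snd X a) (snd Y b)) (1\<^sub>m (fst M)))"
  "op23 = msum nn nn K (\<lambda>a b. kron (kron (1\<^sub>m (fst X)) (snd Y a)) (snd M b))"
  unfolding op21_def op12_def op23_def tensor_act_msum
  by (simp_all add: kron_msum_left[OF one_carrier_mat kron_carrier[OF c(1,2)]]
      kron_msum_right[OF one_carrier_mat kron_carrier[OF c(2,3)]] kron_assoc mult.assoc)

private lemma op_carrier [simp]: "op21 t \<in> carrier_mat nn nn" "op12 t \<in> carrier_mat nn nn"
  "op23 \<in> carrier_mat nn nn" "op13 \<in> carrier_mat nn nn"
  by (simp_all add: op_msum op13_def)

private lemma km: "kron (kron A B) C * kron (kron A' B') C' = kron (kron (A * A') (B * B')) (C * C')"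
  if "A \<in> carrier_mat (fst X) (fst X)" "A' \<in> carrier_mat (fst X) (fst X)"
   "B \<in> carrier_mat (fst Y) (fst Y)" "B' \<in> carrier_mat (fst Y) (fst Y)"
   "C \<in> carrier_mat (fst M) (fst M)" "C' \<in> carrier_mat (fst M) (fst M)"
  using that by (simp add: kron_mult[OF kron_carrier[OF that(1,3)] that(5) kron_carrier[OF that(2,4)] that(6)]
      kron_mult[OF that(1,3) that(2,4)])

private lemma trilin_kron: "i < nn \<Longrightarrow> j < nn \<Longrightarrow>
   trilin sH sH sB (*) (\<lambda>u v w. kron (kron (snd X u) (snd Y v)) (snd M w) $$ (i, j))"
  by (intro mtensor3_entries[where n = nn and m = nn] mlin_kron_left mlin_kron_right kron_carrier c
      mlin_rep[OF X] mlin_rep[OF Y] mlin_rep[OF M] lin_id)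

private lemma XYm: "snd X a * snd X a' = snd X (a * a')" "snd Y a * snd Y a' = snd Y (a * a')"
  "snd M m * snd M m' = snd M (m * m')"
  by (simp_all add: fdmodsD(3)[OF X] fdmodsD(3)[OF Y] fdmodsD(3)[OF M])

private lemma one_simps: "1\<^sub>m (fst X) * snd X a = snd X a" "snd X a * 1\<^sub>m (fst X) = snd X a"
   "1\<^sub>m (fst Y) * snd Y a = snd Y a" "snd Y a * 1\<^sub>m (fst Y) = snd Y a"
   "1\<^sub>m (fst M) * snd M m = snd M m" "snd M m * 1\<^sub>m (fst M) = snd M m"
  using left_mult_one_mat[OF c(1)] right_mult_one_mat[OF c(1)] left_mult_one_mat[OF c(2)]
    right_mult_one_mat[OF c(2)] left_mult_one_mat[OF c(3)] right_mult_one_mat[OF c(3)] by simp_all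

lemma K_act_tensor_left:
  assumes R': "tensor_inverse sH sH R R'"
  shows "tensor_act K (tensor_rep \<Delta> X Y) M = op23 * op21 R * op13 * op21 R'"
proof -
  have "tensor_act K (tensor_rep \<Delta> X Y) M =
     msum nn nn K (\<lambda>x m. msum nn nn (\<Delta> x) (\<lambda>u v. kron (kron (snd X u) (snd Y v)) (snd M m)))"
    unfolding tensor_act_msum[of K] fst_tensor_rep snd_tensor_rep
    by (simp add: tensor_act_msum kron_msum_left[OF c(3) kron_carrier[OF c(1,2)]])
  also have "\<dots> = msum nn nn K (\<lambda>k k'. msum nn nn R (\<lambda>r r'. msum nn nn K (\<lambda>l l'. msum nn nn R' (\<lambda>s s'.
     kron (kron (snd X (r' * l * s')) (snd Y (k * r * s))) (snd M (k' * l'))))))"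
    by (rule msum_eqI) (simp_all add: msum_index K_comul_sw[OF R' vector_space_field trilin_kron])
  also have "\<dots> = op23 * (op21 R * (op13 * op21 R'))"
    unfolding op_msum op13_def
    apply (simp only: msum_mult_right[where p = nn and n = nn and m = nn] kc msum_carrier mult_carrier_mat[of _ nn nn _ nn])
    apply (simp add: msum_mult_left[where p = nn and n = nn and m = nn] mult_carrier_mat[of _ nn nn _ nn]
        kc km c one_simps XYm mult.assoc[where ?'a = 'h] mult.assoc[where ?'a = 'b])
    done
  finally show ?thesis by (simp add: assoc_mult_mat[of _ nn nn _ nn _ nn] mult_carrier_mat[of _ nn nn _ nn])
qed

lemma K_act_tensor_right:
  "tensor_act K X (tensor_rep \<delta> Y M) = op21 R * op13 * op12 R"
proof -
  have "tensor_act K X (tensor_rep \<delta> Y M) =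
     msum nn nn K (\<lambda>x m. msum nn nn (\<delta> m) (\<lambda>u v. kron (kron (snd X x) (snd Y u)) (snd M v)))"
    unfolding tensor_act_msum[of K] fst_tensor_rep snd_tensor_rep
    by (simp add: tensor_act_msum kron_msum_right[OF c(1) kron_carrier[OF c(2,3)]] kron_assoc mult.assoc)
  also have "\<dots> = msum nn nn R (\<lambda>r r'. msum nn nn K (\<lambda>k k'. msum nn nn R (\<lambda>s s'.
     kron (kron (snd X (r' * k * s)) (snd Y (r * s'))) (snd M k'))))"
    by (rule msum_eqI) (simp_all add: msum_index K_coact_right_sw[OF vector_space_field trilin_kron])
  also have "\<dots> = op21 R * (op13 * op12 R)"
    unfolding op_msum op13_def
    apply (simp only: msum_mult_right[where p = nn and n = nn and m = nn] kc msum_carrier mult_carrier_mat[of _ nn nn _ nn])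
    apply (simp add: msum_mult_left[where p = nn and n = nn and m = nn] mult_carrier_mat[of _ nn nn _ nn]
        kc km c one_simps XYm mult.assoc[where ?'a = 'h] mult.assoc[where ?'a = 'b])
    done
  finally show ?thesis by (simp add: assoc_mult_mat[of _ nn nn _ nn _ nn] mult_carrier_mat[of _ nn nn _ nn])
qed

lemma op21_inverse:
  assumes R': "tensor_inverse sH sH R R'" shows "op21 R' * op21 R = 1\<^sub>m nn"
proof -
  have b: "bilin sH sH (*) (\<lambda>a b. kron (kron (snd X b) (snd Y a)) (1\<^sub>m (fst M)) $$ (i, j))" if "i < nn" "j < nn" for i j
    by (intro mbilin_entry[where n = nn and m = nn] that mbilinI mlin_kron_left mlin_kron_right c mlin_rep[OF X] mlin_rep[OF Y] lin_id one_carrier_mat)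
  show ?thesis
    unfolding op_msum
    by (rule trans[OF msum_mult_msum[OF kc(2) kc(2)]], rule msum_eqI)
      (simp_all add: msum_index km c XYm tensor_inverse_sw(2)[OF R' vsH vsH vector_space_field b]
        fdmodsD(2)[OF X] fdmodsD(2)[OF Y])
qed

text \<open>Exchanges the first two factors, Y \<otimes> X \<otimes> M \<rightarrow> X \<otimes> Y
  \<otimes> M. It reduces the braiding of Y with X to the operator R21 on X \<otimes> Y \<otimes>
  M.\<close>

private definition fl :: "'k mat" where "fl = kron (flip_mat (fst Y) (fst X)) (1\<^sub>m (fst M))"
private lemma fl_carrier: "fl \<in> carrier_mat nn (fst Y * fst X * fst M)"
  unfolding fl_def by (intro kron_carrier flip_carrier one_carrier_mat)

text \<open>Pulling the flip to the right of R exchanges its legs, so that the braiding of Y with X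
  is R21 after the flip.\<close>

lemma kron_braiding: "kron (R_braiding R Y X) (1\<^sub>m (fst M)) = op21 R * fl"
proof -
  have k: "kron (snd X b) (snd Y a) \<in> carrier_mat xy xy" for a b by (intro kron_carrier c)
  have "R_braiding R Y X = msum xy xy R (\<lambda>a b. kron (snd X b) (snd Y a)) * flip_mat (fst Y) (fst X)"
    unfolding R_braiding_def tensor_act_msum
    by (simp add: msum_mult_right[OF flip_carrier k] msum_mult_left[OF flip_carrier kron_carrier[OF c(2,1)]] flip_kron_mat[OF c(2,1)])
  then show ?thesis unfolding op21_def fl_def
    by (simp add: kron_mult[OF msum_carrier one_carrier_mat flip_carrier one_carrier_mat])
qed

lemma kron_braiding': "kron (R_braiding R X Y) (1\<^sub>m (fst M)) = kron (flip_mat (fst X) (fst Y)) (1\<^sub>m (fst M)) * op12 R"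
  unfolding R_braiding_def op12_def
  by (simp add: kron_mult[OF flip_carrier one_carrier_mat tensor_act_carrier one_carrier_mat])

lemma fl_K: "fl * kron (1\<^sub>m (fst Y)) (tensor_act K X M) = op13 * fl"
proof -
  have k: "kron (1\<^sub>m (fst Y)) (snd X a) \<in> carrier_mat (fst Y * fst X) (fst Y * fst X)" 
     "kron (snd X a) (1\<^sub>m (fst Y)) \<in> carrier_mat xy xy" for a
    by (intro kron_carrier c one_carrier_mat)+
  have "kron (1\<^sub>m (fst Y)) (tensor_act K X M) = msum (fst Y * fst X * fst M) (fst Y * fst X * fst M) K
      (\<lambda>a b. kron (kron (1\<^sub>m (fst Y)) (snd X a)) (snd M b))"
    unfolding tensor_act_msum
    by (simp add: kron_msum_right[OF one_carrier_mat kron_carrier[OF c(1,3)]] kron_assoc mult.assoc)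
  moreover have "fl * kron (kron (1\<^sub>m (fst Y)) (snd X a)) (snd M b) = kron (kron (snd X a) (1\<^sub>m (fst Y))) (snd M b) * fl" for a b
    unfolding fl_def
    by (simp add: kron_mult[OF flip_carrier one_carrier_mat k(1) c(3)] kron_mult[OF k(2) c(3) flip_carrier one_carrier_mat]
        flip_kron_mat[OF one_carrier_mat c(1)] one_simps)
  ultimately show ?thesis unfolding op13_def
    by (simp add: msum_mult_left[OF fl_carrier kron_carrier[OF k(1) c(3)]] msum_mult_right[OF fl_carrier kc(4)])
qed

text \<open>Composition with the braiding R21 \<open>fl\<close> on the right cancels the trailing
  inverse of R21 in the coproduct axiom of K; moving \<open>fl\<close> past K13 turns the latter
  into K acting on X inside Y \<otimes> X \<otimes> M.\<close>

lemma K_braid_tensor_left: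
  "tensor_act K (tensor_rep \<Delta> X Y) M * kron (R_braiding R Y X) (1\<^sub>m (fst M)) =
   kron (1\<^sub>m (fst X)) (tensor_act K Y M) * (kron (R_braiding R Y X) (1\<^sub>m (fst M)) * kron (1\<^sub>m (fst Y)) (tensor_act K X M))"
proof -
  obtain R' where R': "tensor_inverse sH sH R R'" using R_invertible by blast
  note a = assoc_mult_mat[of _ nn nn _ nn _ nn] assoc_mult_mat[of _ nn nn _ nn _ "fst Y * fst X * fst M"]
    assoc_mult_mat[of _ nn nn _ "fst Y * fst X * fst M" _ "fst Y * fst X * fst M"]
  have kk: "kron (1\<^sub>m (fst Y)) (tensor_act K X M) \<in> carrier_mat (fst Y * fst X * fst M) (fst Y * fst X * fst M)"
    using kron_carrier[OF one_carrier_mat tensor_act_carrier[of K X M], of "fst Y"] by (simp add: mult.assoc)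
  have "tensor_act K (tensor_rep \<Delta> X Y) M * kron (R_braiding R Y X) (1\<^sub>m (fst M)) =
      op23 * (op21 R * (op13 * ((op21 R' * op21 R) * fl)))"
    unfolding K_act_tensor_left[OF R'] kron_braiding
    by (simp add: a fl_carrier mult_carrier_mat[of _ nn nn])
  also have "\<dots> = op23 * (op21 R * (op13 * fl))" using left_mult_one_mat[OF fl_carrier] by (simp add: op21_inverse[OF R'])
  also have "\<dots> = op23 * (op21 R * fl * kron (1\<^sub>m (fst Y)) (tensor_act K X M))"
    by (simp add: a fl_carrier kk fl_K)
  finally show ?thesis unfolding kron_braiding op23_def by simp
qed

text \<open>A pair of mutually inverse flips inserted between K13 and R12, the left one moved past
  K13, supplies the flips of the two braidings.\<close>

lemma K_braid_tensor_right:
  "tensor_act K X (tensor_rep \<delta> Y M) =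
   kron (R_braiding R Y X) (1\<^sub>m (fst M)) * (kron (1\<^sub>m (fst Y)) (tensor_act K X M) * kron (R_braiding R X Y) (1\<^sub>m (fst M)))"
proof -
  let ?mm = "fst Y * fst X * fst M"
  let ?f = "kron (flip_mat (fst X) (fst Y)) (1\<^sub>m (fst M))"
  note a = assoc_mult_mat[of _ nn nn _ nn _ nn] assoc_mult_mat[of _ nn nn _ ?mm _ nn] 
    assoc_mult_mat[of _ nn ?mm _ ?mm _ nn] assoc_mult_mat[of _ nn ?mm _ nn _ nn] assoc_mult_mat[of _ ?mm ?mm _ nn _ nn]
  have kk: "kron (1\<^sub>m (fst Y)) (tensor_act K X M) \<in> carrier_mat ?mm ?mm"
    using kron_carrier[OF one_carrier_mat tensor_act_carrier[of K X M], of "fst Y"] by (simp add: mult.assoc)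
  have f: "?f \<in> carrier_mat ?mm nn" by (intro kron_carrier flip_carrier one_carrier_mat)
  have ff: "fl * ?f = 1\<^sub>m nn" unfolding fl_def
    by (simp add: kron_mult[OF flip_carrier one_carrier_mat flip_carrier one_carrier_mat] flip_flip)
  have "kron (R_braiding R Y X) (1\<^sub>m (fst M)) * (kron (1\<^sub>m (fst Y)) (tensor_act K X M) * kron (R_braiding R X Y) (1\<^sub>m (fst M))) =
    op21 R * ((fl * kron (1\<^sub>m (fst Y)) (tensor_act K X M)) * (?f * op12 R))"
    unfolding kron_braiding kron_braiding'
    by (simp add: a fl_carrier kk f mult_carrier_mat[of _ ?mm nn] mult_carrier_mat[of _ ?mm ?mm])
  also have "\<dots> = op21 R * (op13 * ((fl * ?f) * op12 R))"
    unfolding fl_K by (simp add: a fl_carrier f mult_carrier_mat[of _ ?mm nn])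
  also have "\<dots> = op21 R * op13 * op12 R"
    using left_mult_one_mat[OF op_carrier(2)] by (simp add: ff a)
  finally show ?thesis by (simp add: K_act_tensor_right)
qed

end

lemma inv_mor_one:
  assumes "X \<in> fdmods sB" shows "inv_mor (B_FdMod sB \<delta>) X X (1\<^sub>m (fst X)) = 1\<^sub>m (fst X)"
  unfolding inv_mor_def inverse_of_def
  by (rule the_equality) (auto simp: one_intertwiners[OF assms] dest!: intertwinersD(1))

lemma braided_module_category_B_FdMod:
  "braided_module_category (H_FdMod sH \<Delta> \<epsilon> S) (R_braiding R) (B_FdMod sB \<delta>) (K_braiding K)"
proof -
  note aH = tensor_rep_fdmodsH and aB = tensor_rep_fdmods
  have rb: "kron (R_braiding R X Y) (1\<^sub>m m) \<in> carrier_mat (fst Y * fst X * m) (fst X * fst Y * m)" for X Y :: "('k, 'h) rep" and m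
    unfolding R_braiding_def by (intro kron_carrier mult_carrier_mat[OF flip_carrier tensor_act_carrier] one_carrier_mat)
  have kb: "kron (1\<^sub>m (fst Y)) (tensor_act K X M) \<in> carrier_mat (fst Y * fst X * fst M) (fst Y * fst X * fst M)" for X Y M
    using kron_carrier[OF one_carrier_mat tensor_act_carrier[of K X M], of "fst Y"] by (simp add: mult.assoc)
  have ta: "tensor_act K (tensor_rep \<Delta> X Y) M \<in> carrier_mat (fst X * fst Y * fst M) (fst X * fst Y * fst M)"
    "tensor_act K X (tensor_rep \<delta> Y M) \<in> carrier_mat (fst X * fst Y * fst M) (fst X * fst Y * fst M)" for X Y M
    using tensor_act_carrier[of K "tensor_rep \<Delta> X Y" M] tensor_act_carrier[of K X "tensor_rep \<delta> Y M"] by (simp_all add: mult.assoc)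
  \<comment> \<open>Source and target coincide by strict associativity, so the inverse constraint is
    again an identity matrix.\<close>
  have iv: "inv_mor (B_FdMod sB \<delta>) (tensor_rep \<delta> (tensor_rep \<Delta> Y X) M) (tensor_rep \<delta> Y (tensor_rep \<delta> X M))
      (1\<^sub>m (fst Y * fst X * fst M)) = 1\<^sub>m (fst Y * fst X * fst M)"
    if "X \<in> fdmods sH" "Y \<in> fdmods sH" "M \<in> fdmods sB" for X Y M
    using inv_mor_one[OF aB[OF aH[OF that(2,1)] that(3)]]
    by (simp only: tensor_rep_assoc[OF that(2,1,3)] fst_tensor_rep mult.assoc)
  show ?thesis
    unfolding braided_module_category_def H_FdMod_simps B_FdMod_simps K_braiding_def
  proof (intro conjI ballI module_category_B_FdMod K_act_iso)
    fix X Y M N f g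
    assume *: "X \<in> fdmods sH" "Y \<in> fdmods sH" "M \<in> fdmods sB" "N \<in> fdmods sB" "f \<in> intertwiners X Y" "g \<in> intertwiners M N"
    show "tensor_act K Y N * kron f g = kron f g * tensor_act K X M"
      by (rule intertwiners_tensor(1)[OF *, symmetric])
  next
    fix X Y M assume *: "X \<in> fdmods sH" "Y \<in> fdmods sH" "M \<in> fdmods sB"
    let ?n = "fst X * fst Y * fst M" and ?m = "fst Y * fst X * fst M"
    note kb1 = kb[of X Y M] and kb2 = kb[of Y X M]
    note rb1 = rb[of Y X "fst M"] and rb2 = rb[of X Y "fst M"]
    show "1\<^sub>m (fst X * fst Y * fst M) * tensor_act K (tensor_rep \<Delta> X Y) M * kron (R_braiding R Y X) (1\<^sub>m (fst M)) =
       kron (1\<^sub>m (fst X)) (tensor_act K Y M) * 1\<^sub>m (fst X * fst Y * fst M) * kron (R_braiding R Y X) (1\<^sub>m (fst M)) *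
       inv_mor (B_FdMod sB \<delta>) (tensor_rep \<delta> (tensor_rep \<Delta> Y X) M) (tensor_rep \<delta> Y (tensor_rep \<delta> X M))
        (1\<^sub>m (fst Y * fst X * fst M)) * kron (1\<^sub>m (fst Y)) (tensor_act K X M) * 1\<^sub>m (fst Y * fst X * fst M)"
      unfolding iv[OF *] left_mult_one_mat[OF ta(1)] right_mult_one_mat[OF kb1]
        right_mult_one_mat[OF mult_carrier_mat[OF kb1 rb1]]
        right_mult_one_mat[OF mult_carrier_mat[OF kb1 mult_carrier_mat[OF rb1 kb2]]]
        assoc_mult_mat[OF kb1 rb1 kb2]
      by (rule K_braid_tensor_left[OF *])
    show "tensor_act K X (tensor_rep \<delta> Y M) * 1\<^sub>m (fst X * fst Y * fst M) =
       1\<^sub>m (fst X * fst Y * fst M) * kron (R_braiding R Y X) (1\<^sub>m (fst M)) *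
       inv_mor (B_FdMod sB \<delta>) (tensor_rep \<delta> (tensor_rep \<Delta> Y X) M) (tensor_rep \<delta> Y (tensor_rep \<delta> X M))
        (1\<^sub>m (fst Y * fst X * fst M)) * kron (1\<^sub>m (fst Y)) (tensor_act K X M) * 1\<^sub>m (fst Y * fst X * fst M) *
       kron (R_braiding R X Y) (1\<^sub>m (fst M))"
      unfolding iv[OF *] right_mult_one_mat[OF ta(2)] left_mult_one_mat[OF rb1] right_mult_one_mat[OF rb1]
        right_mult_one_mat[OF mult_carrier_mat[OF rb1 kb2]] assoc_mult_mat[OF rb1 kb2 rb2]
      by (rule K_braid_tensor_right[OF *])
  qed
qed

end

subsection \<open>Finite-dimensional modules as matrix representations\<close>

text \<open>Coordinates for a basis of \<open>U\<close>, which is finite because \<open>U\<close>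
  lies in the span of a finite set. The spaces to be made into matrix modules occur as sets of
  functions, so \<open>co\<close> is a total map whose linearity is guaranteed on
  \<open>U\<close>.\<close>

lemma (in vector_space) subspace_coordinates:
  assumes U: "subspace U" and T: "U \<subseteq> span T" "finite T"
  obtains n and co :: "'b \<Rightarrow> 'a mat" and \<phi> :: "'a mat \<Rightarrow> 'b" where
    "\<And>u. co u \<in> carrier_mat n 1" "\<And>v. \<phi> v \<in> U"
    "\<And>u. u \<in> U \<Longrightarrow> \<phi> (co u) = u" "\<And>v. v \<in> carrier_mat n 1 \<Longrightarrow> co (\<phi> v) = v"
    "\<And>u v. u \<in> U \<Longrightarrow> v \<in> U \<Longrightarrow> co (u + v) = co u + co v" "\<And>c u. u \<in> U \<Longrightarrow> co (scale c u) = c \<cdot>\<^sub>m co u"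
    "\<And>v w. v \<in> carrier_mat n 1 \<Longrightarrow> w \<in> carrier_mat n 1 \<Longrightarrow> \<phi> (v + w) = \<phi> v + \<phi> w"
    "\<And>c v. v \<in> carrier_mat n 1 \<Longrightarrow> \<phi> (c \<cdot>\<^sub>m v) = scale c (\<phi> v)"
proof -
  obtain Bs where Bs: "Bs \<subseteq> U" "independent Bs" "U \<subseteq> span Bs"
    using maximal_independent_subset[of U] by blast
  have fin: "finite Bs" using independent_span_bound[OF T(2) Bs(2)] Bs(1) T(1) by blast
  obtain e where e: "bij_betw e {0..<card Bs} Bs" using ex_bij_betw_nat_finite[OF fin] by blast
  let ?n = "card Bs"
  have eB: "e i \<in> Bs" if "i < ?n" for i using e that by (auto simp: bij_betw_def)
  have sumB: "(\<Sum>j<?n. g (e j)) = (\<Sum>b\<in>Bs. g b)" for g :: "'b \<Rightarrow> 'b"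
    using sum.reindex_bij_betw[OF e, of g] by (simp add: lessThan_atLeast0)
  define co where "co u = mat ?n 1 (\<lambda>(i, _). representation Bs u (e i))" for u
  define \<phi> where "\<phi> v = (\<Sum>j<?n. scale (v $$ (j, 0)) (e j))" for v :: "'a mat"
  have \<phi>U: "\<phi> v \<in> U" for v unfolding \<phi>_def
    using Bs(1) eB by (intro subspace_sum[OF U] subspace_scale[OF U]) auto
  show ?thesis
  proof (rule that[of co ?n \<phi>])
    fix u assume u: "u \<in> U"
    have "\<phi> (co u) = (\<Sum>j<?n. scale (representation Bs u (e j)) (e j))" unfolding \<phi>_def co_def by simp
    also have "\<dots> = u"
      using sumB[of "\<lambda>b. scale (representation Bs u b) b"] sum_representation_eq[OF Bs(2) _ fin order_refl, of u] u Bs(3)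
      by auto
    finally show "\<phi> (co u) = u" .
  next
    fix v :: "'a mat" assume v: "v \<in> carrier_mat ?n 1"
    have "representation Bs (\<phi> v) (e i) = v $$ (i, 0)" if i: "i < ?n" for i
    proof -
      have s: "scale (v $$ (j, 0)) (e j) \<in> span Bs" if "j < ?n" for j
        using eB[OF that] by (intro span_scale span_base)
      have "representation Bs (\<phi> v) (e i) = (\<Sum>j<?n. representation Bs (scale (v $$ (j, 0)) (e j)) (e i))"
        unfolding \<phi>_def using s by (subst representation_sum[OF Bs(2)]) auto
      also have "\<dots> = (\<Sum>j<?n. if j = i then v $$ (j, 0) else 0)"
      proof (rule sum.cong[OF refl])
        fix j assume j: "j \<in> {..<?n}"
        have "e j = e i \<longleftrightarrow> j = i" using e i j by (auto simp: bij_betw_def inj_on_def)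
        then show "representation Bs (scale (v $$ (j, 0)) (e j)) (e i) = (if j = i then v $$ (j, 0) else 0)"
          using j eB[of j] by (auto simp: representation_scale[OF Bs(2)] span_base representation_basis[OF Bs(2)])
      qed
      finally show ?thesis using i by simp
    qed
    then show "co (\<phi> v) = v" using v unfolding co_def by (auto intro!: eq_matI)
  next
    fix u v assume "u \<in> U" "v \<in> U"
    then show "co (u + v) = co u + co v"
      using Bs(3) by (auto simp: co_def representation_add[OF Bs(2)] subset_iff intro!: eq_matI)
  next
    fix c u assume "u \<in> U"
    then show "co (scale c u) = c \<cdot>\<^sub>m co u"
      using Bs(3) by (auto simp: co_def representation_scale[OF Bs(2)] subset_iff intro!: eq_matI)
  next
    fix v w :: "'a mat" assume "v \<in> carrier_mat ?n 1" "w \<in> carrier_mat ?n 1"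
    then show "\<phi> (v + w) = \<phi> v + \<phi> w" by (simp add: \<phi>_def scale_left_distrib sum.distrib)
  next
    fix c and v :: "'a mat" assume "v \<in> carrier_mat ?n 1"
    then show "\<phi> (c \<cdot>\<^sub>m v) = scale c (\<phi> v)" by (simp add: \<phi>_def scale_sum_right)
  qed (simp_all add: \<phi>U co_def)
qed

text \<open>Carries an abstract finite-dimensional module over to \<open>fdmods\<close>: the matrix
  of \<open>a\<close> is that of its action conjugated by the coordinates. The regular module, the
  adjoint module, the internal Homs and the end over B-modules all arise in this way.\<close>

lemma (in vector_space) realize_module:
  fixes sA :: "'a \<Rightarrow> 'c::{ring,monoid_mult} \<Rightarrow> 'c" and act :: "'c \<Rightarrow> 'b \<Rightarrow> 'b"
  assumes U: "subspace U" and T: "U \<subseteq> span T" "finite T"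
    and act: "\<And>a u. u \<in> U \<Longrightarrow> act a u \<in> U"
      "\<And>a u v. u \<in> U \<Longrightarrow> v \<in> U \<Longrightarrow> act a (u + v) = act a u + act a v"
      "\<And>a c u. u \<in> U \<Longrightarrow> act a (scale c u) = scale c (act a u)"
      "\<And>a b u. u \<in> U \<Longrightarrow> act (a + b) u = act a u + act b u"
      "\<And>a c u. u \<in> U \<Longrightarrow> act (sA c a) u = scale c (act a u)"
      "\<And>u. u \<in> U \<Longrightarrow> act 1 u = u"
      "\<And>a b u. u \<in> U \<Longrightarrow> act (a * b) u = act a (act b u)"
  obtains P and co :: "'b \<Rightarrow> 'a mat" and \<phi> :: "'a mat \<Rightarrow> 'b" where "P \<in> fdmods sA"
    "\<And>u. co u \<in> carrier_mat (fst P) 1" "\<And>v. \<phi> v \<in> U"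
    "\<And>u. u \<in> U \<Longrightarrow> \<phi> (co u) = u" "\<And>v. v \<in> carrier_mat (fst P) 1 \<Longrightarrow> co (\<phi> v) = v"
    "\<And>u v. u \<in> U \<Longrightarrow> v \<in> U \<Longrightarrow> co (u + v) = co u + co v" "\<And>c u. u \<in> U \<Longrightarrow> co (scale c u) = c \<cdot>\<^sub>m co u"
    "\<And>v w. v \<in> carrier_mat (fst P) 1 \<Longrightarrow> w \<in> carrier_mat (fst P) 1 \<Longrightarrow> \<phi> (v + w) = \<phi> v + \<phi> w"
    "\<And>c v. v \<in> carrier_mat (fst P) 1 \<Longrightarrow> \<phi> (c \<cdot>\<^sub>m v) = scale c (\<phi> v)"
    "\<And>a u. u \<in> U \<Longrightarrow> snd P a * co u = co (act a u)"
proof -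
  obtain n and co :: "'b \<Rightarrow> 'a mat" and \<phi> :: "'a mat \<Rightarrow> 'b" where
    co: "\<And>u. co u \<in> carrier_mat n 1" and \<phi>: "\<And>v. \<phi> v \<in> U"
    and \<phi>co: "\<And>u. u \<in> U \<Longrightarrow> \<phi> (co u) = u" and co\<phi>: "\<And>v. v \<in> carrier_mat n 1 \<Longrightarrow> co (\<phi> v) = v"
    and co_add: "\<And>u v. u \<in> U \<Longrightarrow> v \<in> U \<Longrightarrow> co (u + v) = co u + co v"
    and co_scale: "\<And>c u. u \<in> U \<Longrightarrow> co (scale c u) = c \<cdot>\<^sub>m co u"
    and \<phi>_add: "\<And>v w. v \<in> carrier_mat n 1 \<Longrightarrow> w \<in> carrier_mat n 1 \<Longrightarrow> \<phi> (v + w) = \<phi> v + \<phi> w"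
    and \<phi>_scale: "\<And>c v. v \<in> carrier_mat n 1 \<Longrightarrow> \<phi> (c \<cdot>\<^sub>m v) = scale c (\<phi> v)"
    by (rule subspace_coordinates[OF U T], rule that; assumption)
  have "\<exists>G. G \<in> carrier_mat n n \<and> (\<forall>v\<in>carrier_mat n 1. G * v = co (act a (\<phi> v)))" for a
  proof -
    obtain G where "G \<in> carrier_mat n n" "\<And>v. v \<in> carrier_mat n 1 \<Longrightarrow> G * v = co (act a (\<phi> v))"
      by (rule linear_to_mat[of n "\<lambda>v. co (act a (\<phi> v))" n])
        (use co in \<open>simp_all add: \<phi> act \<phi>_add \<phi>_scale co_add co_scale\<close>)
    then show ?thesis by blast
  qed
  then obtain \<rho> where \<rho>: "\<And>a. \<rho> a \<in> carrier_mat n n" "\<And>a v. v \<in> carrier_mat n 1 \<Longrightarrow> \<rho> a * v = co (act a (\<phi> v))"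
    by metis
  have "(n, \<rho>) \<in> fdmods sA"
  proof (rule fdmodsI)
    show "mlin sA n n \<rho>"
    proof (rule mlinI)
      fix a b show "\<rho> (a + b) = \<rho> a + \<rho> b"
        by (rule mat_eq_cols[of _ n n]) (simp_all add: \<rho> add_mult_distrib_mat[OF \<rho>(1) \<rho>(1)] act \<phi> co_add)
    next
      fix c a show "\<rho> (sA c a) = c \<cdot>\<^sub>m \<rho> a"
        by (rule mat_eq_cols[of _ n n]) (simp_all add: \<rho> mult_smult_assoc_mat[OF \<rho>(1)] act \<phi> co_scale)
    qed (rule \<rho>)
    show "\<rho> 1 = 1\<^sub>m n"
      by (rule mat_eq_cols[of _ n n]) (simp_all add: \<rho> act \<phi> co\<phi>)
    fix a b show "\<rho> (a * b) = \<rho> a * \<rho> b"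
      by (rule mat_eq_cols[of _ n n]) (simp_all add: \<rho> assoc_mult_mat[OF \<rho>(1) \<rho>(1)] act \<phi> \<phi>co co[simplified] mult_carrier_mat[OF \<rho>(1) \<rho>(1)])
  qed
  then show ?thesis
    using co \<phi> \<phi>co co\<phi> co_add co_scale \<phi>_add \<phi>_scale \<rho>(2)
    by (intro that[of "(n, \<rho>)" co \<phi>]) auto
qed

text \<open>The left regular module together with a linear isomorphism \<open>co\<close> from the
  algebra to columns. It is free on \<open>co 1\<close>, which is what makes the elements of other
  modules accessible.\<close>

definition is_regular :: "('k::field \<Rightarrow> 'a::{ring,monoid_mult} \<Rightarrow> 'a) \<Rightarrow> ('k, 'a) rep \<Rightarrow> ('a \<Rightarrow> 'k mat) \<Rightarrow> bool" where
  "is_regular sA P co \<longleftrightarrow> P \<in> fdmods sA \<and> mlin sA (fst P) 1 co \<and>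
     bij_betw co UNIV (carrier_mat (fst P) 1) \<and> (\<forall>a b. snd P a * co b = co (a * b))"

lemma (in fd_algebra) regular_exists: obtains P co where "is_regular sA P co"
proof -
  obtain V where V: "finite V" "span V = UNIV" using finite_dim by blast
  have "subspace UNIV" by simp
  moreover have "UNIV \<subseteq> span V" using V by simp
  ultimately obtain P and co :: "'a \<Rightarrow> 'k mat" and \<phi> :: "'k mat \<Rightarrow> 'a" where P: "P \<in> fdmods sA"
    "\<And>u. co u \<in> carrier_mat (fst P) 1" "\<And>v. \<phi> v \<in> UNIV"
    "\<And>u. u \<in> UNIV \<Longrightarrow> \<phi> (co u) = u" "\<And>v. v \<in> carrier_mat (fst P) 1 \<Longrightarrow> co (\<phi> v) = v"
    "\<And>u v. u \<in> UNIV \<Longrightarrow> v \<in> UNIV \<Longrightarrow> co (u + v) = co u + co v" "\<And>c u. u \<in> UNIV \<Longrightarrow> co (sA c u) = c \<cdot>\<^sub>m co u"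
    "\<And>v w. v \<in> carrier_mat (fst P) 1 \<Longrightarrow> w \<in> carrier_mat (fst P) 1 \<Longrightarrow> \<phi> (v + w) = \<phi> v + \<phi> w"
    "\<And>c v. v \<in> carrier_mat (fst P) 1 \<Longrightarrow> \<phi> (c \<cdot>\<^sub>m v) = sA c (\<phi> v)"
    "\<And>a u. u \<in> UNIV \<Longrightarrow> snd P a * co u = co (a * u)"
    by (rule realize_module[of UNIV V "(*)" sA])
      (auto simp: V distrib_left distrib_right scale_mult_left scale_mult_right mult.assoc)
  have "bij_betw co UNIV (carrier_mat (fst P) 1)"
    by (rule bij_betwI[of _ _ _ \<phi>]) (use P in auto)
  then have "is_regular sA P co" unfolding is_regular_def using P(1,2,6,7,10) by (auto intro: mlinI)
  then show ?thesis by (rule that)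
qed

context
  fixes sA :: "'k::field \<Rightarrow> 'a::{ring,monoid_mult} \<Rightarrow> 'a" and P co
  assumes reg: "is_regular sA P co"
begin

lemma regularD: "P \<in> fdmods sA" "mlin sA (fst P) 1 co" "co a \<in> carrier_mat (fst P) 1"
  "snd P a * co b = co (a * b)" "v \<in> carrier_mat (fst P) 1 \<Longrightarrow> \<exists>a. v = co a" "co a = co b \<longleftrightarrow> a = b"
  "bij_betw co UNIV (carrier_mat (fst P) 1)"
proof -
  show "P \<in> fdmods sA" and l: "mlin sA (fst P) 1 co" and "snd P a * co b = co (a * b)"
    and b: "bij_betw co UNIV (carrier_mat (fst P) 1)"
    using reg unfolding is_regular_def by auto
  show "co a \<in> carrier_mat (fst P) 1" by (rule mlinD(1)[OF l])
  show "co a = co b \<longleftrightarrow> a = b" using bij_betw_imp_inj_on[OF b] by (rule inj_eq)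
  show "\<exists>a. v = co a" if "v \<in> carrier_mat (fst P) 1"
  proof -
    have "v \<in> range co" using that bij_betw_imp_surj_on[OF b] by (simp only:)
    then show ?thesis by blast
  qed
qed

lemma regular_mat_eq:
  assumes "A \<in> carrier_mat n (fst P)" "B \<in> carrier_mat n (fst P)" "\<And>a. A * co a = B * co a" shows "A = B"
proof (rule mat_eq_cols[OF assms(1,2)])
  fix v :: "'k mat" assume "v \<in> carrier_mat (fst P) 1"
  then obtain a where "v = co a" using regularD(5) by blast
  then show "A * v = B * v" using assms(3) by simp
qed

lemma regular_linear_to_mat:
  assumes f: "mlin sA n 1 f"
  obtains G where "G \<in> carrier_mat n (fst P)" "\<And>a. G * co a = f a"
proof -
  define ic where "ic = inv_into UNIV co"
  have ic: "ic (co a) = a" for a unfolding ic_def using regularD(6) by (intro inv_into_f_f) (auto simp: inj_on_def)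
  have co: "\<exists>a. v = co a" if "v \<in> carrier_mat (fst P) 1" for v using regularD(5)[OF that] .
  obtain G where "G \<in> carrier_mat n (fst P)" "\<And>v. v \<in> carrier_mat (fst P) 1 \<Longrightarrow> G * v = f (ic v)"
  proof (rule linear_to_mat[of "fst P" "\<lambda>v. f (ic v)" n])
    fix v w :: "'k mat" assume "v \<in> carrier_mat (fst P) 1" "w \<in> carrier_mat (fst P) 1"
    then obtain a b where "v = co a" "w = co b" using co by blast
    then show "f (ic (v + w)) = f (ic v) + f (ic w)"
      by (simp add: ic mlinD(2)[OF regularD(2), symmetric] mlinD(2)[OF f])
  next
    fix c and v :: "'k mat" assume "v \<in> carrier_mat (fst P) 1"
    then obtain a where "v = co a" using co by blast
    then show "f (ic (c \<cdot>\<^sub>m v)) = c \<cdot>\<^sub>m f (ic v)"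
      by (simp add: ic mlinD(3)[OF regularD(2), symmetric] mlinD(3)[OF f])
  qed (use mlinD(1)[OF f] in auto)
  note G = this
  have "G * co a = f a" for a using G(2)[OF regularD(3), of a] ic[of a] by simp
  with G(1) show ?thesis by (rule that)
qed

text \<open>Freeness of the regular module: the generator \<open>co 1\<close> may be sent to any
  vector \<open>x\<close>.\<close>

lemma regular_orbit_map:
  assumes X: "X \<in> fdmods sA" and x: "x \<in> carrier_mat (fst X) 1"
  obtains f where "f \<in> intertwiners P X" "\<And>a. f * co a = snd X a * x"
proof -
  obtain f where f: "f \<in> carrier_mat (fst X) (fst P)" "\<And>a. f * co a = snd X a * x"
    using regular_linear_to_mat[OF mlin_mult_right[OF x fdmodsD(6)[OF X]]] by blast
  have "f \<in> intertwiners P X"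
  proof (rule intertwinersI[OF f(1)])
    fix a
    note c = fdmodsD(1)[OF X] fdmodsD(1)[OF regularD(1)]
    show "f * snd P a = snd X a * f"
      by (rule regular_mat_eq[OF mult_carrier_mat[OF f(1) c(2)] mult_carrier_mat[OF c(1) f(1)]])
        (simp add: assoc_mult_mat[OF f(1) c(2) regularD(3)] assoc_mult_mat[OF c(1) f(1) regularD(3)] regularD(4) f(2)
          fdmodsD(3)[OF X] assoc_mult_mat[OF c(1) c(1) x])
  qed
  then show ?thesis using f(2) by (rule that)
qed

lemma regular_functional:
  assumes "lin sA (*) f" obtains F where "F \<in> carrier_mat 1 (fst P)" "\<And>a. F * co a = mat 1 1 (\<lambda>_. f a)"
proof -
  have "mlin sA 1 1 (\<lambda>a. mat 1 1 (\<lambda>_. f a))"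
    using linD[OF assms] by (intro mlinI) (auto intro!: eq_matI)
  from regular_linear_to_mat[OF this] that show ?thesis by blast
qed

end

subsection \<open>Ends in categories of modules\<close>

text \<open>A wedge of vector spaces whose vertex is the ground field, that is, a candidate element
  of the underlying space of the end, invariant or not.\<close>

definition natural_family where
  "natural_family A T Tc Tv w \<longleftrightarrow> (\<forall>X\<in>Obj A. w X \<in> carrier_mat (fst (T X X)) 1) \<and>
     (\<forall>X\<in>Obj A. \<forall>Y\<in>Obj A. \<forall>f\<in>Hom A X Y. Tv X Y X f * w X = Tc X Y Y f * (w Y :: 'k::field mat))"

context fd_hopf_algebra begin

context
  fixes A :: "('k, 'o, 'm, 'z) lin_cat_scheme" and T :: "'o \<Rightarrow> 'o \<Rightarrow> ('k, 'h) rep" and Tc Tv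
  assumes T: "\<And>X Y. X \<in> Obj A \<Longrightarrow> Y \<in> Obj A \<Longrightarrow> T X Y \<in> fdmods sH"
    and Tv: "\<And>X Y f. X \<in> Obj A \<Longrightarrow> Y \<in> Obj A \<Longrightarrow> f \<in> Hom A X Y \<Longrightarrow> Tv X Y X f \<in> intertwiners (T X X) (T X Y)"
    and Tc: "\<And>X Y f. X \<in> Obj A \<Longrightarrow> Y \<in> Obj A \<Longrightarrow> f \<in> Hom A X Y \<Longrightarrow> Tc X Y Y f \<in> intertwiners (T Y Y) (T X Y)"
begin

private abbreviation (input) "CC \<equiv> H_FdMod sH \<Delta> \<epsilon> S"

lemma end_universal:
  assumes "is_end A CC T Tc Tv E \<pi>" "is_wedge A CC T Tc Tv W p"
  shows "\<exists>!u. u \<in> intertwiners W E \<and> (\<forall>X\<in>Obj A. \<pi> X * u = p X)"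
proof -
  have "\<exists>!u. u \<in> Hom CC W E \<and> (\<forall>X\<in>Obj A. Cmp CC (\<pi> X) u = p X)"
    using assms unfolding is_end_def by blast
  then show ?thesis by (simp only: H_FdMod_simps)
qed

text \<open>The vectors \<open>v\<close> and \<open>w\<close> are the images of 1 under module maps
  from the regular module to \<open>E\<close>. Those maps agree after every projection, hence agree
  by uniqueness in the universal property.\<close>

lemma end_projections_inj:
  assumes E: "is_end A CC T Tc Tv E \<pi>" and v: "v \<in> carrier_mat (fst E) 1" and w: "w \<in> carrier_mat (fst E) 1"
    and eq: "\<And>X. X \<in> Obj A \<Longrightarrow> \<pi> X * v = \<pi> X * w"
  shows "v = w"
proof -
  obtain P co where P: "is_regular sH P co" by (rule regular_exists)
  note r = regularD[OF P]
  have Eo: "E \<in> fdmods sH" and \<pi>: "\<And>X. X \<in> Obj A \<Longrightarrow> \<pi> X \<in> intertwiners E (T X X)"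
    and dn: "\<And>X Y f. X \<in> Obj A \<Longrightarrow> Y \<in> Obj A \<Longrightarrow> f \<in> Hom A X Y \<Longrightarrow> Tv X Y X f * \<pi> X = Tc X Y Y f * \<pi> Y"
    using E unfolding is_end_def is_wedge_def by auto
  obtain f where f: "f \<in> intertwiners P E" "\<And>a. f * co a = snd E a * v" by (rule regular_orbit_map[OF P Eo v]) blast
  obtain g where g: "g \<in> intertwiners P E" "\<And>a. g * co a = snd E a * w" by (rule regular_orbit_map[OF P Eo w]) blast
  note fc = intertwinersD(1)[OF f(1)] and gc = intertwinersD(1)[OF g(1)] and Ec = fdmodsD(1)[OF Eo]
  have fg: "\<pi> X * g = \<pi> X * f" if X: "X \<in> Obj A" for X
  proof -
    note pc = intertwinersD(1)[OF \<pi>[OF X]] and Tcc = fdmodsD(1)[OF T[OF X X]]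
    show ?thesis
      by (rule regular_mat_eq[OF P mult_carrier_mat[OF pc gc] mult_carrier_mat[OF pc fc]])
        (simp add: assoc_mult_mat[OF pc fc r(3)] assoc_mult_mat[OF pc gc r(3)] f(2) g(2)
          assoc_mult_mat[OF pc Ec v, symmetric] assoc_mult_mat[OF pc Ec w, symmetric]
          intertwinersD(2)[OF \<pi>[OF X]] assoc_mult_mat[OF Tcc pc v] assoc_mult_mat[OF Tcc pc w] eq[OF X])
  qed
  have "is_wedge A CC T Tc Tv P (\<lambda>X. \<pi> X * f)"
    unfolding is_wedge_def H_FdMod_simps
  proof (intro conjI ballI)
    fix X assume X: "X \<in> Obj A"
    show "\<pi> X * f \<in> intertwiners P (T X X)" by (rule intertwiners_comp[OF r(1) Eo T[OF X X] f(1) \<pi>[OF X]])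
  next
    fix X Y q assume X: "X \<in> Obj A" and Y: "Y \<in> Obj A" and q: "q \<in> Hom A X Y"
    note pX = intertwinersD(1)[OF \<pi>[OF X]] and pY = intertwinersD(1)[OF \<pi>[OF Y]]
      and tv = intertwinersD(1)[OF Tv[OF X Y q]] and tc = intertwinersD(1)[OF Tc[OF X Y q]]
    show "Tv X Y X q * (\<pi> X * f) = Tc X Y Y q * (\<pi> Y * f)"
      by (simp add: assoc_mult_mat[OF tv pX fc, symmetric] assoc_mult_mat[OF tc pY fc, symmetric] dn[OF X Y q])
  qed (rule r)
  from end_universal[OF E this] have "f = g" using f(1) g(1) fg by blast
  then have "snd E 1 * v = snd E 1 * w" using f(2)[of 1] g(2)[of 1] by simp
  then show ?thesis using v w by (simp add: fdmodsD(2)[OF Eo])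
qed

text \<open>By freeness each column \<open>w X\<close> extends to a module map from the regular
  module; these form a wedge, and the induced map into \<open>E\<close> sends 1 to the required
  vector.\<close>

lemma end_projections_surj:
  assumes E: "is_end A CC T Tc Tv E \<pi>" and w: "natural_family A T Tc Tv w"
  shows "\<exists>v\<in>carrier_mat (fst E) 1. \<forall>X\<in>Obj A. \<pi> X * v = w X"
proof -
  obtain P co where P: "is_regular sH P co" by (rule regular_exists)
  note r = regularD[OF P]
  have Eo: "E \<in> fdmods sH" and \<pi>: "\<And>X. X \<in> Obj A \<Longrightarrow> \<pi> X \<in> intertwiners E (T X X)"
    using E unfolding is_end_def is_wedge_def by auto
  have wc: "\<And>X. X \<in> Obj A \<Longrightarrow> w X \<in> carrier_mat (fst (T X X)) 1"
    and wn: "\<And>X Y f. X \<in> Obj A \<Longrightarrow> Y \<in> Obj A \<Longrightarrow> f \<in> Hom A X Y \<Longrightarrow> Tv X Y X f * w X = Tc X Y Y f * w Y"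
    using w unfolding natural_family_def by auto
  have "\<exists>f. f \<in> intertwiners P (T X X) \<and> (\<forall>a. f * co a = snd (T X X) a * w X)" if X: "X \<in> Obj A" for X
    using regular_orbit_map[OF P T[OF X X] wc[OF X]] by blast
  then obtain p where p: "\<And>X. X \<in> Obj A \<Longrightarrow> p X \<in> intertwiners P (T X X)"
    "\<And>X a. X \<in> Obj A \<Longrightarrow> p X * co a = snd (T X X) a * w X" by metis
  have "is_wedge A CC T Tc Tv P p"
    unfolding is_wedge_def H_FdMod_simps
  proof (intro conjI ballI p(1))
    fix X Y q assume X: "X \<in> Obj A" and Y: "Y \<in> Obj A" and q: "q \<in> Hom A X Y"
    note pX = intertwinersD(1)[OF p(1)[OF X]] and pY = intertwinersD(1)[OF p(1)[OF Y]]
      and tv = intertwinersD(1)[OF Tv[OF X Y q]] and tc = intertwinersD(1)[OF Tc[OF X Y q]]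
      and cX = fdmodsD(1)[OF T[OF X X]] and cY = fdmodsD(1)[OF T[OF Y Y]] and cXY = fdmodsD(1)[OF T[OF X Y]]
    show "Tv X Y X q * p X = Tc X Y Y q * p Y"
      by (rule regular_mat_eq[OF P mult_carrier_mat[OF tv pX] mult_carrier_mat[OF tc pY]])
        (simp add: assoc_mult_mat[OF tv pX r(3)] assoc_mult_mat[OF tc pY r(3)] p(2)[OF X] p(2)[OF Y]
          assoc_mult_mat[OF tv cX wc[OF X], symmetric] assoc_mult_mat[OF tc cY wc[OF Y], symmetric]
          intertwinersD(2)[OF Tv[OF X Y q]] intertwinersD(2)[OF Tc[OF X Y q]]
          assoc_mult_mat[OF cXY tv wc[OF X]] assoc_mult_mat[OF cXY tc wc[OF Y]] wn[OF X Y q])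
  qed (rule r)
  from end_universal[OF E this] obtain u where u: "u \<in> intertwiners P E" "\<And>X. X \<in> Obj A \<Longrightarrow> \<pi> X * u = p X"
    by blast
  note uc = intertwinersD(1)[OF u(1)]
  have "\<pi> X * (u * co 1) = w X" if X: "X \<in> Obj A" for X
    using assoc_mult_mat[OF intertwinersD(1)[OF \<pi>[OF X]] uc r(3)] u(2)[OF X] p(2)[OF X, of 1] wc[OF X]
    by (simp add: fdmodsD(2)[OF T[OF X X]])
  moreover have "u * co 1 \<in> carrier_mat (fst E) 1" using uc r(3) by (rule mult_carrier_mat)
  ultimately show ?thesis by blast
qed

text \<open>Ends may be formed on underlying vector spaces: the mediating map is defined vector by
  vector, and joint injectivity of the projections makes it linear, H-equivariant and
  unique.\<close>

lemma is_endI: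
  assumes Eo: "E \<in> fdmods sH" and \<pi>: "\<And>X. X \<in> Obj A \<Longrightarrow> \<pi> X \<in> intertwiners E (T X X)"
    and dn: "\<And>X Y f. X \<in> Obj A \<Longrightarrow> Y \<in> Obj A \<Longrightarrow> f \<in> Hom A X Y \<Longrightarrow> Tv X Y X f * \<pi> X = Tc X Y Y f * \<pi> Y"
    and inj: "\<And>v w. v \<in> carrier_mat (fst E) 1 \<Longrightarrow> w \<in> carrier_mat (fst E) 1 \<Longrightarrow>
      (\<And>X. X \<in> Obj A \<Longrightarrow> \<pi> X * v = \<pi> X * w) \<Longrightarrow> v = w"
    and surj: "\<And>w. natural_family A T Tc Tv w \<Longrightarrow> \<exists>v\<in>carrier_mat (fst E) 1. \<forall>X\<in>Obj A. \<pi> X * v = w X"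
  shows "is_end A CC T Tc Tv E \<pi>"
proof -
  note pc = intertwinersD(1)[OF \<pi>]
  have "\<exists>!u. u \<in> intertwiners W E \<and> (\<forall>X\<in>Obj A. \<pi> X * u = p X)" if wedge: "is_wedge A CC T Tc Tv W p" for W p
  proof -
    have Wo: "W \<in> fdmods sH" and p: "\<And>X. X \<in> Obj A \<Longrightarrow> p X \<in> intertwiners W (T X X)"
      and pd: "\<And>X Y f. X \<in> Obj A \<Longrightarrow> Y \<in> Obj A \<Longrightarrow> f \<in> Hom A X Y \<Longrightarrow> Tv X Y X f * p X = Tc X Y Y f * p Y"
      using wedge unfolding is_wedge_def by auto
    note ppc = intertwinersD(1)[OF p]
    have "natural_family A T Tc Tv (\<lambda>X. p X * x)" if x: "x \<in> carrier_mat (fst W) 1" for x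
      unfolding natural_family_def
    proof (intro conjI ballI)
      fix X Y q assume X: "X \<in> Obj A" and Y: "Y \<in> Obj A" and q: "q \<in> Hom A X Y"
      note tv = intertwinersD(1)[OF Tv[OF X Y q]] and tc = intertwinersD(1)[OF Tc[OF X Y q]]
      show "Tv X Y X q * (p X * x) = Tc X Y Y q * (p Y * x)"
        by (simp add: assoc_mult_mat[OF tv ppc[OF X] x, symmetric] assoc_mult_mat[OF tc ppc[OF Y] x, symmetric] pd[OF X Y q])
    qed (rule mult_carrier_mat[OF ppc x])
    then have "\<exists>v\<in>carrier_mat (fst E) 1. \<forall>X\<in>Obj A. \<pi> X * v = p X * x" if "x \<in> carrier_mat (fst W) 1" for x
      using surj that by blast
    then obtain g where g: "\<And>x. x \<in> carrier_mat (fst W) 1 \<Longrightarrow> g x \<in> carrier_mat (fst E) 1"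
      "\<And>x X. x \<in> carrier_mat (fst W) 1 \<Longrightarrow> X \<in> Obj A \<Longrightarrow> \<pi> X * g x = p X * x" by metis
    obtain u where u: "u \<in> carrier_mat (fst E) (fst W)" "\<And>x. x \<in> carrier_mat (fst W) 1 \<Longrightarrow> u * x = g x"
    proof (rule linear_to_mat[of "fst W" g "fst E"])
      fix x y :: "'k mat" assume xy: "x \<in> carrier_mat (fst W) 1" "y \<in> carrier_mat (fst W) 1"
      show "g (x + y) = g x + g y"
      proof (rule inj)
        fix X assume X: "X \<in> Obj A"
        show "\<pi> X * g (x + y) = \<pi> X * (g x + g y)"
          using xy X by (simp add: g mult_add_distrib_mat[OF pc[OF X] g(1) g(1)] mult_add_distrib_mat[OF ppc[OF X]])
      qed (use g xy in auto)
    next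
      fix c and x :: "'k mat" assume x: "x \<in> carrier_mat (fst W) 1"
      show "g (c \<cdot>\<^sub>m x) = c \<cdot>\<^sub>m g x"
      proof (rule inj)
        fix X assume X: "X \<in> Obj A"
        show "\<pi> X * g (c \<cdot>\<^sub>m x) = \<pi> X * (c \<cdot>\<^sub>m g x)"
          using x X by (simp add: g mult_smult_distrib[OF pc[OF X] g(1)] mult_smult_distrib[OF ppc[OF X]])
      qed (use g x in auto)
    qed (use g in auto)
    have pu: "\<pi> X * u = p X" if X: "X \<in> Obj A" for X
      by (rule mat_eq_cols[OF mult_carrier_mat[OF pc[OF X] u(1)] ppc[OF X]])
        (simp add: assoc_mult_mat[OF pc[OF X] u(1)] u(2) g(2) X)
    have ui: "u \<in> intertwiners W E"
    proof (rule intertwinersI[OF u(1)])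
      fix a
      note cW = fdmodsD(1)[OF Wo, of a] and cE = fdmodsD(1)[OF Eo, of a]
      show "u * snd W a = snd E a * u"
      proof (rule mat_eq_cols[OF mult_carrier_mat[OF u(1) cW] mult_carrier_mat[OF cE u(1)]])
        fix x :: "'k mat" assume x: "x \<in> carrier_mat (fst W) 1"
        have ux: "u * x \<in> carrier_mat (fst E) 1" by (rule mult_carrier_mat[OF u(1) x])
        have Wx: "snd W a * x \<in> carrier_mat (fst W) 1" by (rule mult_carrier_mat[OF cW x])
        have "u * (snd W a * x) = snd E a * (u * x)"
        proof (rule inj)
          fix X assume X: "X \<in> Obj A"
          note cT = fdmodsD(1)[OF T[OF X X], of a]
          have "\<pi> X * (u * (snd W a * x)) = p X * (snd W a * x)"
            by (simp add: assoc_mult_mat[OF pc[OF X] u(1) Wx, symmetric] pu X)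
          also have "\<dots> = snd (T X X) a * (p X * x)"
            by (simp add: assoc_mult_mat[OF ppc[OF X] cW x, symmetric] intertwinersD(2)[OF p[OF X]] assoc_mult_mat[OF cT ppc[OF X] x])
          also have "\<dots> = snd (T X X) a * (\<pi> X * (u * x))"
            by (simp add: assoc_mult_mat[OF pc[OF X] u(1) x, symmetric] pu X)
          also have "\<dots> = \<pi> X * (snd E a * (u * x))"
            by (simp add: assoc_mult_mat[OF pc[OF X] cE ux, symmetric] intertwinersD(2)[OF \<pi>[OF X]] assoc_mult_mat[OF cT pc[OF X] ux])
          finally show "\<pi> X * (u * (snd W a * x)) = \<pi> X * (snd E a * (u * x))" .
        qed (rule mult_carrier_mat[OF u(1) Wx] mult_carrier_mat[OF cE ux])+
        then show "u * snd W a * x = snd E a * u * x"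
          by (simp add: assoc_mult_mat[OF u(1) cW x] assoc_mult_mat[OF cE u(1) x])
      qed
    qed
    show ?thesis
    proof (rule ex1I[of _ u])
      fix u' assume u': "u' \<in> intertwiners W E \<and> (\<forall>X\<in>Obj A. \<pi> X * u' = p X)"
      then have u'c: "u' \<in> carrier_mat (fst E) (fst W)" by (auto dest: intertwinersD(1))
      show "u' = u"
      proof (rule mat_eq_cols[OF u'c u(1)])
        fix x :: "'k mat" assume x: "x \<in> carrier_mat (fst W) 1"
        show "u' * x = u * x"
        proof (rule inj)
          fix X assume X: "X \<in> Obj A"
          then have "\<pi> X * u' = \<pi> X * u" using u' pu by simp
          then show "\<pi> X * (u' * x) = \<pi> X * (u * x)"
            by (simp add: assoc_mult_mat[OF pc[OF X] u'c x, symmetric] assoc_mult_mat[OF pc[OF X] u(1) x, symmetric])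
        qed (rule mult_carrier_mat[OF u'c x] mult_carrier_mat[OF u(1) x])+
      qed
    qed (use ui pu in auto)
  qed
  moreover have "is_wedge A CC T Tc Tv E \<pi>"
    unfolding is_wedge_def using Eo \<pi> dn by simp
  ultimately show ?thesis unfolding is_end_def by simp
qed

end

end

subsection \<open>Internal Homs\<close>

lemma kron_col_one:
  assumes u: "u \<in> carrier_mat n q" and A: "A \<in> carrier_mat m p"
  shows "kron u (1\<^sub>m m) * kron (1\<^sub>m q) A = kron u A"
  using u A by (simp add: kron_mult[OF u one_carrier_mat one_carrier_mat A])

lemma kron_col_mult:
  assumes u: "u \<in> carrier_mat n 1" and A: "A \<in> carrier_mat m p"
  shows "kron u (1\<^sub>m m) * A = kron u A"
  using kron_col_one[OF u A] by simp

lemma kron_comp_one: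
  assumes g: "g \<in> carrier_mat n k" and u: "u \<in> carrier_mat k q"
  shows "kron (g * u) (1\<^sub>m m) = kron g (1\<^sub>m m) * kron u (1\<^sub>m m)"
  by (simp add: kron_mult[OF g one_carrier_mat u one_carrier_mat])

text \<open>Both sides list the products of an entry (i, j) of \<open>A\<close> with entry k of
  \<open>v\<close> in the order of the digits i, j, k.\<close>

lemma vecc_kron_row:
  assumes A: "A \<in> carrier_mat n m" and v: "v \<in> carrier_mat p 1"
  shows "vecc (kron A (transpose_mat v)) = kron (vecc A) v"
proof (rule eq_matI)
  fix i j assume "i < dim_row (kron (vecc A) v)" "j < dim_col (kron (vecc A) v)"
  then have i: "i < n * m * p" and j: "j = 0" using A v by (auto simp: vecc_def)
  have i': "i < n * (m * p)" using i by (simp add: mult.assoc)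
  have vt: "transpose_mat v \<in> carrier_mat 1 p" using v by simp
  have k: "kron A (transpose_mat v) \<in> carrier_mat n (m * p)" using kron_carrier[OF A vt] by simp
  note d = div_mod_less[OF i] div_mod_less[OF i']
  have 1: "i mod (m * p) div p = i div p mod m" "i mod (m * p) mod p = i mod p" "i div (m * p) = i div p div m"
    by (cases "p = 0"; simp add: mod_mult2_eq mult.commute[of m] div_mult2_eq)+
  have "vecc (kron A (transpose_mat v)) $$ (i, 0) = kron A (transpose_mat v) $$ (i div (m * p), i mod (m * p))"
    by (rule vecc_index[OF k i'])
  also have "\<dots> = A $$ (i div p div m, i div p mod m) * v $$ (i mod p, 0)"
    using d kron_index[OF A vt, of "i div (m * p)" "i mod (m * p)"] v by (simp add: 1)
  also have "\<dots> = kron (vecc A) v $$ (i, 0)"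
    using d kron_index[OF vecc_carrier(1)[OF A] v i] by (simp add: vecc_index[OF A])
  finally show "vecc (kron A (transpose_mat v)) $$ (i, j) = kron (vecc A) v $$ (i, j)" using j by simp
qed (use A v in \<open>auto simp: vecc_def\<close>)

text \<open>The matrix of (A, v) \<mapsto> A v when \<open>A\<close> is given in flattened form; it
  converts families of matrices into single matrices on tensor products.\<close>

lemma vecc_eval:
  assumes A: "A \<in> carrier_mat n m" and v: "v \<in> carrier_mat m 1"
  shows "kron (1\<^sub>m n) (evm m) * kron (vecc A) v = A * v"
proof -
  have vt: "transpose_mat v \<in> carrier_mat 1 m" using v by simp
  have k: "kron A (transpose_mat v) \<in> carrier_mat n (m * m)" using kron_carrier[OF A vt] by simp
  have "kron (1\<^sub>m n) (evm m) * kron (vecc A) v = vecc (1\<^sub>m n * kron A (transpose_mat v) * coevm m)"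
    using vecc_mult[OF one_carrier_mat k coevm_carrier(1)] by (simp add: evm_transpose vecc_kron_row[OF A v])
  also have "1\<^sub>m n * kron A (transpose_mat v) * coevm m = A * v"
    using left_mult_one_mat[OF k] vecc_mult[OF A one_carrier_mat v] A v mult_carrier_mat[OF A v]
    by (simp add: coevm_eq_vecc vecc_col[of "A * v" n])
  finally show ?thesis using mult_carrier_mat[OF A v] by (simp add: vecc_col[of _ n])
qed

text \<open>Uncurrying: \<open>G\<close> sends \<open>co a\<close> to the flattened matrix
  \<Phi>(a), which evaluation applies to \<open>v\<close>.\<close>

lemma regular_bilinear_to_mat:
  assumes reg: "is_regular sA P co" and \<Phi>: "mlin sA n m \<Phi>"
  obtains f where "f \<in> carrier_mat n (fst P * m)"
    "\<And>a v. v \<in> carrier_mat m 1 \<Longrightarrow> f * kron (co a) v = \<Phi> a * v"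
proof -
  obtain G where G: "G \<in> carrier_mat (n * m) (fst P)" "\<And>a. G * co a = vecc (\<Phi> a)"
    by (rule regular_linear_to_mat[OF reg mlin_vecc[OF \<Phi>]]) blast
  let ?e = "kron (1\<^sub>m n) (evm m)" 
  have e: "?e \<in> carrier_mat n (n * m * m)" using kron_carrier[OF one_carrier_mat evm_carrier(1), of n m] by (simp add: mult.assoc)
  have k: "kron G (1\<^sub>m m) \<in> carrier_mat (n * m * m) (fst P * m)" by (intro kron_carrier G one_carrier_mat)
  show ?thesis
  proof (rule that[of "?e * kron G (1\<^sub>m m)"])
    fix a and v :: "'a mat" assume v: "v \<in> carrier_mat m 1"
    note c = regularD(3)[OF reg, of a]
    have "?e * kron G (1\<^sub>m m) * kron (co a) v = ?e * kron (vecc (\<Phi> a)) v"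
      using v by (simp add: assoc_mult_mat[OF e k kron_carrier[OF c v]] kron_mult[OF G(1) one_carrier_mat c v] G(2))
    then show "?e * kron G (1\<^sub>m m) * kron (co a) v = \<Phi> a * v"
      by (simp add: vecc_eval[OF mlinD(1)[OF \<Phi>] v])
  qed (rule mult_carrier_mat[OF e k])
qed

text \<open>For \<open>f : X \<triangleright> M \<rightarrow> N\<close> and \<open>x \<in> X\<close>, the map \<open>h \<otimes> m \<mapsto> f (h x \<otimes> m)\<close> from \<open>H \<triangleright> M\<close> to \<open>N\<close>,
  as a matrix-valued function of \<open>h\<close>.\<close>

definition orb :: "('k::field, 'h) rep \<Rightarrow> ('k, 'b) rep \<Rightarrow> 'k mat \<Rightarrow> 'k mat \<Rightarrow> 'h \<Rightarrow> 'k mat" where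
  "orb X M f x h = f * kron (snd X h * x) (1\<^sub>m (fst M))"

text \<open>The \<open>B\<close>-linear maps \<open>H \<triangleright> M \<rightarrow> N\<close>.\<close>

definition F_space where
  "F_space sH \<delta> M N = {\<Phi>. mlin sH (fst N) (fst M) \<Phi> \<and>
     (\<forall>b h. msum (fst N) (fst M) (\<delta> b) (\<lambda>x y. \<Phi> (x * h) * snd M y) = snd N b * \<Phi> h)}"

lemma F_spaceD: "\<Phi> \<in> F_space sH \<delta> M N \<Longrightarrow> mlin sH (fst N) (fst M) \<Phi>"
  "\<Phi> \<in> F_space sH \<delta> M N \<Longrightarrow> msum (fst N) (fst M) (\<delta> b) (\<lambda>x y. \<Phi> (x * h) * snd M y) = snd N b * \<Phi> h"
  unfolding F_space_def by blast+

context fd_comodule_algebra begin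

abbreviation (input) "CH \<equiv> H_FdMod sH \<Delta> \<epsilon> S"
abbreviation (input) "CB \<equiv> B_FdMod sB \<delta>"

lemma orb_carrier:
  assumes "X \<in> fdmods sH" "f \<in> carrier_mat n (fst X * fst M)" "x \<in> carrier_mat (fst X) 1"
  shows "orb X M f x h \<in> carrier_mat n (fst M)" "kron (snd X h * x) (1\<^sub>m (fst M)) \<in> carrier_mat (fst X * fst M) (fst M)"
proof -
  show k: "kron (snd X h * x) (1\<^sub>m (fst M)) \<in> carrier_mat (fst X * fst M) (fst M)"
    using kron_carrier[OF mult_carrier_mat[OF fdmodsD(1)[OF assms(1), of h] assms(3)] one_carrier_mat[of "fst M"]] by simp
  show "orb X M f x h \<in> carrier_mat n (fst M)" unfolding orb_def by (rule mult_carrier_mat[OF assms(2) k])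
qed

lemma orb_mlin:
  assumes X: "X \<in> fdmods sH" and f: "f \<in> carrier_mat n (fst X * fst M)" and x: "x \<in> carrier_mat (fst X) 1"
  shows "mlin sH n (fst M) (orb X M f x)"
proof -
  have "mlin sH n (1 * fst M) (\<lambda>h. f * kron (snd X h * x) (1\<^sub>m (fst M)))"
    by (intro mlin_mult_left[OF f] mlin_kron_left mlin_mult_right[OF x] fdmodsD(6)[OF X] one_carrier_mat)
  then show ?thesis by (simp add: orb_def[abs_def])
qed

lemma orb_eval:
  assumes X: "X \<in> fdmods sH" and f: "f \<in> carrier_mat n (fst X * fst M)" and x: "x \<in> carrier_mat (fst X) 1"
    and v: "v \<in> carrier_mat (fst M) p"
  shows "orb X M f x h * v = f * kron (snd X h * x) v" "orb X M f x 1 * v = f * kron x v"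
proof -
  note cX = fdmodsD(1)[OF X]
  show 1: "orb X M f x h * v = f * kron (snd X h * x) v" for h
    unfolding orb_def
    by (simp add: assoc_mult_mat[OF f orb_carrier(2)[OF X f x] v] kron_col_mult[OF mult_carrier_mat[OF cX x] v])
  show "orb X M f x 1 * v = f * kron x v" using x by (simp add: 1 fdmodsD(2)[OF X])
qed

text \<open>For fixed x, the map h \<otimes> m \<mapsto> h x \<otimes> m from H \<triangleright> M
  to X \<triangleright> M is B-linear, and so is \<open>f\<close>.\<close>

lemma orb_F_space:
  assumes X: "X \<in> fdmods sH" and M: "M \<in> fdmods sB" and N: "N \<in> fdmods sB"
    and f: "f \<in> intertwiners (tensor_rep \<delta> X M) N" and x: "x \<in> carrier_mat (fst X) 1"
  shows "orb X M f x \<in> F_space sH \<delta> M N"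
proof -
  have fc: "f \<in> carrier_mat (fst N) (fst X * fst M)" using intertwinersD(1)[OF f] by simp
  note cX = fdmodsD(1)[OF X] and cM = fdmodsD(1)[OF M] and cN = fdmodsD(1)[OF N]
  have "msum (fst N) (fst M) (\<delta> b) (\<lambda>u v. orb X M f x (u * h) * snd M v) = snd N b * orb X M f x h" for b h
  proof -
    let ?k = "kron (snd X h * x) (1\<^sub>m (fst M))"
    note kc = orb_carrier(2)[OF X fc x]
    note Xh = mult_carrier_mat[OF cX x, of h]
    have kk: "kron (snd X u * (snd X h * x)) (snd M v) \<in> carrier_mat (fst X * fst M) (fst M)" for u v
      using kron_carrier[OF mult_carrier_mat[OF cX Xh] cM] by simp
    have "snd N b * orb X M f x h = f * tensor_act (\<delta> b) X M * ?k"
      unfolding orb_def using assoc_mult_mat[OF cN fc kc] intertwinersD(2)[OF f] by (simp add: snd_tensor_rep)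
    also have "\<dots> = f * (tensor_act (\<delta> b) X M * ?k)"
      by (rule assoc_mult_mat[OF fc tensor_act_carrier kc])
    also have "tensor_act (\<delta> b) X M * ?k = msum (fst X * fst M) (fst M) (\<delta> b) (\<lambda>u v. kron (snd X u * (snd X h * x)) (snd M v))"
      unfolding tensor_act_msum msum_mult_right[OF kc kron_carrier[OF cX cM]]
      by (simp add: kron_mult[OF cX cM Xh one_carrier_mat] right_mult_one_mat[OF cM])
    also have "f * \<dots> = msum (fst N) (fst M) (\<delta> b) (\<lambda>u v. f * kron (snd X u * (snd X h * x)) (snd M v))"
      by (rule msum_mult_left[OF fc kk])
    also have "\<dots> = msum (fst N) (fst M) (\<delta> b) (\<lambda>u v. orb X M f x (u * h) * snd M v)"
      by (simp add: orb_eval(1)[OF X fc x cM] fdmodsD(3)[OF X] assoc_mult_mat[OF cX cX x])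
    finally show ?thesis by simp
  qed
  then show ?thesis unfolding F_space_def using orb_mlin[OF X fc x] by blast
qed

text \<open>Turns the equation in the universal property, where a map is precomposed with
  \<open>g\<close> on the first factor, into one about the vector \<open>g * x\<close>.\<close>

lemma orb_comp:
  assumes X: "X \<in> fdmods sH" and Y: "Y \<in> fdmods sH" and g: "g \<in> intertwiners X Y"
    and f: "f \<in> carrier_mat n (fst Y * fst M)" and x: "x \<in> carrier_mat (fst X) 1"
  shows "orb Y M f (g * x) = orb X M (f * kron g (1\<^sub>m (fst M))) x"
proof
  fix h
  note gc = intertwinersD(1)[OF g] and cX = fdmodsD(1)[OF X] and cY = fdmodsD(1)[OF Y]
  have "snd Y h * (g * x) = g * (snd X h * x)"
    by (simp add: assoc_mult_mat[OF cY gc x, symmetric] intertwinersD(2)[OF g, symmetric] assoc_mult_mat[OF gc cX x])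
  moreover have k: "kron (snd X h * x) (1\<^sub>m (fst M)) \<in> carrier_mat (fst X * fst M) (fst M)"
    using kron_carrier[OF mult_carrier_mat[OF cX[of h] x] one_carrier_mat[of "fst M"]] by simp
  ultimately show "orb Y M f (g * x) h = orb X M (f * kron g (1\<^sub>m (fst M))) x h"
    unfolding orb_def
    by (simp add: kron_comp_one[OF gc mult_carrier_mat[OF cX x]] assoc_mult_mat[OF f kron_carrier[OF gc one_carrier_mat] k])
qed

lemma orb_add:
  assumes X: "X \<in> fdmods sH" and f: "f \<in> carrier_mat n (fst X * fst M)"
    and x: "x \<in> carrier_mat (fst X) 1" and y: "y \<in> carrier_mat (fst X) 1"
  shows "orb X M f (x + y) h = orb X M f x h + orb X M f y h"
  unfolding orb_def
  by (simp add: mult_add_distrib_mat[OF fdmodsD(1)[OF X] x y]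
      kron_add_left[OF mult_carrier_mat[OF fdmodsD(1)[OF X] x] mult_carrier_mat[OF fdmodsD(1)[OF X] y]]
      mult_add_distrib_mat[OF f orb_carrier(2)[OF X f x] orb_carrier(2)[OF X f y]])

lemma orb_smult:
  assumes X: "X \<in> fdmods sH" and f: "f \<in> carrier_mat n (fst X * fst M)" and x: "x \<in> carrier_mat (fst X) 1"
  shows "orb X M f (c \<cdot>\<^sub>m x) h = c \<cdot>\<^sub>m orb X M f x h"
  unfolding orb_def
  by (simp add: mult_smult_distrib[OF fdmodsD(1)[OF X] x] kron_smult_left mult_smult_distrib[OF f orb_carrier(2)[OF X f x]])

lemma orb_act:
  assumes X: "X \<in> fdmods sH" and x: "x \<in> carrier_mat (fst X) 1"
  shows "orb X M f (snd X a * x) h = orb X M f x (h * a)"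
  unfolding orb_def by (simp add: fdmodsD(3)[OF X] assoc_mult_mat[OF fdmodsD(1)[OF X] fdmodsD(1)[OF X] x])

lemma mat_eq_orb:
  assumes X: "X \<in> fdmods sH" and f: "f \<in> carrier_mat n (fst X * fst M)" and g: "g \<in> carrier_mat n (fst X * fst M)"
    and eq: "\<And>x. x \<in> carrier_mat (fst X) 1 \<Longrightarrow> orb X M f x 1 = orb X M g x 1"
  shows "f = g"
proof (rule mat_eq_kron_cols[OF f g])
  fix u v :: "'k mat" assume u: "u \<in> carrier_mat (fst X) 1" and v: "v \<in> carrier_mat (fst M) 1"
  show "f * kron u v = g * kron u v"
    using orb_eval(2)[OF X f u v] orb_eval(2)[OF X g u v] eq[OF u] by simp
qed

lemma F_space_right_mult:
  assumes \<Phi>: "\<Phi> \<in> F_space sH \<delta> M N" shows "(\<lambda>h. \<Phi> (h * a)) \<in> F_space sH \<delta> M N"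
proof -
  have "mlin sH (fst N) (fst M) (\<lambda>h. \<Phi> (h * a))" by (intro mlin_comp[OF F_spaceD(1)[OF \<Phi>]] H.lin_rules)
  then show ?thesis unfolding F_space_def using F_spaceD(2)[OF \<Phi>] by (simp add: mult.assoc)
qed

text \<open>Converse of \<open>orb_F_space\<close>: on the pure tensor of \<open>u\<close> and
  \<open>v\<close> the B-linearity of \<open>f\<close> is that of the orbit map of \<open>u\<close>,
  taken at h = 1.\<close>

lemma F_space_imp_intertwiner:
  assumes X: "X \<in> fdmods sH" and M: "M \<in> fdmods sB" and N: "N \<in> fdmods sB"
    and fc: "f \<in> carrier_mat (fst N) (fst X * fst M)"
    and F: "\<And>x. x \<in> carrier_mat (fst X) 1 \<Longrightarrow> orb X M f x \<in> F_space sH \<delta> M N"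
  shows "f \<in> intertwiners (tensor_rep \<delta> X M) N"
proof (rule intertwinersI)
  note cX = fdmodsD(1)[OF X] and cM = fdmodsD(1)[OF M] and cN = fdmodsD(1)[OF N]
  fix b
  show "f * snd (tensor_rep \<delta> X M) b = snd N b * f"
    unfolding snd_tensor_rep
  proof (rule mat_eq_kron_cols[OF mult_carrier_mat[OF fc tensor_act_carrier] mult_carrier_mat[OF cN fc]])
    fix u v :: "'k mat" assume u: "u \<in> carrier_mat (fst X) 1" and v: "v \<in> carrier_mat (fst M) 1"
    note \<Phi> = F[OF u]
    note \<Phi>c = mlinD(1)[OF F_spaceD(1)[OF \<Phi>]]
    have kc: "kron u v \<in> carrier_mat (fst X * fst M) 1" using kron_carrier[OF u v] by simp
    have k2: "kron (snd X x * u) (snd M y * v) \<in> carrier_mat (fst X * fst M) 1" for x y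
      using kron_carrier[OF mult_carrier_mat[OF cX u] mult_carrier_mat[OF cM v]] by simp
    have "f * tensor_act (\<delta> b) X M * kron u v = f * (tensor_act (\<delta> b) X M * kron u v)"
      by (rule assoc_mult_mat[OF fc tensor_act_carrier kc])
    also have "tensor_act (\<delta> b) X M * kron u v = msum (fst X * fst M) 1 (\<delta> b) (\<lambda>x y. kron (snd X x * u) (snd M y * v))"
      unfolding tensor_act_msum msum_mult_right[OF kc kron_carrier[OF cX cM]]
      by (simp only: kron_mult[OF cX cM u v])
    also have "f * \<dots> = msum (fst N) 1 (\<delta> b) (\<lambda>x y. f * kron (snd X x * u) (snd M y * v))"
      by (rule msum_mult_left[OF fc k2])
    also have "\<dots> = msum (fst N) 1 (\<delta> b) (\<lambda>x y. orb X M f u (x * 1) * snd M y * v)"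
      by (simp add: orb_eval(1)[OF X fc u mult_carrier_mat[OF cM v]] assoc_mult_mat[OF \<Phi>c cM v])
    also have "\<dots> = msum (fst N) (fst M) (\<delta> b) (\<lambda>x y. orb X M f u (x * 1) * snd M y) * v"
      by (rule msum_mult_right[OF v mult_carrier_mat[OF \<Phi>c cM], symmetric])
    also have "\<dots> = snd N b * f * kron u v"
      by (simp only: F_spaceD(2)[OF \<Phi>] assoc_mult_mat[OF cN \<Phi>c v] orb_eval(2)[OF X fc u v] assoc_mult_mat[OF cN fc kc])
    finally show "f * tensor_act (\<delta> b) X M * kron u v = snd N b * f * kron u v" .
  qed
qed (simp add: fc)

text \<open>Given f : X \<triangleright> M \<rightarrow> N, a vector x has to be sent to the unique
  vector with the same orbit map; linearity and H-equivariance follow because \<open>orb\<close> is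
  injective and compatible with both structures.\<close>

lemma internal_homI:
  assumes ih: "\<And>M N. M \<in> fdmods sB \<Longrightarrow> N \<in> fdmods sB \<Longrightarrow> ih M N \<in> fdmods sH"
    and iev: "\<And>M N. M \<in> fdmods sB \<Longrightarrow> N \<in> fdmods sB \<Longrightarrow> iev M N \<in> intertwiners (tensor_rep \<delta> (ih M N) M) N"
    and bij: "\<And>M N. M \<in> fdmods sB \<Longrightarrow> N \<in> fdmods sB \<Longrightarrow>
      bij_betw (orb (ih M N) M (iev M N)) (carrier_mat (fst (ih M N)) 1) (F_space sH \<delta> M N)"
  shows "internal_hom CH CB ih iev"
  unfolding internal_hom_def H_FdMod_simps B_FdMod_simps
proof (intro ballI conjI ih iev)
  fix M N X f assume M: "M \<in> fdmods sB" and N: "N \<in> fdmods sB" and X: "X \<in> fdmods sH"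
    and f: "f \<in> intertwiners (tensor_rep \<delta> X M) N"
  let ?I = "ih M N" and ?e = "iev M N"
  note I = ih[OF M N] and e = iev[OF M N]
  have fc: "f \<in> carrier_mat (fst N) (fst X * fst M)" using intertwinersD(1)[OF f] by simp
  have ec: "?e \<in> carrier_mat (fst N) (fst ?I * fst M)" using intertwinersD(1)[OF e] by simp
  note oF = orb_F_space[OF X M N f]
  have inj: "v = w" if "v \<in> carrier_mat (fst ?I) 1" "w \<in> carrier_mat (fst ?I) 1"
      "\<And>h. orb ?I M ?e v h = orb ?I M ?e w h" for v w
    using bij[OF M N] that unfolding bij_betw_def inj_on_def by blast
  have "\<exists>v\<in>carrier_mat (fst ?I) 1. orb ?I M ?e v = orb X M f x" if "x \<in> carrier_mat (fst X) 1" for x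
    using bij[OF M N] oF[OF that] unfolding bij_betw_def by (metis imageE)
  then obtain g where g: "\<And>x. x \<in> carrier_mat (fst X) 1 \<Longrightarrow> g x \<in> carrier_mat (fst ?I) 1"
    "\<And>x. x \<in> carrier_mat (fst X) 1 \<Longrightarrow> orb ?I M ?e (g x) = orb X M f x" by metis
  obtain G where G: "G \<in> carrier_mat (fst ?I) (fst X)" "\<And>x. x \<in> carrier_mat (fst X) 1 \<Longrightarrow> G * x = g x"
  proof (rule linear_to_mat[of "fst X" g "fst ?I"])
    fix x y :: "'k mat" assume xy: "x \<in> carrier_mat (fst X) 1" "y \<in> carrier_mat (fst X) 1"
    have xy': "x + y \<in> carrier_mat (fst X) 1" using xy by simp
    show "g (x + y) = g x + g y"
      by (rule inj) (use xy g(1)[OF xy(1)] g(1)[OF xy(2)] g(1)[OF xy'] in \<open>simp_all add: g(2) xy' orb_add[OF I ec] orb_add[OF X fc]\<close>)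
  next
    fix c and x :: "'k mat" assume x: "x \<in> carrier_mat (fst X) 1"
    have x': "c \<cdot>\<^sub>m x \<in> carrier_mat (fst X) 1" using x by simp
    show "g (c \<cdot>\<^sub>m x) = c \<cdot>\<^sub>m g x"
      by (rule inj) (use x g(1)[OF x] g(1)[OF x'] in \<open>simp_all add: g(2) x' orb_smult[OF I ec] orb_smult[OF X fc]\<close>)
  qed (use g(1) in auto)
  have Gi: "G \<in> intertwiners X ?I"
  proof (rule intertwinersI[OF G(1)])
    fix a
    note cX = fdmodsD(1)[OF X, of a] and cI = fdmodsD(1)[OF I, of a]
    show "G * snd X a = snd ?I a * G"
    proof (rule mat_eq_cols[OF mult_carrier_mat[OF G(1) cX] mult_carrier_mat[OF cI G(1)]])
      fix x :: "'k mat" assume x: "x \<in> carrier_mat (fst X) 1"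
      note ax = mult_carrier_mat[OF cX x] and Gx = mult_carrier_mat[OF G(1) x]
      have "G * (snd X a * x) = snd ?I a * (G * x)"
      proof (rule inj)
        fix h
        have "orb ?I M ?e (G * (snd X a * x)) h = orb X M f (snd X a * x) h" by (simp only: G(2)[OF ax] g(2)[OF ax])
        also have "\<dots> = orb X M f x (h * a)" by (rule orb_act[OF X x])
        also have "\<dots> = orb ?I M ?e (snd ?I a * (G * x)) h"
          by (simp only: G(2)[OF x] orb_act[OF I g(1)[OF x]] g(2)[OF x])
        finally show "orb ?I M ?e (G * (snd X a * x)) h = orb ?I M ?e (snd ?I a * (G * x)) h" .
      qed (rule mult_carrier_mat[OF G(1) ax] mult_carrier_mat[OF cI Gx])+
      then show "G * snd X a * x = snd ?I a * G * x"
        by (simp add: assoc_mult_mat[OF G(1) cX x] assoc_mult_mat[OF cI G(1) x])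
    qed
  qed
  have k: "?e * kron g' (1\<^sub>m (fst M)) \<in> carrier_mat (fst N) (fst X * fst M)" if "g' \<in> carrier_mat (fst ?I) (fst X)" for g'
    by (rule mult_carrier_mat[OF ec kron_carrier[OF that one_carrier_mat]])
  show "\<exists>!g. g \<in> intertwiners X ?I \<and> ?e * kron g (1\<^sub>m (fst M)) = f"
  proof (rule ex1I[of _ G])
    have "?e * kron G (1\<^sub>m (fst M)) = f"
      by (rule mat_eq_orb[OF X k[OF G(1)] fc]) (simp only: orb_comp[OF X I Gi ec, symmetric] G(2) g(2))
    then show "G \<in> intertwiners X ?I \<and> ?e * kron G (1\<^sub>m (fst M)) = f" using Gi by simp
    fix g' assume g': "g' \<in> intertwiners X ?I \<and> ?e * kron g' (1\<^sub>m (fst M)) = f"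
    then have g'c: "g' \<in> carrier_mat (fst ?I) (fst X)" by (auto dest: intertwinersD(1))
    show "g' = G"
    proof (rule mat_eq_cols[OF g'c G(1)])
      fix x :: "'k mat" assume x: "x \<in> carrier_mat (fst X) 1"
      have "orb ?I M ?e (g' * x) = orb X M f x" using orb_comp[OF X I _ ec x, of g'] g' by simp
      then show "g' * x = G * x"
        by (intro inj[OF mult_carrier_mat[OF g'c x] mult_carrier_mat[OF G(1) x]]) (simp add: G(2)[OF x] g(2)[OF x])
    qed
  qed
qed

context
  fixes ih iev
  assumes hom: "internal_hom CH CB ih iev"
begin

lemma ih_fdmods: "M \<in> fdmods sB \<Longrightarrow> N \<in> fdmods sB \<Longrightarrow> ih M N \<in> fdmods sH"
  and iev_intertwiner: "M \<in> fdmods sB \<Longrightarrow> N \<in> fdmods sB \<Longrightarrow> iev M N \<in> intertwiners (tensor_rep \<delta> (ih M N) M) N"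
  and iev_carrier: "M \<in> fdmods sB \<Longrightarrow> N \<in> fdmods sB \<Longrightarrow> iev M N \<in> carrier_mat (fst N) (fst (ih M N) * fst M)"
  and ih_universal: "M \<in> fdmods sB \<Longrightarrow> N \<in> fdmods sB \<Longrightarrow> X \<in> fdmods sH \<Longrightarrow> f \<in> intertwiners (tensor_rep \<delta> X M) N \<Longrightarrow>
     \<exists>!g. g \<in> intertwiners X (ih M N) \<and> iev M N * kron g (1\<^sub>m (fst M)) = f"
proof -
  have h: "\<forall>M\<in>fdmods sB. \<forall>N\<in>fdmods sB. ih M N \<in> fdmods sH \<and> iev M N \<in> intertwiners (tensor_rep \<delta> (ih M N) M) N \<and>
     (\<forall>X\<in>fdmods sH. \<forall>f\<in>intertwiners (tensor_rep \<delta> X M) N.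
       \<exists>!g. g \<in> intertwiners X (ih M N) \<and> iev M N * kron g (1\<^sub>m (fst M)) = f)"
    using hom unfolding internal_hom_def H_FdMod_simps B_FdMod_simps .
  then show "M \<in> fdmods sB \<Longrightarrow> N \<in> fdmods sB \<Longrightarrow> ih M N \<in> fdmods sH"
    and e: "M \<in> fdmods sB \<Longrightarrow> N \<in> fdmods sB \<Longrightarrow> iev M N \<in> intertwiners (tensor_rep \<delta> (ih M N) M) N"
    and "M \<in> fdmods sB \<Longrightarrow> N \<in> fdmods sB \<Longrightarrow> X \<in> fdmods sH \<Longrightarrow> f \<in> intertwiners (tensor_rep \<delta> X M) N \<Longrightarrow>
     \<exists>!g. g \<in> intertwiners X (ih M N) \<and> iev M N * kron g (1\<^sub>m (fst M)) = f"
    by blast+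
  show "M \<in> fdmods sB \<Longrightarrow> N \<in> fdmods sB \<Longrightarrow> iev M N \<in> carrier_mat (fst N) (fst (ih M N) * fst M)"
    using intertwinersD(1)[OF e] by simp
qed

abbreviation (input) "oev M N \<equiv> orb (ih M N) M (iev M N)"

text \<open>The universal property tested on the regular H-module: module maps from H to ih M N are
  vectors of ih M N, and B-linear maps from H \<triangleright> M to N are the elements of
  \<open>F_space\<close>.\<close>

lemma oev_bij:
  assumes M: "M \<in> fdmods sB" and N: "N \<in> fdmods sB"
  shows "bij_betw (oev M N) (carrier_mat (fst (ih M N)) 1) (F_space sH \<delta> M N)"
proof -
  obtain P co where P: "is_regular sH P co" by (rule H.regular_exists)
  note r = regularD[OF P]
  let ?I = "ih M N" and ?e = "iev M N"
  note I = ih_fdmods[OF M N] and ec = iev_carrier[OF M N] and e = iev_intertwiner[OF M N]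
  note cM = fdmodsD(1)[OF M] and cN = fdmodsD(1)[OF N] and cI = fdmodsD(1)[OF I] and cP = fdmodsD(1)[OF r(1)]
  have inj: "v = w" if v: "v \<in> carrier_mat (fst ?I) 1" and w: "w \<in> carrier_mat (fst ?I) 1"
    and eq: "oev M N v = oev M N w" for v w
  proof -
    obtain f where f: "f \<in> intertwiners P ?I" "\<And>a. f * co a = snd ?I a * v" by (rule regular_orbit_map[OF P I v]) blast
    obtain g where g: "g \<in> intertwiners P ?I" "\<And>a. g * co a = snd ?I a * w" by (rule regular_orbit_map[OF P I w]) blast
    note fc = intertwinersD(1)[OF f(1)] and gc = intertwinersD(1)[OF g(1)]
    have "?e * kron g (1\<^sub>m (fst M)) = ?e * kron f (1\<^sub>m (fst M))"
    proof (rule mat_eq_orb[OF r(1) mult_carrier_mat[OF ec kron_carrier[OF gc one_carrier_mat]]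
          mult_carrier_mat[OF ec kron_carrier[OF fc one_carrier_mat]]])
      fix x :: "'k mat" assume x: "x \<in> carrier_mat (fst P) 1"
      then obtain a where a: "x = co a" using r(5) by blast
      have "orb ?I M ?e (g * x) 1 = orb ?I M ?e (f * x) 1"
        unfolding a f(2) g(2) orb_act[OF I v] orb_act[OF I w] eq ..
      then show "orb P M (?e * kron g (1\<^sub>m (fst M))) x 1 = orb P M (?e * kron f (1\<^sub>m (fst M))) x 1"
        by (simp only: orb_comp[OF r(1) I g(1) ec x] orb_comp[OF r(1) I f(1) ec x])
    qed
    moreover have "?e * kron f (1\<^sub>m (fst M)) \<in> intertwiners (tensor_rep \<delta> P M) N"
      by (rule intertwiners_comp[OF tensor_rep_fdmods[OF r(1) M] tensor_rep_fdmods[OF I M] N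
            intertwiners_tensor(2)[OF r(1) I M M f(1) one_intertwiners[OF M]] e])
    ultimately have "f = g" using ih_universal[OF M N r(1)] f(1) g(1) by blast
    then have "snd ?I 1 * v = snd ?I 1 * w" using f(2)[of 1] g(2)[of 1] by simp
    then show "v = w" using v w by (simp add: fdmodsD(2)[OF I])
  qed
  have surj: "\<exists>v\<in>carrier_mat (fst ?I) 1. \<Phi> = oev M N v" if \<Phi>: "\<Phi> \<in> F_space sH \<delta> M N" for \<Phi>
  proof -
    note \<Phi>l = F_spaceD(1)[OF \<Phi>] and \<Phi>c = mlinD(1)[OF F_spaceD(1)[OF \<Phi>]]
    obtain f where fc: "f \<in> carrier_mat (fst N) (fst P * fst M)"
      and f: "\<And>a v. v \<in> carrier_mat (fst M) 1 \<Longrightarrow> f * kron (co a) v = \<Phi> a * v"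
      by (rule regular_bilinear_to_mat[OF P \<Phi>l]) blast
    have f1: "orb P M f (co a) 1 = \<Phi> a" for a
    proof (rule mat_eq_cols[OF orb_carrier(1)[OF r(1) fc r(3)] \<Phi>c])
      fix v :: "'k mat" assume v: "v \<in> carrier_mat (fst M) 1"
      show "orb P M f (co a) 1 * v = \<Phi> a * v" by (simp only: orb_eval(2)[OF r(1) fc r(3) v] f[OF v])
    qed
    have fi: "f \<in> intertwiners (tensor_rep \<delta> P M) N"
    proof (rule F_space_imp_intertwiner[OF r(1) M N fc])
      fix x :: "'k mat" assume "x \<in> carrier_mat (fst P) 1"
      then obtain a where a: "x = co a" using r(5) by blast
      have "orb P M f x = (\<lambda>h. \<Phi> (h * a))"
        using orb_act[OF r(1) r(3), of M f _ a 1] by (intro ext) (simp add: a r(4) f1[symmetric])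
      then show "orb P M f x \<in> F_space sH \<delta> M N" by (simp add: F_space_right_mult[OF \<Phi>])
    qed
    obtain g where g: "g \<in> intertwiners P ?I" "?e * kron g (1\<^sub>m (fst M)) = f"
      using ih_universal[OF M N r(1) fi] by blast
    have "oev M N (g * co 1) h = \<Phi> h" for h
    proof -
      have "oev M N (g * co 1) h = orb P M f (co 1) h" by (simp only: orb_comp[OF r(1) I g(1) ec r(3)] g(2))
      also have "\<dots> = orb P M f (snd P h * co 1) 1" by (simp add: orb_act[OF r(1) r(3)])
      finally show ?thesis by (simp add: r(4) f1)
    qed
    then have "\<Phi> = oev M N (g * co 1)" by (intro ext) simp
    then show ?thesis by (rule bexI) (rule mult_carrier_mat[OF intertwinersD(1)[OF g(1)] r(3)])
  qed
  show ?thesis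
    by (rule bij_betwI') (use inj surj orb_F_space[OF I M N e] in auto)
qed

lemma oev_inj:
  assumes "M \<in> fdmods sB" "N \<in> fdmods sB" "v \<in> carrier_mat (fst (ih M N)) 1" "w \<in> carrier_mat (fst (ih M N)) 1"
    "\<And>h. oev M N v h = oev M N w h"
  shows "v = w"
proof -
  have "oev M N v = oev M N w" using assms(5) by (rule ext)
  then show ?thesis using oev_bij[OF assms(1,2)] assms(3,4) unfolding bij_betw_def inj_on_def by blast
qed

text \<open>Elementwise form of the adjunction. The structure maps of internal Homs are defined as
  adjuncts, so their effect on orbit maps can be read off from it.\<close>

lemma adjunct_props:
  assumes M: "M \<in> fdmods sB" and N: "N \<in> fdmods sB" and X: "X \<in> fdmods sH" and f: "f \<in> intertwiners (tensor_rep \<delta> X M) N"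
  shows "internal_hom_data.adjunct CH CB ih iev X M N f \<in> intertwiners X (ih M N)"
    "x \<in> carrier_mat (fst X) 1 \<Longrightarrow> oev M N (internal_hom_data.adjunct CH CB ih iev X M N f * x) = orb X M f x"
proof -
  let ?a = "internal_hom_data.adjunct CH CB ih iev X M N f"
  have "?a = (THE g. g \<in> intertwiners X (ih M N) \<and> iev M N * kron g (1\<^sub>m (fst M)) = f)"
    unfolding internal_hom_data.adjunct_def by simp
  with theI'[OF ih_universal[OF M N X f]] have a: "?a \<in> intertwiners X (ih M N)" "iev M N * kron ?a (1\<^sub>m (fst M)) = f"
    by simp_all
  show "?a \<in> intertwiners X (ih M N)" by fact
  show "oev M N (?a * x) = orb X M f x" if x: "x \<in> carrier_mat (fst X) 1"
    by (simp only: orb_comp[OF X ih_fdmods[OF M N] a(1) iev_carrier[OF M N] x] a(2))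
qed

lemma ih_cov_props:
  assumes M: "M \<in> fdmods sB" and N: "N \<in> fdmods sB" and N': "N' \<in> fdmods sB" and f: "f \<in> intertwiners N N'"
  shows "internal_hom_data.ih_cov CH CB ih iev N N' M f \<in> intertwiners (ih M N) (ih M N')"
    "x \<in> carrier_mat (fst (ih M N)) 1 \<Longrightarrow> oev M N' (internal_hom_data.ih_cov CH CB ih iev N N' M f * x) h = f * oev M N x h"
proof -
  note I = ih_fdmods[OF M N]
  have fi: "f * iev M N \<in> intertwiners (tensor_rep \<delta> (ih M N) M) N'"
    by (rule intertwiners_comp[OF tensor_rep_fdmods[OF I M] N N' iev_intertwiner[OF M N] f])
  have d: "internal_hom_data.ih_cov CH CB ih iev N N' M f = internal_hom_data.adjunct CH CB ih iev (ih M N) M N' (f * iev M N)"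
    unfolding internal_hom_data.ih_cov_def by simp
  show "internal_hom_data.ih_cov CH CB ih iev N N' M f \<in> intertwiners (ih M N) (ih M N')"
    unfolding d by (rule adjunct_props(1)[OF M N' I fi])
  show "oev M N' (internal_hom_data.ih_cov CH CB ih iev N N' M f * x) h = f * oev M N x h" if x: "x \<in> carrier_mat (fst (ih M N)) 1"
    unfolding d adjunct_props(2)[OF M N' I fi x]
    by (simp add: orb_def assoc_mult_mat[OF intertwinersD(1)[OF f] iev_carrier[OF M N] orb_carrier(2)[OF I iev_carrier[OF M N] x]])
qed

lemma ih_con_props:
  assumes M: "M \<in> fdmods sB" and M': "M' \<in> fdmods sB" and N: "N \<in> fdmods sB" and f: "f \<in> intertwiners M M'"
  shows "internal_hom_data.ih_con CH CB ih iev M M' N f \<in> intertwiners (ih M' N) (ih M N)"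
    "x \<in> carrier_mat (fst (ih M' N)) 1 \<Longrightarrow> oev M N (internal_hom_data.ih_con CH CB ih iev M M' N f * x) h = oev M' N x h * f"
proof -
  note I = ih_fdmods[OF M' N] and fc = intertwinersD(1)[OF f]
  let ?k = "kron (1\<^sub>m (fst (ih M' N))) f"
  have fi: "iev M' N * ?k \<in> intertwiners (tensor_rep \<delta> (ih M' N) M) N"
    by (rule intertwiners_comp[OF tensor_rep_fdmods[OF I M] tensor_rep_fdmods[OF I M'] N
          intertwiners_tensor(2)[OF I I M M' one_intertwiners[OF I] f] iev_intertwiner[OF M' N]])
  have d: "internal_hom_data.ih_con CH CB ih iev M M' N f = internal_hom_data.adjunct CH CB ih iev (ih M' N) M N (iev M' N * ?k)"
    unfolding internal_hom_data.ih_con_def by simp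
  show "internal_hom_data.ih_con CH CB ih iev M M' N f \<in> intertwiners (ih M' N) (ih M N)"
    unfolding d by (rule adjunct_props(1)[OF M N I fi])
  show "oev M N (internal_hom_data.ih_con CH CB ih iev M M' N f * x) h = oev M' N x h * f" if x: "x \<in> carrier_mat (fst (ih M' N)) 1"
  proof -
    note hx = mult_carrier_mat[OF fdmodsD(1)[OF I, of h] x]
    have k2: "kron (snd (ih M' N) h * x) (1\<^sub>m (fst M)) \<in> carrier_mat (fst (ih M' N) * fst M) (fst M)"
      using kron_carrier[OF hx one_carrier_mat, of "fst M"] by simp
    have "?k * kron (snd (ih M' N) h * x) (1\<^sub>m (fst M)) = kron (snd (ih M' N) h * x) f"
      using left_mult_one_mat[OF hx] right_mult_one_mat[OF fc]
      by (simp add: kron_mult[OF one_carrier_mat fc hx one_carrier_mat])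
    then show ?thesis
      unfolding d adjunct_props(2)[OF M N I fi x]
      by (simp add: orb_def[of _ M] orb_eval(1)[OF I iev_carrier[OF M' N] x fc]
        assoc_mult_mat[OF iev_carrier[OF M' N] kron_carrier[OF one_carrier_mat fc] k2])
  qed
qed

lemma ih_coev_props:
  assumes M: "M \<in> fdmods sB"
  shows "internal_hom_data.ih_coev CH CB ih iev M \<in> intertwiners H.unit_rep (ih M M)"
    "oev M M (internal_hom_data.ih_coev CH CB ih iev M) h = \<epsilon> h \<cdot>\<^sub>m 1\<^sub>m (fst M)"
proof -
  have i: "1\<^sub>m (fst M) \<in> intertwiners (tensor_rep \<delta> H.unit_rep M) M"
    by (simp only: tensor_rep_unit[OF M] one_intertwiners[OF M])
  have d: "internal_hom_data.ih_coev CH CB ih iev M = internal_hom_data.adjunct CH CB ih iev H.unit_rep M M (1\<^sub>m (fst M))"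
    unfolding internal_hom_data.ih_coev_def by simp
  show c: "internal_hom_data.ih_coev CH CB ih iev M \<in> intertwiners H.unit_rep (ih M M)"
    unfolding d by (rule adjunct_props(1)[OF M M H.unit_rep_fdmods i])
  have "internal_hom_data.ih_coev CH CB ih iev M * 1\<^sub>m 1 = internal_hom_data.ih_coev CH CB ih iev M"
    using intertwinersD(1)[OF c] by simp
  then have "oev M M (internal_hom_data.ih_coev CH CB ih iev M) h = orb H.unit_rep M (1\<^sub>m (fst M)) (1\<^sub>m 1) h"
    using adjunct_props(2)[OF M M H.unit_rep_fdmods i, of "1\<^sub>m 1", folded d] by simp
  also have "\<dots> = \<epsilon> h \<cdot>\<^sub>m 1\<^sub>m (fst M)"
    unfolding orb_def snd_conv by (simp add: scalar_mult[OF one_carrier_mat, simplified] kron_smult_left)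
  finally show "oev M M (internal_hom_data.ih_coev CH CB ih iev M) h = \<epsilon> h \<cdot>\<^sub>m 1\<^sub>m (fst M)" .
qed

end

end

lemma msum_smult:
  assumes "\<And>a b. F a b \<in> carrier_mat n m"
  shows "msum n m t (\<lambda>a b. c \<cdot>\<^sub>m F a b) = c \<cdot>\<^sub>m msum n m t F"
proof (rule msum_eqI)
  fix i j assume ij: "i < n" "j < m"
  have l: "lin (*) (*) (\<lambda>x. c * x)" by (auto simp: lin_def algebra_simps)
  have d: "dim_row (F a b) = n" "dim_col (F a b) = m" for a b using assms[of a b] by auto
  show "sw t (\<lambda>a b. (c \<cdot>\<^sub>m F a b) $$ (i, j)) = (c \<cdot>\<^sub>m msum n m t F) $$ (i, j)"
    using ij by (simp add: d lin_sw[OF l] msum_def)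
qed simp

lemma msum_add:
  assumes "\<And>a b. F a b \<in> carrier_mat n m" "\<And>a b. G a b \<in> carrier_mat n m"
  shows "msum n m t (\<lambda>a b. F a b + G a b) = msum n m t F + msum n m t G"
proof -
  have "dim_row (G a b) = n" "dim_col (G a b) = m" for a b using assms(2)[of a b] by auto
  then show ?thesis by (auto intro!: eq_matI simp: msum_def sw_add)
qed

text \<open>The antipode inverts the \<open>H\<close>-action on the first factor: \<open>\<Psi> h = h\<^sub>1 S(h\<^sub>2) \<Psi> h\<^sub>3\<close>.\<close>

lemma (in fd_hopf_algebra) antipode_contract_inj:
  assumes X: "X \<in> fdmods sH" and \<Psi>: "mlin sH (fst X * n) m \<Psi>" and \<Psi>': "mlin sH (fst X * n) m \<Psi>'"
    and eq: "\<And>c h. c \<in> carrier_mat 1 (fst X) \<Longrightarrow>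
      msum n m (\<Delta> h) (\<lambda>a b. kron (c * snd X (S a)) (1\<^sub>m n) * \<Psi> b) =
      msum n m (\<Delta> h) (\<lambda>a b. kron (c * snd X (S a)) (1\<^sub>m n) * \<Psi>' b)"
  shows "\<Psi> h = \<Psi>' h"
proof -
  let ?k = "fst X * n"
  note cX = fdmodsD(1)[OF X]
  \<comment> \<open>The transform S(h1) \<Phi>(h2), acting on the X leg. The hypothesis compares its
    contractions with all functionals \<open>c\<close>, and these determine it.\<close>
  define V where "V \<Phi> h = msum ?k m (\<Delta> h) (\<lambda>a b. kron (snd X (S a)) (1\<^sub>m n) * \<Phi> b)" for \<Phi> h
  have kc: "kron (snd X a) (1\<^sub>m n) \<in> carrier_mat ?k ?k" for a by (intro kron_carrier cX one_carrier_mat)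
  have V1: "kron c (1\<^sub>m n) * V \<Phi> h = msum n m (\<Delta> h) (\<lambda>a b. kron (c * snd X (S a)) (1\<^sub>m n) * \<Phi> b)"
    if c: "c \<in> carrier_mat 1 (fst X)" and \<Phi>: "mlin sH ?k m \<Phi>" for c \<Phi> h
  proof -
    have cc: "kron c (1\<^sub>m n) \<in> carrier_mat n ?k" using kron_carrier[OF c one_carrier_mat[of n]] by simp
    show ?thesis unfolding V_def msum_mult_left[OF cc mult_carrier_mat[OF kc mlinD(1)[OF \<Phi>]]]
      by (simp add: assoc_mult_mat[OF cc kc mlinD(1)[OF \<Phi>], symmetric] kron_comp_one[OF c cX])
  qed
  have V2: "V \<Psi> h = V \<Psi>' h" for h
    by (rule col_eq_contract[of _ "fst X" n m]) (simp_all add: V1 \<Psi> \<Psi>' eq, simp_all add: V_def)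
  have V3: "\<Phi> h = msum ?k m (\<Delta> h) (\<lambda>a b. kron (snd X a) (1\<^sub>m n) * V \<Phi> b)" if \<Phi>: "mlin sH ?k m \<Phi>" for \<Phi> h
  proof -
    note \<Phi>c = mlinD(1)[OF \<Phi>]
    have l: "mlin sH ?k m (\<lambda>z. kron (snd X z) (1\<^sub>m n) * \<Phi> q)" for q
      by (intro mlin_mult_right[OF \<Phi>c] mlin_kron_left one_carrier_mat fdmodsD(6)[OF X])
    have "msum ?k m (\<Delta> h) (\<lambda>a b. kron (snd X a) (1\<^sub>m n) * V \<Phi> b) =
        msum ?k m (\<Delta> h) (\<lambda>a b. msum ?k m (\<Delta> b) (\<lambda>p q. kron (snd X (a * S p)) (1\<^sub>m n) * \<Phi> q))"
      unfolding V_def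
      by (simp add: msum_mult_left[OF kc mult_carrier_mat[OF kc \<Phi>c]] assoc_mult_mat[OF kc kc \<Phi>c, symmetric]
          kron_comp_one[OF cX cX, symmetric] fdmodsD(3)[OF X])
    also have "\<dots> = msum ?k m (\<Delta> h) (\<lambda>x q. msum ?k m (\<Delta> x) (\<lambda>a p. kron (snd X (a * S p)) (1\<^sub>m n) * \<Phi> q))"
      by (rule mDelta_coassoc[symmetric])
        (intro mlin_mult_right[OF \<Phi>c] mlin_mult_left[OF kc] mlin_kron_left one_carrier_mat mlin_rep[OF X] lin_rules \<Phi>)+
    also have "\<dots> = msum ?k m (\<Delta> h) (\<lambda>x q. \<epsilon> x \<cdot>\<^sub>m \<Phi> q)"
      by (simp add: msum_lin[OF l, symmetric] Delta_antipode_right mlinD(3)[OF l] fdmodsD(2)[OF X] left_mult_one_mat[OF \<Phi>c])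
    also have "\<dots> = \<Phi> h" by (rule mDelta_counit_left[OF \<Phi>])
    finally show ?thesis by simp
  qed
  show ?thesis by (subst V3[OF \<Psi>], subst V3[OF \<Psi>']) (simp only: V2)
qed

context fd_comodule_algebra begin

text \<open>Feeding in the coaction of b produces S(x1) from the coproduct; B-linearity of
  \<open>\<psi>\<close> turns the rest into x2 acting on X and the remaining leg acting on N. S(x1)
  x2 cancels, and only the action of b on N survives.\<close>

lemma antipode_contract_F_space:
  assumes X: "X \<in> fdmods sH" and M: "M \<in> fdmods sB" and N: "N \<in> fdmods sB"
    and \<psi>: "\<psi> \<in> F_space sH \<delta> M (tensor_rep \<delta> X N)" and c: "c \<in> carrier_mat 1 (fst X)"
  shows "(\<lambda>h. msum (fst N) (fst M) (\<Delta> h) (\<lambda>p q. kron (c * snd X (S p)) (1\<^sub>m (fst N)) * \<psi> q)) \<in> F_space sH \<delta> M N"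
proof -
  let ?n = "fst N" and ?m = "fst M" and ?k = "fst X * fst N"
  note cX = fdmodsD(1)[OF X] and cM = fdmodsD(1)[OF M] and cN = fdmodsD(1)[OF N]
  note XX = mlin_rep[OF X] and NN = mlin_rep[OF N] and MM = mlin_rep[OF M]
  \<comment> \<open>\<open>KK z\<close> is the functional c composed with the action of z on the X
    leg; \<open>LL z w\<close> lets w act on the N leg as well.\<close>
  define LL where "LL z w = kron (c * snd X z) (snd N w)" for z w
  define KK where "KK z = kron (c * snd X z) (1\<^sub>m ?n)" for z
  have \<psi>l: "mlin sH ?k ?m \<psi>" using F_spaceD(1)[OF \<psi>] by simp
  note \<psi>c = mlinD(1)[OF \<psi>l]
  have Lc: "LL z w \<in> carrier_mat ?n ?k" and Kc: "KK z \<in> carrier_mat ?n ?k" for z w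
    using kron_carrier[OF mult_carrier_mat[OF c cX] cN] kron_carrier[OF mult_carrier_mat[OF c cX] one_carrier_mat]
    unfolding LL_def KK_def by simp_all
  have "mlin sH (1 * ?n) ?k (\<lambda>z. LL z w)" "mlin sH (1 * ?n) ?k KK" for w
    unfolding LL_def KK_def[abs_def] by (intro mlin_kron_left mlin_mult_left[OF c] cN one_carrier_mat fdmodsD(6)[OF X])+
  then have Ll: "mlin sH ?n ?k (\<lambda>z. LL z w)" and Kl: "mlin sH ?n ?k KK" for w by simp_all
  have "mlin sB (1 * ?n) ?k (LL z)" for z
    unfolding LL_def[abs_def] by (intro mlin_kron_right mult_carrier_mat[OF c cX] fdmodsD(6)[OF N])
  then have Lr: "mlin sB ?n ?k (LL z)" for z by simp
  have KX: "KK z * kron (snd X v) (snd N w) = LL (z * v) w" for z v w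
    unfolding KK_def LL_def
    by (simp add: kron_mult[OF mult_carrier_mat[OF c cX] one_carrier_mat cX cN] left_mult_one_mat[OF cN]
        assoc_mult_mat[OF c cX cX] fdmodsD(3)[OF X])
  have bK: "mbilin sH sH ?n ?m (\<lambda>p q. KK (S p) * \<psi> q)"
    by (intro mbilinI mlin_mult_right[OF \<psi>c] mlin_mult_left[OF Kc] \<psi>l mlin_comp[OF Kl] H.lin_rules)
  have "msum ?n ?m (\<delta> b) (\<lambda>x y. msum ?n ?m (\<Delta> (x * h)) (\<lambda>p q. KK (S p) * \<psi> q) * snd M y) =
     snd N b * msum ?n ?m (\<Delta> h) (\<lambda>p q. KK (S p) * \<psi> q)" for b h
  proof -
    have c1: "KK z * \<psi> w * snd M y \<in> carrier_mat ?n ?m" for z w y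
      by (rule mult_carrier_mat[OF mult_carrier_mat[OF Kc \<psi>c] cM])
    have c2: "LL z w * \<psi> y \<in> carrier_mat ?n ?m" for z w y by (rule mult_carrier_mat[OF Lc \<psi>c])
    \<comment> \<open>B-linearity of \<open>\<psi>\<close> under the fixed functional
      \<open>KK g\<close>: the coaction on the source is exchanged for the diagonal action on X
      \<otimes> N.\<close>
    have inner: "msum ?n ?m (\<delta> z) (\<lambda>v w. KK g * \<psi> (v * h2) * snd M w) = msum ?n ?m (\<delta> z) (\<lambda>v w. LL (g * v) w * \<psi> h2)"
      for z g h2
    proof -
      have "msum ?n ?m (\<delta> z) (\<lambda>v w. KK g * \<psi> (v * h2) * snd M w) = KK g * msum ?k ?m (\<delta> z) (\<lambda>v w. \<psi> (v * h2) * snd M w)"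
        by (simp add: msum_mult_left[OF Kc mult_carrier_mat[OF \<psi>c cM]] assoc_mult_mat[OF Kc \<psi>c cM])
      also have "msum ?k ?m (\<delta> z) (\<lambda>v w. \<psi> (v * h2) * snd M w) = tensor_act (\<delta> z) X N * \<psi> h2"
        using F_spaceD(2)[OF \<psi>] by (simp add: snd_tensor_rep)
      also have "KK g * \<dots> = msum ?n ?m (\<delta> z) (\<lambda>v w. LL (g * v) w * \<psi> h2)"
        unfolding tensor_act_msum msum_mult_right[OF \<psi>c kron_carrier[OF cX cN]]
        by (simp add: msum_mult_left[OF Kc mult_carrier_mat[OF kron_carrier[OF cX cN] \<psi>c]]
            assoc_mult_mat[OF Kc kron_carrier[OF cX cN] \<psi>c, symmetric] KX)
      finally show ?thesis .
    qed
    have l: "mlin sH ?n ?m (\<lambda>z. LL (g * z) w * \<psi> h2)" for g w h2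
      by (intro mlin_mult_right[OF \<psi>c] mlin_comp[OF Ll] H.lin_rules)
    have "msum ?n ?m (\<delta> b) (\<lambda>x y. msum ?n ?m (\<Delta> (x * h)) (\<lambda>p q. KK (S p) * \<psi> q) * snd M y) =
       msum ?n ?m (\<delta> b) (\<lambda>x y. msum ?n ?m (\<Delta> x) (\<lambda>x1 x2. msum ?n ?m (\<Delta> h) (\<lambda>h1 h2. KK (S h1 * S x1) * \<psi> (x2 * h2) * snd M y)))"
      by (simp add: H.mDelta_mult[OF bK] H.antipode_mult msum_mult_right[OF cM msum_carrier]
          msum_mult_right[OF cM mult_carrier_mat[OF Kc \<psi>c]])
    also have "\<dots> = msum ?n ?m (\<delta> b) (\<lambda>x1 z. msum ?n ?m (\<delta> z) (\<lambda>x2 y. msum ?n ?m (\<Delta> h) (\<lambda>h1 h2. KK (S h1 * S x1) * \<psi> (x2 * h2) * snd M y)))"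
      by (rule mdelta_coassoc; intro mlin_msum)
        (intro mlin_mult_right[OF cM] mlin_mult_right[OF \<psi>c] mlin_comp[OF Kl] H.lin_rules
          mlin_mult_left[OF Kc] mlin_comp[OF \<psi>l] mlin_mult_left[OF mult_carrier_mat[OF Kc \<psi>c]] fdmodsD(6)[OF M])+
    also have "\<dots> = msum ?n ?m (\<delta> b) (\<lambda>x1 z. msum ?n ?m (\<Delta> h) (\<lambda>h1 h2. msum ?n ?m (\<delta> z) (\<lambda>x2 y. KK (S h1 * S x1) * \<psi> (x2 * h2) * snd M y)))"
      by (intro msum_cong msum_swap)
    also have "\<dots> = msum ?n ?m (\<delta> b) (\<lambda>x1 z. msum ?n ?m (\<Delta> h) (\<lambda>h1 h2. msum ?n ?m (\<delta> z) (\<lambda>v w. LL (S h1 * (S x1 * v)) w * \<psi> h2)))"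
      by (simp add: inner mult.assoc)
    also have "\<dots> = msum ?n ?m (\<delta> b) (\<lambda>x1 z. msum ?n ?m (\<delta> z) (\<lambda>v w. msum ?n ?m (\<Delta> h) (\<lambda>h1 h2. LL (S h1 * (S x1 * v)) w * \<psi> h2)))"
      by (intro msum_cong msum_swap)
    \<comment> \<open>Coassociativity is used in reverse, so that u and v become the two legs of one
      coproduct and S(u) v can collapse.\<close>
    also have "\<dots> = msum ?n ?m (\<delta> b) (\<lambda>x w. msum ?n ?m (\<Delta> x) (\<lambda>u v. msum ?n ?m (\<Delta> h) (\<lambda>h1 h2. LL (S h1 * (S u * v)) w * \<psi> h2)))"
      by (rule mdelta_coassoc[symmetric]; intro mlin_msum)
        (intro mlin_mult_right[OF \<psi>c] mlin_comp[OF Ll] H.lin_rules Lr)+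
    also have "\<dots> = msum ?n ?m (\<delta> b) (\<lambda>x w. msum ?n ?m (\<Delta> h) (\<lambda>h1 h2. msum ?n ?m (\<Delta> x) (\<lambda>u v. LL (S h1 * (S u * v)) w * \<psi> h2)))"
      by (intro msum_cong msum_swap)
    also have "\<dots> = msum ?n ?m (\<delta> b) (\<lambda>x w. msum ?n ?m (\<Delta> h) (\<lambda>h1 h2. \<epsilon> x \<cdot>\<^sub>m (LL (S h1) w * \<psi> h2)))"
      by (intro msum_cong) (simp add: msum_lin[OF l, symmetric] H.Delta_antipode_left mlinD(3)[OF l])
    also have "\<dots> = msum ?n ?m (\<delta> b) (\<lambda>x w. \<epsilon> x \<cdot>\<^sub>m msum ?n ?m (\<Delta> h) (\<lambda>h1 h2. LL (S h1) w * \<psi> h2))"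
      by (simp only: msum_smult[OF c2])
    also have "\<dots> = msum ?n ?m (\<Delta> h) (\<lambda>h1 h2. LL (S h1) b * \<psi> h2)"
      by (rule mdelta_counit) (intro mlin_msum mlin_mult_right[OF \<psi>c] Lr)
    also have "\<dots> = snd N b * msum ?n ?m (\<Delta> h) (\<lambda>p q. KK (S p) * \<psi> q)"
    proof -
      have "LL z b = snd N b * KK z" for z
        using kron_mult[OF one_carrier_mat cN mult_carrier_mat[OF c cX] one_carrier_mat, of b z]
          left_mult_one_mat[OF mult_carrier_mat[OF c cX]] right_mult_one_mat[OF cN]
        unfolding LL_def KK_def by simp
      then show ?thesis by (simp add: msum_mult_left[OF cN mult_carrier_mat[OF Kc \<psi>c]] assoc_mult_mat[OF cN Kc \<psi>c])
    qed
    finally show ?thesis .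
  qed
  then show ?thesis unfolding F_space_def KK_def[symmetric] using H.mlin_Delta[OF bK] by blast
qed

section \<open>The canonical isomorphism X \<otimes> ih M N \<rightarrow> ih M (X \<triangleright>
  N)\<close>

context
  fixes ih iev
  assumes hom: "internal_hom CH CB ih iev"
begin

abbreviation (input) "oevh M N \<equiv> orb (ih M N) M (iev M N)"
abbreviation (input) "can X M N \<equiv> internal_hom_data.ih_can CH CB ih iev X M N"

context
  fixes X M N
  assumes X: "X \<in> fdmods sH" and M: "M \<in> fdmods sB" and N: "N \<in> fdmods sB"
begin

private abbreviation (input) "I \<equiv> ih M N"
text \<open>Evaluation after the action of b on ih M N; all orbit maps at b arise from this one
  matrix by inserting a vector, as \<open>J_oev\<close> records.\<close>

private definition J :: "'h \<Rightarrow> 'k mat" where "J b = iev M N * kron (snd I b) (1\<^sub>m (fst M))"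

private lemmas fI = ih_fdmods[OF hom M N]
private lemmas eI = iev_carrier[OF hom M N]
private lemmas cX = fdmodsD(1)[OF X]
private lemmas cM = fdmodsD(1)[OF M]
private lemmas cN = fdmodsD(1)[OF N]
private lemmas cI = fdmodsD(1)[OF fI]

private lemma J_carrier: "J b \<in> carrier_mat (fst N) (fst I * fst M)"
  unfolding J_def by (rule mult_carrier_mat[OF eI kron_carrier[OF cI one_carrier_mat]])

private lemma J_mlin: "mlin sH (fst N) (fst I * fst M) J"
  unfolding J_def[abs_def] by (intro mlin_mult_left[OF eI] mlin_kron_left one_carrier_mat fdmodsD(6)[OF fI])

private lemma J_oev:
  assumes v: "v \<in> carrier_mat (fst I) 1" shows "oevh M N v b = J b * kron v (1\<^sub>m (fst M))"
proof -
  have "kron v (1\<^sub>m (fst M)) \<in> carrier_mat (fst I * fst M) (fst M)" using kron_carrier[OF v one_carrier_mat[of "fst M"]] by simp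
  then show ?thesis unfolding orb_def J_def
    by (simp add: kron_comp_one[OF cI v] assoc_mult_mat[OF eI kron_carrier[OF cI one_carrier_mat]])
qed

text \<open>The canonical map is the adjunct of id \<otimes> iev, so its orbit maps let h act
  diagonally on X \<otimes> ih M N before evaluating: h1 stays on X and h2 enters the evaluation on
  M.\<close>

lemma ih_can_intertwiner: "can X M N \<in> intertwiners (tensor_rep \<Delta> X I) (ih M (tensor_rep \<delta> X N))"
  and ih_can_oev: "y \<in> carrier_mat (fst X * fst I) 1 \<Longrightarrow> oevh M (tensor_rep \<delta> X N) (can X M N * y) h =
     msum (fst X * fst N) (fst M) (\<Delta> h) (\<lambda>a b. kron (snd X a) (iev M N * kron (snd I b) (1\<^sub>m (fst M))) * kron y (1\<^sub>m (fst M)))"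
  unfolding J_def[symmetric]
proof -
  let ?f = "kron (1\<^sub>m (fst X)) (iev M N)"
  have fc: "?f \<in> carrier_mat (fst X * fst N) (fst X * fst I * fst M)"
    using kron_carrier[OF one_carrier_mat eI, of "fst X"] by (simp add: mult.assoc)
  have fi: "?f \<in> intertwiners (tensor_rep \<delta> (tensor_rep \<Delta> X I) M) (tensor_rep \<delta> X N)"
    unfolding tensor_rep_assoc[OF X fI M]
    by (rule intertwiners_tensor(2)[OF X X tensor_rep_fdmods[OF fI M] N one_intertwiners[OF X] iev_intertwiner[OF hom M N]])
  have d: "can X M N = internal_hom_data.adjunct CH CB ih iev (tensor_rep \<Delta> X I) M (tensor_rep \<delta> X N) ?f"
    unfolding internal_hom_data.ih_can_def by (simp add: right_mult_one_mat[OF fc])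
  note XI = H.tensor_rep_fdmodsH[OF X fI] and XN = tensor_rep_fdmods[OF X N]
  show "can X M N \<in> intertwiners (tensor_rep \<Delta> X I) (ih M (tensor_rep \<delta> X N))"
    unfolding d by (rule adjunct_props(1)[OF hom M XN XI fi])
  assume y: "y \<in> carrier_mat (fst X * fst I) 1"
  let ?Z = "kron y (1\<^sub>m (fst M))"
  have Z: "?Z \<in> carrier_mat (fst X * fst I * fst M) (fst M)" using kron_carrier[OF y one_carrier_mat[of "fst M"]] by simp
  have y': "y \<in> carrier_mat (fst (tensor_rep \<Delta> X I)) 1" using y by simp
  note k = kron_carrier[OF cX cI]
  note k2 = kron_carrier[OF k one_carrier_mat[of "fst M"]]
  have "oevh M (tensor_rep \<delta> X N) (can X M N * y) h = ?f * kron (tensor_act (\<Delta> h) X I * y) (1\<^sub>m (fst M))"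
    unfolding d adjunct_props(2)[OF hom M XN XI fi y'] by (simp add: orb_def snd_tensor_rep)
  also have "\<dots> = ?f * (kron (tensor_act (\<Delta> h) X I) (1\<^sub>m (fst M)) * ?Z)"
    by (simp add: kron_comp_one[OF tensor_act_carrier y])
  also have "\<dots> = msum (fst X * fst N) (fst M) (\<Delta> h) (\<lambda>a b. ?f * (kron (kron (snd X a) (snd I b)) (1\<^sub>m (fst M)) * ?Z))"
    unfolding tensor_act_msum kron_msum_left[OF one_carrier_mat k] msum_mult_right[OF Z k2]
    by (rule msum_mult_left[OF fc mult_carrier_mat[OF k2 Z]])
  also have "\<dots> = msum (fst X * fst N) (fst M) (\<Delta> h) (\<lambda>a b. kron (snd X a) (J b) * ?Z)"
  proof (rule msum_cong)
    fix a b
    have "?f * kron (kron (snd X a) (snd I b)) (1\<^sub>m (fst M)) = kron (snd X a) (J b)"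
      unfolding kron_assoc J_def
      by (simp add: kron_mult[OF one_carrier_mat eI cX kron_carrier[OF cI one_carrier_mat]] left_mult_one_mat[OF cX])
    then show "?f * (kron (kron (snd X a) (snd I b)) (1\<^sub>m (fst M)) * ?Z) = kron (snd X a) (J b) * ?Z"
      by (simp add: assoc_mult_mat[OF fc k2 Z, symmetric])
  qed
  finally show "oevh M (tensor_rep \<delta> X N) (can X M N * y) h =
     msum (fst X * fst N) (fst M) (\<Delta> h) (\<lambda>a b. kron (snd X a) (J b) * kron y (1\<^sub>m (fst M)))" .
qed

text \<open>S(h1) meets the part of h2 that the diagonal action puts on X and cancels it, so that
  contraction with \<open>c\<close> recovers the c-component of \<open>y\<close>. This plays the
  role of a left inverse of the canonical map.\<close>

lemma ih_can_contract:
  assumes y: "y \<in> carrier_mat (fst X * fst I) 1" and c: "c \<in> carrier_mat 1 (fst X)"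
  shows "msum (fst N) (fst M) (\<Delta> h) (\<lambda>a b. kron (c * snd X (S a)) (1\<^sub>m (fst N)) * oevh M (tensor_rep \<delta> X N) (can X M N * y) b) =
     oevh M N (kron c (1\<^sub>m (fst I)) * y) h"
proof -
  let ?Z = "kron y (1\<^sub>m (fst M))" and ?n = "fst N" and ?m = "fst M"
  have Z: "?Z \<in> carrier_mat (fst X * (fst I * fst M)) (fst M)"
    using kron_carrier[OF y one_carrier_mat[of "fst M"]] by (simp add: mult.assoc)
  define G where "G z q = kron (c * snd X z) (J q) * ?Z" for z q
  note cXz = mult_carrier_mat[OF c cX]
  have kJ: "kron (snd X a) (J b) \<in> carrier_mat (fst X * ?n) (fst X * (fst I * fst M))" for a b
    by (rule kron_carrier[OF cX J_carrier])
  have kc: "kron (c * snd X a) (1\<^sub>m ?n) \<in> carrier_mat ?n (fst X * ?n)" for a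
    using kron_carrier[OF cXz one_carrier_mat[of ?n]] by simp
  have Gl: "mlin sH ?n ?m (\<lambda>z. G z q)" "mlin sH ?n ?m (G z)" for z q
  proof -
    have "mlin sH (1 * ?n) ?m (\<lambda>z. G z q)" "mlin sH (1 * ?n) ?m (G z)" unfolding G_def[abs_def]
      by (intro mlin_mult_right[OF Z] mlin_kron_left J_carrier mlin_mult_left[OF c] fdmodsD(6)[OF X])
        (intro mlin_mult_right[OF Z] mlin_kron_right J_mlin cXz)
    then show "mlin sH ?n ?m (\<lambda>z. G z q)" "mlin sH ?n ?m (G z)" by simp_all
  qed
  have st: "kron (c * snd X a) (1\<^sub>m ?n) * (kron (snd X p) (J q) * ?Z) = G (a * p) q" for a p q
    unfolding G_def
    by (simp add: assoc_mult_mat[OF kc kJ Z, symmetric] kron_mult[OF cXz one_carrier_mat cX J_carrier]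
        left_mult_one_mat[OF J_carrier] assoc_mult_mat[OF c cX cX] fdmodsD(3)[OF X])
  have "msum ?n ?m (\<Delta> h) (\<lambda>a b. kron (c * snd X (S a)) (1\<^sub>m ?n) * oevh M (tensor_rep \<delta> X N) (can X M N * y) b) =
     msum ?n ?m (\<Delta> h) (\<lambda>a b. msum ?n ?m (\<Delta> b) (\<lambda>p q. G (S a * p) q))"
    unfolding ih_can_oev[OF y, folded J_def] msum_mult_left[OF kc mult_carrier_mat[OF kJ Z]] st ..
  also have "\<dots> = msum ?n ?m (\<Delta> h) (\<lambda>x q. msum ?n ?m (\<Delta> x) (\<lambda>a p. G (S a * p) q))"
    by (rule H.mDelta_coassoc[symmetric]) (intro mlin_comp[OF Gl(1)] Gl(2) H.lin_rules)+
  also have "\<dots> = msum ?n ?m (\<Delta> h) (\<lambda>x q. \<epsilon> x \<cdot>\<^sub>m G 1 q)"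
    by (simp add: msum_lin[OF Gl(1), symmetric] H.Delta_antipode_left mlinD(3)[OF Gl(1)])
  also have "\<dots> = G 1 h" by (rule H.mDelta_counit_left[OF Gl(2)])
  also have "\<dots> = oevh M N (kron c (1\<^sub>m (fst I)) * y) h"
  proof -
    have k1: "kron c (1\<^sub>m (fst I)) \<in> carrier_mat (fst I) (fst X * fst I)" using kron_carrier[OF c one_carrier_mat[of "fst I"]] by simp
    have k2: "kron c (1\<^sub>m (fst I * fst M)) \<in> carrier_mat (fst I * fst M) (fst X * (fst I * fst M))"
      using kron_carrier[OF c one_carrier_mat[of "fst I * fst M"]] by simp
    have "J h * (kron c (1\<^sub>m (fst I * fst M)) * ?Z) = kron c (J h) * ?Z"
      using kron_mult[OF one_carrier_mat J_carrier c one_carrier_mat, of h] left_mult_one_mat[OF c] right_mult_one_mat[OF J_carrier]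
      by (simp add: assoc_mult_mat[OF J_carrier k2 Z, symmetric])
    moreover have "kron (kron c (1\<^sub>m (fst I)) * y) (1\<^sub>m (fst M)) = kron c (1\<^sub>m (fst I * fst M)) * ?Z"
      by (simp add: kron_comp_one[OF k1 y] kron_assoc)
    ultimately show ?thesis
      unfolding G_def using J_oev[OF mult_carrier_mat[OF k1 y]] c by (simp add: fdmodsD(2)[OF X])
  qed
  finally show ?thesis .
qed

text \<open>Injectivity: the contractions recover every component of y. Surjectivity: the
  contractions of a given vector z are B-linear maps H \<triangleright> M \<rightarrow> N by
  \<open>antipode_contract_F_space\<close>, hence vectors of ih M N depending linearly on the
  functional, and these assemble into y.\<close>

lemma ih_can_bij:
  "bij_betw (\<lambda>y. can X M N * y) (carrier_mat (fst X * fst I) 1) (carrier_mat (fst (ih M (tensor_rep \<delta> X N))) 1)"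
proof -
  note XN = tensor_rep_fdmods[OF X N]
  have cc: "can X M N \<in> carrier_mat (fst (ih M (tensor_rep \<delta> X N))) (fst X * fst I)"
    using intertwinersD(1)[OF ih_can_intertwiner] by simp
  have k1: "kron c (1\<^sub>m (fst I)) * y \<in> carrier_mat (fst I) 1" if "c \<in> carrier_mat 1 (fst X)" "y \<in> carrier_mat (fst X * fst I) 1" for c y :: "'k mat"
    using kron_carrier[OF that(1) one_carrier_mat[of "fst I"]] that(2) by simp
  show ?thesis
  proof (rule bij_betwI')
    fix y y' :: "'k mat" assume y: "y \<in> carrier_mat (fst X * fst I) 1" and y': "y' \<in> carrier_mat (fst X * fst I) 1"
    have "y = y'" if e: "can X M N * y = can X M N * y'"
    proof (rule col_eq_contract[OF y y'])
      fix c :: "'k mat" assume c: "c \<in> carrier_mat 1 (fst X)"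
      show "kron c (1\<^sub>m (fst I)) * y = kron c (1\<^sub>m (fst I)) * y'"
        by (rule oev_inj[OF hom M N k1[OF c y] k1[OF c y']])
          (simp only: ih_can_contract[OF y c, symmetric] ih_can_contract[OF y' c, symmetric] e)
    qed
    then show "(can X M N * y = can X M N * y') = (y = y')" by blast
  next
    fix y :: "'k mat" assume y: "y \<in> carrier_mat (fst X * fst I) 1"
    show "can X M N * y \<in> carrier_mat (fst (ih M (tensor_rep \<delta> X N))) 1" by (rule mult_carrier_mat[OF cc y])
  next
    fix z :: "'k mat" assume z: "z \<in> carrier_mat (fst (ih M (tensor_rep \<delta> X N))) 1"
    let ?\<psi> = "oevh M (tensor_rep \<delta> X N) z"
    have \<psi>: "?\<psi> \<in> F_space sH \<delta> M (tensor_rep \<delta> X N)"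
      by (rule orb_F_space[OF ih_fdmods[OF hom M XN] M XN iev_intertwiner[OF hom M XN] z])
    have \<psi>l: "mlin sH (fst X * fst N) (fst M) ?\<psi>" using F_spaceD(1)[OF \<psi>] by simp
    define \<phi> where "\<phi> c h = msum (fst N) (fst M) (\<Delta> h) (\<lambda>p q. kron (c * snd X (S p)) (1\<^sub>m (fst N)) * ?\<psi> q)" for c h
    have \<phi>: "\<phi> c \<in> F_space sH \<delta> M N" if "c \<in> carrier_mat 1 (fst X)" for c
      unfolding \<phi>_def[abs_def] by (rule antipode_contract_F_space[OF X M N \<psi> that])
    have "\<exists>v\<in>carrier_mat (fst I) 1. oevh M N v = \<phi> (transpose_mat u)" if "u \<in> carrier_mat (fst X) 1" for u
      using oev_bij[OF hom M N] \<phi>[of "transpose_mat u"] that unfolding bij_betw_def by (metis imageE transpose_carrier_mat)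
    then obtain g where g: "\<And>u. u \<in> carrier_mat (fst X) 1 \<Longrightarrow> g u \<in> carrier_mat (fst I) 1"
      "\<And>u. u \<in> carrier_mat (fst X) 1 \<Longrightarrow> oevh M N (g u) = \<phi> (transpose_mat u)" by metis
    have \<psi>c: "?\<psi> q \<in> carrier_mat (fst X * fst N) (fst M)" for q by (rule mlinD(1)[OF \<psi>l])
    have l: "mlin (*) (fst N) (fst M) (\<lambda>s. kron ((s \<cdot>\<^sub>m c) * snd X p) (1\<^sub>m (fst N)) * ?\<psi> q)"
      if "c \<in> carrier_mat 1 (fst X)" for c p q
    proof -
      have "mlin (*) (1 * fst N) (fst M) (\<lambda>s. kron ((s \<cdot>\<^sub>m c) * snd X p) (1\<^sub>m (fst N)) * ?\<psi> q)"
        by (intro mlin_mult_right[OF \<psi>c] mlin_kron_left one_carrier_mat mlin_mult_right[OF cX] mlin_smult[OF that] lin_id)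
      then show ?thesis by simp
    qed
    have kc: "kron (c * snd X p) (1\<^sub>m (fst N)) * ?\<psi> q \<in> carrier_mat (fst N) (fst M)" if "c \<in> carrier_mat 1 (fst X)" for c p q
      using kron_carrier[OF mult_carrier_mat[OF that cX] one_carrier_mat[of "fst N"]] mult_carrier_mat[OF _ \<psi>c] by simp
    have \<phi>_add: "\<phi> (c + d) h = \<phi> c h + \<phi> d h" if c: "c \<in> carrier_mat 1 (fst X)" and d: "d \<in> carrier_mat 1 (fst X)" for c d h
    proof -
      have "kron ((c + d) * snd X p) (1\<^sub>m (fst N)) * ?\<psi> q = kron (c * snd X p) (1\<^sub>m (fst N)) * ?\<psi> q + kron (d * snd X p) (1\<^sub>m (fst N)) * ?\<psi> q" for p q
        using kron_carrier[OF mult_carrier_mat[OF c cX] one_carrier_mat[of "fst N"], of p] kron_carrier[OF mult_carrier_mat[OF d cX] one_carrier_mat[of "fst N"], of p]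
        by (simp add: add_mult_distrib_mat[OF c d cX] kron_add_left[OF mult_carrier_mat[OF c cX] mult_carrier_mat[OF d cX]]
            add_mult_distrib_mat[OF _ _ \<psi>c])
      then have "\<phi> (c + d) h = msum (fst N) (fst M) (\<Delta> h) (\<lambda>p q. kron (c * snd X (S p)) (1\<^sub>m (fst N)) * ?\<psi> q + kron (d * snd X (S p)) (1\<^sub>m (fst N)) * ?\<psi> q)"
        by (simp only: \<phi>_def)
      then show ?thesis unfolding \<phi>_def by (simp only: msum_add[OF kc[OF c] kc[OF d]])
    qed
    have \<phi>_smult: "\<phi> (s \<cdot>\<^sub>m c) h = s \<cdot>\<^sub>m \<phi> c h" if c: "c \<in> carrier_mat 1 (fst X)" for c s h
    proof -
      have "kron ((s \<cdot>\<^sub>m c) * snd X p) (1\<^sub>m (fst N)) * ?\<psi> q = s \<cdot>\<^sub>m (kron (c * snd X p) (1\<^sub>m (fst N)) * ?\<psi> q)" for p q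
        using kron_carrier[OF mult_carrier_mat[OF c cX] one_carrier_mat[of "fst N"], of p]
        by (simp add: mult_smult_assoc_mat[OF c cX] kron_smult_left mult_smult_assoc_mat[OF _ \<psi>c])
      then show ?thesis unfolding \<phi>_def by (simp add: msum_smult[OF kc[OF c]])
    qed
    obtain G where G: "G \<in> carrier_mat (fst I) (fst X)" "\<And>u. u \<in> carrier_mat (fst X) 1 \<Longrightarrow> G * u = g u"
    proof (rule linear_to_mat[of "fst X" g "fst I"])
      fix u w :: "'k mat" assume u: "u \<in> carrier_mat (fst X) 1" and w: "w \<in> carrier_mat (fst X) 1"
      have uw: "u + w \<in> carrier_mat (fst X) 1" using u w by simp
      show "g (u + w) = g u + g w"
      proof (rule oev_inj[OF hom M N g(1)[OF uw]])
        fix h show "oevh M N (g (u + w)) h = oevh M N (g u + g w) h"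
          using u w by (simp add: g(2)[OF uw] orb_add[OF fI eI g(1)[OF u] g(1)[OF w]] g(2)[OF u] g(2)[OF w] transpose_add[OF u w] \<phi>_add)
      qed (use g(1)[OF u] g(1)[OF w] in simp)
    next
      fix s and u :: "'k mat" assume u: "u \<in> carrier_mat (fst X) 1"
      have su: "s \<cdot>\<^sub>m u \<in> carrier_mat (fst X) 1" using u by simp
      have t: "transpose_mat (s \<cdot>\<^sub>m u) = s \<cdot>\<^sub>m transpose_mat u" by (auto intro!: eq_matI)
      show "g (s \<cdot>\<^sub>m u) = s \<cdot>\<^sub>m g u"
      proof (rule oev_inj[OF hom M N g(1)[OF su]])
        fix h show "oevh M N (g (s \<cdot>\<^sub>m u)) h = oevh M N (s \<cdot>\<^sub>m g u) h"
          using u by (simp add: g(2)[OF su] orb_smult[OF fI eI g(1)[OF u]] g(2)[OF u] t \<phi>_smult)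
      qed (use g(1)[OF u] in simp)
    qed (use g(1) in auto)
    \<comment> \<open>The linear map from functionals on X to ih M N, flattened into an element of X
      \<otimes> ih M N.\<close>
    define y where "y = vecc (transpose_mat G)"
    have Gt: "transpose_mat G \<in> carrier_mat (fst X) (fst I)" using G(1) by simp
    have y: "y \<in> carrier_mat (fst X * fst I) 1" unfolding y_def by (rule vecc_carrier(1)[OF Gt])
    have cy: "kron c (1\<^sub>m (fst I)) * y = g (transpose_mat c)" if c: "c \<in> carrier_mat 1 (fst X)" for c :: "'k mat"
    proof -
      have ct: "transpose_mat c \<in> carrier_mat (fst X) 1" using c by simp
      have cG: "c * transpose_mat G \<in> carrier_mat 1 (fst I)" by (rule mult_carrier_mat[OF c Gt])
      have "kron c (1\<^sub>m (fst I)) * y = vecc (c * transpose_mat G)"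
        unfolding y_def using vecc_mult[OF c Gt one_carrier_mat] right_mult_one_mat[OF cG] by simp
      also have "\<dots> = G * transpose_mat c"
        using vecc_row[OF cG] transpose_mult[OF c Gt] by simp
      finally show ?thesis by (simp add: G(2)[OF ct])
    qed
    \<comment> \<open>The canonical image of y and the given z have the same contractions, and
      contractions determine an orbit map.\<close>
    have "oevh M (tensor_rep \<delta> X N) (can X M N * y) h = ?\<psi> h" for h
    proof (rule H.antipode_contract_inj[OF X _ \<psi>l])
      show "mlin sH (fst X * fst N) (fst M) (oevh M (tensor_rep \<delta> X N) (can X M N * y))"
        using F_spaceD(1)[OF orb_F_space[OF ih_fdmods[OF hom M XN] M XN iev_intertwiner[OF hom M XN] mult_carrier_mat[OF cc y]]] by simp
      fix c :: "'k mat" and h assume c: "c \<in> carrier_mat 1 (fst X)"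
      have ct: "transpose_mat c \<in> carrier_mat (fst X) 1" using c by simp
      have "oevh M N (g (transpose_mat c)) h = \<phi> c h" using g(2)[OF ct] by simp
      then show "msum (fst N) (fst M) (\<Delta> h) (\<lambda>a b. kron (c * snd X (S a)) (1\<^sub>m (fst N)) * oevh M (tensor_rep \<delta> X N) (can X M N * y) b) =
        msum (fst N) (fst M) (\<Delta> h) (\<lambda>a b. kron (c * snd X (S a)) (1\<^sub>m (fst N)) * ?\<psi> b)"
        unfolding ih_can_contract[OF y c] cy[OF c] by (simp only: \<phi>_def)
    qed
    then have "can X M N * y = z" by (intro oev_inj[OF hom M XN mult_carrier_mat[OF cc y] z])
    then show "\<exists>y\<in>carrier_mat (fst X * fst I) 1. z = can X M N * y" using y by blast
  qed
qed

lemma ih_can_inv_props: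
  "internal_hom_data.ih_can_inv CH CB ih iev X M N \<in> intertwiners (ih M (tensor_rep \<delta> X N)) (tensor_rep \<Delta> X I)"
  "can X M N * internal_hom_data.ih_can_inv CH CB ih iev X M N = 1\<^sub>m (fst (ih M (tensor_rep \<delta> X N)))"
proof -
  note XN = tensor_rep_fdmods[OF X N] and XI = H.tensor_rep_fdmodsH[OF X fI]
  have b: "bij_betw (\<lambda>v. can X M N * v) (carrier_mat (fst (tensor_rep \<Delta> X I)) 1) (carrier_mat (fst (ih M (tensor_rep \<delta> X N))) 1)"
    using ih_can_bij by simp
  obtain g where g: "g \<in> intertwiners (ih M (tensor_rep \<delta> X N)) (tensor_rep \<Delta> X I)"
    "g * can X M N = 1\<^sub>m (fst (tensor_rep \<Delta> X I))" "can X M N * g = 1\<^sub>m (fst (ih M (tensor_rep \<delta> X N)))"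
    by (rule is_iso_intertwiner[OF XI ih_fdmods[OF hom M XN] ih_can_intertwiner b])
  note cc = intertwinersD(1)[OF ih_can_intertwiner] and gc = intertwinersD(1)[OF g(1)]
  have "inv_mor CH (tensor_rep \<Delta> X I) (ih M (tensor_rep \<delta> X N)) (can X M N) = g"
    unfolding inv_mor_def
  proof (rule the_equality)
    show "inverse_of CH (tensor_rep \<Delta> X I) (ih M (tensor_rep \<delta> X N)) (can X M N) g"
      unfolding inverse_of_def using g ih_can_intertwiner by simp
    fix g' assume "inverse_of CH (tensor_rep \<Delta> X I) (ih M (tensor_rep \<delta> X N)) (can X M N) g'"
    then have g': "g' \<in> intertwiners (ih M (tensor_rep \<delta> X N)) (tensor_rep \<Delta> X I)" "g' * can X M N = 1\<^sub>m (fst (tensor_rep \<Delta> X I))"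
      unfolding inverse_of_def by simp_all
    note g'c = intertwinersD(1)[OF g'(1)]
    have "g' = g' * (can X M N * g)" using right_mult_one_mat[OF g'c] g(3) by simp
    also have "\<dots> = g" using assoc_mult_mat[OF g'c cc gc] g'(2) left_mult_one_mat[OF gc] by simp
    finally show "g' = g" .
  qed
  then have "internal_hom_data.ih_can_inv CH CB ih iev X M N = g"
    unfolding internal_hom_data.ih_can_inv_def by simp
  then show "internal_hom_data.ih_can_inv CH CB ih iev X M N \<in> intertwiners (ih M (tensor_rep \<delta> X N)) (tensor_rep \<Delta> X I)"
    "can X M N * internal_hom_data.ih_can_inv CH CB ih iev X M N = 1\<^sub>m (fst (ih M (tensor_rep \<delta> X N)))"
    using g by simp_all
qed

end

lemma ih_can_oev_elementary:
  assumes X: "X \<in> fdmods sH" and M: "M \<in> fdmods sB" and N: "N \<in> fdmods sB"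
    and x: "x \<in> carrier_mat (fst X) 1" and w: "w \<in> carrier_mat (fst (ih M N)) 1"
  shows "oevh M (tensor_rep \<delta> X N) (can X M N * kron x w) h =
     msum (fst X * fst N) (fst M) (\<Delta> h) (\<lambda>a b. kron (snd X a * x) (oevh M N w b))"
proof -
  note fI = ih_fdmods[OF hom M N] and eI = iev_carrier[OF hom M N]
  note cX = fdmodsD(1)[OF X] and cI = fdmodsD(1)[OF fI]
  have xw: "kron x w \<in> carrier_mat (fst X * fst (ih M N)) 1" using kron_carrier[OF x w] by simp
  have wc: "kron w (1\<^sub>m (fst M)) \<in> carrier_mat (fst (ih M N) * fst M) (fst M)" using kron_carrier[OF w one_carrier_mat[of "fst M"]] by simp
  show ?thesis
    unfolding ih_can_oev[OF X M N xw]
  proof (rule msum_cong)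
    fix a b
    let ?J = "iev M N * kron (snd (ih M N) b) (1\<^sub>m (fst M))"
    note Jc = mult_carrier_mat[OF eI kron_carrier[OF cI one_carrier_mat]]
    have J: "?J * kron w (1\<^sub>m (fst M)) = oevh M N w b"
      unfolding orb_def by (simp add: kron_comp_one[OF cI w] assoc_mult_mat[OF eI kron_carrier[OF cI one_carrier_mat] wc])
    show "kron (snd X a) ?J * kron (kron x w) (1\<^sub>m (fst M)) = kron (snd X a * x) (oevh M N w b)"
      unfolding kron_assoc J[symmetric] by (rule kron_mult[OF cX Jc x wc])
  qed
qed

end

end

text \<open>The interchange law for maps acting on different tensor factors: \<open>F\<close> is
  applied to the first factor, \<open>Q\<close> and \<open>c\<close> to the others.\<close>

lemma kron_row_split:
  assumes F: "F \<in> carrier_mat 1 a" and c: "c \<in> carrier_mat 1 b" and Q: "Q \<in> carrier_mat (b * m) p"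
  shows "kron (kron F c) (1\<^sub>m m) * kron (1\<^sub>m a) Q = kron c (1\<^sub>m m) * Q * kron F (1\<^sub>m p)"
proof -
  have cm: "kron c (1\<^sub>m m) \<in> carrier_mat m (b * m)" using kron_carrier[OF c one_carrier_mat[of m]] by simp
  have cQ: "kron c (1\<^sub>m m) * Q \<in> carrier_mat m p" by (rule mult_carrier_mat[OF cm Q])
  have "kron (kron F c) (1\<^sub>m m) * kron (1\<^sub>m a) Q = kron F (kron c (1\<^sub>m m) * Q)"
    unfolding kron_assoc using right_mult_one_mat[OF F] by (simp add: kron_mult[OF F cm one_carrier_mat Q])
  also have "\<dots> = kron (1\<^sub>m 1) (kron c (1\<^sub>m m) * Q) * kron F (1\<^sub>m p)"
    by (simp only: kron_mult[OF one_carrier_mat cQ F one_carrier_mat] left_mult_one_mat[OF F] right_mult_one_mat[OF cQ])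
  finally show ?thesis by simp
qed

lemma col_eq_contract2:
  fixes A B :: "'k::field mat"
  assumes A: "A \<in> carrier_mat (a * b * m) n" and B: "B \<in> carrier_mat (a * b * m) n"
    and eq: "\<And>F c. F \<in> carrier_mat 1 a \<Longrightarrow> c \<in> carrier_mat 1 b \<Longrightarrow>
      kron (kron F c) (1\<^sub>m m) * A = kron (kron F c) (1\<^sub>m m) * B"
  shows "A = B"
proof (rule col_eq_contract[of A a "b * m" n B])
  show A': "A \<in> carrier_mat (a * (b * m)) n" and B': "B \<in> carrier_mat (a * (b * m)) n" using A B by (simp_all add: mult.assoc)
  fix F :: "'k mat" assume F: "F \<in> carrier_mat 1 a"
  have Fk: "kron F (1\<^sub>m (b * m)) \<in> carrier_mat (b * m) (a * (b * m))" using kron_carrier[OF F one_carrier_mat[of "b * m"]] by simp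
  show "kron F (1\<^sub>m (b * m)) * A = kron F (1\<^sub>m (b * m)) * B"
  proof (rule col_eq_contract[of _ b m n])
    fix c :: "'k mat" assume c: "c \<in> carrier_mat 1 b"
    have cm: "kron c (1\<^sub>m m) \<in> carrier_mat m (b * m)" using kron_carrier[OF c one_carrier_mat[of m]] by simp
    have "kron c (1\<^sub>m m) * (kron F (1\<^sub>m (b * m)) * Z) = kron (kron F c) (1\<^sub>m m) * Z" if Z: "Z \<in> carrier_mat (a * (b * m)) n" for Z
    proof -
      have "kron (kron F c) (1\<^sub>m m) * kron (1\<^sub>m a) (1\<^sub>m (b * m)) = kron c (1\<^sub>m m) * 1\<^sub>m (b * m) * kron F (1\<^sub>m (b * m))"
        by (rule kron_row_split[OF F c one_carrier_mat])
      moreover have "kron (kron F c) (1\<^sub>m m) \<in> carrier_mat m (a * (b * m))"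
        using kron_carrier[OF kron_carrier[OF F c] one_carrier_mat[of m]] by (simp add: mult.assoc)
      ultimately have "kron (kron F c) (1\<^sub>m m) = kron c (1\<^sub>m m) * kron F (1\<^sub>m (b * m))"
        using right_mult_one_mat[OF cm] right_mult_one_mat[of "kron (kron F c) (1\<^sub>m m)" m "a * (b * m)"] by simp
      then show ?thesis by (simp add: assoc_mult_mat[OF cm Fk Z])
    qed
    then show "kron c (1\<^sub>m m) * (kron F (1\<^sub>m (b * m)) * A) = kron c (1\<^sub>m m) * (kron F (1\<^sub>m (b * m)) * B)"
      using eq[OF F c] A' B' by simp
  qed (rule mult_carrier_mat[OF Fk A'] mult_carrier_mat[OF Fk B'])+
qed

lemma kron_transpose_one_one: "A \<in> carrier_mat 1 1 \<Longrightarrow> kron (transpose_mat A) B = A $$ (0, 0) \<cdot>\<^sub>m B"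
  by (auto intro!: eq_matI simp: kron_def)

subsection \<open>The morphism \<open>\<omega>\<close>\<close>

context fd_quasitriangular_comodule_algebra begin

lemma theta_B_eq: "theta_B \<Delta> S sB K f h = sw (\<Delta> h) (\<lambda>h1 h2. sw K (\<lambda>k k'. sB (f (S h1 * k * h2)) k'))"
  unfolding theta_B_def sum_list_map_bind2[where \<beta> = "\<lambda>x y. sB (f x) y"] sw_def ..

lemma snd_theta_B:
  assumes M: "M \<in> fdmods sB"
  shows "snd M (theta_B \<Delta> S sB K f h) =
    msum (fst M) (fst M) (\<Delta> h) (\<lambda>h1 h2. msum (fst M) (fst M) K (\<lambda>k k'. f (S h1 * k * h2) \<cdot>\<^sub>m snd M k'))"
  unfolding theta_B_eq msum_lin[OF fdmodsD(6)[OF M]] by (simp add: fdmodsD(5)[OF M])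

context
  fixes ih iev
  assumes hom: "internal_hom CH CB ih iev"
begin

private abbreviation (input) "om X M \<equiv> internal_hom_data.omega_component CH CB ih iev (K_braiding K) X M"
private abbreviation (input) "ov M N \<equiv> orb (ih M N) M (iev M N)"

context
  fixes X M
  assumes X: "X \<in> fdmods sH" and M: "M \<in> fdmods sB"
begin

private abbreviation (input) "D \<equiv> dual_rep X"
private abbreviation (input) "IM \<equiv> ih M M"
private abbreviation (input) "DM \<equiv> tensor_rep \<delta> D M"
private abbreviation (input) "cn \<equiv> internal_hom_data.ih_can CH CB ih iev D M M"
private abbreviation (input) "cni \<equiv> internal_hom_data.ih_can_inv CH CB ih iev D M M"
private abbreviation (input) "cov \<equiv> internal_hom_data.ih_cov CH CB ih iev DM DM M (tensor_act K D M)"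
private abbreviation (input) "coev \<equiv> internal_hom_data.ih_coev CH CB ih iev M"

private lemmas D = dual_rep_fdmods[OF X]
private lemmas DM = tensor_rep_fdmods[OF D M]
private lemmas I = ih_fdmods[OF hom M M]
private lemmas J = ih_fdmods[OF hom M DM]
private lemmas DI = tensor_rep_fdmodsH[OF D I]
private lemmas cn_i = ih_can_intertwiner[OF hom D M M]
private lemmas cni_i = ih_can_inv_props(1)[OF hom D M M]
private lemmas cov_i = ih_cov_props(1)[OF hom M DM DM tensor_act_K_intertwiner[OF D M]]
private lemmas coev_i = ih_coev_props(1)[OF hom M]

private lemma carriers: "cn \<in> carrier_mat (fst (ih M DM)) (fst X * fst IM)" "cni \<in> carrier_mat (fst X * fst IM) (fst (ih M DM))"
  "cov \<in> carrier_mat (fst (ih M DM)) (fst (ih M DM))" "coev \<in> carrier_mat (fst IM) 1"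
  using intertwinersD(1)[OF cn_i] intertwinersD(1)[OF cni_i] intertwinersD(1)[OF cov_i] intertwinersD(1)[OF coev_i] by simp_all

private lemma omega_component_eq:
  "om X M = kron (1\<^sub>m (fst X)) cni * kron (1\<^sub>m (fst X)) cov * kron (1\<^sub>m (fst X)) cn * kron (coevm (fst X)) coev"
  unfolding internal_hom_data.omega_component_def by (simp add: K_braiding_def)

text \<open>A composite of module maps; unit and associativity isomorphisms are equalities of
  representations, so consecutive sources and targets match exactly.\<close>

lemma omega_component_intertwiner: "om X M \<in> intertwiners unit_rep (tensor_rep \<Delta> (tensor_rep \<Delta> X D) IM)"
proof -
  note XD = tensor_rep_fdmodsH[OF X D] and u = unit_rep_fdmods and XX = one_intertwiners[OF X]
  have 0: "kron (coevm (fst X)) coev \<in> intertwiners unit_rep (tensor_rep \<Delta> X (tensor_rep \<Delta> D IM))"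
    using intertwiners_tensor(2)[OF u XD u I coevm_intertwiner[OF X] coev_i, of \<Delta>]
    by (simp only: tensor_rep_unitH[OF unit_rep_fdmods] tensor_rep_assocH[OF X D I])
  note XDI = tensor_rep_fdmodsH[OF X DI] and XJ = tensor_rep_fdmodsH[OF X J]
  have 1: "kron (1\<^sub>m (fst X)) cn \<in> intertwiners (tensor_rep \<Delta> X (tensor_rep \<Delta> D IM)) (tensor_rep \<Delta> X (ih M DM))"
    by (rule intertwiners_tensor(2)[OF X X DI J XX cn_i])
  have 2: "kron (1\<^sub>m (fst X)) cov \<in> intertwiners (tensor_rep \<Delta> X (ih M DM)) (tensor_rep \<Delta> X (ih M DM))"
    by (rule intertwiners_tensor(2)[OF X X J J XX cov_i])
  have 3: "kron (1\<^sub>m (fst X)) cni \<in> intertwiners (tensor_rep \<Delta> X (ih M DM)) (tensor_rep \<Delta> X (tensor_rep \<Delta> D IM))"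
    by (rule intertwiners_tensor(2)[OF X X J DI XX cni_i])
  show ?thesis
    unfolding omega_component_eq tensor_rep_assocH[OF X D I]
    by (rule intertwiners_comp[OF u XDI XDI 0
          intertwiners_comp[OF XDI XJ XDI 1 intertwiners_comp[OF XJ XJ XDI 2 3]]])
qed

text \<open>Pairing the leg X with \<open>F\<close> turns coevaluation into a vector of the dual of
  X, namely F transposed; K acts on it, and the contraction against \<open>c\<close> contributes
  S(h1). Since z acts on the dual by the transpose of S(z), the scalar formed with S(h1) k h2 on the
  dual is a coefficient of S(S(h1) k h2) on X.\<close>

lemma omega_component_contract:
  assumes F: "F \<in> carrier_mat 1 (fst X)" and c: "c \<in> carrier_mat 1 (fst X)"
  shows "ov M M (kron (kron F c) (1\<^sub>m (fst IM)) * om X M) h =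
     snd M (theta_B \<Delta> S sB K (\<lambda>z. (F * snd X (S z) * transpose_mat c) $$ (0, 0)) h)"
proof -
  let ?n = "fst X" and ?m = "fst M" and ?I = "fst IM"
  let ?Ft = "transpose_mat F"
  note cX = fdmodsD(1)[OF X] and cM = fdmodsD(1)[OF M]
  have cD: "snd D h \<in> carrier_mat ?n ?n" for h using fdmodsD(1)[OF D] by simp
  have Ft: "?Ft \<in> carrier_mat ?n 1" using F by simp
  have Ft': "?Ft \<in> carrier_mat (fst D) 1" and c': "c \<in> carrier_mat 1 (fst D)" using Ft c by simp_all
  \<comment> \<open>The endomorphism through which the component of \<omega> factors: the module
    braiding conjugated by the canonical isomorphism.\<close>
  define Q where "Q = cni * (cov * cn)"
  have covcn: "cov * cn \<in> carrier_mat (fst (ih M DM)) (?n * ?I)" by (rule mult_carrier_mat[OF carriers(3,1)])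
  have Qc: "Q \<in> carrier_mat (?n * ?I) (?n * ?I)" unfolding Q_def by (rule mult_carrier_mat[OF carriers(2) covcn])
  have Om: "om X M = kron (1\<^sub>m ?n) Q * kron (coevm ?n) coev"
    unfolding omega_component_eq Q_def
    by (simp add: kron_mult[OF one_carrier_mat carriers(2) one_carrier_mat carriers(3)]
        kron_mult[OF one_carrier_mat mult_carrier_mat[OF carriers(2,3)] one_carrier_mat carriers(1)]
        assoc_mult_mat[OF carriers(2,3,1)])
  define w where "w = kron ?Ft coev"
  have wc: "w \<in> carrier_mat (?n * ?I) 1" unfolding w_def using kron_carrier[OF Ft carriers(4)] by simp
  define y where "y = Q * w"
  have yc: "y \<in> carrier_mat (?n * ?I) 1" unfolding y_def by (rule mult_carrier_mat[OF Qc wc])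
  have yc': "y \<in> carrier_mat (fst D * ?I) 1" using yc by simp
  have kc: "kron c (1\<^sub>m ?I) \<in> carrier_mat ?I (?n * ?I)" using kron_carrier[OF c one_carrier_mat[of ?I]] by simp
  have step1: "kron (kron F c) (1\<^sub>m ?I) * om X M = kron c (1\<^sub>m ?I) * y"
  proof -
    have k1: "kron (kron F c) (1\<^sub>m ?I) \<in> carrier_mat ?I (?n * (?n * ?I))"
      using kron_carrier[OF kron_carrier[OF F c] one_carrier_mat[of ?I]] by (simp add: mult.assoc)
    have k2: "kron (1\<^sub>m ?n) Q \<in> carrier_mat (?n * (?n * ?I)) (?n * (?n * ?I))" by (rule kron_carrier[OF one_carrier_mat Qc])
    have k3: "kron (coevm ?n) coev \<in> carrier_mat (?n * (?n * ?I)) 1" using kron_carrier[OF coevm_carrier(1) carriers(4)] by (simp add: mult.assoc)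
    have k4: "kron F (1\<^sub>m (?n * ?I)) \<in> carrier_mat (?n * ?I) (?n * (?n * ?I))" using kron_carrier[OF F one_carrier_mat[of "?n * ?I"]] by simp
    have F1: "kron F (1\<^sub>m ?n) \<in> carrier_mat ?n (?n * ?n)" using kron_carrier[OF F one_carrier_mat[of ?n]] by simp
    have "kron F (1\<^sub>m (?n * ?I)) * kron (coevm ?n) coev = kron (kron F (1\<^sub>m ?n)) (1\<^sub>m ?I) * kron (coevm ?n) coev"
      by (simp only: kron_assoc kron_one)
    also have "\<dots> = w"
      using left_mult_one_mat[OF carriers(4)]
      by (simp add: kron_mult[OF F1 one_carrier_mat coevm_carrier(1) carriers(4)] coevm_contract[OF F] vecc_row[OF F] w_def)
    finally have w: "kron F (1\<^sub>m (?n * ?I)) * kron (coevm ?n) coev = w" .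
    have "kron (kron F c) (1\<^sub>m ?I) * om X M = kron c (1\<^sub>m ?I) * Q * kron F (1\<^sub>m (?n * ?I)) * kron (coevm ?n) coev"
      unfolding Om by (simp add: assoc_mult_mat[OF k1 k2 k3, symmetric] kron_row_split[OF F c Qc])
    then show ?thesis
      by (simp add: assoc_mult_mat[OF mult_carrier_mat[OF kc Qc] k4 k3] w assoc_mult_mat[OF kc Qc wc] y_def)
  qed
  \<comment> \<open>Applying the canonical map to \<open>y\<close> removes its inverse from the
    formula; what remains is read off from orbit maps.\<close>
  have cy: "cn * y = cov * (cn * w)"
  proof -
    have "cn * y = cn * cni * (cov * cn) * w"
      unfolding y_def Q_def
      by (simp only: assoc_mult_mat[OF carriers(1) mult_carrier_mat[OF carriers(2) covcn] wc, symmetric]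
          assoc_mult_mat[OF carriers(1,2) covcn, symmetric])
    then show ?thesis
      using ih_can_inv_props(2)[OF hom D M M] left_mult_one_mat[OF covcn] by (simp add: assoc_mult_mat[OF carriers(3,1) wc])
  qed
  have cwc: "cn * w \<in> carrier_mat (fst (ih M DM)) 1" by (rule mult_carrier_mat[OF carriers(1) wc])
  \<comment> \<open>The orbit map of \<open>coev\<close> is \<epsilon>, so the coproduct of b
    collapses and b acts on the dual leg alone.\<close>
  have ov_w: "ov M DM (cn * w) b = kron (snd D b * ?Ft) (1\<^sub>m ?m)" for b
  proof -
    have l: "mlin sH (?n * ?m) (1 * ?m) (\<lambda>z. kron (snd D z * ?Ft) (1\<^sub>m ?m))"
      using fdmodsD(6)[OF D] by (intro mlin_kron_left mlin_mult_right[OF Ft] one_carrier_mat) simp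
    have "ov M DM (cn * w) b = msum (?n * ?m) ?m (\<Delta> b) (\<lambda>p q. \<epsilon> q \<cdot>\<^sub>m kron (snd D p * ?Ft) (1\<^sub>m ?m))"
      unfolding w_def using ih_can_oev_elementary[OF hom D M M Ft' carriers(4), of b]
      by (simp add: ih_coev_props(2)[OF hom M] kron_smult_right)
    also have "\<dots> = kron (snd D b * ?Ft) (1\<^sub>m ?m)"
      using mDelta_counit_right[OF l, of b] by simp
    finally show ?thesis .
  qed
  have ov_y: "ov M DM (cn * y) b = tensor_act K D M * kron (snd D b * ?Ft) (1\<^sub>m ?m)" for b
    unfolding cy ih_cov_props(2)[OF hom M DM DM tensor_act_K_intertwiner[OF D M] cwc] ov_w ..
  \<comment> \<open>A 1 by 1 matrix is transposed to move from the dual of X back to X; the dual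
    action puts an S around the whole product S(a) k b.\<close>
  have entry: "kron (c * snd D (S a)) (1\<^sub>m ?m) * (tensor_act K D M * kron (snd D b * ?Ft) (1\<^sub>m ?m)) =
      msum ?m ?m K (\<lambda>k k'. (F * snd X (S (S a * k * b)) * transpose_mat c) $$ (0, 0) \<cdot>\<^sub>m snd M k')" for a b
  proof -
    have cDa: "c * snd D z \<in> carrier_mat 1 ?n" for z by (rule mult_carrier_mat[OF c cD])
    have k1: "kron (c * snd D z) (1\<^sub>m ?m) \<in> carrier_mat ?m (?n * ?m)" for z using kron_carrier[OF cDa[of z] one_carrier_mat[of ?m]] by simp
    have dF: "snd D z * ?Ft \<in> carrier_mat ?n 1" for z by (rule mult_carrier_mat[OF cD Ft])
    have k2: "kron (snd D z * ?Ft) (1\<^sub>m ?m) \<in> carrier_mat (?n * ?m) ?m" for z using kron_carrier[OF dF[of z] one_carrier_mat[of ?m]] by simp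
    have k3: "kron (snd D k) (snd M k') \<in> carrier_mat (?n * ?m) (?n * ?m)" for k k' by (rule kron_carrier[OF cD cM])
    have ta: "tensor_act K D M = msum (?n * ?m) (?n * ?m) K (\<lambda>k k'. kron (snd D k) (snd M k'))"
      by (simp add: tensor_act_msum)
    have "kron (c * snd D (S a)) (1\<^sub>m ?m) * (tensor_act K D M * kron (snd D b * ?Ft) (1\<^sub>m ?m)) =
      msum ?m ?m K (\<lambda>k k'. kron (c * snd D (S a)) (1\<^sub>m ?m) * (kron (snd D k) (snd M k') * kron (snd D b * ?Ft) (1\<^sub>m ?m)))"
      unfolding ta msum_mult_right[OF k2 k3] by (rule msum_mult_left[OF k1 mult_carrier_mat[OF k3 k2]])
    also have "\<dots> = msum ?m ?m K (\<lambda>k k'. (F * snd X (S (S a * k * b)) * transpose_mat c) $$ (0, 0) \<cdot>\<^sub>m snd M k')"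
    proof (rule msum_cong)
      fix k k'
      have ct: "transpose_mat c \<in> carrier_mat ?n 1" using c by simp
      have "kron (snd D k) (snd M k') * kron (snd D b * ?Ft) (1\<^sub>m ?m) = kron (snd D k * (snd D b * ?Ft)) (snd M k')"
        using kron_mult[OF cD cM dF one_carrier_mat, of k k' b] right_mult_one_mat[OF cM] by simp
      then have "kron (c * snd D (S a)) (1\<^sub>m ?m) * (kron (snd D k) (snd M k') * kron (snd D b * ?Ft) (1\<^sub>m ?m)) =
         kron (c * snd D (S a) * (snd D k * (snd D b * ?Ft))) (snd M k')"
        using kron_mult[OF cDa one_carrier_mat mult_carrier_mat[OF cD dF] cM, of "S a" k b k'] left_mult_one_mat[OF cM] by simp
      also have "c * snd D (S a) * (snd D k * (snd D b * ?Ft)) = c * (snd D (S a * k * b) * ?Ft)"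
        by (simp only: assoc_mult_mat[OF c cD mult_carrier_mat[OF cD dF]] fdmodsD(3)[OF D]
            assoc_mult_mat[OF mult_carrier_mat[OF cD cD] cD Ft] assoc_mult_mat[OF cD cD dF])
      also have "\<dots> = transpose_mat (F * snd X (S (S a * k * b)) * transpose_mat c)"
        by (simp add: transpose_mult[OF mult_carrier_mat[OF F cX] ct] transpose_mult[OF F cX])
      finally show "kron (c * snd D (S a)) (1\<^sub>m ?m) * (kron (snd D k) (snd M k') * kron (snd D b * ?Ft) (1\<^sub>m ?m)) =
        (F * snd X (S (S a * k * b)) * transpose_mat c) $$ (0, 0) \<cdot>\<^sub>m snd M k'"
        using kron_transpose_one_one[OF mult_carrier_mat[OF mult_carrier_mat[OF F cX] ct]] by simp
    qed
    finally show ?thesis .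
  qed
  show ?thesis
    unfolding step1 snd_theta_B[OF M]
    using ih_can_contract[OF hom D M M yc' c', of h] by (simp only: ov_y entry)
qed

end

subsection \<open>The elements of the two ends\<close>

lemma regular_faithful: "is_regular sA P co \<Longrightarrow> snd P a = snd P b \<Longrightarrow> a = b"
  using regularD(4,6)[of sA P co] by (metis mult.right_neutral)

text \<open>The regular module is faithful, so linearity of \<xi> and the condition defining E(H,B)
  may be tested on the matrices of \<open>Q\<close>.\<close>

lemma F_space_regular:
  assumes Q: "is_regular sB Q cb" and F: "(\<lambda>h. snd Q (\<xi> h)) \<in> F_space sH \<delta> Q Q"
  shows "\<xi> \<in> E_space sH sB \<delta>"
proof -
  note r = regularD[OF Q]
  note l = F_spaceD(1)[OF F] and e = F_spaceD(2)[OF F]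
  have "lin sH sB \<xi>"
  proof (rule linI)
    fix x y show "\<xi> (x + y) = \<xi> x + \<xi> y"
      by (rule regular_faithful[OF Q]) (simp only: mlinD(2)[OF l] fdmodsD(4)[OF r(1)])
  next
    fix c x show "\<xi> (sH c x) = sB c (\<xi> x)"
      by (rule regular_faithful[OF Q]) (simp only: mlinD(3)[OF l] fdmodsD(5)[OF r(1)])
  qed
  moreover have "sw (\<delta> b) (\<lambda>x y. \<xi> (x * h) * y) = b * \<xi> h" for b h
    by (rule regular_faithful[OF Q]) (simp only: msum_lin[OF fdmodsD(6)[OF r(1)]] fdmodsD(3)[OF r(1)] e)
  ultimately show ?thesis
    unfolding E_space_def by (simp add: linear_iff_lin vsH vsB sw_def)
qed

lemma E_space_F_space:
  assumes M: "M \<in> fdmods sB" and \<xi>: "\<xi> \<in> E_space sH sB \<delta>"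
  shows "(\<lambda>h. snd M (\<xi> h)) \<in> F_space sH \<delta> M M"
proof -
  have l: "lin sH sB \<xi>" and e: "\<And>b h. sw (\<delta> b) (\<lambda>x y. \<xi> (x * h) * y) = b * \<xi> h"
    using \<xi> unfolding E_space_def by (simp_all add: linear_iff_lin vsH vsB sw_def)
  have "msum (fst M) (fst M) (\<delta> b) (\<lambda>x y. snd M (\<xi> (x * h)) * snd M y) = snd M b * snd M (\<xi> h)" for b h
    using msum_lin[OF fdmodsD(6)[OF M], of "\<delta> b" "\<lambda>x y. \<xi> (x * h) * y"] by (simp add: e fdmodsD(3)[OF M])
  then show ?thesis unfolding F_space_def using mlin_rep[OF M l] by blast
qed

private lemma ih_functor:
  "\<And>M N. M \<in> fdmods sB \<Longrightarrow> N \<in> fdmods sB \<Longrightarrow> ih M N \<in> fdmods sH"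
  "\<And>M N f. M \<in> Obj CB \<Longrightarrow> N \<in> Obj CB \<Longrightarrow> f \<in> Hom CB M N \<Longrightarrow>
     internal_hom_data.ih_cov CH CB ih iev M N M f \<in> intertwiners (ih M M) (ih M N)"
  "\<And>M N f. M \<in> Obj CB \<Longrightarrow> N \<in> Obj CB \<Longrightarrow> f \<in> Hom CB M N \<Longrightarrow>
     internal_hom_data.ih_con CH CB ih iev M N N f \<in> intertwiners (ih N N) (ih M N)"
  using ih_fdmods[OF hom] ih_cov_props(1)[OF hom] ih_con_props(1)[OF hom] by simp_all

private abbreviation (input) "natM \<equiv> natural_family CB ih (internal_hom_data.ih_con CH CB ih iev) (internal_hom_data.ih_cov CH CB ih iev)"

text \<open>The value \<xi>(h) is what the component at the regular module does to 1. Naturality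
  along the maps b \<mapsto> b m fixes the component at every M; for M the regular module itself it
  shows that this component is left multiplication by \<xi>(h).\<close>

lemma natural_family_E_space:
  assumes w: "natM w"
  shows "\<exists>\<xi>\<in>E_space sH sB \<delta>. \<forall>M\<in>fdmods sB. \<forall>h. ov M M (w M) h = snd M (\<xi> h)"
proof -
  have wc: "\<And>M. M \<in> fdmods sB \<Longrightarrow> w M \<in> carrier_mat (fst (ih M M)) 1"
    and wn: "\<And>M N f. M \<in> fdmods sB \<Longrightarrow> N \<in> fdmods sB \<Longrightarrow> f \<in> intertwiners M N \<Longrightarrow>
      internal_hom_data.ih_cov CH CB ih iev M N M f * w M = internal_hom_data.ih_con CH CB ih iev M N N f * w N"
    using w unfolding natural_family_def by simp_all
  obtain Q cb where Q: "is_regular sB Q cb" by (rule B.regular_exists)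
  note r = regularD[OF Q]
  have \<Phi>F: "ov M M (w M) \<in> F_space sH \<delta> M M" if M: "M \<in> fdmods sB" for M
    by (rule orb_F_space[OF ih_fdmods[OF hom M M] M M iev_intertwiner[OF hom M M] wc[OF M]])
  note \<Phi>c = mlinD(1)[OF F_spaceD(1)[OF \<Phi>F]]
  have "\<exists>b. ov Q Q (w Q) h * cb 1 = cb b" for h
    by (rule r(5)[OF mult_carrier_mat[OF \<Phi>c[OF r(1)] r(3)]])
  then obtain \<xi> where \<xi>: "\<And>h. ov Q Q (w Q) h * cb 1 = cb (\<xi> h)" by metis
  have main: "ov M M (w M) h = snd M (\<xi> h)" if M: "M \<in> fdmods sB" for M h
  proof (rule mat_eq_cols[OF \<Phi>c[OF M] fdmodsD(1)[OF M]])
    fix m :: "'k mat" assume m: "m \<in> carrier_mat (fst M) 1"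
    obtain f where f: "f \<in> intertwiners Q M" "\<And>b. f * cb b = snd M b * m" by (rule regular_orbit_map[OF Q M m]) blast
    note fc = intertwinersD(1)[OF f(1)]
    have "f * ov Q Q (w Q) h = ov M M (w M) h * f"
      using arg_cong[OF wn[OF r(1) M f(1)], of "\<lambda>z. ov Q M z h"]
      by (simp only: ih_cov_props(2)[OF hom r(1) r(1) M f(1) wc[OF r(1)]] ih_con_props(2)[OF hom r(1) M M f(1) wc[OF M]])
    then have "ov M M (w M) h * (f * cb 1) = f * (ov Q Q (w Q) h * cb 1)"
      by (simp add: assoc_mult_mat[OF \<Phi>c[OF M] fc r(3), symmetric] assoc_mult_mat[OF fc \<Phi>c[OF r(1)] r(3), symmetric])
    then show "ov M M (w M) h * m = snd M (\<xi> h) * m" using m by (simp add: \<xi> f(2) fdmodsD(2)[OF M])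
  qed
  have "(\<lambda>h. snd Q (\<xi> h)) \<in> F_space sH \<delta> Q Q" using \<Phi>F[OF r(1)] by (simp add: main[OF r(1), symmetric])
  from F_space_regular[OF Q this] main show ?thesis by blast
qed

lemma E_space_natural_family:
  assumes \<xi>: "\<xi> \<in> E_space sH sB \<delta>" and wc: "\<And>M. M \<in> fdmods sB \<Longrightarrow> w M \<in> carrier_mat (fst (ih M M)) 1"
    and w: "\<And>M h. M \<in> fdmods sB \<Longrightarrow> ov M M (w M) h = snd M (\<xi> h)"
  shows "natM w"
  unfolding natural_family_def B_FdMod_simps
proof (intro conjI ballI wc)
  fix M N f assume M: "M \<in> fdmods sB" and N: "N \<in> fdmods sB" and f: "f \<in> intertwiners M N"
  let ?a = "internal_hom_data.ih_cov CH CB ih iev M N M f" and ?b = "internal_hom_data.ih_con CH CB ih iev M N N f"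
  show "?a * w M = ?b * w N"
  proof (rule oev_inj[OF hom M N])
    show "?a * w M \<in> carrier_mat (fst (ih M N)) 1"
      by (rule mult_carrier_mat[OF intertwinersD(1)[OF ih_cov_props(1)[OF hom M M N f]] wc[OF M]])
    show "?b * w N \<in> carrier_mat (fst (ih M N)) 1"
      by (rule mult_carrier_mat[OF intertwinersD(1)[OF ih_con_props(1)[OF hom M N N f]] wc[OF N]])
    fix h show "ov M N (?a * w M) h = ov M N (?b * w N) h"
      by (simp only: ih_cov_props(2)[OF hom M M N f wc[OF M]] ih_con_props(2)[OF hom M N N f wc[OF N]] w[OF M] w[OF N] intertwinersD(2)[OF f])
  qed
qed

lemma E_space_lift:
  assumes M: "M \<in> fdmods sB" and \<xi>: "\<xi> \<in> E_space sH sB \<delta>"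
  shows "\<exists>v\<in>carrier_mat (fst (ih M M)) 1. \<forall>h. ov M M v h = snd M (\<xi> h)"
proof -
  have "(\<lambda>h. snd M (\<xi> h)) \<in> ov M M ` carrier_mat (fst (ih M M)) 1"
    using oev_bij[OF hom M M] E_space_F_space[OF M \<xi>] unfolding bij_betw_def by simp
  then obtain v where v: "v \<in> carrier_mat (fst (ih M M)) 1" "ov M M v = (\<lambda>h. snd M (\<xi> h))" by auto
  show ?thesis by (rule bexI[OF _ v(1)]) (simp add: v(2))
qed

text \<open>Joint injectivity and surjectivity of the projections identify the vectors of an
  arbitrary end with natural families, and these correspond to E(H,B).\<close>

lemma end_of_M_elements:
  assumes E: "end_of_M CH CB ih iev EM \<pi>M"
  obtains q where "bij_betw q (carrier_mat (fst EM) 1) (E_space sH sB \<delta>)"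
    "\<And>v M h. v \<in> carrier_mat (fst EM) 1 \<Longrightarrow> M \<in> fdmods sB \<Longrightarrow> ov M M (\<pi>M M * v) h = snd M (q v h)"
proof -
  have E': "is_end CB CH ih (internal_hom_data.ih_con CH CB ih iev) (internal_hom_data.ih_cov CH CB ih iev) EM \<pi>M"
    using E unfolding end_of_M_def .
  have \<pi>: "\<And>M. M \<in> fdmods sB \<Longrightarrow> \<pi>M M \<in> intertwiners EM (ih M M)"
    and dn: "\<And>M N f. M \<in> fdmods sB \<Longrightarrow> N \<in> fdmods sB \<Longrightarrow> f \<in> intertwiners M N \<Longrightarrow>
       internal_hom_data.ih_cov CH CB ih iev M N M f * \<pi>M M = internal_hom_data.ih_con CH CB ih iev M N N f * \<pi>M N"
    using E' unfolding is_end_def is_wedge_def by simp_all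
  note pc = intertwinersD(1)[OF \<pi>]
  note T = ih_functor(1)[folded B_FdMod_simps(1)[of sB \<delta>]]
  have nat: "natM (\<lambda>M. \<pi>M M * v)" if v: "v \<in> carrier_mat (fst EM) 1" for v
    unfolding natural_family_def B_FdMod_simps
  proof (intro conjI ballI mult_carrier_mat[OF pc v])
    fix M N f assume M: "M \<in> fdmods sB" and N: "N \<in> fdmods sB" and f: "f \<in> intertwiners M N"
    show "internal_hom_data.ih_cov CH CB ih iev M N M f * (\<pi>M M * v) = internal_hom_data.ih_con CH CB ih iev M N N f * (\<pi>M N * v)"
      using assoc_mult_mat[OF intertwinersD(1)[OF ih_cov_props(1)[OF hom M M N f]] pc[OF M] v]
        assoc_mult_mat[OF intertwinersD(1)[OF ih_con_props(1)[OF hom M N N f]] pc[OF N] v] dn[OF M N f] by simp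
  qed
  have "\<exists>\<xi>. \<xi> \<in> E_space sH sB \<delta> \<and> (\<forall>M\<in>fdmods sB. \<forall>h. ov M M (\<pi>M M * v) h = snd M (\<xi> h))"
    if "v \<in> carrier_mat (fst EM) 1" for v using natural_family_E_space[OF nat[OF that]] by blast
  then obtain q where q: "\<And>v. v \<in> carrier_mat (fst EM) 1 \<Longrightarrow> q v \<in> E_space sH sB \<delta>"
    "\<And>v M h. v \<in> carrier_mat (fst EM) 1 \<Longrightarrow> M \<in> fdmods sB \<Longrightarrow> ov M M (\<pi>M M * v) h = snd M (q v h)" by metis
  obtain Q cb where Q: "is_regular sB Q cb" by (rule B.regular_exists)
  have "bij_betw q (carrier_mat (fst EM) 1) (E_space sH sB \<delta>)"
  proof (rule bij_betwI')
    fix v w :: "'k mat" assume v: "v \<in> carrier_mat (fst EM) 1" and w: "w \<in> carrier_mat (fst EM) 1"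
    have "v = w" if e: "q v = q w"
    proof (rule end_projections_inj[OF T ih_functor(2,3) E' v w])
      fix M assume "M \<in> Obj CB"
      then have M: "M \<in> fdmods sB" by simp
      show "\<pi>M M * v = \<pi>M M * w"
        by (rule oev_inj[OF hom M M mult_carrier_mat[OF pc[OF M] v] mult_carrier_mat[OF pc[OF M] w]])
          (simp only: q(2)[OF v M] q(2)[OF w M] e)
    qed
    then show "(q v = q w) = (v = w)" by blast
  next
    fix v :: "'k mat" assume "v \<in> carrier_mat (fst EM) 1" then show "q v \<in> E_space sH sB \<delta>" by (rule q(1))
  next
    fix \<xi> assume \<xi>: "\<xi> \<in> E_space sH sB \<delta>"
    have "\<exists>v. v \<in> carrier_mat (fst (ih M M)) 1 \<and> (\<forall>h. ov M M v h = snd M (\<xi> h))" if "M \<in> fdmods sB" for M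
      using E_space_lift[OF that \<xi>] by blast
    then obtain w where w: "\<And>M. M \<in> fdmods sB \<Longrightarrow> w M \<in> carrier_mat (fst (ih M M)) 1"
      "\<And>M h. M \<in> fdmods sB \<Longrightarrow> ov M M (w M) h = snd M (\<xi> h)" by metis
    have "\<exists>v\<in>carrier_mat (fst EM) 1. \<forall>M\<in>Obj CB. \<pi>M M * v = w M"
      by (rule end_projections_surj[OF T ih_functor(2,3) E' E_space_natural_family[OF \<xi> w]])
    then obtain v where v: "v \<in> carrier_mat (fst EM) 1" "\<And>M. M \<in> fdmods sB \<Longrightarrow> \<pi>M M * v = w M" by auto
    note r = regularD[OF Q]
    have "q v h = \<xi> h" for h
      by (rule regular_faithful[OF Q]) (simp only: q(2)[OF v(1) r(1), symmetric] v(2)[OF r(1)] w(2)[OF r(1)])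
    then show "\<exists>v\<in>carrier_mat (fst EM) 1. \<xi> = q v" using v(1) by (intro bexI[of _ v]) (auto simp: fun_eq_iff)
  qed
  then show ?thesis using q(2) by (rule that)
qed

end

end

text \<open>Coevaluation turns \<open>f\<close> into its flattening, and evaluation contracts that
  with a column u; the result, u transposed times f, is the transpose of f applied to u.\<close>

lemma dual_mor_transpose:
  assumes f: "f \<in> carrier_mat (fst Y) (fst X)"
  shows "dual_mor (H_FdMod sH \<Delta> \<epsilon> S) X Y f = transpose_mat f"
proof -
  let ?n = "fst X" and ?m = "fst Y"
  have ft: "transpose_mat f \<in> carrier_mat ?n ?m" using f by simp
  have f1: "kron f (1\<^sub>m ?n) \<in> carrier_mat (?m * ?n) (?n * ?n)" by (rule kron_carrier[OF f one_carrier_mat])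
  have k1: "kron (evm ?m) (1\<^sub>m ?n) \<in> carrier_mat ?n (?m * (?m * ?n))"
    using kron_carrier[OF evm_carrier(1) one_carrier_mat, of ?m ?n] by (simp add: mult.assoc)
  have k2: "kron (1\<^sub>m ?m) (kron f (1\<^sub>m ?n)) \<in> carrier_mat (?m * (?m * ?n)) (?m * (?n * ?n))"
    by (rule kron_carrier[OF one_carrier_mat f1])
  have k3: "kron (1\<^sub>m ?m) (coevm ?n) \<in> carrier_mat (?m * (?n * ?n)) ?m"
    using kron_carrier[OF one_carrier_mat[of ?m] coevm_carrier(1)[of ?n]] by simp
  have v: "vecc f \<in> carrier_mat (?m * ?n) 1" by (rule vecc_carrier(1)[OF f])
  have k4: "kron (1\<^sub>m ?m) (vecc f) \<in> carrier_mat (?m * (?m * ?n)) ?m" using kron_carrier[OF one_carrier_mat[of ?m] v] by simp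
  have "dual_mor (H_FdMod sH \<Delta> \<epsilon> S) X Y f = kron (evm ?m) (1\<^sub>m ?n) * kron (1\<^sub>m ?m) (kron f (1\<^sub>m ?n)) * kron (1\<^sub>m ?m) (coevm ?n)"
    unfolding dual_mor_def by simp
  also have "\<dots> = kron (evm ?m) (1\<^sub>m ?n) * kron (1\<^sub>m ?m) (vecc f)"
    by (simp add: assoc_mult_mat[OF k1 k2 k3] kron_mult[OF one_carrier_mat f1 one_carrier_mat coevm_carrier(1)] coevm_contract[OF f])
  also have "\<dots> = transpose_mat f"
  proof (rule mat_eq_cols[OF mult_carrier_mat[OF k1 k4] ft])
    fix u :: "'a mat" assume u: "u \<in> carrier_mat ?m 1"
    have ut: "transpose_mat u \<in> carrier_mat 1 ?m" using u by simp
    have "kron (1\<^sub>m ?m) (vecc f) * u = kron (1\<^sub>m ?m) (vecc f) * kron u (1\<^sub>m 1)" by simp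
    also have "\<dots> = kron u (vecc f)"
      using left_mult_one_mat[OF u] right_mult_one_mat[OF v] by (simp only: kron_mult[OF one_carrier_mat v u one_carrier_mat])
    finally have "kron (1\<^sub>m ?m) (vecc f) * u = kron u (vecc f)" .
    then have "kron (evm ?m) (1\<^sub>m ?n) * kron (1\<^sub>m ?m) (vecc f) * u = kron (transpose_mat u) (1\<^sub>m ?n) * vecc f"
      by (simp add: assoc_mult_mat[OF k1 k4 u] evm_contract2[OF u v])
    also have "\<dots> = vecc (transpose_mat u * f)"
      using vecc_mult[OF ut f one_carrier_mat] right_mult_one_mat[OF mult_carrier_mat[OF ut f]] by simp
    also have "\<dots> = transpose_mat f * u"
      by (simp add: vecc_row[OF mult_carrier_mat[OF ut f]] transpose_mult[OF ut f])
    finally show "kron (evm ?m) (1\<^sub>m ?n) * kron (1\<^sub>m ?m) (vecc f) * u = transpose_mat f * u" .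
  qed
  finally show ?thesis .
qed

lemma vector_space_fun:
  assumes "vector_space s" shows "vector_space (\<lambda>c (f :: 'i \<Rightarrow> 'w::ab_group_add) x. s (c :: 'k::field) (f x))"
proof -
  interpret vector_space s by fact
  show ?thesis by unfold_locales (auto simp: fun_eq_iff scale_right_distrib scale_left_distrib)
qed

text \<open>A linear map is determined by its values on a basis, and these lie in the span of
  \<open>T\<close>; so the products of coordinate functions with elements of \<open>T\<close> span.
  It supplies finite dimension for internal Homs and for E(H,B).\<close>

lemma (in fd_algebra) linear_maps_finite:
  fixes sW :: "'k \<Rightarrow> 'w::ab_group_add \<Rightarrow> 'w"
  assumes W: "vector_space sW" and T: "finite T"
    and U: "\<And>\<Psi>. \<Psi> \<in> U \<Longrightarrow> lin sA sW \<Psi> \<and> (\<forall>a. \<Psi> a \<in> module.span sW T)"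
  obtains T' where "finite T'" "U \<subseteq> module.span (\<lambda>c (f :: 'a \<Rightarrow> 'w) x. sW c (f x)) T'"
proof -
  interpret W: vector_space sW by (fact W)
  interpret F: vector_space "\<lambda>c (f :: 'a \<Rightarrow> 'w) x. sW c (f x)" by (rule vector_space_fun[OF W])
  obtain P co where P: "is_regular sA P co" by (rule regular_exists)
  note r = regularD[OF P]
  let ?d = "fst P"
  have "\<exists>b. ucol ?d i = co b" for i using r(5)[OF ucol_carrier(1)] .
  then obtain b where b: "\<And>i. co (b i) = ucol ?d i" by metis
  \<comment> \<open>The coordinate functions dual to the basis \<open>b\<close>.\<close>
  define c where "c i a = co a $$ (i, 0)" for i a
  have dec: "a = (\<Sum>i<?d. sA (c i a) (b i))" for a
  proof -
    have ls: "lin sA (*) (\<lambda>a. co a $$ (k, 0))" if "k < ?d" for k by (rule mlin_entry[OF r(2) that]) simp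
    have "co a = co (\<Sum>i<?d. sA (c i a) (b i))"
    proof (rule eq_matI)
      fix k j assume "k < dim_row (co (\<Sum>i<?d. sA (c i a) (b i)))" "j < dim_col (co (\<Sum>i<?d. sA (c i a) (b i)))"
      then have k: "k < ?d" and j: "j = 0" using r(3)[of "\<Sum>i<?d. sA (c i a) (b i)"] by auto
      have "co (\<Sum>i<?d. sA (c i a) (b i)) $$ (k, 0) = (\<Sum>i<?d. c i a * co (b i) $$ (k, 0))"
        by (simp add: lin_sum[OF ls[OF k]] linD(2)[OF ls[OF k]])
      also have "\<dots> = (\<Sum>i<?d. if i = k then c i a else 0)"
        by (rule sum.cong) (use k in \<open>auto simp: b ucol_def\<close>)
      finally show "co a $$ (k, j) = co (\<Sum>i<?d. sA (c i a) (b i)) $$ (k, j)" using k j by (simp add: c_def)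
    qed (use r(3)[of a] r(3)[of "\<Sum>i<?d. sA (c i a) (b i)"] in auto)
    then show ?thesis by (simp only: r(6))
  qed
  define T' where "T' = (\<lambda>(i, t) a. sW (c i a) t) ` ({..<?d} \<times> T)"
  have fin: "finite T'" unfolding T'_def using T by auto
  have sp: "(\<lambda>a. sW (c i a) w) \<in> F.span T'" if i: "i < ?d" and w: "w \<in> W.span T" for i w
    using w
  proof (induction rule: W.span_induct_alt)
    case base
    have "(\<lambda>a. sW (c i a) 0) = 0" by (auto simp: fun_eq_iff)
    then show ?case using F.span_zero by simp
  next
    case (step s x y)
    have eq: "(\<lambda>a. sW (c i a) (sW s x + y)) = (\<lambda>a. sW s (sW (c i a) x)) + (\<lambda>a. sW (c i a) y)"
      by (auto simp: fun_eq_iff W.scale_right_distrib mult.commute)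
    have "(\<lambda>a. sW (c i a) x) \<in> F.span T'"
      using step i by (intro F.span_base) (auto simp: T'_def image_iff)
    from F.span_add[OF F.span_scale[OF this, of s] step(2)] show ?case unfolding eq .
  qed
  have "U \<subseteq> F.span T'"
  proof
    fix \<Psi> assume "\<Psi> \<in> U"
    then have l: "lin sA sW \<Psi>" and s: "\<And>a. \<Psi> a \<in> W.span T" using U by auto
    have e1: "\<Psi> a = (\<Sum>i<?d. sW (c i a) (\<Psi> (b i)))" for a
      by (subst dec[of a]) (simp only: lin_sum[OF l] linD(2)[OF l])
    have e2: "(\<Sum>i<n. (\<lambda>a. sW (c i a) (\<Psi> (b i)))) a = (\<Sum>i<n. sW (c i a) (\<Psi> (b i)))" for a n
      by (induction n) auto
    have "\<Psi> = (\<Sum>i<?d. (\<lambda>a. sW (c i a) (\<Psi> (b i))))" by (rule ext) (rule trans[OF e1 e2[symmetric]])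
    also have "\<dots> \<in> F.span T'" by (intro F.span_sum sp s) auto
    finally show "\<Psi> \<in> F.span T'" .
  qed
  with fin show ?thesis by (rule that)
qed

subsection \<open>The end of \<open>X \<otimes> X\<^sup>*\<close>\<close>

context fd_hopf_algebra begin

context begin

private abbreviation (input) "CT \<equiv> H_FdMod sH \<Delta> \<epsilon> S"
private abbreviation (input) "T0 \<equiv> (\<lambda>X Y. tensor_rep \<Delta> Y (dual_rep X))"
private abbreviation (input) "Tc0 \<equiv> (\<lambda>X Y Z f. kron (1\<^sub>m (fst Z)) (dual_mor CT X Y f))"
private abbreviation (input) "Tv0 \<equiv> (\<lambda>X Y Z f. kron f (1\<^sub>m (fst Z)))"

private lemma end_of_C_iff: "end_of_C CT E \<pi> \<longleftrightarrow> is_end CT CT T0 Tc0 Tv0 E \<pi>"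
  unfolding end_of_C_def by simp

private lemma T0_fdmods: "X \<in> Obj CT \<Longrightarrow> Y \<in> Obj CT \<Longrightarrow> T0 X Y \<in> fdmods sH"
  by (simp add: tensor_rep_fdmodsH dual_rep_fdmods)

private lemma Tv0_intertwiner:
  assumes "X \<in> Obj CT" "Y \<in> Obj CT" "f \<in> Hom CT X Y" shows "Tv0 X Y X f \<in> intertwiners (T0 X X) (T0 X Y)"
proof -
  have X: "X \<in> fdmods sH" and Y: "Y \<in> fdmods sH" and f: "f \<in> intertwiners X Y" using assms by simp_all
  show ?thesis using intertwiners_tensor(2)[OF X Y dual_rep_fdmods[OF X] dual_rep_fdmods[OF X] f one_intertwiners[OF dual_rep_fdmods[OF X]], of \<Delta>] by simp
qed

private lemma Tc0_intertwiner:
  assumes "X \<in> Obj CT" "Y \<in> Obj CT" "f \<in> Hom CT X Y" shows "Tc0 X Y Y f \<in> intertwiners (T0 Y Y) (T0 X Y)"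
proof -
  have X: "X \<in> fdmods sH" and Y: "Y \<in> fdmods sH" and f: "f \<in> intertwiners X Y" using assms by simp_all
  note fc = intertwinersD(1)[OF f] and cX = fdmodsD(1)[OF X] and cY = fdmodsD(1)[OF Y]
  have t: "transpose_mat f \<in> intertwiners (dual_rep Y) (dual_rep X)"
    by (rule intertwinersI)
      (use fc in \<open>simp_all add: transpose_mult[OF fc cX, symmetric] transpose_mult[OF cY fc, symmetric] intertwinersD(2)[OF f]\<close>)
  show ?thesis unfolding dual_mor_transpose[OF fc]
    by (rule intertwiners_tensor(2)[OF Y Y dual_rep_fdmods[OF Y] dual_rep_fdmods[OF X] one_intertwiners[OF Y] t])
qed

text \<open>On flattened matrices the two functorial actions are left and right multiplication, so
  the wedge condition is ordinary naturality of a family of endomorphisms.\<close>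

private lemma natural_vecc:
  assumes X: "X \<in> fdmods sH" and Y: "Y \<in> fdmods sH" and f: "f \<in> intertwiners X Y"
    and A: "A \<in> carrier_mat (fst X) (fst X)" and B: "B \<in> carrier_mat (fst Y) (fst Y)"
  shows "Tv0 X Y X f * vecc A = Tc0 X Y Y f * vecc B \<longleftrightarrow> f * A = B * f"
proof -
  note fc = intertwinersD(1)[OF f]
  have 1: "Tv0 X Y X f * vecc A = vecc (f * A)"
    using vecc_mult[OF fc A one_carrier_mat] right_mult_one_mat[OF mult_carrier_mat[OF fc A]] by simp
  have 2: "Tc0 X Y Y f * vecc B = vecc (B * f)"
    using vecc_mult[OF one_carrier_mat B fc] left_mult_one_mat[OF B] by (simp add: dual_mor_transpose[OF fc])
  show ?thesis unfolding 1 2 using vecc_inj[OF mult_carrier_mat[OF fc A] mult_carrier_mat[OF B fc]] by auto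
qed

private abbreviation (input) "natC \<equiv> natural_family CT T0 Tc0 Tv0"

private lemma natural_family_vecc: "natC (\<lambda>X. vecc (snd X a))"
  unfolding natural_family_def
proof (intro conjI ballI)
  fix X assume "X \<in> Obj CT"
  then have X: "X \<in> fdmods sH" by simp
  show "vecc (snd X a) \<in> carrier_mat (fst (T0 X X)) 1" using vecc_carrier(1)[OF fdmodsD(1)[OF X]] by simp
next
  fix X Y f assume "X \<in> Obj CT" "Y \<in> Obj CT" "f \<in> Hom CT X Y"
  then have X: "X \<in> fdmods sH" and Y: "Y \<in> fdmods sH" and f: "f \<in> intertwiners X Y" by simp_all
  show "Tv0 X Y X f * vecc (snd X a) = Tc0 X Y Y f * vecc (snd Y a)"
    using natural_vecc[OF X Y f fdmodsD(1)[OF X] fdmodsD(1)[OF Y]] intertwinersD(2)[OF f] by blast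
qed

text \<open>Natural endomorphisms of the forgetful functor are given by elements of H:
  \<open>a\<close> is the image of 1 in the regular module, and every vector x of a module is the
  image of 1 under a module map.\<close>

private lemma natural_familyD:
  assumes w: "natC w" shows "\<exists>a. \<forall>X\<in>fdmods sH. w X = vecc (snd X a)"
proof -
  obtain P co where P: "is_regular sH P co" by (rule regular_exists)
  note r = regularD[OF P]
  define A where "A X = unvec (fst X) (fst X) (w X)" for X :: "('k, 'h) rep"
  have Ac: "A X \<in> carrier_mat (fst X) (fst X)" for X by (simp add: A_def)
  have wA: "w X = vecc (A X)" if X: "X \<in> fdmods sH" for X
  proof -
    have "w X \<in> carrier_mat (fst X * fst X) 1" using w X unfolding natural_family_def by simp
    then show ?thesis unfolding A_def by (rule vecc_unvec[symmetric])
  qed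
  have nat: "f * A X = A Y * f" if X: "X \<in> fdmods sH" and Y: "Y \<in> fdmods sH" and f: "f \<in> intertwiners X Y" for X Y f
  proof -
    have "Tv0 X Y X f * w X = Tc0 X Y Y f * w Y" using w X Y f unfolding natural_family_def H_FdMod_simps by blast
    then show ?thesis unfolding wA[OF X] wA[OF Y] using natural_vecc[OF X Y f Ac Ac] by blast
  qed
  obtain a where a: "A P * co 1 = co a" using r(5)[OF mult_carrier_mat[OF Ac r(3)]] by blast
  have "A X = snd X a" if X: "X \<in> fdmods sH" for X
  proof (rule mat_eq_cols[OF Ac fdmodsD(1)[OF X]])
    fix x :: "'k mat" assume x: "x \<in> carrier_mat (fst X) 1"
    obtain f where f: "f \<in> intertwiners P X" "\<And>b. f * co b = snd X b * x" by (rule regular_orbit_map[OF P X x]) blast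
    note fc = intertwinersD(1)[OF f(1)]
    have "A X * (f * co 1) = f * (A P * co 1)"
      by (simp add: assoc_mult_mat[OF Ac fc r(3), symmetric] assoc_mult_mat[OF fc Ac r(3), symmetric] nat[OF r(1) X f(1)])
    then show "A X * x = snd X a * x" using x by (simp add: a f(2) fdmodsD(2)[OF X])
  qed
  then show ?thesis using wA by auto
qed

lemma end_of_C_elements:
  assumes E: "end_of_C CT EC \<pi>C"
  obtains p where "bij_betw p (carrier_mat (fst EC) 1) UNIV"
    "\<And>v X. v \<in> carrier_mat (fst EC) 1 \<Longrightarrow> X \<in> fdmods sH \<Longrightarrow> \<pi>C X * v = vecc (snd X (p v))"
proof -
  have E': "is_end CT CT T0 Tc0 Tv0 EC \<pi>C" using E by (simp add: end_of_C_iff)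
  have \<pi>: "\<And>X. X \<in> Obj CT \<Longrightarrow> \<pi>C X \<in> intertwiners EC (T0 X X)"
    and dn: "\<And>X Y f. X \<in> Obj CT \<Longrightarrow> Y \<in> Obj CT \<Longrightarrow> f \<in> Hom CT X Y \<Longrightarrow> Tv0 X Y X f * \<pi>C X = Tc0 X Y Y f * \<pi>C Y"
    using E' unfolding is_end_def is_wedge_def H_FdMod_simps by blast+
  note pc = intertwinersD(1)[OF \<pi>]
  have nat: "natC (\<lambda>X. \<pi>C X * v)" if v: "v \<in> carrier_mat (fst EC) 1" for v
    unfolding natural_family_def
  proof (intro conjI ballI mult_carrier_mat[OF pc v])
    fix X Y f assume *: "X \<in> Obj CT" "Y \<in> Obj CT" "f \<in> Hom CT X Y"
    show "Tv0 X Y X f * (\<pi>C X * v) = Tc0 X Y Y f * (\<pi>C Y * v)"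
      using assoc_mult_mat[OF intertwinersD(1)[OF Tv0_intertwiner[OF *]] pc[OF *(1)] v]
        assoc_mult_mat[OF intertwinersD(1)[OF Tc0_intertwiner[OF *]] pc[OF *(2)] v] dn[OF *] by simp
  qed
  have "\<exists>a. \<forall>X\<in>fdmods sH. \<pi>C X * v = vecc (snd X a)" if "v \<in> carrier_mat (fst EC) 1" for v
    using natural_familyD[OF nat[OF that]] by blast
  then obtain p where p: "\<And>v X. v \<in> carrier_mat (fst EC) 1 \<Longrightarrow> X \<in> fdmods sH \<Longrightarrow> \<pi>C X * v = vecc (snd X (p v))" by metis
  obtain P co where P: "is_regular sH P co" by (rule regular_exists)
  note r = regularD[OF P]
  have "bij_betw p (carrier_mat (fst EC) 1) UNIV"
  proof (rule bij_betwI')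
    fix v w :: "'k mat" assume v: "v \<in> carrier_mat (fst EC) 1" and w: "w \<in> carrier_mat (fst EC) 1"
    have "v = w" if e: "p v = p w"
    proof (rule end_projections_inj[OF T0_fdmods Tv0_intertwiner Tc0_intertwiner E' v w])
      fix X assume "X \<in> Obj CT"
      then show "\<pi>C X * v = \<pi>C X * w" using p[OF v] p[OF w] e by simp
    qed
    then show "(p v = p w) = (v = w)" by blast
  next
    fix a :: 'h
    have "\<exists>v\<in>carrier_mat (fst EC) 1. \<forall>X\<in>Obj CT. \<pi>C X * v = vecc (snd X a)"
      by (rule end_projections_surj[OF T0_fdmods Tv0_intertwiner Tc0_intertwiner E' natural_family_vecc])
    then obtain v where v: "v \<in> carrier_mat (fst EC) 1" "\<pi>C P * v = vecc (snd P a)" using r(1) by auto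
    have "vecc (snd P a) = vecc (snd P (p v))" using v p[OF v(1) r(1)] by simp
    then have "snd P a = snd P (p v)" by (rule vecc_inj[OF fdmodsD(1)[OF r(1)] fdmodsD(1)[OF r(1)]])
    then have "a = p v" using r(4,6) by (metis mult.right_neutral)
    then show "\<exists>v\<in>carrier_mat (fst EC) 1. a = p v" using v(1) by blast
  qed simp
  then show ?thesis using p by (rule that)
qed

text \<open>The end is \<open>H\<close> with the adjoint action.\<close>

lemma end_of_C_exists: obtains EC \<pi>C where "end_of_C CT EC \<pi>C"
proof -
  \<comment> \<open>Dictated by the projections: on the flattened matrix of a, h acts through left
    multiplication by h1 and right multiplication by S(h2).\<close>
  define act where "act g a = sw (\<Delta> g) (\<lambda>x y. x * a * S y)" for g a
  have bact: "bilin sH sH sH (\<lambda>x y. x * a * S y)" for a by (intro bilinI lin_rules)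
  have act_lin: "lin sH sH (\<lambda>g. act g a)" "lin sH sH (act g)" for a g
    unfolding act_def[abs_def] by (rule lin_Delta[OF vector_space_axioms bact], intro lin_sw_rules lin_rules)
  have act_one: "act 1 a = a" for a unfolding act_def by (simp add: Delta_one[OF vector_space_axioms bact] antipode_one)
  have act_mult: "act (g * h) a = act g (act h a)" for g h a
  proof -
    have "act (g * h) a = sw (\<Delta> g) (\<lambda>x y. sw (\<Delta> h) (\<lambda>x' y'. x * (x' * a * S y') * S y))"
      unfolding act_def by (subst Delta_mult[OF vector_space_axioms bact]) (simp add: antipode_mult mult.assoc)
    also have "\<dots> = sw (\<Delta> g) (\<lambda>x y. x * act h a * S y)"
      unfolding act_def by (intro sw_cong lin_sw[symmetric, of sH sH "\<lambda>z. _ * z * S _"] lin_rules)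
    finally show ?thesis by (simp only: act_def)
  qed
  obtain V where V: "finite V" "span V = UNIV" using finite_dim by blast
  have U: "subspace UNIV" "UNIV \<subseteq> span V" using V by simp_all
  obtain E and co :: "'h \<Rightarrow> 'k mat" and \<phi> :: "'k mat \<Rightarrow> 'h" where E: "E \<in> fdmods sH"
    and co: "\<And>u. co u \<in> carrier_mat (fst E) 1" and \<phi>co: "\<And>u. \<phi> (co u) = u"
    and co\<phi>: "\<And>v. v \<in> carrier_mat (fst E) 1 \<Longrightarrow> co (\<phi> v) = v"
    and \<phi>_add: "\<And>v w. v \<in> carrier_mat (fst E) 1 \<Longrightarrow> w \<in> carrier_mat (fst E) 1 \<Longrightarrow> \<phi> (v + w) = \<phi> v + \<phi> w"
    and \<phi>_smult: "\<And>c v. v \<in> carrier_mat (fst E) 1 \<Longrightarrow> \<phi> (c \<cdot>\<^sub>m v) = sH c (\<phi> v)"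
    and E_act: "\<And>a u. snd E a * co u = co (act a u)"
    by (rule realize_module[OF U V(1), of act sH])
      (auto simp: linD[OF act_lin(1)] linD[OF act_lin(2)] act_one act_mult)
  have \<phi>_act: "\<phi> (snd E a * v) = act a (\<phi> v)" if "v \<in> carrier_mat (fst E) 1" for a v
    using E_act[of a "\<phi> v"] co\<phi>[OF that] \<phi>co[of "act a (\<phi> v)"] by simp
  have "\<exists>G. G \<in> carrier_mat (fst X * fst X) (fst E) \<and> (\<forall>v\<in>carrier_mat (fst E) 1. G * v = vecc (snd X (\<phi> v)))"
    if X: "X \<in> fdmods sH" for X
  proof -
    note c = fdmodsD(1)[OF X]
    obtain G where "G \<in> carrier_mat (fst X * fst X) (fst E)" "\<And>v. v \<in> carrier_mat (fst E) 1 \<Longrightarrow> G * v = vecc (snd X (\<phi> v))"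
      by (rule linear_to_mat[of "fst E" "\<lambda>v. vecc (snd X (\<phi> v))" "fst X * fst X"])
        (use vecc_carrier(1)[OF c] in \<open>auto simp: \<phi>_add \<phi>_smult fdmodsD(4,5)[OF X] vecc_add[OF c c] vecc_smult\<close>)
    then show ?thesis by blast
  qed
  then obtain \<pi> where \<pi>c: "\<And>X. X \<in> fdmods sH \<Longrightarrow> \<pi> X \<in> carrier_mat (fst X * fst X) (fst E)"
    and \<pi>: "\<And>X v. X \<in> fdmods sH \<Longrightarrow> v \<in> carrier_mat (fst E) 1 \<Longrightarrow> \<pi> X * v = vecc (snd X (\<phi> v))" by metis
  have "is_end CT CT T0 Tc0 Tv0 E \<pi>"
  proof (rule is_endI[OF T0_fdmods Tv0_intertwiner Tc0_intertwiner E])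
    fix X assume "X \<in> Obj CT"
    then have X: "X \<in> fdmods sH" by simp
    note c = fdmodsD(1)[OF X] and cE = fdmodsD(1)[OF E]
    show "\<pi> X \<in> intertwiners E (T0 X X)"
    proof (rule intertwinersI)
      fix h
      show "\<pi> X * snd E h = snd (T0 X X) h * \<pi> X"
      proof (rule mat_eq_cols[of _ "fst X * fst X" "fst E"])
        fix v :: "'k mat" assume v: "v \<in> carrier_mat (fst E) 1"
        note Ev = mult_carrier_mat[OF cE v]
        have l: "mlin sH (fst X * fst X) 1 (\<lambda>z. vecc (snd X z))" by (intro mlin_vecc fdmodsD(6)[OF X])
        have "snd (T0 X X) h * (\<pi> X * v) = msum (fst X * fst X) 1 (\<Delta> h) (\<lambda>x y. vecc (snd X (x * \<phi> v * S y)))"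
        proof -
          have k: "kron (snd X x) (transpose_mat (snd X y)) \<in> carrier_mat (fst X * fst X) (fst X * fst X)" for x y
            using c by auto
          have "snd (T0 X X) h = msum (fst X * fst X) (fst X * fst X) (\<Delta> h) (\<lambda>x y. kron (snd X x) (transpose_mat (snd X (S y))))"
            by (simp add: snd_tensor_rep tensor_act_msum)
          then show ?thesis
            by (simp only: \<pi>[OF X v] msum_mult_right[OF vecc_carrier(1)[OF c] k] vecc_mult[OF c c c] fdmodsD(3)[OF X])
        qed
        also have "\<dots> = vecc (snd X (act h (\<phi> v)))" unfolding act_def by (rule msum_lin[OF l, symmetric])
        also have "\<dots> = \<pi> X * (snd E h * v)" by (simp only: \<pi>[OF X Ev] \<phi>_act[OF v])
        finally show "\<pi> X * snd E h * v = snd (T0 X X) h * \<pi> X * v"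
          using assoc_mult_mat[OF \<pi>c[OF X] cE v]
            assoc_mult_mat[OF fdmodsD(1)[OF T0_fdmods[OF \<open>X \<in> Obj CT\<close> \<open>X \<in> Obj CT\<close>]] _ v, of "\<pi> X"] \<pi>c[OF X] by simp
      next
        show "\<pi> X * snd E h \<in> carrier_mat (fst X * fst X) (fst E)" by (rule mult_carrier_mat[OF \<pi>c[OF X] cE])
        show "snd (T0 X X) h * \<pi> X \<in> carrier_mat (fst X * fst X) (fst E)"
          using mult_carrier_mat[OF fdmodsD(1)[OF T0_fdmods[OF \<open>X \<in> Obj CT\<close> \<open>X \<in> Obj CT\<close>]], of "\<pi> X"] \<pi>c[OF X] by simp
      qed
    qed (use \<pi>c[OF X] in simp)
  next
    fix X Y f assume *: "X \<in> Obj CT" "Y \<in> Obj CT" "f \<in> Hom CT X Y"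
    then have X: "X \<in> fdmods sH" and Y: "Y \<in> fdmods sH" by simp_all
    note tv = intertwinersD(1)[OF Tv0_intertwiner[OF *]] and tc = intertwinersD(1)[OF Tc0_intertwiner[OF *]]
    have pX: "\<pi> X \<in> carrier_mat (fst (T0 X X)) (fst E)" and pY: "\<pi> Y \<in> carrier_mat (fst (T0 Y Y)) (fst E)"
      using \<pi>c[OF X] \<pi>c[OF Y] by simp_all
    show "Tv0 X Y X f * \<pi> X = Tc0 X Y Y f * \<pi> Y"
    proof (rule mat_eq_cols[OF mult_carrier_mat[OF tv pX] mult_carrier_mat[OF tc pY]])
      fix v :: "'k mat" assume v: "v \<in> carrier_mat (fst E) 1"
      have "Tv0 X Y X f * vecc (snd X (\<phi> v)) = Tc0 X Y Y f * vecc (snd Y (\<phi> v))"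
        using natural_family_vecc * unfolding natural_family_def by blast
      then show "Tv0 X Y X f * \<pi> X * v = Tc0 X Y Y f * \<pi> Y * v"
        by (simp only: assoc_mult_mat[OF tv pX v] assoc_mult_mat[OF tc pY v] \<pi>[OF X v] \<pi>[OF Y v])
    qed
  next
    fix v w :: "'k mat" assume v: "v \<in> carrier_mat (fst E) 1" and w: "w \<in> carrier_mat (fst E) 1"
      and e: "\<And>X. X \<in> Obj CT \<Longrightarrow> \<pi> X * v = \<pi> X * w"
    obtain P c where P: "is_regular sH P c" by (rule regular_exists)
    note r = regularD[OF P]
    have "vecc (snd P (\<phi> v)) = vecc (snd P (\<phi> w))" using e[of P] r(1) \<pi>[OF r(1) v] \<pi>[OF r(1) w] by simp
    then have "snd P (\<phi> v) = snd P (\<phi> w)" by (rule vecc_inj[OF fdmodsD(1)[OF r(1)] fdmodsD(1)[OF r(1)]])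
    then have "\<phi> v = \<phi> w" using r(4,6) by (metis mult.right_neutral)
    then have "co (\<phi> v) = co (\<phi> w)" by simp
    then show "v = w" by (simp only: co\<phi>[OF v] co\<phi>[OF w])
  next
    fix w assume "natC w"
    from natural_familyD[OF this] obtain a where a: "\<And>X. X \<in> fdmods sH \<Longrightarrow> w X = vecc (snd X a)" by blast
    show "\<exists>v\<in>carrier_mat (fst E) 1. \<forall>X\<in>Obj CT. \<pi> X * v = w X"
      using \<pi>[OF _ co, of _ a] a by (intro bexI[OF _ co[of a]]) (simp add: \<phi>co)
  qed
  then show ?thesis by (intro that[of E \<pi>]) (simp add: end_of_C_iff)
qed

end

end

subsection \<open>Existence of internal Homs and of the end over \<open>B\<close>-modules\<close>

context fd_comodule_algebra begin

text \<open>The space of B-linear maps H \<triangleright> M \<rightarrow> N, with H acting by right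
  translation and evaluation at 1 as counit. Matrices do not form a vector space type, so these maps
  are encoded as scalar functions of an element of H and a pair of indices, and realized as a matrix
  module from there.\<close>

lemma internal_hom_exists:
  assumes M: "M \<in> fdmods sB" and N: "N \<in> fdmods sB"
  shows "\<exists>I e. I \<in> fdmods sH \<and> e \<in> intertwiners (tensor_rep \<delta> I M) N \<and>
     bij_betw (orb I M e) (carrier_mat (fst I) 1) (F_space sH \<delta> M N)"
proof -
  let ?n = "fst N" and ?m = "fst M"
  define s1 :: "'k \<Rightarrow> (nat \<times> nat \<Rightarrow> 'k) \<Rightarrow> nat \<times> nat \<Rightarrow> 'k" where "s1 = (\<lambda>c f x. c * f x)"
  define s2 :: "'k \<Rightarrow> ('h \<Rightarrow> nat \<times> nat \<Rightarrow> 'k) \<Rightarrow> 'h \<Rightarrow> nat \<times> nat \<Rightarrow> 'k" where "s2 = (\<lambda>c f x. s1 c (f x))"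
  have v1: "vector_space s1" unfolding s1_def by (rule vector_space_fun[OF vector_space_field])
  have v2: "vector_space s2" unfolding s2_def by (rule vector_space_fun[OF v1])
  interpret V1: vector_space s1 by (rule v1)
  interpret V2: vector_space s2 by (rule v2)
  define mt where "mt \<Psi> h = mat ?n ?m (\<Psi> h)" for \<Psi> :: "'h \<Rightarrow> nat \<times> nat \<Rightarrow> 'k" and h
  \<comment> \<open>Entries outside the n by m range are fixed to 0, so that a function is
    determined by its matrices.\<close>
  define U where "U = {\<Psi>. mt \<Psi> \<in> F_space sH \<delta> M N \<and> (\<forall>h i j. \<not> (i < ?n \<and> j < ?m) \<longrightarrow> \<Psi> h (i, j) = 0)}"
  have mtc: "mt \<Psi> h \<in> carrier_mat ?n ?m" for \<Psi> h unfolding mt_def by simp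
  note cM = fdmodsD(1)[OF M] and cN = fdmodsD(1)[OF N]
  have mt_add: "mt (\<Psi> + \<Psi>') h = mt \<Psi> h + mt \<Psi>' h" and mt_scale: "mt (s2 c \<Psi>) h = c \<cdot>\<^sub>m mt \<Psi> h" for \<Psi> \<Psi>' c h
    unfolding mt_def s2_def s1_def by (auto intro!: eq_matI)
  have mt_lin: "mlin sH ?n ?m (mt \<Psi>)" and mt_F: "msum ?n ?m (\<delta> b) (\<lambda>x y. mt \<Psi> (x * h) * snd M y) = snd N b * mt \<Psi> h"
    and mt_zero: "\<not> (i < ?n \<and> j < ?m) \<Longrightarrow> \<Psi> h (i, j) = 0"
    if "\<Psi> \<in> U" for \<Psi> b h i j
    using that F_spaceD[of "mt \<Psi>" sH \<delta> M N] unfolding U_def by blast+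
  have U_lin: "lin sH s1 \<Psi>" if \<Psi>: "\<Psi> \<in> U" for \<Psi>
  proof -
    have l: "lin sH (*) (\<lambda>h. \<Psi> h (i, j))" for i j
    proof (cases "i < ?n \<and> j < ?m")
      case True
      then show ?thesis using mlin_entry[OF mt_lin[OF \<Psi>], of i j] by (simp add: mt_def)
    next
      case False
      then show ?thesis using mt_zero[OF \<Psi> False] by (simp add: lin_def)
    qed
    show ?thesis by (rule linI) (auto simp: fun_eq_iff s1_def linD[OF l])
  qed
  have sub: "V2.subspace U"
  proof (rule V2.subspaceI)
    have z: "mt 0 h = 0\<^sub>m ?n ?m" for h by (auto simp: mt_def intro!: eq_matI)
    have "msum ?n ?m (\<delta> b) (\<lambda>x y. 0\<^sub>m ?n ?m * snd M y) = snd N b * 0\<^sub>m ?n ?m" for b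
      using left_mult_zero_mat[OF cM] right_mult_zero_mat[OF cN, of b] by (auto intro!: msum_eqI)
    moreover have "mlin sH ?n ?m (\<lambda>h. 0\<^sub>m ?n ?m)" by (rule mlinI) auto
    ultimately show "0 \<in> U" unfolding U_def F_space_def by (simp add: z[abs_def])
  next
    fix x y assume x: "x \<in> U" and y: "y \<in> U"
    have "mlin sH ?n ?m (mt (x + y))"
    proof (rule mlinI[OF mtc])
      fix u v show "mt (x + y) (u + v) = mt (x + y) u + mt (x + y) v"
        by (simp add: mt_add mlinD(2)[OF mt_lin[OF x]] mlinD(2)[OF mt_lin[OF y]] comm_add_mat[OF mtc mtc] assoc_add_mat[OF mtc mtc]
            assoc_add_mat[OF mtc add_carrier_mat[OF mtc]]) (auto intro!: eq_matI simp: mt_def)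
    next
      fix c u show "mt (x + y) (sH c u) = c \<cdot>\<^sub>m mt (x + y) u"
        by (simp add: mt_add mlinD(3)[OF mt_lin[OF x]] mlinD(3)[OF mt_lin[OF y]] add_smult_distrib_left_mat[OF mtc mtc])
    qed
    moreover have "msum ?n ?m (\<delta> b) (\<lambda>p q. mt (x + y) (p * h) * snd M q) = snd N b * mt (x + y) h" for b h
    proof -
      have "msum ?n ?m (\<delta> b) (\<lambda>p q. mt x (p * h) * snd M q + mt y (p * h) * snd M q) =
         msum ?n ?m (\<delta> b) (\<lambda>p q. mt x (p * h) * snd M q) + msum ?n ?m (\<delta> b) (\<lambda>p q. mt y (p * h) * snd M q)"
        by (rule msum_add) (rule mult_carrier_mat[OF mtc cM])+
      then show ?thesis
        by (simp add: mt_add add_mult_distrib_mat[OF mtc mtc cM] mt_F[OF x] mt_F[OF y] mult_add_distrib_mat[OF cN mtc mtc])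
    qed
    ultimately show "x + y \<in> U" using mt_zero[OF x] mt_zero[OF y] unfolding U_def F_space_def by simp
  next
    fix c x assume x: "x \<in> U"
    have e: "mt (s2 c x) = (\<lambda>h. c \<cdot>\<^sub>m mt x h)" by (rule ext) (rule mt_scale)
    have "msum ?n ?m (\<delta> b) (\<lambda>p q. c \<cdot>\<^sub>m mt x (p * h) * snd M q) = snd N b * (c \<cdot>\<^sub>m mt x h)" for b h
      by (simp add: mult_smult_assoc_mat[OF mtc cM] msum_smult[OF mult_carrier_mat[OF mtc cM]] mt_F[OF x] mult_smult_distrib[OF cN mtc])
    then have "mt (s2 c x) \<in> F_space sH \<delta> M N"
      using mlin_smult_const[OF mt_lin[OF x]] unfolding F_space_def e by simp
    moreover have "s2 c x h (i, j) = 0" if "\<not> (i < ?n \<and> j < ?m)" for h i j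
      using mt_zero[OF x that] by (simp add: s2_def s1_def)
    ultimately show "s2 c x \<in> U" unfolding U_def by simp
  qed
  \<comment> \<open>The elementary matrices; they span the values of all functions in
    \<open>U\<close>.\<close>
  define T where "T = (\<lambda>(i, j) (x :: nat \<times> nat). if x = (i, j) then 1 else 0 :: 'k) ` ({..<?n} \<times> {..<?m})"
  have finT: "finite T" unfolding T_def by simp
  have "\<Psi> a \<in> V1.span T" if \<Psi>: "\<Psi> \<in> U" for \<Psi> a
  proof -
    let ?e = "\<lambda>ij (x :: nat \<times> nat). if x = ij then 1 else 0 :: 'k"
    have ap: "(\<Sum>ij\<in>J. s1 (\<Psi> a ij) (?e ij)) x = (\<Sum>ij\<in>J. \<Psi> a ij * ?e ij x)" if "finite J" for J x
      using that by (induction J rule: finite_induct) (auto simp: s1_def)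
    have "\<Psi> a = (\<Sum>ij\<in>{..<?n} \<times> {..<?m}. s1 (\<Psi> a ij) (?e ij))"
    proof
      fix x :: "nat \<times> nat"
      have "(\<Sum>ij\<in>{..<?n} \<times> {..<?m}. \<Psi> a ij * ?e ij x) = (\<Sum>ij\<in>{..<?n} \<times> {..<?m}. if ij = x then \<Psi> a x else 0)"
        by (rule sum.cong) auto
      also have "\<dots> = \<Psi> a x" using mt_zero[OF \<Psi>, of "fst x" "snd x" a] by (cases x) auto
      finally show "\<Psi> a x = (\<Sum>ij\<in>{..<?n} \<times> {..<?m}. s1 (\<Psi> a ij) (?e ij)) x" by (subst ap) simp_all
    qed
    also have "\<dots> \<in> V1.span T"
      by (intro V1.span_sum V1.span_scale V1.span_base) (auto simp: T_def image_iff)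
    finally show ?thesis .
  qed
  with U_lin have "\<Psi> \<in> U \<Longrightarrow> lin sH s1 \<Psi> \<and> (\<forall>a. \<Psi> a \<in> V1.span T)" for \<Psi> by simp
  then obtain T' where T': "finite T'" "U \<subseteq> V2.span T'"
    unfolding s2_def by (rule H.linear_maps_finite[OF v1 finT])
  \<comment> \<open>Forced by the form of orbit maps: the orbit map of a v at h is that of v at h
    a.\<close>
  define act where "act a \<Psi> h = \<Psi> (h * a)" for a :: 'h and \<Psi> :: "'h \<Rightarrow> nat \<times> nat \<Rightarrow> 'k" and h
  have mt_act: "mt (act a \<Psi>) h = mt \<Psi> (h * a)" for a \<Psi> h unfolding mt_def act_def ..
  obtain I and co :: "('h \<Rightarrow> nat \<times> nat \<Rightarrow> 'k) \<Rightarrow> 'k mat" and \<phi> :: "'k mat \<Rightarrow> 'h \<Rightarrow> nat \<times> nat \<Rightarrow> 'k" where I: "I \<in> fdmods sH"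
    and co: "\<And>u. co u \<in> carrier_mat (fst I) 1" and \<phi>: "\<And>v. \<phi> v \<in> U"
    and \<phi>co: "\<And>u. u \<in> U \<Longrightarrow> \<phi> (co u) = u" and co\<phi>: "\<And>v. v \<in> carrier_mat (fst I) 1 \<Longrightarrow> co (\<phi> v) = v"
    and \<phi>_add: "\<And>v w. v \<in> carrier_mat (fst I) 1 \<Longrightarrow> w \<in> carrier_mat (fst I) 1 \<Longrightarrow> \<phi> (v + w) = \<phi> v + \<phi> w"
    and \<phi>_smult: "\<And>c v. v \<in> carrier_mat (fst I) 1 \<Longrightarrow> \<phi> (c \<cdot>\<^sub>m v) = s2 c (\<phi> v)"
    and I_act: "\<And>a u. u \<in> U \<Longrightarrow> snd I a * co u = co (act a u)"
  proof (rule V2.realize_module[OF sub T'(2,1), of act sH])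
    fix a u assume u: "u \<in> U"
    have "mt (act a u) = (\<lambda>h. mt u (h * a))" by (rule ext) (rule mt_act)
    then show "act a u \<in> U"
      using F_space_right_mult[of "mt u" M N a] u mt_zero[OF u] unfolding U_def by (auto simp: act_def)
  next
    fix a b u assume u: "u \<in> U"
    show "act (a + b) u = act a u + act b u"
      by (intro ext) (simp add: act_def distrib_left linD(1)[OF U_lin[OF u]])
  next
    fix c a u assume u: "u \<in> U"
    show "act (sH c a) u = s2 c (act a u)"
      by (rule ext) (simp add: act_def s2_def H.scale_mult_right linD(2)[OF U_lin[OF u]])
  qed (auto simp: act_def s2_def fun_eq_iff mult.assoc)
  have \<phi>_act: "\<phi> (snd I a * v) = act a (\<phi> v)" if v: "v \<in> carrier_mat (fst I) 1" for a v
  proof -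
    have "act a (\<phi> v) \<in> U"
    proof -
      have "mt (act a (\<phi> v)) = (\<lambda>h. mt (\<phi> v) (h * a))" by (rule ext) (rule mt_act)
      then show ?thesis
        using F_space_right_mult[of "mt (\<phi> v)" M N a] \<phi>[of v] mt_zero[OF \<phi>] unfolding U_def by (auto simp: act_def)
    qed
    then show ?thesis using I_act[OF \<phi>, of a v] co\<phi>[OF v] \<phi>co by simp
  qed
  obtain G where G: "G \<in> carrier_mat (?n * ?m) (fst I)" "\<And>v. v \<in> carrier_mat (fst I) 1 \<Longrightarrow> G * v = vecc (mt (\<phi> v) 1)"
    by (rule linear_to_mat[of "fst I" "\<lambda>v. vecc (mt (\<phi> v) 1)" "?n * ?m"])
      (use vecc_carrier(1)[OF mtc] in \<open>auto simp: \<phi>_add \<phi>_smult mt_add mt_scale vecc_add[OF mtc mtc] vecc_smult\<close>)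
  \<comment> \<open>The counit \<Phi> \<otimes> m \<mapsto> \<Phi>(1) m, where \<open>G\<close>
    stores \<Phi>(1) in flattened form.\<close>
  define e where "e = kron (1\<^sub>m ?n) (evm ?m) * kron G (1\<^sub>m ?m)"
  have ek: "kron (1\<^sub>m ?n) (evm ?m) \<in> carrier_mat ?n (?n * ?m * ?m)" using kron_carrier[OF one_carrier_mat evm_carrier(1), of ?n ?m] by (simp add: mult.assoc)
  have Gk: "kron G (1\<^sub>m ?m) \<in> carrier_mat (?n * ?m * ?m) (fst I * ?m)" by (intro kron_carrier G one_carrier_mat)
  have ec: "e \<in> carrier_mat ?n (fst I * ?m)" unfolding e_def by (rule mult_carrier_mat[OF ek Gk])
  have e: "e * kron v w = mt (\<phi> v) 1 * w" if v: "v \<in> carrier_mat (fst I) 1" and w: "w \<in> carrier_mat ?m 1" for v w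
  proof -
    have "e * kron v w = kron (1\<^sub>m ?n) (evm ?m) * kron (vecc (mt (\<phi> v) 1)) w"
      unfolding e_def using w
      by (simp add: assoc_mult_mat[OF ek Gk kron_carrier[OF v w]] kron_mult[OF G(1) one_carrier_mat v w] G(2)[OF v])
    then show ?thesis by (simp add: vecc_eval[OF mtc w])
  qed
  have orb_e: "orb I M e v = mt (\<phi> v)" if v: "v \<in> carrier_mat (fst I) 1" for v
  proof
    fix h
    show "orb I M e v h = mt (\<phi> v) h"
    proof (rule mat_eq_cols[OF orb_carrier(1)[OF I ec v] mtc])
      fix w :: "'k mat" assume w: "w \<in> carrier_mat ?m 1"
      show "orb I M e v h * w = mt (\<phi> v) h * w"
        by (simp add: orb_eval(1)[OF I ec v w] e[OF mult_carrier_mat[OF fdmodsD(1)[OF I] v] w] \<phi>_act[OF v] mt_act)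
    qed
  qed
  have ei: "e \<in> intertwiners (tensor_rep \<delta> I M) N"
  proof (rule F_space_imp_intertwiner[OF I M N ec])
    fix x :: "'k mat" assume "x \<in> carrier_mat (fst I) 1"
    then show "orb I M e x \<in> F_space sH \<delta> M N" using \<phi>[of x] by (simp add: orb_e U_def)
  qed
  have "bij_betw (orb I M e) (carrier_mat (fst I) 1) (F_space sH \<delta> M N)"
  proof (rule bij_betwI')
    fix v w :: "'k mat" assume v: "v \<in> carrier_mat (fst I) 1" and w: "w \<in> carrier_mat (fst I) 1"
    have "v = w" if "orb I M e v = orb I M e w"
    proof -
      have eq: "mt (\<phi> v) h = mt (\<phi> w) h" for h using fun_cong[OF that, of h] by (simp only: orb_e[OF v] orb_e[OF w])
      have "\<phi> v h (i, j) = \<phi> w h (i, j)" for h i j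
      proof (cases "i < ?n \<and> j < ?m")
        case True then show ?thesis using arg_cong[OF eq[of h], of "\<lambda>A. A $$ (i, j)"] by (simp add: mt_def)
      next
        case False then show ?thesis using mt_zero[OF \<phi> False] by simp
      qed
      then have "\<phi> v = \<phi> w" by (auto simp: fun_eq_iff)
      then have "co (\<phi> v) = co (\<phi> w)" by simp
      then show ?thesis by (simp only: co\<phi>[OF v] co\<phi>[OF w])
    qed
    then show "(orb I M e v = orb I M e w) = (v = w)" by blast
  next
    fix v :: "'k mat" assume "v \<in> carrier_mat (fst I) 1"
    then show "orb I M e v \<in> F_space sH \<delta> M N" using \<phi>[of v] by (simp add: orb_e U_def)
  next
    fix \<Phi> assume \<Phi>: "\<Phi> \<in> F_space sH \<delta> M N"
    note \<Phi>c = mlinD(1)[OF F_spaceD(1)[OF \<Phi>]]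
    define \<Psi> where "\<Psi> h ij = (if fst ij < ?n \<and> snd ij < ?m then \<Phi> h $$ ij else 0)" for h ij
    have mt\<Psi>: "mt \<Psi> = \<Phi>"
    proof
      fix h show "mt \<Psi> h = \<Phi> h" using \<Phi>c[of h] by (auto simp: mt_def \<Psi>_def intro!: eq_matI)
    qed
    then have "\<Psi> \<in> U" using \<Phi> by (simp add: U_def) (simp add: \<Psi>_def)
    then show "\<exists>v\<in>carrier_mat (fst I) 1. \<Phi> = orb I M e v"
      by (intro bexI[of _ "co \<Psi>"] co) (simp add: orb_e[OF co] \<phi>co mt\<Psi>)
  qed
  with I ei show ?thesis by blast
qed

lemma internal_hom_B_FdMod: obtains ih iev where "internal_hom CH CB ih iev"
proof -
  have "\<forall>M N. \<exists>I e. M \<in> fdmods sB \<longrightarrow> N \<in> fdmods sB \<longrightarrow> I \<in> fdmods sH \<and> e \<in> intertwiners (tensor_rep \<delta> I M) N \<and>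
     bij_betw (orb I M e) (carrier_mat (fst I) 1) (F_space sH \<delta> M N)"
    using internal_hom_exists by blast
  then obtain ih iev where "\<And>M N. M \<in> fdmods sB \<Longrightarrow> N \<in> fdmods sB \<Longrightarrow> ih M N \<in> fdmods sH \<and>
     iev M N \<in> intertwiners (tensor_rep \<delta> (ih M N) M) N \<and>
     bij_betw (orb (ih M N) M (iev M N)) (carrier_mat (fst (ih M N)) 1) (F_space sH \<delta> M N)"
    by metis
  then show ?thesis by (intro that[of ih iev] internal_homI) blast+
qed

end

context fd_quasitriangular_comodule_algebra begin

context begin

private abbreviation (input) "funscale \<equiv> (\<lambda>c (f :: 'h \<Rightarrow> 'b) x. sB c (f x))"

lemma E_space_iff: "\<xi> \<in> E_space sH sB \<delta> \<longleftrightarrow> lin sH sB \<xi> \<and> (\<forall>b h. sw (\<delta> b) (\<lambda>x y. \<xi> (x * h) * y) = b * \<xi> h)"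
  unfolding E_space_def by (simp add: linear_iff_lin vsH vsB sw_def)

private lemma E_space_subspace: "module.subspace funscale (E_space sH sB \<delta>)"
proof -
  interpret F: vector_space funscale by (rule vector_space_fun[OF vsB])
  show ?thesis
  proof (rule F.subspaceI)
    have "lin sH sB 0" by (rule linI) simp_all
    moreover have "sw (\<delta> b) (\<lambda>p q. (0 :: 'h \<Rightarrow> 'b) (p * h) * q) = sw (\<delta> b) (\<lambda>p q. 0)" for b h
      by (rule sw_cong) simp
    ultimately show "0 \<in> E_space sH sB \<delta>" unfolding E_space_iff by (simp only: sw_zero) simp
  next
    fix x y assume xy: "x \<in> E_space sH sB \<delta>" "y \<in> E_space sH sB \<delta>"
    have "sw (\<delta> b) (\<lambda>p q. (x + y) (p * h) * q) = sw (\<delta> b) (\<lambda>p q. x (p * h) * q) + sw (\<delta> b) (\<lambda>p q. y (p * h) * q)" for b h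
      unfolding sw_add[symmetric] by (rule sw_cong) (simp add: distrib_right)
    moreover have "sw (\<delta> b) (\<lambda>p q. x (p * h) * q) = b * x h" "sw (\<delta> b) (\<lambda>p q. y (p * h) * q) = b * y h" for b h
      using xy unfolding E_space_iff by blast+
    ultimately have "sw (\<delta> b) (\<lambda>p q. (x + y) (p * h) * q) = b * (x + y) h" for b h
      by (simp only: plus_fun_apply distrib_left)
    moreover have "lin sH sB (x + y)"
      using xy unfolding E_space_iff lin_def by (simp add: algebra_simps B.scale_right_distrib)
    ultimately show "x + y \<in> E_space sH sB \<delta>" unfolding E_space_iff by blast
  next
    fix c x assume x: "x \<in> E_space sH sB \<delta>"
    have l: "lin sB sB (sB c)" by (auto simp: lin_def B.scale_right_distrib mult.commute)
    have "sw (\<delta> b) (\<lambda>p q. sB c (x (p * h)) * q) = b * sB c (x h)" for b h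
      using x lin_sw[OF l, of "\<delta> b" "\<lambda>p q. x (p * h) * q"] unfolding E_space_iff
      by (simp add: B.scale_mult_left B.scale_mult_right)
    moreover have "lin sH sB (\<lambda>a. sB c (x a))" using x unfolding E_space_iff by (auto intro: lin_scale[OF vsB])
    ultimately show "(\<lambda>a. sB c (x a)) \<in> E_space sH sB \<delta>" unfolding E_space_iff by simp
  qed
qed

lemma E_space_right_mult: "\<xi> \<in> E_space sH sB \<delta> \<Longrightarrow> (\<lambda>h. \<xi> (h * a)) \<in> E_space sH sB \<delta>"
  unfolding E_space_iff by (auto simp: mult.assoc distrib_right scale_mult_left lin_def)

text \<open>E(H,B) with H acting by right translation. The projection at M sends \<xi> to the vector
  of ih M M whose orbit map is h \<mapsto> \<rho>(\<xi> h); injectivity of orbit maps makes these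
  choices linear, equivariant and natural.\<close>

lemma end_of_M_exists:
  assumes hom: "internal_hom CH CB ih iev"
  obtains EM \<pi>M where "end_of_M CH CB ih iev EM \<pi>M"
proof -
  interpret F: vector_space funscale by (rule vector_space_fun[OF vsB])
  obtain V where V: "finite V" "B.span V = UNIV" using B.finite_dim by blast
  obtain T' where T': "finite T'" "E_space sH sB \<delta> \<subseteq> F.span T'"
    by (rule linear_maps_finite[OF vsB V(1), of "E_space sH sB \<delta>"]) (auto simp: E_space_iff V(2))
  define act where "act a \<xi> h = \<xi> (h * a)" for a :: 'h and \<xi> :: "'h \<Rightarrow> 'b" and h
  have actE: "act a \<xi> \<in> E_space sH sB \<delta>" if "\<xi> \<in> E_space sH sB \<delta>" for a \<xi>
    unfolding act_def[abs_def] by (rule E_space_right_mult[OF that])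
  obtain E and co :: "('h \<Rightarrow> 'b) \<Rightarrow> 'k mat" and \<phi> :: "'k mat \<Rightarrow> 'h \<Rightarrow> 'b" where E: "E \<in> fdmods sH"
    and co: "\<And>u. co u \<in> carrier_mat (fst E) 1" and \<phi>: "\<And>v. \<phi> v \<in> E_space sH sB \<delta>"
    and \<phi>co: "\<And>u. u \<in> E_space sH sB \<delta> \<Longrightarrow> \<phi> (co u) = u" and co\<phi>: "\<And>v. v \<in> carrier_mat (fst E) 1 \<Longrightarrow> co (\<phi> v) = v"
    and \<phi>_add: "\<And>v w. v \<in> carrier_mat (fst E) 1 \<Longrightarrow> w \<in> carrier_mat (fst E) 1 \<Longrightarrow> \<phi> (v + w) = \<phi> v + \<phi> w"
    and \<phi>_smult: "\<And>c v. v \<in> carrier_mat (fst E) 1 \<Longrightarrow> \<phi> (c \<cdot>\<^sub>m v) = funscale c (\<phi> v)"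
    and E_act: "\<And>a u. u \<in> E_space sH sB \<delta> \<Longrightarrow> snd E a * co u = co (act a u)"
  proof (rule F.realize_module[OF E_space_subspace T'(2,1), of act sH])
    fix a b u assume "u \<in> E_space sH sB \<delta>"
    then have "lin sH sB u" unfolding E_space_iff by simp
    from linD(1)[OF this] show "act (a + b) u = act a u + act b u"
      by (intro ext) (simp add: act_def distrib_left)
  next
    fix c a u assume u: "u \<in> E_space sH sB \<delta>"
    then have "lin sH sB u" unfolding E_space_iff by simp
    from linD(2)[OF this] show "act (sH c a) u = (\<lambda>x. sB c (act a u x))"
      by (intro ext) (simp add: act_def scale_mult_right)
  qed (auto simp: actE, auto simp: act_def fun_eq_iff mult.assoc)
  have \<phi>_act: "\<phi> (snd E a * v) = act a (\<phi> v)" if v: "v \<in> carrier_mat (fst E) 1" for a v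
    using E_act[OF \<phi>, of a v] co\<phi>[OF v] \<phi>co[OF actE[OF \<phi>]] by simp
  let ?ov = "\<lambda>M N. orb (ih M N) M (iev M N)"
  note oM = ih_fdmods[OF hom] and eM = iev_carrier[OF hom]
  have "\<exists>G. G \<in> carrier_mat (fst (ih M M)) (fst E) \<and>
      (\<forall>v\<in>carrier_mat (fst E) 1. \<forall>h. ?ov M M (G * v) h = snd M (\<phi> v h))" if M: "M \<in> fdmods sB" for M
  proof -
    have "\<exists>x. x \<in> carrier_mat (fst (ih M M)) 1 \<and> (\<forall>h. ?ov M M x h = snd M (\<phi> v h))" for v
      using E_space_lift[OF hom M \<phi>] by blast
    then obtain g where g: "\<And>v. g v \<in> carrier_mat (fst (ih M M)) 1" "\<And>v h. ?ov M M (g v) h = snd M (\<phi> v h)" by metis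
    obtain G where "G \<in> carrier_mat (fst (ih M M)) (fst E)" "\<And>v. v \<in> carrier_mat (fst E) 1 \<Longrightarrow> G * v = g v"
    proof (rule linear_to_mat[of "fst E" g "fst (ih M M)"])
      fix v w :: "'k mat" assume "v \<in> carrier_mat (fst E) 1" "w \<in> carrier_mat (fst E) 1"
      then show "g (v + w) = g v + g w"
        by (intro oev_inj[OF hom M M g(1) add_carrier_mat[OF g(1)]])
          (simp add: g(2) orb_add[OF oM[OF M M] eM[OF M M] g(1) g(1)] \<phi>_add fdmodsD(4)[OF M])
    next
      fix c and v :: "'k mat" assume "v \<in> carrier_mat (fst E) 1"
      then show "g (c \<cdot>\<^sub>m v) = c \<cdot>\<^sub>m g v"
        by (intro oev_inj[OF hom M M g(1) smult_carrier_mat[OF g(1)]])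
          (simp add: g(2) orb_smult[OF oM[OF M M] eM[OF M M] g(1)] \<phi>_smult fdmodsD(5)[OF M])
    qed (use g(1) in auto)
    then show ?thesis using g(2) by auto
  qed
  then obtain \<pi> where \<pi>c: "\<And>M. M \<in> fdmods sB \<Longrightarrow> \<pi> M \<in> carrier_mat (fst (ih M M)) (fst E)"
    and \<pi>: "\<And>M v h. M \<in> fdmods sB \<Longrightarrow> v \<in> carrier_mat (fst E) 1 \<Longrightarrow> ?ov M M (\<pi> M * v) h = snd M (\<phi> v h)" by metis
  have \<pi>v: "\<pi> M * v \<in> carrier_mat (fst (ih M M)) 1" if "M \<in> fdmods sB" "v \<in> carrier_mat (fst E) 1" for M v
    by (rule mult_carrier_mat[OF \<pi>c[OF that(1)] that(2)])
  have "is_end CB CH ih (internal_hom_data.ih_con CH CB ih iev) (internal_hom_data.ih_cov CH CB ih iev) E \<pi>"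
  proof (rule is_endI[OF _ _ _ E])
    fix M N assume "M \<in> Obj CB" "N \<in> Obj CB" then show "ih M N \<in> fdmods sH" by (simp add: oM)
  next
    fix M N f assume "M \<in> Obj CB" "N \<in> Obj CB" "f \<in> Hom CB M N"
    then show "internal_hom_data.ih_cov CH CB ih iev M N M f \<in> intertwiners (ih M M) (ih M N)"
      "internal_hom_data.ih_con CH CB ih iev M N N f \<in> intertwiners (ih N N) (ih M N)"
      by (simp_all add: ih_cov_props(1)[OF hom] ih_con_props(1)[OF hom])
  next
    fix M assume "M \<in> Obj CB"
    then have M: "M \<in> fdmods sB" by simp
    note cE = fdmodsD(1)[OF E] and cI = fdmodsD(1)[OF oM[OF M M]]
    show "\<pi> M \<in> intertwiners E (ih M M)"
    proof (rule intertwinersI[OF \<pi>c[OF M]])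
      fix a show "\<pi> M * snd E a = snd (ih M M) a * \<pi> M"
      proof (rule mat_eq_cols[OF mult_carrier_mat[OF \<pi>c[OF M] cE] mult_carrier_mat[OF cI \<pi>c[OF M]]])
        fix v :: "'k mat" assume v: "v \<in> carrier_mat (fst E) 1"
        note Ev = mult_carrier_mat[OF cE v]
        have "\<pi> M * (snd E a * v) = snd (ih M M) a * (\<pi> M * v)"
        proof (rule oev_inj[OF hom M M \<pi>v[OF M Ev] mult_carrier_mat[OF cI \<pi>v[OF M v]]])
          fix h show "?ov M M (\<pi> M * (snd E a * v)) h = ?ov M M (snd (ih M M) a * (\<pi> M * v)) h"
            by (simp add: \<pi>[OF M Ev] \<phi>_act[OF v] act_def orb_act[OF oM[OF M M] \<pi>v[OF M v]] \<pi>[OF M v])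
        qed
        then show "\<pi> M * snd E a * v = snd (ih M M) a * \<pi> M * v"
          by (simp add: assoc_mult_mat[OF \<pi>c[OF M] cE v] assoc_mult_mat[OF cI \<pi>c[OF M] v])
      qed
    qed
  next
    fix M N f assume "M \<in> Obj CB" "N \<in> Obj CB" "f \<in> Hom CB M N"
    then have M: "M \<in> fdmods sB" and N: "N \<in> fdmods sB" and f: "f \<in> intertwiners M N" by simp_all
    note tv = intertwinersD(1)[OF ih_cov_props(1)[OF hom M M N f]] and tc = intertwinersD(1)[OF ih_con_props(1)[OF hom M N N f]]
    show "internal_hom_data.ih_cov CH CB ih iev M N M f * \<pi> M = internal_hom_data.ih_con CH CB ih iev M N N f * \<pi> N"
    proof (rule mat_eq_cols[OF mult_carrier_mat[OF tv \<pi>c[OF M]] mult_carrier_mat[OF tc \<pi>c[OF N]]])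
      fix v :: "'k mat" assume v: "v \<in> carrier_mat (fst E) 1"
      have "natural_family CB ih (internal_hom_data.ih_con CH CB ih iev) (internal_hom_data.ih_cov CH CB ih iev) (\<lambda>M. \<pi> M * v)"
        by (rule E_space_natural_family[OF hom \<phi> \<pi>v[OF _ v] \<pi>[OF _ v]])
      then have "internal_hom_data.ih_cov CH CB ih iev M N M f * (\<pi> M * v) = internal_hom_data.ih_con CH CB ih iev M N N f * (\<pi> N * v)"
        using M N f unfolding natural_family_def B_FdMod_simps by blast
      then show "internal_hom_data.ih_cov CH CB ih iev M N M f * \<pi> M * v = internal_hom_data.ih_con CH CB ih iev M N N f * \<pi> N * v"
        by (simp only: assoc_mult_mat[OF tv \<pi>c[OF M] v] assoc_mult_mat[OF tc \<pi>c[OF N] v])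
    qed
  next
    fix v w :: "'k mat" assume v: "v \<in> carrier_mat (fst E) 1" and w: "w \<in> carrier_mat (fst E) 1"
      and e: "\<And>M. M \<in> Obj CB \<Longrightarrow> \<pi> M * v = \<pi> M * w"
    obtain Q cb where Q: "is_regular sB Q cb" by (rule B.regular_exists)
    note r = regularD[OF Q]
    have "\<phi> v h = \<phi> w h" for h
      by (rule regular_faithful[OF hom Q]) (use e[of Q] r(1) \<pi>[OF r(1) v, of h] \<pi>[OF r(1) w, of h] in simp)
    then have "\<phi> v = \<phi> w" by (rule ext)
    then have "co (\<phi> v) = co (\<phi> w)" by simp
    then show "v = w" by (simp only: co\<phi>[OF v] co\<phi>[OF w])
  next
    fix w assume nat: "natural_family CB ih (internal_hom_data.ih_con CH CB ih iev) (internal_hom_data.ih_cov CH CB ih iev) w"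
    then have wc: "\<And>M. M \<in> fdmods sB \<Longrightarrow> w M \<in> carrier_mat (fst (ih M M)) 1" unfolding natural_family_def by simp
    obtain \<xi> where \<xi>: "\<xi> \<in> E_space sH sB \<delta>" "\<And>M h. M \<in> fdmods sB \<Longrightarrow> ?ov M M (w M) h = snd M (\<xi> h)"
      using natural_family_E_space[OF hom nat] by blast
    have "\<pi> M * co \<xi> = w M" if M: "M \<in> fdmods sB" for M
      by (rule oev_inj[OF hom M M \<pi>v[OF M co] wc[OF M]]) (simp only: \<pi>[OF M co] \<phi>co[OF \<xi>(1)] \<xi>(2)[OF M])
    then show "\<exists>v\<in>carrier_mat (fst E) 1. \<forall>M\<in>Obj CB. \<pi> M * v = w M" using co by (intro bexI[of _ "co \<xi>"]) auto
  qed
  then show ?thesis by (intro that[of E \<pi>]) (simp add: end_of_M_def)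
qed

end

end

subsection \<open>The morphism \<open>\<theta>\<close>\<close>

text \<open>In the regular module, the vector is 1 and the functional sends the coordinates of a to
  g(a).\<close>

lemma (in fd_algebra) matrix_coefficient:
  assumes g: "lin sA (*) g"
  obtains P F c where "P \<in> fdmods sA" "F \<in> carrier_mat 1 (fst P)" "c \<in> carrier_mat 1 (fst P)"
    "\<And>a. F * snd P a * transpose_mat c = mat 1 1 (\<lambda>_. g a)"
proof -
  obtain P co where P: "is_regular sA P co" by (rule regular_exists)
  note r = regularD[OF P]
  obtain F where F: "F \<in> carrier_mat 1 (fst P)" "\<And>a. F * co a = mat 1 1 (\<lambda>_. g a)"
    by (rule regular_functional[OF P g]) blast
  have c: "transpose_mat (co 1) \<in> carrier_mat 1 (fst P)" using r(3) by simp
  have "F * snd P a * transpose_mat (transpose_mat (co 1)) = mat 1 1 (\<lambda>_. g a)" for a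
    by (simp only: transpose_transpose assoc_mult_mat[OF F(1) fdmodsD(1)[OF r(1)] r(3)] r(4) mult_1_right F(2))
  then show ?thesis by (rule that[OF r(1) F(1) c])
qed

context fd_quasitriangular_comodule_algebra begin

context
  fixes ih iev EC \<pi>C EM \<pi>M and p :: "'k mat \<Rightarrow> 'h" and q :: "'k mat \<Rightarrow> 'h \<Rightarrow> 'b"
  assumes hom: "internal_hom CH CB ih iev"
    and EC: "end_of_C CH EC \<pi>C" and EM: "end_of_M CH CB ih iev EM \<pi>M"
    and p_bij: "bij_betw p (carrier_mat (fst EC) 1) UNIV"
    and p: "\<And>v X. v \<in> carrier_mat (fst EC) 1 \<Longrightarrow> X \<in> fdmods sH \<Longrightarrow> \<pi>C X * v = vecc (snd X (p v))"
    and q_bij: "bij_betw q (carrier_mat (fst EM) 1) (E_space sH sB \<delta>)"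
    and q: "\<And>v M h. v \<in> carrier_mat (fst EM) 1 \<Longrightarrow> M \<in> fdmods sB \<Longrightarrow>
      orb (ih M M) M (iev M M) (\<pi>M M * v) h = snd M (q v h)"
begin

private abbreviation (input) "oc X M \<equiv> internal_hom_data.omega_component CH CB ih iev (K_braiding K) X M"
private abbreviation (input) "oe M \<equiv> orb (ih M M) M (iev M M)"
private abbreviation (input) "Th g \<equiv> theta_B \<Delta> S sB K (\<lambda>z. g (S z))"
private abbreviation (input) "nC \<equiv> fst EC"
private abbreviation (input) "nM \<equiv> fst EM"

private lemma EC_fdmods: "EC \<in> fdmods sH"
  and \<pi>C: "X \<in> fdmods sH \<Longrightarrow> \<pi>C X \<in> intertwiners EC (tensor_rep \<Delta> X (dual_rep X))"
  using EC unfolding end_of_C_def is_end_def is_wedge_def by simp_all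

private lemma EM_fdmods: "EM \<in> fdmods sH"
  and \<pi>M: "M \<in> fdmods sB \<Longrightarrow> \<pi>M M \<in> intertwiners EM (ih M M)"
  using EM unfolding end_of_M_def is_end_def is_wedge_def by simp_all

private lemma \<pi>C_carrier: "X \<in> fdmods sH \<Longrightarrow> \<pi>C X \<in> carrier_mat (fst X * fst X) nC"
  using intertwinersD(1)[OF \<pi>C] by simp

private lemmas \<pi>M_carrier = intertwinersD(1)[OF \<pi>M]

private lemma \<pi>M_inj:
  assumes v: "v \<in> carrier_mat nM 1" and w: "w \<in> carrier_mat nM 1"
    and e: "\<And>M. M \<in> fdmods sB \<Longrightarrow> \<pi>M M * v = \<pi>M M * w"
  shows "v = w"
proof -
  obtain Q cb where Q: "is_regular sB Q cb" by (rule B.regular_exists)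
  note r = regularD[OF Q]
  have "q v h = q w h" for h
    by (rule regular_faithful[OF hom Q]) (simp only: q[OF v r(1), symmetric] q[OF w r(1), symmetric] e[OF r(1)])
  then have "q v = q w" by (rule ext)
  then show "v = w" using bij_betw_imp_inj_on[OF q_bij] v w unfolding inj_on_def by blast
qed

private definition "pinv = inv_into (carrier_mat nC 1) p"

private lemma pinv: "pinv a \<in> carrier_mat nC 1" "p (pinv a) = a" "v \<in> carrier_mat nC 1 \<Longrightarrow> pinv (p v) = v"
proof -
  show "pinv a \<in> carrier_mat nC 1" unfolding pinv_def using p_bij by (intro inv_into_into) (simp add: bij_betw_def)
  show "p (pinv a) = a" unfolding pinv_def using p_bij by (intro f_inv_into_f) (simp add: bij_betw_def)
  show "v \<in> carrier_mat nC 1 \<Longrightarrow> pinv (p v) = v" unfolding pinv_def by (rule inv_into_f_f[OF bij_betw_imp_inj_on[OF p_bij]])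
qed

text \<open>The bijection \<open>p\<close> comes without linearity; this is recovered from the
  linear projection to the component of the regular module, on which H acts faithfully.\<close>

private lemma p_linear:
  assumes v: "v \<in> carrier_mat nC 1" and w: "w \<in> carrier_mat nC 1"
  shows "p (v + w) = p v + p w" "p (c \<cdot>\<^sub>m v) = sH c (p v)"
proof -
  obtain P co where P: "is_regular sH P co" by (rule regular_exists)
  note r = regularD[OF P]
  note P1 = r(1) and cP = fdmodsD(1)[OF r(1)]
  have "vecc (snd P (p (v + w))) = vecc (snd P (p v + p w))"
    by (simp only: p[OF add_carrier_mat[OF w] P1, symmetric] fdmodsD(4)[OF P1] vecc_add[OF cP cP]
        p[OF v P1, symmetric] p[OF w P1, symmetric] mult_add_distrib_mat[OF \<pi>C_carrier[OF P1] v w])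
  from regular_faithful[OF hom P vecc_inj[OF cP cP this]] show "p (v + w) = p v + p w" .
  have "vecc (snd P (p (c \<cdot>\<^sub>m v))) = vecc (snd P (sH c (p v)))"
    by (simp only: p[OF smult_carrier_mat[OF v] P1, symmetric] fdmodsD(5)[OF P1] vecc_smult
        p[OF v P1, symmetric] mult_smult_distrib[OF \<pi>C_carrier[OF P1] v])
  from regular_faithful[OF hom P vecc_inj[OF cP cP this]] show "p (c \<cdot>\<^sub>m v) = sH c (p v)" .
qed

private lemma pinv_linear: "pinv (a + b) = pinv a + pinv b" "pinv (sH c a) = c \<cdot>\<^sub>m pinv a"
proof -
  have "pinv (p (pinv a + pinv b)) = pinv a + pinv b" by (intro pinv(3) add_carrier_mat pinv(1))
  then show "pinv (a + b) = pinv a + pinv b" by (simp only: p_linear(1)[OF pinv(1) pinv(1)] pinv(2))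
  have "pinv (p (c \<cdot>\<^sub>m pinv a)) = c \<cdot>\<^sub>m pinv a" by (intro pinv(3) smult_carrier_mat pinv(1))
  then show "pinv (sH c a) = c \<cdot>\<^sub>m pinv a" by (simp only: p_linear(2)[OF pinv(1) pinv(1)] pinv(2))
qed

text \<open>Columns \<open>f\<close> are the vectors of the dual of \<open>EC\<close>; transported
  along the bijection of \<open>EC\<close> with H, each becomes a functional on H.\<close>

private definition gf :: "'k mat \<Rightarrow> 'h \<Rightarrow> 'k" where "gf f a = (transpose_mat f * pinv a) $$ (0, 0)"

private lemma gf_mat:
  assumes "f \<in> carrier_mat nC 1" shows "transpose_mat f * pinv a = mat 1 1 (\<lambda>_. gf f a)"
proof (rule eq_matI)
  show "dim_row (transpose_mat f * pinv a) = dim_row (mat 1 1 (\<lambda>_. gf f a))"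
    "dim_col (transpose_mat f * pinv a) = dim_col (mat 1 1 (\<lambda>_. gf f a))" using assms pinv(1)[of a] by auto
qed (auto simp: gf_def)

private lemma gf_lin: assumes f: "f \<in> carrier_mat nC 1" shows "lin sH (*) (gf f)"
proof (rule linI)
  have ft: "transpose_mat f \<in> carrier_mat 1 nC" using f by simp
  have c: "transpose_mat f * pinv a \<in> carrier_mat 1 1" for a by (rule mult_carrier_mat[OF ft pinv(1)])
  show "gf f (a + b) = gf f a + gf f b" for a b
    unfolding gf_def pinv_linear mult_add_distrib_mat[OF ft pinv(1) pinv(1)] using carrier_matD[OF c[of b]] by simp
  show "gf f (sH k a) = k * gf f a" for k a
    unfolding gf_def pinv_linear mult_smult_distrib[OF ft pinv(1)] using carrier_matD[OF c[of a]] by simp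
qed

private lemma gf_bij: "bij_betw gf (carrier_mat nC 1) {g. lin sH (*) g}"
proof (rule bij_betwI')
  fix f f' :: "'k mat" assume f: "f \<in> carrier_mat nC 1" and f': "f' \<in> carrier_mat nC 1"
  have ft: "transpose_mat f \<in> carrier_mat 1 nC" and ft': "transpose_mat f' \<in> carrier_mat 1 nC" using f f' by simp_all
  have "f = f'" if e: "gf f = gf f'"
  proof -
    have "transpose_mat f = transpose_mat f'"
    proof (rule mat_eq_cols[OF ft ft'])
      fix v :: "'k mat" assume v: "v \<in> carrier_mat nC 1"
      have "transpose_mat f * pinv (p v) = transpose_mat f' * pinv (p v)" by (simp only: gf_mat[OF f] gf_mat[OF f'] e)
      then show "transpose_mat f * v = transpose_mat f' * v" by (simp only: pinv(3)[OF v])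
    qed
    then have "transpose_mat (transpose_mat f) = transpose_mat (transpose_mat f')" by (simp only:)
    then show ?thesis by simp
  qed
  then show "(gf f = gf f') = (f = f')" by blast
next
  fix f :: "'k mat" assume "f \<in> carrier_mat nC 1" then show "gf f \<in> {g. lin sH (*) g}" by (simp add: gf_lin)
next
  fix g assume "g \<in> {g. lin sH (*) g}"
  then have g: "lin sH (*) g" by simp
  obtain G where G: "G \<in> carrier_mat 1 nC" "\<And>v. v \<in> carrier_mat nC 1 \<Longrightarrow> G * v = mat 1 1 (\<lambda>_. g (p v))"
    by (rule linear_to_mat[of nC "\<lambda>v. mat 1 1 (\<lambda>_. g (p v))" 1]) (auto simp: p_linear linD[OF g] intro!: eq_matI)
  have "g = gf (transpose_mat G)"
    by (rule ext) (simp add: gf_def G(2)[OF pinv(1)] pinv(2))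
  then show "\<exists>f\<in>carrier_mat nC 1. g = gf f" by (rule bexI) (use G(1) in simp)
qed

text \<open>Contraction commutes with projection: the pair of functionals is pulled back along the
  projection of \<open>EC\<close>, while the projection of \<open>EM\<close> acts on the other
  leg.\<close>

private lemma row_split:
  assumes F: "F \<in> carrier_mat 1 (fst X)" and c: "c \<in> carrier_mat 1 (fst X)" and X: "X \<in> fdmods sH"
    and M: "M \<in> fdmods sB" and Z: "Z \<in> carrier_mat (nC * nM) 1"
  shows "kron (kron F c) (1\<^sub>m (fst (ih M M))) * (kron (\<pi>C X) (\<pi>M M) * Z) =
    \<pi>M M * (kron (kron F c * \<pi>C X) (1\<^sub>m nM) * Z)"
proof -
  let ?I = "fst (ih M M)"
  have Fc: "kron F c \<in> carrier_mat 1 (fst X * fst X)" using kron_carrier[OF F c] by simp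
  note pc = \<pi>C_carrier[OF X] and pm = \<pi>M_carrier[OF M]
  have k1: "kron (kron F c) (1\<^sub>m ?I) \<in> carrier_mat ?I (fst X * fst X * ?I)" using kron_carrier[OF Fc one_carrier_mat[of ?I]] by simp
  have k2: "kron (\<pi>C X) (\<pi>M M) \<in> carrier_mat (fst X * fst X * ?I) (nC * nM)" by (rule kron_carrier[OF pc pm])
  have r: "kron F c * \<pi>C X \<in> carrier_mat 1 nC" by (rule mult_carrier_mat[OF Fc pc])
  have k3: "kron (kron F c * \<pi>C X) (1\<^sub>m nM) \<in> carrier_mat nM (nC * nM)" using kron_carrier[OF r one_carrier_mat[of nM]] by simp
  have a: "kron (kron F c) (1\<^sub>m ?I) * kron (\<pi>C X) (\<pi>M M) = kron (kron F c * \<pi>C X) (\<pi>M M)"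
    unfolding kron_mult[OF Fc one_carrier_mat pc pm] using pm by simp
  have "kron (1\<^sub>m 1) (\<pi>M M) * kron (kron F c * \<pi>C X) (1\<^sub>m nM) = kron (kron F c * \<pi>C X) (\<pi>M M)"
    unfolding kron_mult[OF one_carrier_mat pm r one_carrier_mat] left_mult_one_mat[OF r] right_mult_one_mat[OF pm] ..
  then have b: "\<pi>M M * kron (kron F c * \<pi>C X) (1\<^sub>m nM) = kron (kron F c * \<pi>C X) (\<pi>M M)" by (simp only: kron_one1)
  show ?thesis
    by (simp only: assoc_mult_mat[OF k1 k2 Z, symmetric] assoc_mult_mat[OF pm k3 Z, symmetric] a b)
qed

private lemma row_\<pi>C:
  assumes F: "F \<in> carrier_mat 1 (fst X)" and c: "c \<in> carrier_mat 1 (fst X)" and X: "X \<in> fdmods sH"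
    and v: "v \<in> carrier_mat nC 1"
  shows "kron F c * \<pi>C X * v = F * snd X (p v) * transpose_mat c"
proof -
  have Fc: "kron F c \<in> carrier_mat 1 (fst X * fst X)" using kron_carrier[OF F c] by simp
  have ct: "transpose_mat c \<in> carrier_mat (fst X) 1" using c by simp
  note cX = fdmodsD(1)[OF X]
  have "kron F c * \<pi>C X * v = kron F (transpose_mat (transpose_mat c)) * vecc (snd X (p v))"
    by (simp only: assoc_mult_mat[OF Fc \<pi>C_carrier[OF X] v] p[OF v X] transpose_transpose)
  also have "\<dots> = vecc (F * snd X (p v) * transpose_mat c)" by (rule vecc_mult[OF F cX ct])
  finally show ?thesis by (simp only: vecc_col[OF mult_carrier_mat[OF mult_carrier_mat[OF F cX] ct]])
qed

text \<open>Every functional on H is a matrix coefficient of the regular module, so every functional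
  on \<open>EC\<close> is pulled back from that single component.\<close>

private lemma row_eq:
  assumes f: "f \<in> carrier_mat nC 1"
  obtains P F c where "P \<in> fdmods sH" "F \<in> carrier_mat 1 (fst P)" "c \<in> carrier_mat 1 (fst P)"
    "kron F c * \<pi>C P = transpose_mat f" "\<And>a. (F * snd P a * transpose_mat c) $$ (0, 0) = gf f a"
proof -
  obtain P F c where P: "P \<in> fdmods sH" "F \<in> carrier_mat 1 (fst P)" "c \<in> carrier_mat 1 (fst P)"
    "\<And>a. F * snd P a * transpose_mat c = mat 1 1 (\<lambda>_. gf f a)" by (rule matrix_coefficient[OF gf_lin[OF f]]) blast
  have Fc: "kron F c \<in> carrier_mat 1 (fst P * fst P)" using kron_carrier[OF P(2,3)] by simp
  have "kron F c * \<pi>C P = transpose_mat f"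
  proof (rule mat_eq_cols[OF mult_carrier_mat[OF Fc \<pi>C_carrier[OF P(1)]]])
    show "transpose_mat f \<in> carrier_mat 1 nC" using f by simp
    fix v :: "'k mat" assume v: "v \<in> carrier_mat nC 1"
    show "kron F c * \<pi>C P * v = transpose_mat f * v"
      using gf_mat[OF f, of "p v"] by (simp only: row_\<pi>C[OF P(2,3,1) v] P(4) pinv(3)[OF v])
  qed
  then show ?thesis by (rule that[OF P(1-3)]) (simp add: P(4))
qed

private lemma kron_row_carrier: "f \<in> carrier_mat nC 1 \<Longrightarrow> kron (transpose_mat f) (1\<^sub>m nM) \<in> carrier_mat nM (nC * nM)"
  using kron_carrier[of "transpose_mat f" 1 nC "1\<^sub>m nM" nM nM] by simp

text \<open>With the functional pulled back from a component P, the left-hand side is a contraction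
  of the component of \<omega> at P and the regular B-module, which
  \<open>omega_component_contract\<close> evaluates; faithfulness of the regular B-module gives the
  equality.\<close>

private lemma theta_eq:
  assumes \<omega>: "\<omega> \<in> carrier_mat (nC * nM) 1"
    and om: "\<And>X M. X \<in> fdmods sH \<Longrightarrow> M \<in> fdmods sB \<Longrightarrow> kron (\<pi>C X) (\<pi>M M) * \<omega> = oc X M"
    and f: "f \<in> carrier_mat nC 1"
  shows "q (kron (transpose_mat f) (1\<^sub>m nM) * \<omega>) = Th (gf f)"
proof
  fix h
  let ?v = "kron (transpose_mat f) (1\<^sub>m nM) * \<omega>"
  obtain Q cb where Q: "is_regular sB Q cb" by (rule B.regular_exists)
  note r = regularD[OF Q]
  obtain P F c where P: "P \<in> fdmods sH" "F \<in> carrier_mat 1 (fst P)" "c \<in> carrier_mat 1 (fst P)"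
    "kron F c * \<pi>C P = transpose_mat f" "\<And>a. (F * snd P a * transpose_mat c) $$ (0, 0) = gf f a" by (rule row_eq[OF f]) blast
  have v: "?v \<in> carrier_mat nM 1" by (rule mult_carrier_mat[OF kron_row_carrier[OF f] \<omega>])
  have "snd Q (q ?v h) = oe Q (kron (kron F c) (1\<^sub>m (fst (ih Q Q))) * oc P Q) h"
    by (simp only: q[OF v r(1), symmetric] om[OF P(1) r(1), symmetric] row_split[OF P(2,3,1) r(1) \<omega>] P(4))
  also have "\<dots> = snd Q (Th (gf f) h)" by (simp only: omega_component_contract[OF hom P(1) r(1) P(2,3)] P(5))
  finally show "q ?v h = Th (gf f) h" by (rule regular_faithful[OF hom Q])
qed

text \<open>Membership is read off from the category instead of being computed from the axioms of K:
  acting on the regular B-module, the function is the orbit map of a vector of an internal Hom,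
  hence B-linear.\<close>

lemma theta_antipode_E_space:
  assumes g: "lin sH (*) g" shows "Th g \<in> E_space sH sB \<delta>"
proof -
  obtain P F c where P: "P \<in> fdmods sH" "F \<in> carrier_mat 1 (fst P)" "c \<in> carrier_mat 1 (fst P)"
    "\<And>a. F * snd P a * transpose_mat c = mat 1 1 (\<lambda>_. g a)" by (rule matrix_coefficient[OF g]) blast
  obtain Q cb where Q: "is_regular sB Q cb" by (rule B.regular_exists)
  note r = regularD[OF Q]
  let ?I = "fst (ih Q Q)"
  have k: "kron (kron F c) (1\<^sub>m ?I) \<in> carrier_mat ?I (fst P * fst P * ?I)"
    using kron_carrier[OF kron_carrier[OF P(2,3)] one_carrier_mat[of ?I]] by simp
  have om: "oc P Q \<in> carrier_mat (fst P * fst P * ?I) 1"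
    using intertwinersD(1)[OF omega_component_intertwiner[OF hom P(1) r(1)]] by simp
  have "(\<lambda>h. snd Q (Th g h)) = oe Q (kron (kron F c) (1\<^sub>m ?I) * oc P Q)"
    by (rule ext) (simp add: omega_component_contract[OF hom P(1) r(1) P(2,3)] P(4))
  then have "(\<lambda>h. snd Q (Th g h)) \<in> F_space sH \<delta> Q Q"
    by (simp only: orb_F_space[OF ih_fdmods[OF hom r(1) r(1)] r(1) r(1) iev_intertwiner[OF hom r(1) r(1)] mult_carrier_mat[OF k om]])
  then show ?thesis by (rule F_space_regular[OF hom Q])
qed

text \<open>Functionals on \<open>EC\<close> come from components, and the projections of
  \<open>EM\<close> separate vectors, so the products of projections are jointly injective.\<close>

private lemma kron_rows_eq:
  assumes A: "A \<in> carrier_mat (nC * nM) 1" and B: "B \<in> carrier_mat (nC * nM) 1"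
    and eq: "\<And>X M. X \<in> fdmods sH \<Longrightarrow> M \<in> fdmods sB \<Longrightarrow> kron (\<pi>C X) (\<pi>M M) * A = kron (\<pi>C X) (\<pi>M M) * B"
  shows "A = B"
proof (rule col_eq_contract[OF A B])
  fix r :: "'k mat" assume r: "r \<in> carrier_mat 1 nC"
  then have f: "transpose_mat r \<in> carrier_mat nC 1" by simp
  obtain P F c where P: "P \<in> fdmods sH" "F \<in> carrier_mat 1 (fst P)" "c \<in> carrier_mat 1 (fst P)"
    "kron F c * \<pi>C P = transpose_mat (transpose_mat r)" by (rule row_eq[OF f]) blast
  have k: "kron r (1\<^sub>m nM) \<in> carrier_mat nM (nC * nM)" using kron_row_carrier[OF f] by simp
  show "kron r (1\<^sub>m nM) * A = kron r (1\<^sub>m nM) * B"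
  proof (rule \<pi>M_inj[OF mult_carrier_mat[OF k A] mult_carrier_mat[OF k B]])
    fix M assume M: "M \<in> fdmods sB"
    show "\<pi>M M * (kron r (1\<^sub>m nM) * A) = \<pi>M M * (kron r (1\<^sub>m nM) * B)"
      using row_split[OF P(2,3,1) M A] row_split[OF P(2,3,1) M B] by (simp only: P(4) transpose_transpose eq[OF P(1) M])
  qed
qed

text \<open>By \<open>theta_eq\<close> the contraction of \<omega> with each functional is forced,
  and it depends linearly on the functional; so \<omega> is the tensor of that linear map.
  Invariance holds because all components are invariant and the products of projections are jointly
  injective.\<close>

lemma omega_exists:
  "\<exists>\<omega>\<in>intertwiners unit_rep (tensor_rep \<Delta> EC EM). \<forall>X\<in>fdmods sH. \<forall>M\<in>fdmods sB. kron (\<pi>C X) (\<pi>M M) * \<omega> = oc X M"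
proof -
  \<comment> \<open>The vector of \<open>EM\<close> that contraction of \<omega> with f has to
    produce.\<close>
  define t where "t f = inv_into (carrier_mat nM 1) q (Th (gf f))" for f
  have ThE: "Th (gf f) \<in> E_space sH sB \<delta>" if "f \<in> carrier_mat nC 1" for f
    by (rule theta_antipode_E_space[OF gf_lin[OF that]])
  have t: "t f \<in> carrier_mat nM 1" and qt: "q (t f) = Th (gf f)" if f: "f \<in> carrier_mat nC 1" for f
    using ThE[OF f] q_bij unfolding t_def
    by (simp_all only: bij_betw_def inv_into_into f_inv_into_f)
  have t_eq: "v = t f" if v: "v \<in> carrier_mat nM 1" and f: "f \<in> carrier_mat nC 1"
    and e: "\<And>M h. M \<in> fdmods sB \<Longrightarrow> oe M (\<pi>M M * v) h = snd M (Th (gf f) h)" for v f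
  proof (rule \<pi>M_inj[OF v t[OF f]])
    fix M assume M: "M \<in> fdmods sB"
    show "\<pi>M M * v = \<pi>M M * t f"
      by (rule oev_inj[OF hom M M mult_carrier_mat[OF \<pi>M_carrier[OF M] v] mult_carrier_mat[OF \<pi>M_carrier[OF M] t[OF f]]])
        (simp only: e[OF M] q[OF t[OF f] M] qt[OF f])
  qed
  have oe_add: "oe M (\<pi>M M * (v + w)) h = oe M (\<pi>M M * v) h + oe M (\<pi>M M * w) h"
    and oe_smult: "oe M (\<pi>M M * (c \<cdot>\<^sub>m v)) h = c \<cdot>\<^sub>m oe M (\<pi>M M * v) h"
    if M: "M \<in> fdmods sB" and v: "v \<in> carrier_mat nM 1" and w: "w \<in> carrier_mat nM 1" for M v w c h
  proof -
    note pm = \<pi>M_carrier[OF M] and I = ih_fdmods[OF hom M M] and e = iev_carrier[OF hom M M]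
    show "oe M (\<pi>M M * (v + w)) h = oe M (\<pi>M M * v) h + oe M (\<pi>M M * w) h"
      by (simp only: mult_add_distrib_mat[OF pm v w] orb_add[OF I e mult_carrier_mat[OF pm v] mult_carrier_mat[OF pm w]])
    show "oe M (\<pi>M M * (c \<cdot>\<^sub>m v)) h = c \<cdot>\<^sub>m oe M (\<pi>M M * v) h"
      by (simp only: mult_smult_distrib[OF pm v] orb_smult[OF I e mult_carrier_mat[OF pm v]])
  qed
  have gf_add: "gf (f + f') a = gf f a + gf f' a" and gf_smult: "gf (c \<cdot>\<^sub>m f) a = c * gf f a"
    if f: "f \<in> carrier_mat nC 1" and f': "f' \<in> carrier_mat nC 1" for f f' c a
  proof -
    have ft: "transpose_mat f \<in> carrier_mat 1 nC" "transpose_mat f' \<in> carrier_mat 1 nC" using f f' by simp_all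
    have c: "transpose_mat f * pinv a \<in> carrier_mat 1 1" "transpose_mat f' * pinv a \<in> carrier_mat 1 1"
      by (rule mult_carrier_mat[OF ft(1) pinv(1)], rule mult_carrier_mat[OF ft(2) pinv(1)])
    have "transpose_mat (f + f') = transpose_mat f + transpose_mat f'" using f f' by (auto intro!: eq_matI)
    then show "gf (f + f') a = gf f a + gf f' a"
      unfolding gf_def using carrier_matD[OF c(2)] by (simp add: add_mult_distrib_mat[OF ft pinv(1)])
    have "transpose_mat (c \<cdot>\<^sub>m f) = c \<cdot>\<^sub>m transpose_mat f" by (auto intro!: eq_matI)
    then show "gf (c \<cdot>\<^sub>m f) a = c * gf f a"
      unfolding gf_def using carrier_matD[OF c(1)] by (simp add: mult_smult_assoc_mat[OF ft(1) pinv(1)])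
  qed
  have Th_add: "Th (gf (f + f')) h = Th (gf f) h + Th (gf f') h" and Th_smult: "Th (gf (c \<cdot>\<^sub>m f)) h = sB c (Th (gf f) h)"
    if f: "f \<in> carrier_mat nC 1" and f': "f' \<in> carrier_mat nC 1" for f f' c h
  proof -
    have l: "lin sB sB (sB c)" by (auto simp: lin_def B.scale_right_distrib mult.commute)
    show "Th (gf (f + f')) h = Th (gf f) h + Th (gf f') h"
      unfolding theta_B_eq gf_add[OF f f'] B.scale_left_distrib sw_add ..
    show "Th (gf (c \<cdot>\<^sub>m f)) h = sB c (Th (gf f) h)"
      unfolding theta_B_eq gf_smult[OF f f'] B.scale_scale[symmetric] lin_sw[OF l] ..
  qed
  obtain G where G: "G \<in> carrier_mat nM nC" "\<And>f. f \<in> carrier_mat nC 1 \<Longrightarrow> G * f = t f"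
  proof (rule linear_to_mat[of nC t nM])
    show "t f \<in> carrier_mat nM 1" if "f \<in> carrier_mat nC 1" for f by (rule t[OF that])
    fix f f' :: "'k mat" assume f: "f \<in> carrier_mat nC 1" and f': "f' \<in> carrier_mat nC 1"
    show "t (f + f') = t f + t f'"
      by (rule t_eq[symmetric, OF add_carrier_mat[OF t[OF f']] add_carrier_mat[OF f']])
        (simp only: oe_add[OF _ t[OF f] t[OF f']] q[OF t[OF f]] q[OF t[OF f']] qt[OF f] qt[OF f'] Th_add[OF f f'] fdmodsD(4))
  next
    fix c and f :: "'k mat" assume f: "f \<in> carrier_mat nC 1"
    show "t (c \<cdot>\<^sub>m f) = c \<cdot>\<^sub>m t f"
      by (rule t_eq[symmetric, OF smult_carrier_mat[OF t[OF f]] smult_carrier_mat[OF f]])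
        (simp only: oe_smult[OF _ t[OF f] t[OF f]] q[OF t[OF f]] qt[OF f] Th_smult[OF f f] fdmodsD(5))
  qed blast
  \<comment> \<open>The linear map from the dual of \<open>EC\<close> to \<open>EM\<close>,
    flattened into a vector of the tensor product.\<close>
  define \<omega> where "\<omega> = vecc (transpose_mat G)"
  have Gt: "transpose_mat G \<in> carrier_mat nC nM" using G(1) by simp
  have \<omega>: "\<omega> \<in> carrier_mat (nC * nM) 1" unfolding \<omega>_def by (rule vecc_carrier(1)[OF Gt])
  have row: "kron (transpose_mat f) (1\<^sub>m nM) * \<omega> = t f" if f: "f \<in> carrier_mat nC 1" for f
  proof -
    have ft: "transpose_mat f \<in> carrier_mat 1 nC" using f by simp
    have "kron (transpose_mat f) (transpose_mat (1\<^sub>m nM)) * \<omega> = vecc (transpose_mat f * transpose_mat G * 1\<^sub>m nM)"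
      unfolding \<omega>_def by (rule vecc_mult[OF ft Gt one_carrier_mat])
    also have "\<dots> = transpose_mat (transpose_mat f * transpose_mat G)"
      by (simp only: right_mult_one_mat[OF mult_carrier_mat[OF ft Gt]] vecc_row[OF mult_carrier_mat[OF ft Gt]])
    also have "\<dots> = G * f" by (simp only: transpose_mult[OF ft Gt] transpose_transpose)
    finally show ?thesis by (simp only: transpose_one G(2)[OF f])
  qed
  have om: "kron (\<pi>C X) (\<pi>M M) * \<omega> = oc X M" if X: "X \<in> fdmods sH" and M: "M \<in> fdmods sB" for X M
  proof -
    let ?I = "fst (ih M M)"
    have k: "kron (\<pi>C X) (\<pi>M M) \<in> carrier_mat (fst X * fst X * ?I) (nC * nM)"
      by (rule kron_carrier[OF \<pi>C_carrier[OF X] \<pi>M_carrier[OF M]])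
    have oc: "oc X M \<in> carrier_mat (fst X * fst X * ?I) 1"
      using intertwinersD(1)[OF omega_component_intertwiner[OF hom X M]] by simp
    show ?thesis
    proof (rule col_eq_contract2[OF mult_carrier_mat[OF k \<omega>] oc])
      fix F c :: "'k mat" assume F: "F \<in> carrier_mat 1 (fst X)" and c: "c \<in> carrier_mat 1 (fst X)"
      have Fc: "kron F c \<in> carrier_mat 1 (fst X * fst X)" using kron_carrier[OF F c] by simp
      have kI: "kron (kron F c) (1\<^sub>m ?I) \<in> carrier_mat ?I (fst X * fst X * ?I)"
        using kron_carrier[OF Fc one_carrier_mat[of ?I]] by simp
      \<comment> \<open>An arbitrary pair of row functionals on a component is turned into a
        functional on \<open>EC\<close>, where the contraction of \<omega> is known to be
        \<open>t f\<close>.\<close>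
      define f where "f = transpose_mat (kron F c * \<pi>C X)"
      have f: "f \<in> carrier_mat nC 1" unfolding f_def using mult_carrier_mat[OF Fc \<pi>C_carrier[OF X]] by simp
      have fT: "kron F c * \<pi>C X = transpose_mat f" unfolding f_def by simp
      have gf: "gf f a = (F * snd X a * transpose_mat c) $$ (0, 0)" for a
        unfolding gf_def fT[symmetric] row_\<pi>C[OF F c X pinv(1)] pinv(2) ..
      show "kron (kron F c) (1\<^sub>m ?I) * (kron (\<pi>C X) (\<pi>M M) * \<omega>) = kron (kron F c) (1\<^sub>m ?I) * oc X M"
      proof (rule oev_inj[OF hom M M mult_carrier_mat[OF kI mult_carrier_mat[OF k \<omega>]] mult_carrier_mat[OF kI oc]])
        fix h
        show "oe M (kron (kron F c) (1\<^sub>m ?I) * (kron (\<pi>C X) (\<pi>M M) * \<omega>)) h = oe M (kron (kron F c) (1\<^sub>m ?I) * oc X M) h"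
          by (simp only: row_split[OF F c X M \<omega>] fT row[OF f] q[OF t[OF f] M] qt[OF f] omega_component_contract[OF hom X M F c] gf)
      qed
    qed
  qed
  have "\<omega> \<in> intertwiners unit_rep (tensor_rep \<Delta> EC EM)"
  proof (rule intertwinersI)
    show "\<omega> \<in> carrier_mat (fst (tensor_rep \<Delta> EC EM)) (fst unit_rep)" using \<omega> by simp
    fix h
    note T = tensor_rep_fdmodsH[OF EC_fdmods EM_fdmods]
    have a: "snd (tensor_rep \<Delta> EC EM) h \<in> carrier_mat (nC * nM) (nC * nM)" using fdmodsD(1)[OF T] by simp
    have u: "snd unit_rep h \<in> carrier_mat 1 1" by simp
    show "\<omega> * snd unit_rep h = snd (tensor_rep \<Delta> EC EM) h * \<omega>"
    proof (rule kron_rows_eq[OF mult_carrier_mat[OF \<omega> u] mult_carrier_mat[OF a \<omega>]])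
      fix X M assume X: "X \<in> fdmods sH" and M: "M \<in> fdmods sB"
      let ?XD = "tensor_rep \<Delta> X (dual_rep X)" and ?I = "ih M M" and ?k = "kron (\<pi>C X) (\<pi>M M)"
      note XD = tensor_rep_fdmodsH[OF X dual_rep_fdmods[OF X]] and I = ih_fdmods[OF hom M M]
      have b: "snd (tensor_rep \<Delta> ?XD ?I) h \<in> carrier_mat (fst X * fst X * fst ?I) (fst X * fst X * fst ?I)"
        using fdmodsD(1)[OF tensor_rep_fdmodsH[OF XD I]] by simp
      have k: "?k \<in> carrier_mat (fst X * fst X * fst ?I) (nC * nM)"
        by (rule kron_carrier[OF \<pi>C_carrier[OF X] \<pi>M_carrier[OF M]])
      have "?k * (snd (tensor_rep \<Delta> EC EM) h * \<omega>) = snd (tensor_rep \<Delta> ?XD ?I) h * oc X M"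
        using intertwinersD(2)[OF intertwiners_tensor(2)[OF EC_fdmods XD EM_fdmods I \<pi>C[OF X] \<pi>M[OF M], of \<Delta>], of h]
        by (simp only: assoc_mult_mat[OF k a \<omega>, symmetric] assoc_mult_mat[OF b k \<omega>] om[OF X M])
      also have "\<dots> = ?k * \<omega> * snd unit_rep h"
        by (simp only: om[OF X M] intertwinersD(2)[OF omega_component_intertwiner[OF hom X M]])
      finally show "?k * (\<omega> * snd unit_rep h) = ?k * (snd (tensor_rep \<Delta> EC EM) h * \<omega>)"
        by (simp only: assoc_mult_mat[OF k \<omega> u])
    qed
  qed
  then show ?thesis using om by blast
qed

text \<open>The bijections \<open>gf\<close> and \<open>q\<close> carry the matrix of \<theta> into
  g \<mapsto> \<open>theta_B\<close> of g composed with S. A module map is an isomorphism exactly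
  when it is bijective on vectors, and precomposition with S permutes the functionals on H.\<close>

lemma nondegeneracy_iff:
  assumes \<omega>: "\<omega> \<in> intertwiners unit_rep (tensor_rep \<Delta> EC EM)"
    and om: "\<And>X M. X \<in> fdmods sH \<Longrightarrow> M \<in> fdmods sB \<Longrightarrow> kron (\<pi>C X) (\<pi>M M) * \<omega> = oc X M"
  shows "is_iso CH (dual_rep EC) EM (kron (evm nC) (1\<^sub>m nM) * kron (1\<^sub>m nC) \<omega>) \<longleftrightarrow> factorizable sH \<Delta> S sB \<delta> K"
proof -
  let ?T = "kron (evm nC) (1\<^sub>m nM) * kron (1\<^sub>m nC) \<omega>" and ?D = "dual_rep EC"
  note E = EC_fdmods and N = EM_fdmods and D = dual_rep_fdmods[OF EC_fdmods] and u = unit_rep_fdmods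
  have \<omega>c: "\<omega> \<in> carrier_mat (nC * nM) 1" using intertwinersD(1)[OF \<omega>] by simp
  note EN = tensor_rep_fdmodsH[OF E N] and DE = tensor_rep_fdmodsH[OF D E] 
  note DEN = tensor_rep_fdmodsH[OF D EN]
  have "kron (1\<^sub>m (fst ?D)) \<omega> \<in> intertwiners (tensor_rep \<Delta> ?D unit_rep) (tensor_rep \<Delta> ?D (tensor_rep \<Delta> EC EM))"
    by (rule intertwiners_tensor(2)[OF D D u EN one_intertwiners[OF D] \<omega>])
  then have 1: "kron (1\<^sub>m nC) \<omega> \<in> intertwiners ?D (tensor_rep \<Delta> ?D (tensor_rep \<Delta> EC EM))"
    by (simp only: tensor_rep_unit_right[OF D] fst_conv)
  have 2: "kron (evm nC) (1\<^sub>m nM) \<in> intertwiners (tensor_rep \<Delta> ?D (tensor_rep \<Delta> EC EM)) EM"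
    using intertwiners_tensor(2)[OF DE u N N evm_intertwiner[OF E] one_intertwiners[OF N], of \<Delta>]
    by (simp only: tensor_rep_unitH[OF N] tensor_rep_assocH[OF D E N])
  have T: "?T \<in> intertwiners ?D EM" by (rule intertwiners_comp[OF D DEN N 1 2])
  note c1 = intertwinersD(1)[OF 1] and c2 = intertwinersD(1)[OF 2]
  \<comment> \<open>Inserting the column f into \<theta> contracts the leg \<open>EC\<close> of
    \<omega> with f.\<close>
  have T_apply: "?T * f = kron (transpose_mat f) (1\<^sub>m nM) * \<omega>" if f: "f \<in> carrier_mat nC 1" for f
  proof -
    have c1: "kron (1\<^sub>m nC) \<omega> \<in> carrier_mat (nC * (nC * nM)) nC" using kron_carrier[OF one_carrier_mat \<omega>c, of nC] by simp
    have c2: "kron (evm nC) (1\<^sub>m nM) \<in> carrier_mat nM (nC * (nC * nM))" using kron_carrier[OF evm_carrier(1) one_carrier_mat, of nC nM] by (simp add: mult.assoc)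
    have "kron (1\<^sub>m nC) \<omega> * kron f (1\<^sub>m 1) = kron f \<omega>"
      unfolding kron_mult[OF one_carrier_mat \<omega>c f one_carrier_mat] left_mult_one_mat[OF f] right_mult_one_mat[OF \<omega>c] ..
    then have "kron (1\<^sub>m nC) \<omega> * f = kron f \<omega>" by (simp only: kron_one1)
    then show ?thesis by (simp only: assoc_mult_mat[OF c2 c1 f] evm_contract2[OF f \<omega>c])
  qed
  have qT: "q (?T * f) = Th (gf f)" if f: "f \<in> carrier_mat nC 1" for f
    unfolding T_apply[OF f] by (rule theta_eq[OF \<omega>c om f])
  have Tc: "?T \<in> carrier_mat nM nC" using intertwinersD(1)[OF T] by simp
  have "is_iso CH ?D EM ?T \<longleftrightarrow> bij_betw (\<lambda>f. ?T * f) (carrier_mat nC 1) (carrier_mat nM 1)"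
  proof
    assume "is_iso CH ?D EM ?T"
    then obtain g where g: "g \<in> intertwiners EM ?D" "g * ?T = 1\<^sub>m nC" "?T * g = 1\<^sub>m nM"
      unfolding is_iso_def inverse_of_def by auto
    have gc: "g \<in> carrier_mat nC nM" using intertwinersD(1)[OF g(1)] by simp
    show "bij_betw (\<lambda>f. ?T * f) (carrier_mat nC 1) (carrier_mat nM 1)"
    proof (rule bij_betwI[where g = "\<lambda>v. g * v"])
      show "g * (?T * f) = f" if f: "f \<in> carrier_mat nC 1" for f
        by (simp only: assoc_mult_mat[OF gc Tc f, symmetric] g(2) left_mult_one_mat[OF f])
      show "?T * (g * v) = v" if v: "v \<in> carrier_mat nM 1" for v
        by (simp only: assoc_mult_mat[OF Tc gc v, symmetric] g(3) left_mult_one_mat[OF v])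
    qed (auto intro: mult_carrier_mat[OF Tc] mult_carrier_mat[OF gc])
  next
    assume "bij_betw (\<lambda>f. ?T * f) (carrier_mat nC 1) (carrier_mat nM 1)"
    then have "bij_betw (\<lambda>f. ?T * f) (carrier_mat (fst ?D) 1) (carrier_mat nM 1)" by (simp only: fst_conv)
    then obtain g where "g \<in> intertwiners EM ?D" "g * ?T = 1\<^sub>m (fst ?D)" "?T * g = 1\<^sub>m nM"
      by (rule is_iso_intertwiner[OF D N T])
    with T show "is_iso CH ?D EM ?T" unfolding is_iso_def inverse_of_def H_FdMod_simps by blast
  qed
  also have "\<dots> \<longleftrightarrow> bij_betw (q \<circ> (\<lambda>f. ?T * f)) (carrier_mat nC 1) (E_space sH sB \<delta>)"
    by (rule bij_betw_comp_iff2[OF q_bij]) (auto intro: mult_carrier_mat[OF Tc])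
  also have "\<dots> \<longleftrightarrow> bij_betw (theta_B \<Delta> S sB K \<circ> (\<lambda>f. gf f \<circ> S)) (carrier_mat nC 1) (E_space sH sB \<delta>)"
    by (rule bij_betw_cong) (simp add: qT comp_def)
  \<comment> \<open>Precomposition with the bijective antipode is removed here; the inverse of S is
    linear as well, so functionals go to functionals in both directions.\<close>
  also have "\<dots> \<longleftrightarrow> bij_betw (theta_B \<Delta> S sB K) {g. lin sH (*) g} (E_space sH sB \<delta>)"
  proof (rule bij_betw_comp_iff[symmetric])
    have "bij_betw (\<lambda>g. g \<circ> S) {g. lin sH (*) g} {g. lin sH (*) g}"
    proof (rule bij_betwI[where g = "\<lambda>g. g \<circ> inv_into UNIV S"])
      have Sl: "lin sH sH S" by (rule lin_antipode)
      have "lin sH sH (inv_into UNIV S)"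
      proof (rule linI)
        show "inv_into UNIV S (x + y) = inv_into UNIV S x + inv_into UNIV S y" for x y
          by (rule antipode_inj) (simp add: linD[OF Sl] bij_is_surj[OF antipode_bij] surj_f_inv_f)
        show "inv_into UNIV S (sH c x) = sH c (inv_into UNIV S x)" for c x
          by (rule antipode_inj) (simp add: linD[OF Sl] bij_is_surj[OF antipode_bij] surj_f_inv_f)
      qed
      with Sl show "(\<lambda>g. g \<circ> S) \<in> {g. lin sH (*) g} \<rightarrow> {g. lin sH (*) g}"
        "(\<lambda>g. g \<circ> inv_into UNIV S) \<in> {g. lin sH (*) g} \<rightarrow> {g. lin sH (*) g}" by (auto simp: lin_def)
    qed (auto simp: fun_eq_iff bij_is_surj[OF antipode_bij] surj_f_inv_f bij_is_inj[OF antipode_bij] inv_f_f)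
    from bij_betw_trans[OF gf_bij this] show "bij_betw (\<lambda>f. gf f \<circ> S) (carrier_mat nC 1) {g. lin sH (*) g}"
      by (simp add: comp_def)
  qed
  finally show ?thesis unfolding factorizable_def linear_iff_lin[OF vsH vector_space_field] .
qed

end

end

theorem theorem1p6:
  fixes sH :: "'k::alg_closed_field \<Rightarrow> 'h::{ring,monoid_mult} \<Rightarrow> 'h"
    and \<Delta> :: "'h \<Rightarrow> ('h, 'h) tensor2" and \<epsilon> :: "'h \<Rightarrow> 'k" and S :: "'h \<Rightarrow> 'h"
    and R :: "('h, 'h) tensor2"
    and sB :: "'k \<Rightarrow> 'b::{ring,monoid_mult} \<Rightarrow> 'b"
    and \<delta> :: "'b \<Rightarrow> ('h, 'b) tensor2" and K :: "('h, 'b) tensor2"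
  assumes "fd_quasitriangular_hopf_algebra sH \<Delta> \<epsilon> S R"
    and "fd_quasitriangular_comodule_algebra sH \<Delta> \<epsilon> S R sB \<delta> K"
    and "indecomposable_module_category (H_FdMod sH \<Delta> \<epsilon> S) (B_FdMod sB \<delta>)"
    and "exact_module_category (H_FdMod sH \<Delta> \<epsilon> S) (B_FdMod sB \<delta>)"
  shows "factorizable sH \<Delta> S sB \<delta> K \<longleftrightarrow>
    nondegenerate_braided_module_category (H_FdMod sH \<Delta> \<epsilon> S) (R_braiding R)
      (B_FdMod sB \<delta>) (K_braiding K)"
proof -
  interpret fd_quasitriangular_comodule_algebra sH \<Delta> \<epsilon> S R sB \<delta> K by (fact assms(2))
  let ?C = "H_FdMod sH \<Delta> \<epsilon> S" and ?B = "B_FdMod sB \<delta> :: ('k, ('k, 'h) rep, 'k mat, ('k, 'b) rep, 'k mat) mod_cat"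
  show ?thesis
  proof
    assume fac: "factorizable sH \<Delta> S sB \<delta> K"
    \<comment> \<open>Nondegeneracy asserts that suitable data exist, so they are constructed in
      this direction; in the converse one \<open>nondegeneracy_iff\<close> applies to whatever data
      are given.\<close>
    obtain ih iev where hom: "internal_hom ?C ?B ih iev" by (rule internal_hom_B_FdMod)
    obtain EC \<pi>C where EC: "end_of_C ?C EC \<pi>C" by (rule end_of_C_exists)
    obtain EM \<pi>M where EM: "end_of_M ?C ?B ih iev EM \<pi>M" by (rule end_of_M_exists[OF hom])
    obtain p where p: "bij_betw p (carrier_mat (fst EC) 1) UNIV"
      "\<And>v X. v \<in> carrier_mat (fst EC) 1 \<Longrightarrow> X \<in> fdmods sH \<Longrightarrow> \<pi>C X * v = vecc (snd X (p v))"
      by (rule end_of_C_elements[OF EC]) blast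
    obtain q where q: "bij_betw q (carrier_mat (fst EM) 1) (E_space sH sB \<delta>)"
      "\<And>v M h. v \<in> carrier_mat (fst EM) 1 \<Longrightarrow> M \<in> fdmods sB \<Longrightarrow> orb (ih M M) M (iev M M) (\<pi>M M * v) h = snd M (q v h)"
      by (rule end_of_M_elements[OF hom EM]) blast
    obtain \<omega> where \<omega>: "\<omega> \<in> intertwiners unit_rep (tensor_rep \<Delta> EC EM)"
      "\<And>X M. X \<in> fdmods sH \<Longrightarrow> M \<in> fdmods sB \<Longrightarrow>
         kron (\<pi>C X) (\<pi>M M) * \<omega> = internal_hom_data.omega_component ?C ?B ih iev (K_braiding K) X M"
      using omega_exists[OF hom EC EM p q] by blast
    have \<omega>': "\<forall>X\<in>Obj ?C. \<forall>M\<in>Obj ?B. Cmp ?C (TenM ?C (\<pi>C X) (\<pi>M M)) \<omega> =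
         internal_hom_data.omega_component ?C ?B ih iev (K_braiding K) X M"
      unfolding H_FdMod_simps B_FdMod_simps using \<omega>(2) by blast
    have "is_iso ?C (dual_rep EC) EM (kron (evm (fst EC)) (1\<^sub>m (fst EM)) * kron (1\<^sub>m (fst EC)) \<omega>)"
      using nondegeneracy_iff[OF hom EC EM p q \<omega>] fac by blast
    then have iso: "is_iso ?C (Dual ?C EC) EM
        (Cmp ?C (TenM ?C (Ev ?C EC) (Idn ?C EM)) (TenM ?C (Idn ?C (Dual ?C EC)) \<omega>))" by simp
    show "nondegenerate_braided_module_category ?C (R_braiding R) ?B (K_braiding K)"
      unfolding nondegenerate_braided_module_category_def
    proof (intro conjI exI)
      show "braided_module_category ?C (R_braiding R) ?B (K_braiding K)" by (rule braided_module_category_B_FdMod)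
    qed (fact hom EC EM \<omega>' iso | use \<omega>(1) in simp)+
  next
    assume "nondegenerate_braided_module_category ?C (R_braiding R) ?B (K_braiding K)"
    then obtain ih iev EC \<pi>C EM \<pi>M \<omega> where hom: "internal_hom ?C ?B ih iev"
      and EC: "end_of_C ?C EC \<pi>C" and EM: "end_of_M ?C ?B ih iev EM \<pi>M"
      and \<omega>: "\<omega> \<in> intertwiners unit_rep (tensor_rep \<Delta> EC EM)"
        "\<And>X M. X \<in> fdmods sH \<Longrightarrow> M \<in> fdmods sB \<Longrightarrow>
         kron (\<pi>C X) (\<pi>M M) * \<omega> = internal_hom_data.omega_component ?C ?B ih iev (K_braiding K) X M"
      and iso: "is_iso ?C (dual_rep EC) EM (kron (evm (fst EC)) (1\<^sub>m (fst EM)) * kron (1\<^sub>m (fst EC)) \<omega>)"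
      unfolding nondegenerate_braided_module_category_def by auto
    obtain p where p: "bij_betw p (carrier_mat (fst EC) 1) UNIV"
      "\<And>v X. v \<in> carrier_mat (fst EC) 1 \<Longrightarrow> X \<in> fdmods sH \<Longrightarrow> \<pi>C X * v = vecc (snd X (p v))"
      by (rule end_of_C_elements[OF EC]) blast
    obtain q where q: "bij_betw q (carrier_mat (fst EM) 1) (E_space sH sB \<delta>)"
      "\<And>v M h. v \<in> carrier_mat (fst EM) 1 \<Longrightarrow> M \<in> fdmods sB \<Longrightarrow> orb (ih M M) M (iev M M) (\<pi>M M * v) h = snd M (q v h)"
      by (rule end_of_M_elements[OF hom EM]) blast
    show "factorizable sH \<Delta> S sB \<delta> K" using nondegeneracy_iff[OF hom EC EM p q \<omega>] iso by blast
  qed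
qed

end
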